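(* Let $r_*\ge2$ be an integer and suppose Assumption P1 (stated in the context) is satisfied with $1/2<\tau<r_*$. Let $\hat\theta_n$ be an arbitrary measurable minimizer over $\Theta$ of $Q_n=Q_{n,j_n,r_*}$. If $2^{j_n}\sim n^{1/(2\tau+1)}$, then, as $n\to\infty$, $$\sqrt n\,(\hat\theta_n-\theta_0)\to^dN(0,I(\theta_0)),\qquad I(\theta_0)=\Big(\int_0^1\nabla_\theta p(\theta_0,x)\nabla_\theta p(\theta_0,x)'\,p(\theta_0,x)^{-1}\,dx\Big)^{-1}.$$
   Context: **Notation.** $\lambda$ is Lebesgue measure on $[0,1]$; $\mathcal{L}^2=\mathcal{L}^2([0,1],\lambda)$ with (semi)norm $\|\cdot\|_2$. $\|\cdot\|$ is the Euclidean norm of vectors and associated operator norm of matrices. $a_n\sim b_n$ for positive sequences means $a_n/b_n$ is bounded away from zero and infinity. A prime denotes transpose; $\nabla_\theta$ is the gradient in $\theta$ (column vector), $\nabla_\theta^2$ the matrix of second derivatives. **Besov spaces.** For $h:[0,1]\to\mathbb{R}$ let $\Delta_zh(x)=h(x+z)-h(x)$, $\Delta_z^a=\Delta_z\Delta_z^{a-1}$, with $\Delta_z^a(h)(x)$ so computed if $x,x+az\in[0,1]$ and set to $0$ otherwise. For $0<s<\infty$, with $a$ the smallest integer larger than $s$, $\|h\|_{s,2}=\|h\|_2+\sup_{0\ne|z|<1}|z|^{-s}\|\Delta_z^a(h)\|_2$ and $\mathcal{B}_s=\{h\in\mathcal{L}^2:\|h\|_{s,2}<\infty\}$. For $s>1/2$,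 $\mathsf{B}_s$ is the set of continuous functions on $[0,1]$ belonging to $\mathcal{B}_s$, with norm $\|\cdot\|_{s,2}$. **Model.** $X_1,\dots,X_n$ are i.i.d. on $[0,1]$ with law $P$ and Lebesgue density $p_0$. $\mathcal{P}_\Theta=\{p(\theta):\theta\in\Theta\}$, $\Theta\subseteq\mathbb{R}^b$, is a family of probability densities $p(\theta):[0,1]\to\mathbb{R}$; $p(\theta,x)=p(\theta)(x)$. **B-splines and auxiliary estimator.** For an integer $r\ge1$, $N^{(r)}=\mathbf 1_{[0,1)}*\cdots*\mathbf 1_{[0,1)}$ ($r$-fold convolution). For $l=-r+1,\dots,2^j-1$ set $N^{(r)}_{lj}(x)=N^{(r)}(2^jx-l)$, $x\in[0,1]$. $g_j^{(r)lm}$ is the $(l,m)$ element of the inverse of $\big(\int_0^{2^j}N^{(r)}(u-l)N^{(r)}(u-m)\,du\big)_{l,m}$, $l,m=-r+1,\dots,2^j-1$. For a positive integer $j$, $$p_{n,j,r_*}(y)=\sum_{l=-r_*+1}^{2^j-1}\ \sum_{m=-r_*+1}^{2^j-1}2^jg_j^{(r_* )lm}\Big(\frac1n\sum_{i=1}^nN_{mj}^{(r_* )}(X_i)\Big)N_{lj}^{(r_* )}(y).$$ **Objective function.** Let $A_n=\{p_{n,j,r_*}(y)>0\text{ for every }y\in[0,1]\}$ and $$Q_n(\theta)=Q_{n,j,r_*}(\theta)=\int_0^1\big(p_{n,j,r_*}-p(\theta)\big)^2p_{n,j,r_*}^{-1}\,d\lambda\ \text{ on }A_n,\qquad Q_n(\theta)=0\text{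 otherwise}.$$ **Assumption P1.** (i) $\Theta$ is compact in $\mathbb{R}^b$; there is $\theta_0\in\Theta$ with $p_0=p(\theta_0)$ $\lambda$-a.e.; $p(\theta)=p(\theta_0)$ $\lambda$-a.e. implies $\theta=\theta_0$; $\theta\mapsto p(\theta,x)$ is continuous on $\Theta$ for every $x\in[0,1]$; $p(\theta_0)$ is positive on $[0,1]$. (ii) $\mathcal{P}_\Theta$ is a bounded subset of $\mathsf{B}_\tau$ for some $\tau>1/2$. (iii) $\theta_0$ is an interior point of $\Theta$; there is an open ball $B(\theta_0)\subseteq\Theta$ centered at $\theta_0$ such that $\theta\mapsto p(\theta,x)$ is twice continuously differentiable on $B(\theta_0)$ for every $x\in[0,1]$; $\int_0^1\sup_{\theta\in B(\theta_0)}\|\nabla_\theta p(\theta,x)\|^2dx<\infty$, $\int_0^1\sup_{\theta\in B(\theta_0)}\|\nabla_\theta^2p(\theta,x)\|dx<\infty$; and $\int_0^1\nabla_\theta p(\theta_0,x)\nabla_\theta p(\theta_0,x)'p(\theta_0,x)^{-1}dx$ is positive definite. (iv) For some $\varsigma>1/2$, $\partial p(\theta_0,\cdot)/\partial\theta_q\in\mathsf{B}_\varsigma$ for every $q=1,\dots,b$. *)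

theory Defs
  imports "HOL-Probability.Probability"
begin

(* The Borel version of Lebesgue measure on [0,1].  Functions on [0,1] are represented by functions
   on the reals, of which only the values on [0,1] matter. *)
abbreviation lborel01 :: "real measure" where
  "lborel01 \<equiv> restrict_space lborel {0..1}"

definition prob_density01 :: "(real \<Rightarrow> real) \<Rightarrow> bool" where
  "prob_density01 f \<longleftrightarrow> f \<in> borel_measurable lborel01 \<and> (\<forall>x\<in>{0..1}. 0 \<le> f x)
     \<and> (\<integral>\<^sup>+x. ennreal (f x) \<partial>lborel01) = 1"


definition L2_01 :: "(real \<Rightarrow> real) set" where
  "L2_01 = {h \<in> borel_measurable lborel01. integrable lborel01 (\<lambda>x. (h x)\<^sup>2)}"

definition norm2 :: "(real \<Rightarrow> real) \<Rightarrow> real" where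
  "norm2 h = sqrt (\<integral>x. (h x)\<^sup>2 \<partial>lborel01)"

definition fdiff :: "real \<Rightarrow> (real \<Rightarrow> real) \<Rightarrow> real \<Rightarrow> real" where
  "fdiff z h = (\<lambda>x. h (x + z) - h x)"

(* The intermediate points x + k z (k \<le> a) then lie in [0,1] as well, so that values of h
   outside [0,1] never enter. *)
definition iter_diff :: "nat \<Rightarrow> real \<Rightarrow> (real \<Rightarrow> real) \<Rightarrow> real \<Rightarrow> real" where
  "iter_diff a z h x = (if x \<in> {0..1} \<and> x + real a * z \<in> {0..1} then (fdiff z ^^ a) h x else 0)"

(* Extended-valued.  The real-valued norm2 takes the value 0 on functions that are not
   square-integrable, so this is meaningful only for h in L2_01. *)
definition besov_norm :: "real \<Rightarrow> (real \<Rightarrow> real) \<Rightarrow> ennreal" where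
  "besov_norm s h = (let a = (LEAST a::nat. s < real a) in
     ennreal (norm2 h)
     + (SUP z\<in>{z. z \<noteq> 0 \<and> \<bar>z\<bar> < 1}. ennreal (\<bar>z\<bar> powr (- s) * norm2 (iter_diff a z h))))"

definition besov :: "real \<Rightarrow> (real \<Rightarrow> real) set" where
  "besov s = {h \<in> L2_01. besov_norm s h < \<infinity>}"

definition cont_besov :: "real \<Rightarrow> (real \<Rightarrow> real) set" where
  "cont_besov s = {h \<in> besov s. continuous_on {0..1} h}"


definition conv :: "(real \<Rightarrow> real) \<Rightarrow> (real \<Rightarrow> real) \<Rightarrow> real \<Rightarrow> real" where
  "conv f g x = (\<integral>y. f (x - y) * g y \<partial>lborel)"

(* The r-fold convolution of the indicator of [0,1), for r \<ge> 1. *)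
definition bspline :: "nat \<Rightarrow> real \<Rightarrow> real" where
  "bspline r = (conv (indicator {0..<1}) ^^ (r - 1)) (indicator {0..<1})"

definition bspline_scaled :: "nat \<Rightarrow> nat \<Rightarrow> int \<Rightarrow> real \<Rightarrow> real" where
  "bspline_scaled r j l x = bspline r (2 ^ j * x - of_int l)"

definition spline_index :: "nat \<Rightarrow> nat \<Rightarrow> int set" where
  "spline_index r j = {- int r + 1 .. 2 ^ j - 1}"

definition spline_gram :: "nat \<Rightarrow> nat \<Rightarrow> int \<Rightarrow> int \<Rightarrow> real" where
  "spline_gram r j l m =
     (LBINT u:{0..2 ^ j}. bspline r (u - of_int l) * bspline r (u - of_int m))"

(* The size of the Gram matrix depends on j, so matrices are functions on a finite index set;
   the inverse is chosen as in matrix_inv and is unique on the index set. *)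
definition is_inverse_on :: "'i set \<Rightarrow> ('i \<Rightarrow> 'i \<Rightarrow> real) \<Rightarrow> ('i \<Rightarrow> 'i \<Rightarrow> real) \<Rightarrow> bool" where
  "is_inverse_on I A B \<longleftrightarrow> (\<forall>l\<in>I. \<forall>m\<in>I.
     (\<Sum>k\<in>I. A l k * B k m) = (if l = m then 1 else 0) \<and>
     (\<Sum>k\<in>I. B l k * A k m) = (if l = m then 1 else 0))"

definition inverse_on :: "'i set \<Rightarrow> ('i \<Rightarrow> 'i \<Rightarrow> real) \<Rightarrow> 'i \<Rightarrow> 'i \<Rightarrow> real" where
  "inverse_on I A = (SOME B. is_inverse_on I A B)"

lemma is_inverse_on_unique:
  assumes "finite I" "is_inverse_on I A B" "is_inverse_on I A C" "l \<in> I" "m \<in> I"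
  shows "B l m = C l m"
proof -
  have AC: "(\<Sum>h\<in>I. A k h * C h m) = (if k = m then 1 else 0)" if "k \<in> I" for k
    using assms(3,5) that unfolding is_inverse_on_def by blast
  have BA: "(\<Sum>k\<in>I. B l k * A k h) = (if l = h then 1 else 0)" if "h \<in> I" for h
    using assms(2,4) that unfolding is_inverse_on_def by blast
  have "B l m = (\<Sum>k\<in>I. if k = m then B l k else 0)"
    using assms(1,5) by (simp only: sum.delta if_True)
  also have "\<dots> = (\<Sum>k\<in>I. B l k * (\<Sum>h\<in>I. A k h * C h m))"
    by (rule sum.cong[OF refl]) (simp only: AC, simp)
  also have "\<dots> = (\<Sum>k\<in>I. \<Sum>h\<in>I. B l k * A k h * C h m)"
    by (simp only: sum_distrib_left mult.assoc)
  also have "\<dots> = (\<Sum>h\<in>I. \<Sum>k\<in>I. B l k * A k h * C h m)"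
    by (rule sum.swap)
  also have "\<dots> = (\<Sum>h\<in>I. if l = h then C h m else 0)"
    by (rule sum.cong[OF refl]) (simp only: BA sum_distrib_right[symmetric], simp)
  also have "\<dots> = C l m"
    using assms(1,4) by (simp only: sum.delta' if_True)
  finally show ?thesis .
qed

definition spline_gram_inv :: "nat \<Rightarrow> nat \<Rightarrow> int \<Rightarrow> int \<Rightarrow> real" where
  "spline_gram_inv r j = inverse_on (spline_index r j) (spline_gram r j)"

(* The sample consists of the first n entries xs 0, ..., xs (n - 1) of the sequence xs. *)
definition aux_est :: "nat \<Rightarrow> nat \<Rightarrow> nat \<Rightarrow> (nat \<Rightarrow> real) \<Rightarrow> real \<Rightarrow> real" where
  "aux_est n j r xs y =
     (\<Sum>l\<in>spline_index r j. \<Sum>m\<in>spline_index r j.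
        2 ^ j * spline_gram_inv r j l m
        * (1 / real n * (\<Sum>i<n. bspline_scaled r j m (xs i))) * bspline_scaled r j l y)"

definition Q_obj ::
  "nat \<Rightarrow> nat \<Rightarrow> nat \<Rightarrow> (nat \<Rightarrow> real) \<Rightarrow> (real ^ 'b \<Rightarrow> real \<Rightarrow> real) \<Rightarrow> real ^ 'b \<Rightarrow> real" where
  "Q_obj n j r xs p \<theta> =
     (if \<forall>y\<in>{0..1}. 0 < aux_est n j r xs y
      then \<integral>y. (aux_est n j r xs y - p \<theta> y)\<^sup>2 / aux_est n j r xs y \<partial>lborel01
      else 0)"


definition gradient :: "(real ^ 'b \<Rightarrow> real) \<Rightarrow> real ^ 'b \<Rightarrow> real ^ 'b" where
  "gradient f \<theta> = (THE D. GDERIV f \<theta> :> D)"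

lemma gradient_eqI:
  assumes "GDERIV f \<theta> :> D"
  shows "gradient f \<theta> = D"
  unfolding gradient_def
proof (rule the_equality)
  fix E assume "GDERIV f \<theta> :> E"
  then have "(\<lambda>h. h \<bullet> E) = (\<lambda>h. h \<bullet> D)"
    using assms unfolding gderiv_def by (rule has_derivative_unique)
  then have "\<forall>h. h \<bullet> E = h \<bullet> D"
    by (intro allI) (rule fun_cong)
  then show "E = D"
    by (rule iffD1[OF vector_eq_ldot])
qed (rule assms)

definition hessian :: "(real ^ 'b \<Rightarrow> real) \<Rightarrow> real ^ 'b \<Rightarrow> real ^ 'b ^ 'b" where
  "hessian f \<theta> = jacobian (gradient f) (at \<theta>)"

(* Intended for open U. *)
definition C2_on :: "(real ^ 'b) set \<Rightarrow> (real ^ 'b \<Rightarrow> real) \<Rightarrow> bool" where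
  "C2_on U f \<longleftrightarrow> f differentiable_on U \<and> gradient f differentiable_on U
     \<and> continuous_on U (hessian f)"

definition pos_def :: "real ^ 'b ^ 'b \<Rightarrow> bool" where
  "pos_def A \<longleftrightarrow> transpose A = A \<and> (\<forall>v. v \<noteq> 0 \<longrightarrow> 0 < v \<bullet> (A *v v))"

definition information_matrix ::
  "(real ^ 'b \<Rightarrow> real \<Rightarrow> real) \<Rightarrow> real ^ 'b \<Rightarrow> real ^ 'b ^ 'b" where
  "information_matrix p \<theta> =
     (\<integral>x. (let g = gradient (\<lambda>\<theta>. p \<theta> x) \<theta> in
          (\<chi> q r. g $ q * g $ r / p \<theta> x)) \<partial>lborel01)"

(* The suprema over the ball are taken in [0,\<infinity>]: they are measurable in x, but may be infinite
   on a null set. *)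
definition assumption_P1 ::
  "(real ^ 'b) set \<Rightarrow> (real ^ 'b \<Rightarrow> real \<Rightarrow> real) \<Rightarrow> (real \<Rightarrow> real) \<Rightarrow> real ^ 'b \<Rightarrow> real \<Rightarrow> bool" where
  "assumption_P1 \<Theta> p p0 \<theta>0 \<tau> \<longleftrightarrow>
     (compact \<Theta> \<and> \<theta>0 \<in> \<Theta>
      \<and> (AE x in lborel01. p0 x = p \<theta>0 x)
      \<and> (\<forall>\<theta>\<in>\<Theta>. (AE x in lborel01. p \<theta> x = p \<theta>0 x) \<longrightarrow> \<theta> = \<theta>0)
      \<and> (\<forall>x\<in>{0..1}. continuous_on \<Theta> (\<lambda>\<theta>. p \<theta> x))
      \<and> (\<forall>x\<in>{0..1}. 0 < p \<theta>0 x))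
   \<and> (1 / 2 < \<tau> \<and> p ` \<Theta> \<subseteq> cont_besov \<tau>
      \<and> (\<exists>C::real. \<forall>\<theta>\<in>\<Theta>. besov_norm \<tau> (p \<theta>) \<le> ennreal C))
   \<and> (\<theta>0 \<in> interior \<Theta>
      \<and> (\<exists>\<rho>>0. ball \<theta>0 \<rho> \<subseteq> \<Theta>
           \<and> (\<forall>x\<in>{0..1}. C2_on (ball \<theta>0 \<rho>) (\<lambda>\<theta>. p \<theta> x))
           \<and> (\<integral>\<^sup>+x. (SUP \<theta>\<in>ball \<theta>0 \<rho>. ennreal ((norm (gradient (\<lambda>\<theta>. p \<theta> x) \<theta>))\<^sup>2)) \<partial>lborel01) < \<infinity>
           \<and> (\<integral>\<^sup>+x. (SUP \<theta>\<in>ball \<theta>0 \<rho>. ennreal (onorm ((*v) (hessian (\<lambda>\<theta>. p \<theta> x) \<theta>)))) \<partial>lborel01) < \<infinity>)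
      \<and> pos_def (information_matrix p \<theta>0))
   \<and> (\<exists>\<sigma>>1/2. \<forall>q. (\<lambda>x. gradient (\<lambda>\<theta>. p \<theta> x) \<theta>0 $ q) \<in> cont_besov \<sigma>)"


(* N(\<mu>, \<Sigma>) for positive definite \<Sigma>. *)
definition multivariate_normal :: "real ^ 'b \<Rightarrow> real ^ 'b ^ 'b \<Rightarrow> (real ^ 'b) measure" where
  "multivariate_normal \<mu> \<Sigma> = density lborel (\<lambda>x. ennreal
     (exp (- ((x - \<mu>) \<bullet> (matrix_inv \<Sigma> *v (x - \<mu>))) / 2) / sqrt ((2 * pi) ^ CARD('b) * det \<Sigma>)))"

(* Weak convergence of Borel probability measures; the library's weak_conv_m is restricted to
   measures on the real line. *)
definition weak_conv_to :: "(nat \<Rightarrow> 'a::metric_space measure) \<Rightarrow> 'a measure \<Rightarrow> bool" where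
  "weak_conv_to \<mu> \<nu> \<longleftrightarrow> (\<forall>f::'a \<Rightarrow> real. continuous_on UNIV f \<and> bounded (range f) \<longrightarrow>
     (\<lambda>n. \<integral>x. f x \<partial>\<mu> n) \<longlonglongrightarrow> (\<integral>x. f x \<partial>\<nu>))"

end

theory Submission
  imports Defs
begin

text \<open>The minimum-distance estimator inherits its limit law from a linear functional of the auxiliary
density estimate.

Write \<open>f\<close> for the true density and \<open>q\<close> for the auxiliary estimate. The spline kernel reproduces the
spline space, so that \<open>q\<close> is an average of independent kernel sections with mean the orthogonal
projection of \<open>f\<close>. Its mean squared error splits into a variance, the dimension \<open>2 ^ j + r - 1\<close>
divided by the sample size (\<open>aux_est_error\<close>), and the squared distance of \<open>f\<close> from the spline space,
which Jackson's inequality bounds by the Besov modulus of smoothness (\<open>jackson\<close>, \<open>spline_proj_rates\<close>).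
For \<open>\<tau> > 1 / 2\<close> and the given dimension both are of smaller order than the inverse root of the sample
size, and \<open>q\<close> converges uniformly to \<open>f\<close> in probability; in particular it is eventually positive.

The analytic part is deterministic. If \<open>q\<close> is uniformly close to \<open>f\<close>, identifiability and compactness
force the minimizer to be near \<open>\<theta>0\<close> (\<open>separation\<close>), where the objective is a quadratic with matrix the
information \<open>J\<close> up to relatively small errors (\<open>objective_expansion\<close>). A near-minimizer of such a
function is near the minimizer of the quadratic, so \<open>\<theta> - \<theta>0\<close> is \<open>J\<inverse>\<close> applied to the integral of the
score against \<open>q - f\<close>, up to the squared \<open>L\<^sup>2\<close> distance of \<open>q\<close> and \<open>f\<close> (\<open>minimizer_expansion\<close>).

Integrating the score against \<open>q\<close> amounts to averaging its spline projection over the sample. The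
projection error is orthogonal to the spline space, hence its mean is a product of two projection
errors and negligible (\<open>projection_error_moment\<close>); the score is a quotient of Besov functions and has
some smoothness above one half (\<open>quotient_proj_rate\<close>). What remains is the average of the score itself,
to which the central limit theorem applies in every direction. Characteristic functions and tightness
give weak convergence in Euclidean space (\<open>weak_conv_from_trig\<close>).\<close>

abbreviation int01 :: "(real => 'c :: {banach, second_countable_topology}) => 'c" (binder "I01 " 10) where
 "int01 g == integral\<^sup>L lborel01 g"

abbreviation tends_to :: "(nat => 'c :: topological_space) => 'c => bool" (infixr "--->" 60) where
 "g ---> l == (g \<longlongrightarrow> l) sequentially"

lemmas meas_contI = borel_measurable_continuous_onI
 and lint_cong = Bochner_Integration.integral_cong
 and lint_bound = Bochner_Integration.integrable_bound
 and lint_addable = Bochner_Integration.integrable_add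
 and lint_diff = Bochner_Integration.integral_diff
 and lint_add = Bochner_Integration.integral_add
 and lint_summable = Bochner_Integration.integrable_sum
 and lint_sum = Bochner_Integration.integral_sum

section \<open>Bounded measurable functions on the unit interval\<close>

definition bmeas :: "(real => real) => bool" where
 "bmeas h \<longleftrightarrow> h \<in> borel_measurable lborel01 & (\<exists>B. \<forall>x\<in>{0..1}. \<bar>h x\<bar> <= B)"

definition sq :: "(real => real) => real" where
 "sq h = (I01 x. (h x)\<^sup>2)"

lemma space_lborel01 [simp]: "space lborel01 = {0..1}" by (simp add: space_restrict_space)

lemma prob_space_lborel01: "prob_space lborel01" by (rule prob_spaceI) (simp add: emeasure_restrict_space space_restrict_space)

interpretation U: prob_space lborel01 by (rule prob_space_lborel01)

interpretation UU: pair_prob_space lborel01 lborel01 ..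

lemma measurable_lborel01I [measurable_dest]:
 "f \<in> borel_measurable borel ==> f \<in> borel_measurable lborel01" by (simp add: measurable_restrict_space1)

lemma continuous_on_measurable_lborel01:
 assumes "continuous_on {0..1} f"
 shows "f \<in> borel_measurable lborel01"
proof -
 have "f \<in> borel_measurable (restrict_space borel {0..1})" by (rule borel_measurable_continuous_on_restrict[OF assms])
 then show ?thesis by (simp add: measurable_cong_sets[OF sets_restrict_space_cong[OF sets_lborel] refl])
qed

lemma bmeasI: "h \<in> borel_measurable lborel01 ==> (!!x. x \<in> {0..1} ==> \<bar>h x\<bar> <= B) ==> bmeas h" unfolding bmeas_def by blast

lemma bmeas_measurable [measurable_dest]: "bmeas h ==> h \<in> borel_measurable lborel01" by (simp add: bmeas_def)

lemma bmeas_integrable: "bmeas h ==> integrable lborel01 h" unfolding bmeas_def by (elim conjE exE, rule U.integrable_const_bound) (auto intro!: AE_I2)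

lemma bmeas_const [simp]: "bmeas (%_. c)" by (rule bmeasI[of _ "\<bar>c\<bar>"]) auto

lemma bmeas_add:
 assumes "bmeas f" "bmeas g" shows "bmeas (%x. f x + g x)"
proof -
 obtain A B where "\<forall>x\<in>{0..1}. \<bar>f x\<bar> <= A" "\<forall>x\<in>{0..1}. \<bar>g x\<bar> <= B" using assms unfolding bmeas_def by blast
 moreover have "(%x. f x + g x) \<in> borel_measurable lborel01" using assms by measurable
 ultimately show ?thesis by (intro bmeasI[of _ "A + B"]) (auto intro!: order_trans[OF abs_triangle_ineq] add_mono)
qed

lemma bmeas_mult:
 assumes "bmeas f" "bmeas g" shows "bmeas (%x. f x * g x)"
proof -
 obtain A B where "\<forall>x\<in>{0..1}. \<bar>f x\<bar> <= A" "\<forall>x\<in>{0..1}. \<bar>g x\<bar> <= B" using assms unfolding bmeas_def by blast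
 moreover have "(%x. f x * g x) \<in> borel_measurable lborel01" using assms by measurable
 ultimately show ?thesis by (intro bmeasI[of _ "A * B"]) (auto simp: abs_mult intro!: mult_mono intro: order_trans[OF abs_ge_zero])
qed

lemma bmeas_diff: "bmeas f ==> bmeas g ==> bmeas (%x. f x - g x)" using bmeas_add[of f "%x. - 1 * g x"] bmeas_mult[of "%_. -1" g] by simp

lemma bmeas_power2: "bmeas f ==> bmeas (%x. (f x)\<^sup>2)" unfolding power2_eq_square by (rule bmeas_mult)

lemma bmeas_abs: "bmeas f ==> bmeas (%x. \<bar>f x\<bar>)" unfolding bmeas_def by auto

lemma bmeas_sum: "(!!i. i \<in> I ==> bmeas (f i)) ==> bmeas (%x. \<Sum>i\<in>I. f i x)"
 by (induction I rule: infinite_finite_induct) (auto intro: bmeas_add)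

lemma bmeas_indicator: "A \<in> sets borel ==> bmeas (indicator A)" by (rule bmeasI[of _ 1], rule measurable_lborel01I) (auto simp: indicator_def)

lemmas bmeas_intros = bmeas_const bmeas_add bmeas_mult bmeas_diff bmeas_power2 bmeas_abs bmeas_sum

lemma bmeas_continuous_on:
 assumes "continuous_on {0..1} f" shows "bmeas f"
proof -
 have "compact (f ` {0..1})" by (rule compact_continuous_image[OF assms]) auto
 then obtain B where "\<forall>y\<in>f ` {0..1}. norm y <= B" using compact_imp_bounded bounded_iff by metis
 then show ?thesis by (intro bmeasI[of _ B] continuous_on_measurable_lborel01 assms) auto
qed

lemma bmeas_cong: "bmeas f ==> (!!x. x \<in> {0..1} ==> f x = g x) ==> bmeas g" unfolding bmeas_def using measurable_cong[of lborel01 f g borel] by auto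

lemma sq_cong: "(!!x. x \<in> {0..1} ==> f x = g x) ==> sq f = sq g" unfolding sq_def by (rule lint_cong) auto

lemma sq_nonneg [simp]: "0 <= sq h" unfolding sq_def by (rule integral_nonneg_AE) auto

lemma sq_minus_commute: "sq (%x. f x - g x) = sq (%x. g x - f x)" unfolding sq_def by (simp add: power2_commute)

lemma sq_cmult: "sq (%x. c * f x) = c^2 * sq f" unfolding sq_def by (simp add: power_mult_distrib)

lemma sq_mono:
 assumes "bmeas f" "bmeas g" "!!x. x \<in> {0..1} ==> \<bar>f x\<bar> <= \<bar>g x\<bar>"
 shows "sq f <= sq g" unfolding sq_def
 by (rule integral_mono) (use assms in \<open>auto intro!: bmeas_integrable bmeas_power2 simp: abs_le_square_iff\<close>)

lemma sq_le_const:
 assumes "bmeas f" "!!x. x \<in> {0..1} ==> (f x)^2 <= B"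
 shows "sq f <= B" unfolding sq_def by (rule U.integral_le_const) (use assms in \<open>auto intro!: bmeas_integrable bmeas_power2\<close>)

lemma sum_sq_le: "((a::real) + b)^2 <= 2 * a^2 + 2 * b^2" using sum_squares_bound[of a b] by (simp add: power2_sum)

lemma sq_add_le:
 assumes "bmeas f" "bmeas g"
 shows "sq (%x. f x + g x) <= 2 * sq f + 2 * sq g"
proof -
 have "sq (%x. f x + g x) <= (I01 x. 2 * (f x)^2 + 2 * (g x)^2)" unfolding sq_def
 by (rule integral_mono) (use assms sum_sq_le in \<open>auto intro!: bmeas_integrable bmeas_intros\<close>)
 also have "... = 2 * sq f + 2 * sq g" unfolding sq_def using assms by (simp add: bmeas_integrable bmeas_power2)
 finally show ?thesis .
qed

text \<open>The discriminant of the nonnegative quadratic form \<open>sq (a f - b g)\<close> in \<open>a\<close> and \<open>b\<close> gives the bound.\<close>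

lemma cauchy_schwarz_U:
 assumes "bmeas f" "bmeas g"
 shows "(I01 x. f x * g x)^2 <= sq f * sq g"
proof -
 let ?i = "\<integral>x. f x * g x \<partial>lborel01"
 have *: "0 <= a^2 * sq f - 2 * a * b * ?i + b^2 * sq g" for a b
 proof -
 have "0 <= (I01 x. (a * f x - b * g x)\<^sup>2)" by (rule integral_nonneg_AE) auto
 also have "... = (I01 x. a\<^sup>2 * (f x)^2 - 2 * a * b * (f x * g x) + b^2 * (g x)^2)" by (simp add: power2_eq_square algebra_simps)
 also have "... = a^2 * sq f - 2 * a * b * ?i + b^2 * sq g" unfolding sq_def using assms by (simp add: bmeas_integrable bmeas_intros)
 finally show ?thesis .
 qed
 show ?thesis
 proof (cases "sq g = 0")
 case True
 have "?i = 0"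
 proof (rule ccontr)
  assume "?i ~= 0"
  then show False using *[of 1 "(sq f + 1) / (2 * ?i)"] True by (simp add: field_simps)
 qed
 then show ?thesis by simp
 next
 case False
 then have "0 < sq g" using sq_nonneg[of g] by linarith
 have "0 <= sq g * (sq g * sq f - ?i\<^sup>2)" using *[of "sq g" "?i"] by (simp add: power2_eq_square algebra_simps)
 then show ?thesis using \<open>0 < sq g\<close> by (simp add: zero_le_mult_iff mult.commute)
 qed
qed

section \<open>Inverses of positive definite matrices on finite index sets\<close>

lemma posdef_solvable:
 fixes A :: "'i => 'i => real"
 assumes "finite I" and "!!l m. l \<in> I ==> m \<in> I ==> A l m = A m l"
 and "!!c. (\<Sum>l\<in>I. \<Sum>m\<in>I. c l * A l m * c m) <= 0 ==> \<forall>m\<in>I. c m = 0"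
 shows "\<exists>c. \<forall>l\<in>I. (\<Sum>m\<in>I. A l m * c m) = b l" using assms
proof (induction I arbitrary: A b rule: finite_induct)
 case empty
 then show ?case by simp
next
 case (insert k I)
 note sym = insert.prems(1) and pd = insert.prems(2)
 let ?e = "%m. if m = k then 1 else 0 :: real"
 have akk: "0 < A k k"
 proof (rule ccontr)
 assume "\<not> 0 < A k k"
 have "(\<Sum>l\<in>insert k I. \<Sum>m\<in>insert k I. ?e l * A l m * ?e m) = A k k"
  using insert.hyps by (simp add: if_distrib[of "%x. _ * x"] if_distrib[of "%x. x * _"] cong: if_cong)
 then show False using pd[of ?e] \<open>\<not> 0 < A k k\<close> by auto
 qed
 define B where "B l m = A l m - A l k * A k m / A k k" for l m
 have "\<exists>c. \<forall>l\<in>I. (\<Sum>m\<in>I. B l m * c m) = b l - A l k * b k / A k k"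
 proof (rule insert.IH)
 show "B l m = B m l" if "l \<in> I" "m \<in> I" for l m using that sym[of l m] sym[of l k] sym[of k m] by (simp add: B_def mult.commute)
 fix c assume c: "(\<Sum>l\<in>I. \<Sum>m\<in>I. c l * B l m * c m) <= 0"
 define \<gamma> where "\<gamma> = (\<Sum>m\<in>I. A k m * c m)"
 define d where "d m = (if m = k then - \<gamma> / A k k else c m)" for m
 have dI: "m \<in> I ==> d m = c m" for m using insert.hyps by (auto simp: d_def)
 have dk: "d k = - \<gamma> / A k k" by (simp add: d_def)
 have g2: "(\<Sum>l\<in>I. c l * A l k) = \<gamma>" unfolding \<gamma>_def by (rule sum.cong) (use sym in auto)
 have "(\<Sum>l\<in>insert k I. \<Sum>m\<in>insert k I. d l * A l m * d m) =
  d k * A k k * d k + (\<Sum>m\<in>I. d k * A k m * d m) + (\<Sum>l\<in>I. d l * A l k * d k)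
  + (\<Sum>l\<in>I. \<Sum>m\<in>I. d l * A l m * d m)" using insert.hyps by (simp add: sum.distrib)
 also have "(\<Sum>m\<in>I. d k * A k m * d m) = d k * \<gamma>" unfolding \<gamma>_def sum_distrib_left by (rule sum.cong) (auto simp: dI)
 also have "(\<Sum>l\<in>I. d l * A l k * d k) = \<gamma> * d k" unfolding g2[symmetric] sum_distrib_right by (rule sum.cong) (auto simp: dI)
 also have "(\<Sum>l\<in>I. \<Sum>m\<in>I. d l * A l m * d m) =
  (\<Sum>l\<in>I. \<Sum>m\<in>I. c l * B l m * c m + (c l * A l k) * (A k m * c m) / A k k)" by (intro sum.cong refl) (simp add: dI B_def algebra_simps)
 also have "... = (\<Sum>l\<in>I. \<Sum>m\<in>I. c l * B l m * c m) + \<gamma> * \<gamma> / A k k"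
  by (simp add: sum.distrib flip: sum_divide_distrib sum_product)
  (simp add: g2 flip: \<gamma>_def)
 also have "d k * A k k * d k + d k * \<gamma> + \<gamma> * d k
  + ((\<Sum>l\<in>I. \<Sum>m\<in>I. c l * B l m * c m) + \<gamma> * \<gamma> / A k k)
  = (\<Sum>l\<in>I. \<Sum>m\<in>I. c l * B l m * c m)" using akk by (simp add: dk field_simps)
 finally have "\<forall>m\<in>insert k I. d m = 0" using c by (intro pd) simp
 then show "\<forall>m\<in>I. c m = 0" using dI by auto
 qed
 then obtain c where c: "!!l. l \<in> I ==> (\<Sum>m\<in>I. B l m * c m) = b l - A l k * b k / A k k" by blast
 define \<gamma> where "\<gamma> = (\<Sum>m\<in>I. A k m * c m)"
 define d where "d m = (if m = k then (b k - \<gamma>) / A k k else c m)" for m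
 have dI: "m \<in> I ==> d m = c m" for m using insert.hyps by (auto simp: d_def)
 have dk: "d k = (b k - \<gamma>) / A k k" by (simp add: d_def)
 have split: "(\<Sum>m\<in>insert k I. A l m * d m) = A l k * d k + (\<Sum>m\<in>I. A l m * c m)" for l using insert.hyps by (simp add: dI)
 have "(\<Sum>m\<in>insert k I. A l m * d m) = b l" if "l \<in> insert k I" for l
 proof (cases "l = k")
 case True
 then show ?thesis using akk by (simp only: split) (simp add: dk \<gamma>_def)
 next
 case False
 then have "l \<in> I" using that by auto
 have "(\<Sum>m\<in>I. A l m * c m) = (\<Sum>m\<in>I. B l m * c m + A l k / A k k * (A k m * c m))"
  by (intro sum.cong refl) (simp add: B_def algebra_simps)
 also have "... = b l - A l k * b k / A k k + A l k / A k k * \<gamma>"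
  using c[OF \<open>l \<in> I\<close>] by (simp add: sum.distrib \<gamma>_def sum_distrib_left)
 finally show ?thesis using akk by (simp only: split) (simp add: dk field_simps)
 qed
 then show ?case by blast
qed

lemma posdef_invertible:
 fixes A :: "'i => 'i => real"
 assumes fin: "finite I" and sym: "!!l m. l \<in> I ==> m \<in> I ==> A l m = A m l"
 and pd: "!!c. (\<Sum>l\<in>I. \<Sum>m\<in>I. c l * A l m * c m) <= 0 ==> \<forall>m\<in>I. c m = 0"
 shows "is_inverse_on I A (inverse_on I A)" and "!!l m. l \<in> I ==> m \<in> I ==> inverse_on I A l m = inverse_on I A m l"
proof -
 have "\<forall>k. \<exists>c. \<forall>l\<in>I. (\<Sum>m\<in>I. A l m * c m) = (if l = k then 1 else 0)"
 proof
 fix k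
 show "\<exists>c. \<forall>l\<in>I. (\<Sum>m\<in>I. A l m * c m) = (if l = k then 1 else 0)" by (rule posdef_solvable[OF fin sym pd]) auto
 qed
 then obtain C where C: "!!k l. l \<in> I ==> (\<Sum>m\<in>I. A l m * C k m) = (if l = k then 1 else 0)" by metis
 have CA: "(\<Sum>m\<in>I. C l m * A m k) = (if l = k then 1 else 0)" if "k \<in> I" "l \<in> I" for k l
 proof -
 have "(\<Sum>m\<in>I. C l m * A m k) = (\<Sum>m\<in>I. A k m * C l m)" by (intro sum.cong refl) (use sym that in \<open>simp add: mult.commute\<close>)
 also have "... = (if l = k then 1 else 0)" using C[of k l] that by auto
 finally show ?thesis .
 qed
 have C_sym: "C l k = C k l" if "l \<in> I" "k \<in> I" for l k
 proof -
 have "C k l = (\<Sum>m\<in>I. (if l = m then 1 else 0) * C k m)" using fin that by (simp add: mult_delta_left)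
 also have "... = (\<Sum>m\<in>I. (\<Sum>h\<in>I. C l h * A h m) * C k m)" using CA that by (intro sum.cong refl) simp
 also have "... = (\<Sum>h\<in>I. C l h * (\<Sum>m\<in>I. A h m * C k m))" unfolding sum_distrib_left sum_distrib_right
  by (subst sum.swap) (simp add: mult.assoc)
 also have "... = (\<Sum>h\<in>I. C l h * (if h = k then 1 else 0))" using C by (intro sum.cong refl) simp
 also have "... = C l k" using fin that by (simp add: mult_delta_right)
 finally show ?thesis by simp
 qed
 have inv: "is_inverse_on I A C" unfolding is_inverse_on_def
 proof (intro ballI conjI)
 fix l m assume "l \<in> I" "m \<in> I"
 then show "(\<Sum>k\<in>I. C l k * A k m) = (if l = m then 1 else 0)" using CA by simp
 have "(\<Sum>k\<in>I. A l k * C k m) = (\<Sum>k\<in>I. A l k * C m k)" using C_sym \<open>m \<in> I\<close> by (intro sum.cong refl) simp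
 then show "(\<Sum>k\<in>I. A l k * C k m) = (if l = m then 1 else 0)" using C \<open>l \<in> I\<close> by simp
 qed
 then show *: "is_inverse_on I A (inverse_on I A)" unfolding inverse_on_def by (rule someI[where P="is_inverse_on I A"])
 show "inverse_on I A l m = inverse_on I A m l" if "l \<in> I" "m \<in> I" for l m using is_inverse_on_unique[OF fin * inv] that C_sym by simp
qed

section \<open>Cardinal B-splines\<close>

definition bspline_cdf :: "nat => real => real" where
 "bspline_cdf r x = (\<integral>y. indicator {..x} y * bspline r y \<partial>lborel)"

lemma bspline_1: "bspline (Suc 0) = indicator {0..<1}" by (simp add: bspline_def)

lemma bspline_conv: "1 <= r ==> bspline (Suc r) = conv (indicator {0..<1}) (bspline r)" unfolding bspline_def by (cases r) auto

lemma bspline_eq_window: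
 "1 <= r ==> bspline (Suc r) x = (\<integral>y. indicator {x-1<..x} y * bspline r y \<partial>lborel)" unfolding bspline_conv conv_def
 by (rule lint_cong) (auto simp: indicator_def)

lemma bspline_basic:
 assumes "1 <= r"
 shows "bspline r \<in> borel_measurable borel & (\<forall>x. 0 <= bspline r x & bspline r x <= 1)
 & (\<forall>x. x < 0 \<or> real r <= x --> bspline r x = 0)
 & (\<integral>\<^sup>+x. ennreal (bspline r x) \<partial>lborel) = 1" using assms
proof (induction r rule: dec_induct)
 case base
 have "(\<integral>\<^sup>+x. ennreal (indicator {0..<1::real} x) \<partial>lborel) = emeasure lborel {0..<1::real}" by (simp only: ennreal_indicator) simp
 then show ?case by (auto simp: bspline_1 indicator_def)
next
 case (step r)
 then have m[measurable]: "bspline r \<in> borel_measurable borel" and nn: "!!x. 0 <= bspline r x" and le1: "!!x. bspline r x <= 1"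
 and supp: "!!x. x < 0 \<or> real r <= x ==> bspline r x = 0" and mass: "(\<integral>\<^sup>+x. ennreal (bspline r x) \<partial>lborel) = 1" by auto
 note w = bspline_eq_window[OF step.hyps(1)]
 have eq: "bspline (Suc r) = (%x. \<integral>y. indicator {0..<1} (x - y) * bspline r y \<partial>lborel)"
 by (simp add: bspline_conv[OF step.hyps(1)] conv_def fun_eq_iff)
 have int: "integrable lborel (%y. indicator {x-1<..x} y * bspline r y)" for x by (rule lint_bound[of lborel "indicator {x-1<..x} :: real => real"])
  (use nn le1 in \<open>auto simp: indicator_def\<close>)
 have int': "integrable lborel (%y. indicator {0..<1} (x - y) * bspline r y)" for x
 proof -
 have "(%y. indicator {0..<1} (x - y) * bspline r y) = (%y. indicator {x-1<..x} y * bspline r y)" by (auto simp: fun_eq_iff split: split_indicator)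
 then show ?thesis using int[of x] by simp
 qed
 show ?case
 proof (intro conjI allI impI)
 show "bspline (Suc r) \<in> borel_measurable borel" unfolding eq by measurable
 fix x
 show "0 <= bspline (Suc r) x" unfolding w by (rule integral_nonneg_AE) (use nn in auto)
 have "bspline (Suc r) x <= (\<integral>y. indicator {x-1<..x} y \<partial>lborel)"
  unfolding w by (rule integral_mono[OF int]) (use le1 in \<open>auto split: split_indicator\<close>)
 then show "bspline (Suc r) x <= 1" by simp
 next
 fix x assume "x < 0 \<or> real (Suc r) <= x"
 then have "(%y. indicator {x-1<..x} y * bspline r y) = (%_. 0)" using supp by (auto simp: fun_eq_iff split: split_indicator)
 then show "bspline (Suc r) x = 0" unfolding w by (simp only:) simp
 next
 have "(\<integral>\<^sup>+x. ennreal (bspline (Suc r) x) \<partial>lborel)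
  = (\<integral>\<^sup>+x. (\<integral>\<^sup>+y. ennreal (indicator {0..<1} (x - y) * bspline r y) \<partial>lborel) \<partial>lborel)" unfolding eq
  by (intro nn_integral_cong nn_integral_eq_integral[symmetric] int') (use nn in auto)
 also have "... = (\<integral>\<^sup>+y. (\<integral>\<^sup>+x. ennreal (indicator {0..<1} (x - y) * bspline r y) \<partial>lborel) \<partial>lborel)"
  by (rule lborel_pair.Fubini') measurable
 also have "... = (\<integral>\<^sup>+y. ennreal (bspline r y) \<partial>lborel)"
 proof (rule nn_integral_cong)
  fix y :: real
  have "(\<integral>\<^sup>+x. ennreal (indicator {0..<1} (x - y) * bspline r y) \<partial>lborel)
   = (\<integral>\<^sup>+x. ennreal (bspline r y) * indicator {y..<y+1} x \<partial>lborel)" by (rule nn_integral_cong) (auto simp: indicator_def)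
  also have "... = ennreal (bspline r y)" by (subst nn_integral_cmult_indicator) auto
  finally show "(\<integral>\<^sup>+x. ennreal (indicator {0..<1} (x - y) * bspline r y) \<partial>lborel) = ennreal (bspline r y)" .
 qed
 finally show "(\<integral>\<^sup>+x. ennreal (bspline (Suc r) x) \<partial>lborel) = 1" by (simp add: mass)
 qed
qed

lemma
 assumes "1 <= r"
 shows bspline_measurable: "bspline r \<in> borel_measurable borel" and bspline_nonneg: "0 <= bspline r x" and bspline_le_1: "bspline r x <= 1"
 and bspline_support: "x < 0 \<or> real r <= x ==> bspline r x = 0"
 and bspline_mass_nn: "(\<integral>\<^sup>+x. ennreal (bspline r x) \<partial>lborel) = 1" using bspline_basic[OF assms] by auto

lemma bspline_integrable: "1 <= r ==> integrable lborel (bspline r)" by (rule integrableI_nonneg)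
 (auto simp: bspline_measurable bspline_nonneg bspline_mass_nn)

lemma bspline_mass: "1 <= r ==> (\<integral>x. bspline r x \<partial>lborel) = 1" by (subst integral_eq_nn_integral)
 (auto simp: bspline_measurable bspline_nonneg bspline_mass_nn)

lemma bspline_indicator_integrable:
 assumes "1 <= r" "A \<in> sets borel"
 shows "integrable lborel (%y. indicator A y * bspline r y)"
proof (rule lint_bound[OF bspline_integrable[OF assms(1)]])
 note [measurable] = bspline_measurable[OF assms(1)] assms(2)
 show "(%y. indicator A y * bspline r y) \<in> borel_measurable lborel" by measurable
qed (auto split: split_indicator)

lemma bspline_Suc_cdf:
 assumes "1 <= r"
 shows "bspline (Suc r) x = bspline_cdf r x - bspline_cdf r (x - 1)"
proof -
 have "bspline_cdf r x - bspline_cdf r (x - 1)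
  = (\<integral>y. indicator {..x} y * bspline r y - indicator {..x-1} y * bspline r y \<partial>lborel)" unfolding bspline_cdf_def
 by (rule lint_diff[symmetric]) (auto intro!: bspline_indicator_integrable assms)
 also have "... = (\<integral>y. indicator {x-1<..x} y * bspline r y \<partial>lborel)" by (rule lint_cong) (auto split: split_indicator)
 finally show ?thesis by (simp add: bspline_eq_window[OF assms])
qed

lemma bspline_cdf_nonpos: "1 <= r ==> x <= 0 ==> bspline_cdf r x = 0"
proof -
 assume *: "1 <= r" "x <= 0"
 have "AE y in lborel. y ~= (0::real)" by (rule AE_lborel_singleton)
 then have "AE y in lborel. indicator {..x} y * bspline r y = 0" by eventually_elim (use * in \<open>auto simp: indicator_def bspline_support\<close>)
 then show ?thesis unfolding bspline_cdf_def by (rule integral_eq_zero_AE)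
qed

lemma bspline_cdf_ge: "1 <= r ==> real r <= x ==> bspline_cdf r x = 1" unfolding bspline_cdf_def by (subst bspline_mass[of r, symmetric], simp)
 (rule lint_cong, auto simp: indicator_def bspline_support)

lemma bspline_cdf_diff:
 assumes "1 <= r" "x <= y"
 shows "bspline_cdf r y - bspline_cdf r x = (\<integral>z. indicator {x<..y} z * bspline r z \<partial>lborel)"
proof -
 have "bspline_cdf r y - bspline_cdf r x
  = (\<integral>z. indicator {..y} z * bspline r z - indicator {..x} z * bspline r z \<partial>lborel)" unfolding bspline_cdf_def
 by (rule lint_diff[symmetric]) (auto intro!: bspline_indicator_integrable assms)
 also have "... = (\<integral>z. indicator {x<..y} z * bspline r z \<partial>lborel)"
 by (rule lint_cong) (use assms in \<open>auto split: split_indicator\<close>)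
 finally show ?thesis .
qed

lemma bspline_cdf_lipschitz:
 assumes "1 <= r"
 shows "\<bar>bspline_cdf r x - bspline_cdf r y\<bar> <= \<bar>x - y\<bar>"
proof -
 have *: "\<bar>bspline_cdf r y - bspline_cdf r x\<bar> <= y - x" if "x <= y" for x y
 proof -
 have "bspline_cdf r y - bspline_cdf r x <= (\<integral>z. indicator {x<..y} z \<partial>lborel)" unfolding bspline_cdf_diff[OF assms that]
  by (rule integral_mono[OF bspline_indicator_integrable[OF assms]]) (use bspline_le_1[OF assms] that in \<open>auto split: split_indicator\<close>)
 moreover have "0 <= bspline_cdf r y - bspline_cdf r x" unfolding bspline_cdf_diff[OF assms that]
  by (rule integral_nonneg_AE) (auto simp: bspline_nonneg[OF assms])
 ultimately show ?thesis using that by simp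
 qed
 show ?thesis using *[of x y] *[of y x] by linarith
qed

lemma bspline_lipschitz:
 assumes "2 <= r"
 shows "\<bar>bspline r x - bspline r y\<bar> <= 2 * \<bar>x - y\<bar>"
proof -
 obtain q where q: "r = Suc q" "1 <= q" using assms by (cases r) auto
 have "x - 1 - (y - 1) = x - y" by simp
 then show ?thesis using bspline_cdf_lipschitz[OF q(2), of x y] bspline_cdf_lipschitz[OF q(2), of "x-1" "y-1"]
 unfolding q(1) bspline_Suc_cdf[OF q(2)] by (smt (verit))
qed

lemma lipschitz_imp_continuous_on:
 fixes f :: "real => real"
 assumes "!!x y. x \<in> S ==> y \<in> S ==> \<bar>f x - f y\<bar> <= C * \<bar>x - y\<bar>"
 shows "continuous_on S f"
proof -
 have "(max C 0)-lipschitz_on S f"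
 proof (rule lipschitz_onI)
 fix x y assume "x \<in> S" "y \<in> S"
 then have "\<bar>f x - f y\<bar> <= C * \<bar>x - y\<bar>" by (rule assms)
 also have "... <= max C 0 * \<bar>x - y\<bar>" by (intro mult_right_mono) auto
 finally show "dist (f x) (f y) <= max C 0 * dist x y" by (simp add: dist_real_def)
 qed auto
 then show ?thesis by (rule lipschitz_on_continuous_on)
qed

lemma bspline_continuous: "2 <= r ==> continuous_on S (bspline r)" by (rule lipschitz_imp_continuous_on[where C=2]) (rule bspline_lipschitz)

lemma bspline_cdf_has_derivative:
 assumes r: "1 <= r" and x: "2 <= r \<or> x \<notin> \<int>"
 shows "(bspline_cdf r has_real_derivative bspline r x) (at x)"
proof -
 have cont: "isCont (bspline r) x"
 proof (cases "2 <= r")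
 case True
 then show ?thesis using bspline_continuous[of r UNIV] by (simp add: continuous_on_eq_continuous_at)
 next
 case False
 then have "r = Suc 0" "x ~= 0" "x ~= 1" using r x by auto
 have "x \<in> {..<0} \<or> x \<in> {0<..<1} \<or> x \<in> {1<..}" using \<open>x ~= 0\<close> \<open>x ~= 1\<close> by force
 moreover have loc: "isCont (indicator {0..<1} :: real => real) x" if "x \<in> S" "open S" "!!y. y \<in> S ==> indicator {0..<1} y = (c::real)"
  for S and c x :: real
 proof -
  have "continuous_on S (indicator {0..<1} :: real => real)" using that(3) by (subst continuous_on_cong[OF refl, where g="%_. c"]) auto
  then have "\<forall>x\<in>S. isCont (indicator {0..<1} :: real => real) x" using continuous_on_eq_continuous_at[OF that(2)] by blast
  then show ?thesis using that(1) by blast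
 qed
 ultimately show ?thesis unfolding \<open>r = Suc 0\<close> bspline_1 using loc[of x "{..<0}" 0] loc[of x "{0<..<1}" 1] loc[of x "{1<..}" 0] by auto
 qed
 have "((%h::real. (bspline_cdf r (x + h) - bspline_cdf r x) / h) \<longlongrightarrow> bspline r x) (at 0)"
 proof (rule LIM_I)
 fix e :: real assume "0 < e"
 then obtain d where d: "0 < d" "!!z. \<bar>z - x\<bar> < d ==> \<bar>bspline r z - bspline r x\<bar> < e / 2"
  using cont[unfolded continuous_at_eps_delta, rule_format, of "e / 2"] by (auto simp: dist_real_def)
 have bound: "\<bar>bspline_cdf r v - bspline_cdf r u - (v - u) * bspline r x\<bar> <= (v - u) * (e / 2)"
  if "u <= v" "\<bar>u - x\<bar> < d" "\<bar>v - x\<bar> < d" for u v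
 proof -
  have "bspline_cdf r v - bspline_cdf r u - (v - u) * bspline r x
  = (\<integral>z. indicator {u<..v} z * bspline r z \<partial>lborel) - (\<integral>z. indicator {u<..v} z * bspline r x \<partial>lborel)"
  using that by (simp add: bspline_cdf_diff[OF r that(1)])
  also have "... = (\<integral>z. indicator {u<..v} z * (bspline r z - bspline r x) \<partial>lborel)"
  by (subst lint_diff[OF bspline_indicator_integrable[OF r], symmetric]) (use that in \<open>auto simp: right_diff_distrib\<close>)
  also have "\<bar>\<dots>\<bar> <= (\<integral>z. \<bar>indicator {u<..v} z * (bspline r z - bspline r x)\<bar> \<partial>lborel)"
  by (rule integral_abs_bound)
  also have "... <= (\<integral>z. indicator {u<..v} z * (e / 2) \<partial>lborel)"
  proof (rule integral_mono_AE')
  show "integrable lborel (%z. indicator {u<..v} z * (e / 2))" by (intro integrable_mult_left) (use that in simp)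
  show "AE z in lborel. \<bar>indicator {u<..v} z * (bspline r z - bspline r x)\<bar> <= indicator {u<..v} z * (e / 2)"
   using that d(2) by (auto simp: indicator_def intro!: AE_I2 less_imp_le)
  qed (use \<open>0 < e\<close> in auto)
  also have "... = (v - u) * (e / 2)" using that by simp
  finally show ?thesis .
 qed
 show "\<exists>s>0. \<forall>h::real. h ~= 0 & norm (h - 0) < s --> norm ((bspline_cdf r (x + h) - bspline_cdf r x) / h - bspline r x) < e"
 proof (intro exI[of _ d] conjI allI impI \<open>0 < d\<close>)
  fix h :: real assume h: "h ~= 0 & norm (h - 0) < d"
  have "\<bar>bspline_cdf r (x + h) - bspline_cdf r x - h * bspline r x\<bar> <= \<bar>h\<bar> * (e / 2)"
  using bound[of x "x + h"] bound[of "x + h" x] h \<open>0 < d\<close> by (cases "0 <= h") (auto simp: abs_minus_commute algebra_simps)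
  moreover have "(bspline_cdf r (x + h) - bspline_cdf r x) / h - bspline r x
   = (bspline_cdf r (x + h) - bspline_cdf r x - h * bspline r x) / h" using h by (simp add: field_simps)
  ultimately have "\<bar>(bspline_cdf r (x + h) - bspline_cdf r x) / h - bspline r x\<bar> <= e / 2"
  using h by (simp add: abs_divide divide_le_eq mult.commute)
  then show "norm ((bspline_cdf r (x + h) - bspline_cdf r x) / h - bspline r x) < e" using \<open>0 < e\<close> by simp
 qed
 qed
 then show ?thesis by (simp add: DERIV_def)
qed

lemma bspline_cdf_telescope:
 assumes "1 <= r" "l <= K + 1"
 shows "(\<Sum>m=l..K. bspline (Suc r) (x - of_int m)) = bspline_cdf r (x - of_int l) - bspline_cdf r (x - of_int (K + 1))"
proof -
 have "l - 1 <= K" using assms(2) by simp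
 then show ?thesis
 proof (induction K rule: int_ge_induct)
 case base
 then show ?case by simp
 next
 case (step K)
 then have "{l..K + 1} = insert (K + 1) {l..K}" by auto
 then show ?case using step by (simp add: bspline_Suc_cdf[OF assms(1)] algebra_simps)
 qed
qed

lemma bspline_partition_of_unity:
 assumes "1 <= r" "0 <= x" "x < real_of_int K + 1 \<or> (2 <= r & x <= real_of_int K + 1)" "0 <= K"
 shows "(\<Sum>l=- int r + 1..K. bspline r (x - of_int l)) = 1"
proof (cases "r = Suc 0")
 case True
 then have x: "0 <= x" "x < of_int K + 1" using assms by auto
 have "(\<Sum>l=0..K. bspline r (x - of_int l)) = (\<Sum>l=0..K. if l = \<lfloor>x\<rfloor> then 1 else 0)"
 unfolding True bspline_1 by (intro sum.cong refl) (auto simp: indicator_def floor_eq_iff, linarith+)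
 also have "... = 1" using x by (simp add: floor_le_iff le_floor_iff)
 finally show ?thesis by (simp add: True)
next
 case False
 then obtain q where q: "r = Suc q" "1 <= q" using assms(1) by (cases r) auto
 have "(\<Sum>l=- int r + 1..K. bspline r (x - of_int l))
 = bspline_cdf q (x - of_int (- int r + 1)) - bspline_cdf q (x - of_int (K + 1))" unfolding q(1) by (rule bspline_cdf_telescope) (use q assms(4) in auto)
 also have "... = 1"
 proof -
 have "bspline_cdf q (x - of_int (- int r + 1)) = 1" by (rule bspline_cdf_ge) (use q assms in auto)
 moreover have "bspline_cdf q (x - of_int (K + 1)) = 0" by (rule bspline_cdf_nonpos) (use q assms in auto)
 ultimately show ?thesis by simp
 qed
 finally show ?thesis .
qed

text \<open>Differentiating a vanishing combination of the translates of order \<open>r + 1\<close> gives one of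
 the translates of order \<open>r\<close> with the differences of the coefficients; by induction all coefficients
 agree, and then the partition of unity forces them to be zero.\<close>

lemma bspline_local_independence:
 assumes "1 <= r" "!!u. 0 < u ==> u < 1 ==> (\<Sum>i<r. c i * bspline r (u + real i)) = 0"
 shows "\<forall>i<r. c i = 0" using assms
proof (induction r arbitrary: c rule: dec_induct)
 case base
 then show ?case using base[of "1/2"] by (simp add: bspline_1)
next
 case (step r)
 let ?P = "bspline_cdf r"
 have der: "((%u. \<Sum>i<Suc r. c i * (?P (u + real i) - ?P (u + real i - 1))) has_real_derivative
  (\<Sum>i<Suc r. c i * (bspline r (u + real i) - bspline r (u + real i - 1)))) (at u)" if u: "0 < u" "u < 1" for u
 proof -
 have nint: "u + real i \<notin> \<int>" "u + real i - 1 \<notin> \<int>" for i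
 proof -
  have "u \<notin> \<int>"
  proof
  assume "u \<in> \<int>"
  then obtain k where "u = of_int k" by (elim Ints_cases)
  then show False using u by simp
  qed
  then show "u + real i \<notin> \<int>" "u + real i - 1 \<notin> \<int>"
  using Ints_diff[of "u + real i" "real i"] Ints_diff[of "u + real i - 1" "real i - 1"] by auto
 qed
 have P: "((%u. ?P (u + a)) has_real_derivative bspline r (u + a)) (at u)" if "u + a \<notin> \<int>" for a
 proof -
  have "(?P has_real_derivative bspline r (u + a)) (at (u + a))" by (rule bspline_cdf_has_derivative) (use step.hyps that in auto)
  then show ?thesis by (simp only: DERIV_shift)
 qed
 have "((%u. c i * (?P (u + real i) - ?P (u + real i - 1))) has_real_derivative
  c i * (bspline r (u + real i) - bspline r (u + real i - 1))) (at u)" for i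
  by (rule DERIV_cmult[OF DERIV_diff[OF P[OF nint(1)] P[of "real i - 1", unfolded add_diff_eq, OF nint(2)]]])
 then show ?thesis by (rule DERIV_sum)
 qed
 have zero: "(\<Sum>i<Suc r. c i * (?P (u + real i) - ?P (u + real i - 1))) = 0" if "0 < u" "u < 1" for u
 using step.prems(1)[OF that] by (simp only: bspline_Suc_cdf[OF step.hyps(1)])
 have dzero: "(\<Sum>i<Suc r. c i * (bspline r (u + real i) - bspline r (u + real i - 1))) = 0" if u: "0 < u" "u < 1" for u
 proof (rule DERIV_unique[OF der[OF u]])
 have "((%_. 0) has_real_derivative 0) (at u)" by (rule DERIV_const)
 then show "((%u. \<Sum>i<Suc r. c i * (?P (u + real i) - ?P (u + real i - 1))) has_real_derivative 0) (at u)"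
 proof (rule has_field_derivative_transform_within_open[of _ _ _ "{0<..<1}"])
  show "0 = (\<Sum>i<Suc r. c i * (?P (v + real i) - ?P (v + real i - 1)))" if "v \<in> {0<..<1}" for v
  using zero[of v] that by (simp only: greaterThanLessThan_iff)
 qed (use u in auto)
 qed
 have "(\<Sum>i<r. (c i - c (Suc i)) * bspline r (u + real i)) = 0" if u: "0 < u" "u < 1" for u
 proof -
 have "(\<Sum>i<Suc r. c i * (bspline r (u + real i) - bspline r (u + real i - 1)))
  = (\<Sum>i<Suc r. c i * bspline r (u + real i)) - (\<Sum>i<Suc r. c i * bspline r (u + real i - 1))" by (simp only: right_diff_distrib sum_subtractf)
 also have "(\<Sum>i<Suc r. c i * bspline r (u + real i)) = (\<Sum>i<r. c i * bspline r (u + real i))"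
  using u by (simp add: bspline_support[OF step.hyps(1)])
 also have "(\<Sum>i<Suc r. c i * bspline r (u + real i - 1)) = (\<Sum>i<r. c (Suc i) * bspline r (u + real i))"
  using u by (subst sum.lessThan_Suc_shift) (simp add: bspline_support[OF step.hyps(1)] add_ac)
 finally show ?thesis using dzero[OF u] by (simp add: left_diff_distrib sum_subtractf)
 qed
 then have eq: "\<forall>i<r. c i - c (Suc i) = 0" by (rule step.IH)
 have all: "i <= r ==> c i = c 0" for i
 proof (induction i)
 case (Suc i)
 then show ?case using eq[rule_format, of i] by simp
 qed simp
 have "(\<Sum>i<Suc r. bspline (Suc r) (1/2 + real i)) = (\<Sum>l=- int (Suc r) + 1..0. bspline (Suc r) (1/2 - of_int l))"
 by (rule sum.reindex_bij_witness[of _ "%l. nat (- l)" "%i. - int i"]) auto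
 also have "... = 1" by (rule bspline_partition_of_unity) auto
 finally have pu: "(\<Sum>i<Suc r. bspline (Suc r) (1/2 + real i)) = 1" .
 have "(\<Sum>i<Suc r. c i * bspline (Suc r) (1/2 + real i)) = (\<Sum>i<Suc r. c 0 * bspline (Suc r) (1/2 + real i))"
 proof (rule sum.cong[OF refl])
 fix i assume "i \<in> {..<Suc r}"
 then show "c i * bspline (Suc r) (1 / 2 + real i) = c 0 * bspline (Suc r) (1 / 2 + real i)" using all[of i] by (simp only: lessThan_iff less_Suc_eq_le)
 qed
 also have "... = c 0" using pu by (simp only: flip: sum_distrib_left)
 finally have "c 0 = 0" using step.prems(1)[of "1/2"] by simp
 then show ?case using all by (metis less_Suc_eq_le)
qed

section \<open>Spline spaces and their orthogonal projections\<close>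

definition spline_comb :: "nat => nat => (int => real) => real => real" where
 "spline_comb r j c x = (\<Sum>l\<in>spline_index r j. c l * bspline_scaled r j l x)"

definition spline_space :: "nat => nat => (real => real) set" where
 "spline_space r j = {s. \<exists>c. \<forall>x\<in>{0..1}. s x = spline_comb r j c x}"

lemma finite_spline_index [simp]: "finite (spline_index r j)" by (simp add: spline_index_def)

lemma bspline_scaled_measurable: "1 <= r ==> bspline_scaled r j l \<in> borel_measurable borel" unfolding bspline_scaled_def[abs_def]
 by (rule measurable_compose[OF _ bspline_measurable]) auto

lemma bspline_scaled_nonneg: "1 <= r ==> 0 <= bspline_scaled r j l x" unfolding bspline_scaled_def by (rule bspline_nonneg)

lemma bspline_scaled_le_1: "1 <= r ==> bspline_scaled r j l x <= 1" unfolding bspline_scaled_def by (rule bspline_le_1)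

lemma bspline_scaled_abs_le_1: "1 <= r ==> \<bar>bspline_scaled r j l x\<bar> <= 1"
 using bspline_scaled_nonneg[of r j l x] bspline_scaled_le_1[of r j l x] by (simp only: abs_of_nonneg)

lemma bmeas_bspline_scaled: "1 <= r ==> bmeas (bspline_scaled r j l)" by (rule bmeasI[of _ 1])
 (erule measurable_lborel01I[OF bspline_scaled_measurable], erule bspline_scaled_abs_le_1)

lemma bspline_scaled_continuous: "2 <= r ==> continuous_on S (bspline_scaled r j l)" unfolding bspline_scaled_def[abs_def]
 by (rule continuous_on_compose2[OF bspline_continuous[of r UNIV]]) (auto intro!: continuous_intros)

lemma spline_comb_measurable: "1 <= r ==> spline_comb r j c \<in> borel_measurable borel" unfolding spline_comb_def[abs_def]
 by (intro borel_measurable_sum borel_measurable_times bspline_scaled_measurable) auto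

lemma spline_comb_abs_le: "1 <= r ==> \<bar>spline_comb r j c x\<bar> <= (\<Sum>l\<in>spline_index r j. \<bar>c l\<bar>)" unfolding spline_comb_def
 by (rule order_trans[OF sum_abs])
 (intro sum_mono, simp add: abs_mult mult_left_le bspline_scaled_abs_le_1)

lemma bmeas_spline_comb: "1 <= r ==> bmeas (spline_comb r j c)" unfolding spline_comb_def[abs_def]
 by (intro bmeas_sum bmeas_mult bmeas_const bmeas_bspline_scaled)

lemma bmeas_spline_space: "1 <= r ==> s \<in> spline_space r j ==> bmeas s" unfolding spline_space_def by (auto intro: bmeas_cong[OF bmeas_spline_comb])

lemma spline_comb_in_space: "spline_comb r j c \<in> spline_space r j" unfolding spline_space_def by blast

lemma spline_comb_add: "spline_comb r j (%l. c l + d l) x = spline_comb r j c x + spline_comb r j d x"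
 by (simp add: spline_comb_def sum.distrib algebra_simps)

lemma spline_comb_diff: "spline_comb r j (%l. c l - d l) x = spline_comb r j c x - spline_comb r j d x"
 by (simp add: spline_comb_def sum_subtractf algebra_simps)

lemma spline_space_add:
 assumes "s \<in> spline_space r j" "t \<in> spline_space r j" shows "(%x. s x + t x) \<in> spline_space r j"
proof -
 obtain c d where "\<forall>x\<in>{0..1}. s x = spline_comb r j c x" "\<forall>x\<in>{0..1}. t x = spline_comb r j d x"
 using assms unfolding spline_space_def by blast
 then have "\<forall>x\<in>{0..1}. s x + t x = spline_comb r j (%l. c l + d l) x" by (simp add: spline_comb_add)
 then show ?thesis unfolding spline_space_def by blast
qed

lemma spline_space_diff:
 assumes "s \<in> spline_space r j" "t \<in> spline_space r j" shows "(%x. s x - t x) \<in> spline_space r j"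
proof -
 obtain c d where "\<forall>x\<in>{0..1}. s x = spline_comb r j c x" "\<forall>x\<in>{0..1}. t x = spline_comb r j d x"
 using assms unfolding spline_space_def by blast
 then have "\<forall>x\<in>{0..1}. s x - t x = spline_comb r j (%l. c l - d l) x" by (simp add: spline_comb_diff)
 then show ?thesis unfolding spline_space_def by blast
qed

text \<open>Only the \<open>r\<close> translates whose index is \<open>k - i\<close> with \<open>i < r\<close> meet the \<open>k\<close>-th cell.\<close>

lemma spline_comb_on_cell:
 assumes r: "1 <= r" and k: "0 <= k" "k < 2 ^ j" and u: "0 <= u" "u < 1 \<or> (u <= 1 & k = 2 ^ j - 1)"
 shows "spline_comb r j c ((of_int k + u) / 2 ^ j) = (\<Sum>i<r. c (k - int i) * bspline r (u + real i))"
proof -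
 have "spline_comb r j c ((of_int k + u) / 2 ^ j)
  = (\<Sum>l\<in>spline_index r j. c l * bspline r (of_int k + u - of_int l))" by (simp add: spline_comb_def bspline_scaled_def)
 also have "... = (\<Sum>l\<in>{k - int r + 1..k}. c l * bspline r (of_int k + u - of_int l))"
 proof (rule sum.mono_neutral_right)
 show "{k - int r + 1..k} \<subseteq> spline_index r j" using k by (auto simp: spline_index_def)
 show "\<forall>l\<in>spline_index r j - {k - int r + 1..k}. c l * bspline r (of_int k + u - of_int l) = 0"
 proof
  fix l assume l: "l \<in> spline_index r j - {k - int r + 1..k}"
  then have "l <= k - int r \<or> k + 1 <= l" by auto
  then have "real r <= of_int k + u - of_int l \<or> of_int k + u - of_int l < 0"
  proof
  assume "l <= k - int r"
  then have "of_int l <= of_int k - real r" by (metis of_int_diff of_int_le_iff of_int_of_nat_eq)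
  then show ?thesis using u by linarith
  next
  assume *: "k + 1 <= l"
  then have "of_int k + 1 <= (of_int l :: real)" by (metis of_int_add of_int_le_iff of_int_1)
  moreover have "u < 1" using u * l by (auto simp: spline_index_def)
  ultimately show ?thesis by linarith
  qed
  then show "c l * bspline r (of_int k + u - of_int l) = 0" using bspline_support[OF r, of "of_int k + u - of_int l"] by auto
 qed
 qed auto
 also have "... = (\<Sum>i<r. c (k - int i) * bspline r (u + real i))" by (rule sum.reindex_bij_witness[of _ "%i. k - int i" "%l. nat (k - l)"])
  (auto simp: add_diff_eq add.commute[of u])
 finally show ?thesis .
qed

lemma sq_cell_le:
 assumes m: "f \<in> borel_measurable borel" and b: "!!x. \<bar>f x\<bar> <= B" and k: "0 <= k" "k < 2 ^ j"
 shows "sq (%u. f ((real_of_int k + u) / 2 ^ j)) <= 2 ^ j * sq f"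
proof -
 note [measurable] = m
 have b2: "(f x)^2 <= B^2" for x using power_mono[OF b[of x] abs_ge_zero, of 2] by simp
 have int: "integrable lborel (%x. indicator S x * (f x)^2)" if "S = {a..b}" for S and a b :: real
 proof (rule lint_bound[of lborel "%x. B\<^sup>2 * indicator S x"])
 show "AE x in lborel. norm (indicator S x * (f x)^2) <= norm (B^2 * indicator S x)" using b2 by (auto split: split_indicator intro!: AE_I2)
 show "integrable lborel (%x. B\<^sup>2 * indicator S x)" unfolding that by (intro integrable_mult_right) (simp add: emeasure_lborel_Icc_eq)
 qed (auto simp: that)
 have "sq (%u. f ((of_int k + u) / 2 ^ j)) = (\<integral>u. indicator {0..1} u * (f ((of_int k + u) / 2 ^ j))^2 \<partial>lborel)"
 unfolding sq_def by (subst integral_restrict_space) auto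
 also have "... = 2 ^ j * (\<integral>x. indicator {0..1} (- of_int k + 2 ^ j * x) * (f ((of_int k + (- of_int k + 2 ^ j * x)) / 2 ^ j))^2 \<partial>lborel)"
 by (subst lborel_integral_real_affine[of "2 ^ j" _ "- of_int k"]) auto
 also have "(%x. indicator {0..1} (- of_int k + 2 ^ j * x) * (f ((of_int k + (- of_int k + 2 ^ j * x)) / 2 ^ j))^2)
  = (%x. indicator {of_int k / 2 ^ j..(of_int k + 1) / 2 ^ j} x * (f x)^2)"
 proof
 fix x :: real
 have "- of_int k + 2 ^ j * x \<in> {0..1} \<longleftrightarrow> x \<in> {of_int k / 2 ^ j..(of_int k + 1) / 2 ^ j}"
  by (simp add: divide_le_eq le_divide_eq mult.commute) linarith
 moreover have "(of_int k + (- of_int k + 2 ^ j * x)) / 2 ^ j = x" by simp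
 ultimately show "indicator {0..1} (- of_int k + 2 ^ j * x) * (f ((of_int k + (- of_int k + 2 ^ j * x)) / 2 ^ j))^2
  = indicator {of_int k / 2 ^ j..(of_int k + 1) / 2 ^ j} x * (f x)^2" by (simp only: indicator_def)
 qed
 also have "(\<integral>x. indicator {of_int k / 2 ^ j..(of_int k + 1) / 2 ^ j} x * (f x)^2 \<partial>lborel)
  <= (\<integral>x. indicator {0..1} x * (f x)^2 \<partial>lborel)"
 proof (rule integral_mono[OF int[OF refl] int[OF refl]])
 fix x :: real
 have "real_of_int k + 1 <= 2 ^ j"
 proof -
  have "real_of_int (k + 1) <= real_of_int (2 ^ j)" using k(2) by (simp only: of_int_le_iff)
  then show ?thesis by simp
 qed
 then have "(real_of_int k + 1) / 2 ^ j <= 1" by simp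
 moreover have "0 <= of_int k / (2 ^ j :: real)" using k by simp
 ultimately have sub: "x \<in> {of_int k / 2 ^ j..(of_int k + 1) / 2 ^ j} ==> x \<in> {0..1}" unfolding atLeastAtMost_iff by linarith
 have "indicator {of_int k / 2 ^ j..(of_int k + 1) / 2 ^ j} x <= (indicator {0..1} x :: real)" using sub by (simp only: indicator_def) simp
 then show "indicator {of_int k / 2 ^ j..(of_int k + 1) / 2 ^ j} x * (f x)^2 <= indicator {0..1} x * (f x)^2" by (rule mult_right_mono) simp
 qed
 also have "(\<integral>x. indicator {0..1} x * (f x)^2 \<partial>lborel) = sq f" unfolding sq_def by (subst integral_restrict_space) auto
 finally show ?thesis by simp
qed

lemma sq_zero_AE:
 assumes "bmeas f" "sq f <= 0" shows "AE x in lborel01. f x = 0"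
proof -
 have "(I01 x. (f x)\<^sup>2) = 0" using assms(2) sq_nonneg[of f] unfolding sq_def by linarith
 then have "AE x in lborel01. (f x)\<^sup>2 = 0"
 using assms(1) by (subst integral_nonneg_eq_0_iff_AE[symmetric]) (auto intro: bmeas_integrable bmeas_power2 simp: sq_def)
 then show ?thesis by simp
qed

lemma AE_lborel01_iff: "(AE x in lborel01. P x) \<longleftrightarrow> (AE x in lborel. x \<in> {0..1} --> P x)" by (subst AE_restrict_space_iff) auto

lemma local_gram_posdef:
 assumes r: "1 <= r" and z: "sq (%u. \<Sum>i<r. c i * bspline r (u + real i)) <= 0"
 shows "\<forall>i<r. c i = 0"
proof (rule bspline_local_independence[OF r])
 let ?F = "%u. \<Sum>i<r. c i * bspline r (u + real i)"
 have m: "?F \<in> borel_measurable borel" by (intro borel_measurable_sum borel_measurable_times measurable_compose[OF _ bspline_measurable[OF r]]) auto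
 have "\<bar>?F u\<bar> <= (\<Sum>i<r. \<bar>c i\<bar>)" for u by (rule order_trans[OF sum_abs])
  (auto intro!: sum_mono simp: abs_mult bspline_nonneg[OF r] bspline_le_1[OF r] mult_left_le)
 then have "bmeas ?F" by (intro bmeasI[OF measurable_lborel01I[OF m]])
 then have AE: "AE u in lborel. u \<in> {0..1} --> ?F u = 0" using sq_zero_AE[OF _ z] by (simp add: AE_lborel01_iff)
 fix u :: real assume u: "0 < u" "u < 1"
 show "?F u = 0"
 proof (cases "2 <= r")
 case True
 have "continuous_on UNIV ?F" by (intro continuous_intros continuous_on_compose2[OF bspline_continuous[OF True, of UNIV]]) auto
 then have "closed {u. ?F u = 0}" using continuous_closed_vimage[of "{0}" ?F] by (auto simp: vimage_def continuous_on_eq_continuous_at)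
 moreover have "AE u\<in>{0<..<1} in lebesgue. u \<in> {u. ?F u = 0}" using AE_completion[OF AE] by (rule AE_mp) (auto intro!: AE_I2)
 ultimately show ?thesis using mem_closed_if_AE_lebesgue_open[of "{0<..<1}" "{u. ?F u = 0}" u] u by auto
 next
 case False
 then have r1: "r = Suc 0" using r by auto
 have "\<not> (AE v in lborel. v \<notin> {0<..<1::real})"
 proof
  assume "AE v in lborel. v \<notin> {0<..<1::real}"
  then have "emeasure lborel {0<..<1::real} = 0" by (subst (asm) AE_iff_measurable[of "{0<..<1::real}"]) auto
  then show False by simp
 qed
 moreover have "AE v in lborel. v \<notin> {0<..<1::real}" if "\<nexists>v. v \<in> {0<..<1} & ?F v = 0" using AE by eventually_elim (use that in force)
 ultimately obtain v where "v \<in> {0<..<1}" "?F v = 0" by blast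
 then show ?thesis using u by (simp add: r1 bspline_1)
 qed
qed

lemma sum_square_expand:
 "(\<Sum>i\<in>I. f i :: real)^2 = (\<Sum>i\<in>I. \<Sum>k\<in>I. f i * f k)" by (simp add: power2_eq_square sum_product)

lemma integral_double_sum:
 assumes "!!i k. i \<in> I ==> k \<in> K ==> bmeas (f i k)"
 shows "(I01 x. (\<Sum>i\<in>I. \<Sum>k\<in>K. f i k x)) = (\<Sum>i\<in>I. \<Sum>k\<in>K. \<integral>x. f i k x \<partial>lborel01)" by (subst lint_sum)
 (auto intro!: bmeas_integrable bmeas_sum assms sum.cong lint_sum)

text \<open>The coefficients of a spline are bounded by its norm on any one cell that the basis function
 meets: the local basis functions are independent, so their Gram matrix, which does not depend on
 the cell, has an inverse.\<close>

lemma cell_stability: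
 assumes r: "1 <= r"
 obtains C where "0 < C"
 "!!j k c i. 0 <= k ==> k < 2 ^ j ==> i < r ==> (c (k - int i))^2 <= C * 2 ^ j * sq (spline_comb r j c)"
proof -
 let ?N = "%i u. bspline r (u + real i)"
 have mN: "?N i \<in> borel_measurable borel" for i by (rule measurable_compose[OF _ bspline_measurable[OF r]]) auto
 have bN: "bmeas (?N i)" for i by (rule bmeasI[of _ 1, OF measurable_lborel01I[OF mN]]) (simp add: bspline_nonneg[OF r] bspline_le_1[OF r])
 define G where "G i k = (I01 u. ?N i u * ?N k u)" for i k
 have quad: "(\<Sum>i<r. \<Sum>k<r. c i * G i k * c k) = sq (%u. \<Sum>i<r. c i * ?N i u)" for c
 proof -
 have "sq (%u. \<Sum>i<r. c i * ?N i u) = (I01 u. (\<Sum>i<r. \<Sum>k<r. (c i * c k) * (?N i u * ?N k u)))"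
  unfolding sq_def sum_square_expand by (simp add: mult_ac)
 also have "... = (\<Sum>i<r. \<Sum>k<r. (c i * c k) * G i k)" unfolding G_def by (subst integral_double_sum) (auto intro!: bmeas_intros bN)
 finally show ?thesis by (simp add: mult_ac)
 qed
 define B where "B = inverse_on {..<r} G"
 have inv: "is_inverse_on {..<r} G B" unfolding B_def
 proof (rule posdef_invertible(1))
 show "G l m = G m l" for l m by (simp add: G_def mult.commute)
 show "\<forall>m\<in>{..<r}. c m = 0" if "(\<Sum>l<r. \<Sum>m<r. c l * G l m * c m) <= 0" for c
  using local_gram_posdef[OF r, of c] that unfolding quad by auto
 qed auto
 define C where "C = (1 + (\<Sum>i<r. \<Sum>k<r. \<bar>B i k\<bar>))^2"
 have S0: "0 <= (\<Sum>i<r. \<Sum>k<r. \<bar>B i k\<bar>)" by (intro sum_nonneg) auto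
 have loc: "(c i)^2 <= C * sq (%u. \<Sum>i<r. c i * ?N i u)" if i: "i < r" for c i
 proof -
 let ?F = "%u. \<Sum>i<r. c i * ?N i u"
 have bF: "bmeas ?F" by (intro bmeas_intros bN)
 have GF: "(\<Sum>m<r. G k m * c m) = (I01 u. ?F u * ?N k u)" for k
 proof -
  have "(I01 u. ?F u * ?N k u) = (I01 u. (\<Sum>m<r. c m * (?N k u * ?N m u)))" by (simp only: sum_distrib_right) (simp add: mult_ac)
  also have "... = (\<Sum>m<r. \<integral>u. c m * (?N k u * ?N m u) \<partial>lborel01)" by (rule lint_sum) (intro bmeas_integrable bmeas_intros bN)
  finally show ?thesis by (simp add: G_def mult_ac)
 qed
 have bound: "\<bar>\<integral>u. ?F u * ?N k u \<partial>lborel01\<bar> <= sqrt (sq ?F)" for k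
 proof -
  have "(I01 u. ?F u * ?N k u)^2 <= sq ?F * sq (?N k)" by (rule cauchy_schwarz_U[OF bF bN])
  also have "... <= sq ?F * 1" by (intro mult_left_mono sq_le_const bN)
   (auto simp: bspline_nonneg[OF r] bspline_le_1[OF r] power_le_one)
  finally show ?thesis by (simp add: real_le_rsqrt sqrt_le_D flip: real_sqrt_abs)
 qed
 have "c i = (\<Sum>m<r. (\<Sum>k<r. B i k * G k m) * c m)" using inv i by (simp add: is_inverse_on_def mult_delta_left)
 also have "... = (\<Sum>k<r. B i k * (\<Sum>m<r. G k m * c m))" unfolding sum_distrib_left sum_distrib_right by (subst sum.swap) (simp add: mult.assoc)
 finally have "\<bar>c i\<bar> <= (\<Sum>k<r. \<bar>B i k\<bar> * sqrt (sq ?F))" unfolding GF using bound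
  by (simp add: order_trans[OF sum_abs] sum_mono mult_left_mono abs_mult)
 also have "... = (\<Sum>k<r. \<bar>B i k\<bar>) * sqrt (sq ?F)" by (simp add: sum_distrib_right)
 also have "... <= (1 + (\<Sum>i<r. \<Sum>k<r. \<bar>B i k\<bar>)) * sqrt (sq ?F)"
 proof (rule mult_right_mono)
  have "(\<Sum>k<r. \<bar>B i k\<bar>) <= (\<Sum>i<r. \<Sum>k<r. \<bar>B i k\<bar>)"
  by (rule member_le_sum[of i "{..<r}" "%i. \<Sum>k<r. \<bar>B i k\<bar>"]) (use i in \<open>auto intro: sum_nonneg\<close>)
  then show "(\<Sum>k<r. \<bar>B i k\<bar>) <= 1 + (\<Sum>i<r. \<Sum>k<r. \<bar>B i k\<bar>)" by simp
 qed auto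
 finally have "\<bar>c i\<bar>\<^sup>2 <= ((1 + (\<Sum>i<r. \<Sum>k<r. \<bar>B i k\<bar>)) * sqrt (sq ?F))^2" by (intro power_mono) auto
 then show ?thesis by (simp add: power_mult_distrib C_def)
 qed
 show ?thesis
 proof (rule that[of C])
 show "0 < C" unfolding C_def using S0 by (intro zero_less_power) linarith
 fix j :: nat and k :: int and c :: "int => real" and i :: nat
 assume k: "0 <= k" "k < 2 ^ j" and i: "i < r"
 have "(c (k - int i))^2 <= C * sq (%u. \<Sum>i<r. c (k - int i) * ?N i u)" using loc[OF i, of "%i. c (k - int i)"] .
 also have "sq (%u. \<Sum>i<r. c (k - int i) * ?N i u) = sq (%u. spline_comb r j c ((of_int k + u) / 2 ^ j))" unfolding sq_def
 proof (rule integral_cong_AE)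
  have m1: "(%u. spline_comb r j c ((of_int k + u) / 2 ^ j)) \<in> borel_measurable borel"
  by (rule measurable_compose[OF _ spline_comb_measurable[OF r]]) auto
  then show "(%u. (spline_comb r j c ((of_int k + u) / 2 ^ j))\<^sup>2) \<in> borel_measurable lborel01"
  by (intro measurable_lborel01I borel_measurable_power)
  show "(%u. (\<Sum>i<r. c (k - int i) * ?N i u)\<^sup>2) \<in> borel_measurable lborel01"
  by (intro measurable_lborel01I borel_measurable_power borel_measurable_sum borel_measurable_times mN) auto
  have "AE u in lborel. u ~= (1::real)" by (rule AE_lborel_singleton)
  then show "AE u in lborel01. (\<Sum>i<r. c (k - int i) * ?N i u)\<^sup>2 = (spline_comb r j c ((of_int k + u) / 2 ^ j))^2" unfolding AE_lborel01_iff
  by eventually_elim (auto simp: spline_comb_on_cell[OF r k])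
 qed
 also have "... <= 2 ^ j * sq (spline_comb r j c)" by (rule sq_cell_le[OF spline_comb_measurable[OF r] spline_comb_abs_le[OF r] k])
 finally show "(c (k - int i))^2 <= C * 2 ^ j * sq (spline_comb r j c)" using \<open>0 < C\<close> by (simp add: mult_left_mono)
 qed
qed

lemma gram_scaled:
 assumes "1 <= r"
 shows "(I01 x. bspline_scaled r j l x * bspline_scaled r j m x) = spline_gram r j l m / 2 ^ j"
proof -
 have "spline_gram r j l m = (\<integral>u. indicator {0..2 ^ j} u * (bspline r (u - of_int l) * bspline r (u - of_int m)) \<partial>lborel)"
 by (simp add: spline_gram_def set_lebesgue_integral_def)
 also have "... = 2 ^ j * (\<integral>x. indicator {0..2 ^ j} (2 ^ j * x)
  * (bspline r (2 ^ j * x - of_int l) * bspline r (2 ^ j * x - of_int m)) \<partial>lborel)" by (subst lborel_integral_real_affine[of "2 ^ j" _ 0]) auto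
 also have "(%x::real. indicator {0..2 ^ j} (2 ^ j * x) :: real) = indicator {0..1}"
 by (simp add: fun_eq_iff indicator_def zero_le_mult_iff not_le[of "2 ^ j"])
 also have "(\<integral>x. indicator {0..1} x * (bspline r (2 ^ j * x - of_int l) * bspline r (2 ^ j * x - of_int m)) \<partial>lborel)
  = (I01 x. bspline_scaled r j l x * bspline_scaled r j m x)" by (subst integral_restrict_space) (auto simp: bspline_scaled_def)
 finally show ?thesis by simp
qed

lemma gram_quadratic:
 assumes "1 <= r"
 shows "(\<Sum>l\<in>spline_index r j. \<Sum>m\<in>spline_index r j. c l * spline_gram r j l m * c m)
 = 2 ^ j * sq (spline_comb r j c)"
proof -
 have "sq (spline_comb r j c) = (I01 x. (\<Sum>l\<in>spline_index r j. \<Sum>m\<in>spline_index r j.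
  (c l * c m) * (bspline_scaled r j l x * bspline_scaled r j m x)))" unfolding sq_def spline_comb_def sum_square_expand by (simp add: mult_ac)
 also have "... = (\<Sum>l\<in>spline_index r j. \<Sum>m\<in>spline_index r j. (c l * c m) * (spline_gram r j l m / 2 ^ j))" by (subst integral_double_sum)
  (auto intro!: bmeas_intros bmeas_bspline_scaled[OF assms] simp: gram_scaled[OF assms])
 also have "... = (\<Sum>l\<in>spline_index r j. \<Sum>m\<in>spline_index r j. c l * spline_gram r j l m * c m) / 2 ^ j"
 by (simp add: sum_divide_distrib mult_ac)
 finally show ?thesis by simp
qed

lemma
 assumes r: "1 <= r"
 shows spline_gram_inverse: "is_inverse_on (spline_index r j) (spline_gram r j) (spline_gram_inv r j)"
 and spline_gram_inv_sym: "!!l m. l \<in> spline_index r j ==> m \<in> spline_index r j ==>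
  spline_gram_inv r j l m = spline_gram_inv r j m l"
proof -
 have sym: "spline_gram r j l m = spline_gram r j m l" for l m unfolding spline_gram_def by (simp add: mult.commute)
 have pd: "\<forall>m\<in>spline_index r j. c m = 0"
 if c: "(\<Sum>l\<in>spline_index r j. \<Sum>m\<in>spline_index r j. c l * spline_gram r j l m * c m) <= 0" for c
 proof
 fix l assume l: "l \<in> spline_index r j"
 have z: "sq (spline_comb r j c) = 0" using c sq_nonneg[of "spline_comb r j c"] unfolding gram_quadratic[OF r]
  using zero_less_power[of "2::real" j] by (auto simp: mult_le_0_iff simp del: zero_less_power)
 obtain C where "!!j k c i. 0 <= k ==> k < 2 ^ j ==> i < r ==> (c (k - int i))^2 <= C * 2 ^ j * sq (spline_comb r j c)"
  by (rule cell_stability[OF r]) (rule that)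
 from this[of "max l 0" j "nat (max l 0 - l)" c] have "(c l)^2 <= 0" using l r z by (cases "l <= 0") (simp_all add: spline_index_def max_def, linarith)
 then show "c l = 0" by simp
 qed
 show "is_inverse_on (spline_index r j) (spline_gram r j) (spline_gram_inv r j)"
 unfolding spline_gram_inv_def by (rule posdef_invertible(1)[OF finite_spline_index sym pd])
 show "spline_gram_inv r j l m = spline_gram_inv r j m l" if "l \<in> spline_index r j" "m \<in> spline_index r j" for l m
 unfolding spline_gram_inv_def by (rule posdef_invertible(2)[OF finite_spline_index sym pd that])
qed

text \<open>On one cell a spline is a combination of finitely many basis functions whose
 coefficients its norm on that cell controls, and a cell has length \<open>1 / 2 ^ j\<close>.\<close>

lemma spline_sup_le:
 assumes r: "2 <= r"
 obtains C where "0 < C"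
 "!!j s x. s \<in> spline_space r j ==> x \<in> {0..1} ==> (s x)^2 <= C * 2 ^ j * sq s"
proof -
 have r1: "1 <= r" using r by simp
 obtain C where C: "0 < C"
 "!!j k c i. 0 <= k ==> k < 2 ^ j ==> i < r ==> (c (k - int i))^2 <= C * 2 ^ j * sq (spline_comb r j c)" by (rule cell_stability[OF r1]) (rule that)
 show ?thesis
 proof (rule that[of "real r * (real r * C)"])
 show "0 < real r * (real r * C)" using r C by simp
 fix j :: nat and s :: "real => real" and x :: real
 assume s: "s \<in> spline_space r j" and x: "x \<in> {0..1}"
 then obtain c where c: "!!x. x \<in> {0..1} ==> s x = spline_comb r j c x" unfolding spline_space_def by blast
 obtain k :: int and u :: real where k: "0 <= k" "k < 2 ^ j" and u: "0 <= u" "u < 1 \<or> (u <= 1 & k = 2 ^ j - 1)" and xk: "x = (of_int k + u) / 2 ^ j"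
 proof (cases "x = 1")
  case True
  show ?thesis by (rule that[of "2 ^ j - 1" 1]) (auto simp: True)
 next
  case False
  have "2 ^ j * x < 2 ^ j * 1" using False x by (intro mult_strict_left_mono) auto
  then have lt: "\<lfloor>2 ^ j * x\<rfloor> < 2 ^ j" by (simp add: floor_less_iff)
  show ?thesis
  proof (rule that[of "\<lfloor>2 ^ j * x\<rfloor>" "frac (2 ^ j * x)"])
  show "x = (of_int \<lfloor>2 ^ j * x\<rfloor> + frac (2 ^ j * x)) / 2 ^ j" by (simp add: frac_def)
  qed (use x lt in \<open>auto simp: frac_lt_1\<close>)
 qed
 have "(s x)^2 = (\<Sum>i<r. c (k - int i) * bspline r (u + real i))^2" using c[OF x] spline_comb_on_cell[OF r1 k u] xk by simp
 also have "... <= (\<Sum>i<r. 1\<^sup>2) * (\<Sum>i<r. (c (k - int i) * bspline r (u + real i))\<^sup>2)"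
  using Cauchy_Schwarz_ineq_sum[of "%_. 1" "%i. c (k - int i) * bspline r (u + real i)" "{..<r}"] by simp
 also have "... <= real r * (\<Sum>i<r. C * 2 ^ j * sq s)"
 proof -
  have "(c (k - int i) * bspline r (u + real i))^2 <= C * 2 ^ j * sq s" if "i < r" for i
  proof -
  have "(c (k - int i) * bspline r (u + real i))^2 <= (c (k - int i))^2 * 1" unfolding power_mult_distrib
   by (intro mult_left_mono power_le_one bspline_nonneg[OF r1] bspline_le_1[OF r1]) auto
  also have "... <= C * 2 ^ j * sq (spline_comb r j c)" using C(2)[OF k that] by simp
  also have "sq (spline_comb r j c) = sq s" by (rule sq_cong) (simp add: c)
  finally show ?thesis .
  qed
  then have "(\<Sum>i<r. (c (k - int i) * bspline r (u + real i))\<^sup>2) <= (\<Sum>i<r. C * 2 ^ j * sq s)" by (intro sum_mono) auto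
  then show ?thesis by (simp add: mult_left_mono)
 qed
 finally show "(s x)^2 <= real r * (real r * C) * 2 ^ j * sq s" by (simp add: mult_ac)
 qed
qed

text \<open>The reproducing kernel of the spline space; the auxiliary estimator averages its
 sections at the observations.\<close>

definition spline_kernel :: "nat => nat => real => real => real" where
 "spline_kernel r j x y = (\<Sum>l\<in>spline_index r j. \<Sum>m\<in>spline_index r j.
 2 ^ j * spline_gram_inv r j l m * bspline_scaled r j m x * bspline_scaled r j l y)"

definition spline_proj :: "nat => nat => (real => real) => real => real" where
 "spline_proj r j h y = (I01 x. spline_kernel r j x y * h x)"

lemma aux_est_eq_kernel:
 "aux_est n j r xs y = (1 / real n) * (\<Sum>i<n. spline_kernel r j (xs i) y)"
proof -
 have "(\<Sum>i<n. spline_kernel r j (xs i) y) = (\<Sum>l\<in>spline_index r j. \<Sum>m\<in>spline_index r j. \<Sum>i<n.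
 2 ^ j * spline_gram_inv r j l m * bspline_scaled r j m (xs i) * bspline_scaled r j l y)" unfolding spline_kernel_def
 by (subst sum.swap) (intro sum.cong refl, subst sum.swap, rule refl)
 then show ?thesis unfolding aux_est_def by (simp add: sum_distrib_left sum_distrib_right mult_ac)
qed

lemma spline_kernel_sym: "1 <= r ==> spline_kernel r j x y = spline_kernel r j y x" unfolding spline_kernel_def
 by (subst sum.swap) (auto intro!: sum.cong simp: spline_gram_inv_sym mult_ac)

lemma spline_kernel_comb:
 "spline_kernel r j x = spline_comb r j (%l. \<Sum>m\<in>spline_index r j. 2 ^ j * spline_gram_inv r j l m * bspline_scaled r j m x)"
 unfolding spline_kernel_def spline_comb_def by (auto simp: fun_eq_iff sum_distrib_right)

lemma bmeas_spline_kernel: "1 <= r ==> bmeas (spline_kernel r j x)" unfolding spline_kernel_comb by (rule bmeas_spline_comb)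

lemma bmeas_spline_kernel2: "1 <= r ==> bmeas (%x. spline_kernel r j x y)" by (subst spline_kernel_sym) (auto intro: bmeas_spline_kernel)

lemma bmeas_spline_kernel_diag: "1 <= r ==> bmeas (%x. spline_kernel r j x x)" unfolding spline_kernel_def by (intro bmeas_intros bmeas_bspline_scaled)

lemma spline_kernel_reproduces_basis:
 assumes r: "1 <= r" and k: "k \<in> spline_index r j"
 shows "(I01 y. spline_kernel r j x y * bspline_scaled r j k y) = bspline_scaled r j k x"
proof -
 let ?I = "spline_index r j" and ?g = "spline_gram_inv r j" and ?N = "bspline_scaled r j"
 have "(I01 y. spline_kernel r j x y * ?N k y)
 = (I01 y. (\<Sum>l\<in>?I. \<Sum>m\<in>?I. (2 ^ j * ?g l m * ?N m x) * (?N l y * ?N k y)))"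
 unfolding spline_kernel_def sum_distrib_right by (simp add: mult_ac)
 also have "... = (\<Sum>l\<in>?I. \<Sum>m\<in>?I. (2 ^ j * ?g l m * ?N m x) * (spline_gram r j l k / 2 ^ j))" by (subst integral_double_sum)
  (auto intro!: bmeas_intros bmeas_bspline_scaled[OF r] simp: gram_scaled[OF r])
 also have "... = (\<Sum>m\<in>?I. \<Sum>l\<in>?I. ?N m x * (?g m l * spline_gram r j l k))"
 by (subst sum.swap) (auto intro!: sum.cong simp: spline_gram_inv_sym[OF r] mult_ac)
 also have "... = (\<Sum>m\<in>?I. ?N m x * (if m = k then 1 else 0))" using spline_gram_inverse[OF r, of j] k
 by (intro sum.cong refl) (simp add: is_inverse_on_def flip: sum_distrib_left)
 also have "... = ?N k x" using k by (simp add: mult_delta_right)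
 finally show ?thesis .
qed

lemma spline_kernel_reproduces:
 assumes r: "1 <= r" and s: "s \<in> spline_space r j" and x: "x \<in> {0..1}"
 shows "(I01 y. spline_kernel r j x y * s y) = s x"
proof -
 let ?I = "spline_index r j" and ?N = "bspline_scaled r j"
 obtain c where c: "!!x. x \<in> {0..1} ==> s x = spline_comb r j c x" using s unfolding spline_space_def by blast
 have "(I01 y. spline_kernel r j x y * s y)
  = (I01 y. (\<Sum>l\<in>?I. c l * (spline_kernel r j x y * ?N l y)))" by (intro lint_cong refl)
  (simp add: c spline_comb_def sum_distrib_left mult_ac)
 also have "... = (\<Sum>l\<in>?I. c l * ?N l x)" by (subst lint_sum)
  (auto intro!: bmeas_integrable bmeas_intros bmeas_spline_kernel bmeas_bspline_scaled r
  simp: spline_kernel_reproduces_basis[OF r])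
 finally show ?thesis by (simp add: c[OF x] spline_comb_def)
qed

lemma spline_kernel_diag: "1 <= r ==> x \<in> {0..1} ==> spline_kernel r j x x = sq (spline_kernel r j x)"
 using spline_kernel_reproduces[of r "spline_kernel r j x" j x] by (simp add: sq_def power2_eq_square spline_kernel_comb spline_comb_in_space)

text \<open>The trace of the orthogonal projection onto the spline space is its dimension.\<close>

lemma spline_kernel_trace:
 assumes r: "1 <= r"
 shows "(I01 x. spline_kernel r j x x) = 2 ^ j + real r - 1"
proof -
 let ?I = "spline_index r j" and ?g = "spline_gram_inv r j" and ?N = "bspline_scaled r j"
 have "(I01 x. spline_kernel r j x x)
 = (I01 x. (\<Sum>l\<in>?I. \<Sum>m\<in>?I. (2 ^ j * ?g l m) * (?N m x * ?N l x)))" unfolding spline_kernel_def by (simp add: mult_ac)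
 also have "... = (\<Sum>l\<in>?I. \<Sum>m\<in>?I. (2 ^ j * ?g l m) * (spline_gram r j m l / 2 ^ j))" by (subst integral_double_sum)
  (auto intro!: bmeas_intros bmeas_bspline_scaled[OF r] simp: gram_scaled[OF r])
 also have "... = (\<Sum>l\<in>?I. 1)" using spline_gram_inverse[OF r, of j] by (intro sum.cong refl) (simp add: is_inverse_on_def)
 also have "... = 2 ^ j + real r - 1"
 proof -
 have "0 <= (2::int) ^ j" by simp
 then have "0 <= 2 ^ j + int r - 1" using r by linarith
 then have "int (card ?I) = 2 ^ j + int r - 1" by (simp add: spline_index_def)
 then have "real (card ?I) = of_int (2 ^ j + int r - 1)" by (metis of_int_of_nat_eq)
 then show ?thesis by simp
 qed
 finally show ?thesis .
qed

lemma spline_proj_comb: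
 assumes r: "1 <= r" and h: "bmeas h"
 shows "spline_proj r j h = spline_comb r j (%l. \<Sum>m\<in>spline_index r j.
 2 ^ j * spline_gram_inv r j l m * (I01 x. bspline_scaled r j m x * h x))"
proof
 fix y
 let ?I = "spline_index r j" and ?g = "spline_gram_inv r j" and ?N = "bspline_scaled r j"
 have "spline_proj r j h y = (I01 x. (\<Sum>l\<in>?I. \<Sum>m\<in>?I. (2 ^ j * ?g l m * ?N l y) * (?N m x * h x)))"
 unfolding spline_proj_def spline_kernel_def sum_distrib_right by (simp add: mult_ac)
 also have "... = (\<Sum>l\<in>?I. \<Sum>m\<in>?I. (2 ^ j * ?g l m * ?N l y) * (I01 x. ?N m x * h x))"
 by (subst integral_double_sum) (auto intro!: bmeas_intros bmeas_bspline_scaled r h)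
 finally show "spline_proj r j h y = spline_comb r j (%l. \<Sum>m\<in>?I. 2 ^ j * ?g l m * (I01 x. ?N m x * h x)) y"
 by (simp add: spline_comb_def sum_distrib_left sum_distrib_right mult_ac)
qed

lemma spline_proj_in_space: "1 <= r ==> bmeas h ==> spline_proj r j h \<in> spline_space r j" by (simp add: spline_proj_comb spline_comb_in_space)

lemma bmeas_spline_proj: "1 <= r ==> bmeas h ==> bmeas (spline_proj r j h)" by (rule bmeas_spline_space[OF _ spline_proj_in_space])

lemma spline_proj_inner:
 assumes r: "1 <= r" and h: "bmeas h" and s: "s \<in> spline_space r j"
 shows "(I01 x. spline_proj r j h x * s x) = (I01 x. h x * s x)"
proof -
 let ?I = "spline_index r j" and ?g = "spline_gram_inv r j" and ?N = "bspline_scaled r j"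
 let ?K = "spline_kernel r j"
 have bs: "bmeas s" by (rule bmeas_spline_space[OF r s])
 have "(I01 y. spline_proj r j h y * s y)
 = (I01 y. (\<Sum>l\<in>?I. \<Sum>m\<in>?I. (2 ^ j * ?g l m * (I01 x. ?N m x * h x)) * (?N l y * s y)))"
 unfolding spline_proj_comb[OF r h] spline_comb_def sum_distrib_right by (simp add: mult_ac)
 also have "... = (\<Sum>l\<in>?I. \<Sum>m\<in>?I. (2 ^ j * ?g l m * (I01 x. ?N m x * h x)) * (I01 y. ?N l y * s y))"
 by (subst integral_double_sum) (auto intro!: bmeas_intros bmeas_bspline_scaled r bs)
 also have "... = (\<Sum>l\<in>?I. \<Sum>m\<in>?I. (2 ^ j * ?g l m * (I01 y. ?N l y * s y)) * (I01 x. ?N m x * h x))"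
 by (intro sum.cong refl) (simp only: mult.assoc mult.left_commute mult.commute)
 also have "... = (I01 x. (\<Sum>l\<in>?I. \<Sum>m\<in>?I. (2 ^ j * ?g l m * (I01 y. ?N l y * s y)) * (?N m x * h x)))"
 by (subst integral_double_sum) (auto intro!: bmeas_intros bmeas_bspline_scaled r h)
 also have "... = (I01 x. h x * s x)"
 proof (rule lint_cong[OF refl])
 fix x assume "x \<in> space lborel01"
 then have x: "x \<in> {0..1}" by simp
 have "(\<Sum>l\<in>?I. \<Sum>m\<in>?I. (2 ^ j * ?g l m * (I01 y. ?N l y * s y)) * ?N m x)
  = (\<Sum>l\<in>?I. \<Sum>m\<in>?I. (2 ^ j * ?g l m * ?N m x) * (I01 y. ?N l y * s y))"
  by (intro sum.cong refl) (simp only: mult.assoc mult.left_commute mult.commute)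
 also have "... = (I01 y. (\<Sum>l\<in>?I. \<Sum>m\<in>?I. (2 ^ j * ?g l m * ?N m x) * (?N l y * s y)))"
  by (subst integral_double_sum) (auto intro!: bmeas_intros bmeas_bspline_scaled r bs)
 also have "... = (I01 y. ?K x y * s y)" unfolding spline_kernel_def sum_distrib_right by (simp add: mult_ac)
 also have "... = s x" by (rule spline_kernel_reproduces[OF r s x])
 finally have "h x * (\<Sum>l\<in>?I. \<Sum>m\<in>?I. (2 ^ j * ?g l m * (I01 y. ?N l y * s y)) * ?N m x) = h x * s x" by (simp only:)
 moreover have "(\<Sum>l\<in>?I. \<Sum>m\<in>?I. (2 ^ j * ?g l m * (I01 y. ?N l y * s y)) * (?N m x * h x))
  = h x * (\<Sum>l\<in>?I. \<Sum>m\<in>?I. (2 ^ j * ?g l m * (I01 y. ?N l y * s y)) * ?N m x)"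
  unfolding sum_distrib_left by (intro sum.cong refl) (simp only: mult.assoc mult.left_commute mult.commute)
 ultimately show "(\<Sum>l\<in>?I. \<Sum>m\<in>?I. (2 ^ j * ?g l m * (I01 y. ?N l y * s y)) * (?N m x * h x)) = h x * s x" by (simp only:)
 qed
 finally show ?thesis .
qed

lemma spline_proj_best:
 assumes r: "1 <= r" and h: "bmeas h" and s: "s \<in> spline_space r j"
 shows "sq (%x. h x - spline_proj r j h x) <= sq (%x. h x - s x)" and "sq (%x. s x - spline_proj r j h x) <= sq (%x. h x - s x)"
proof -
 let ?P = "spline_proj r j h"
 have bP: "bmeas ?P" by (rule bmeas_spline_proj[OF r h])
 have bs: "bmeas s" by (rule bmeas_spline_space[OF r s])
 have d: "(%x. ?P x - s x) \<in> spline_space r j" by (rule spline_space_diff[OF spline_proj_in_space[OF r h] s])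
 have bd: "bmeas (%x. ?P x - s x)" by (intro bmeas_diff bP bs)
 have cross: "(I01 x. (h x - ?P x) * (?P x - s x)) = 0"
 proof -
 have "(I01 x. (h x - ?P x) * (?P x - s x))
  = (I01 x. h x * (?P x - s x) - ?P x * (?P x - s x))" by (simp add: left_diff_distrib)
 also have "... = (I01 x. h x * (?P x - s x)) - (I01 x. ?P x * (?P x - s x))" by (rule lint_diff) (intro bmeas_integrable bmeas_mult h bP bd)+
 finally show ?thesis using spline_proj_inner[OF r h d] by simp
 qed
 have "sq (%x. h x - s x) = (I01 x. (h x - ?P x)\<^sup>2 + 2 * ((h x - ?P x) * (?P x - s x)) + (?P x - s x)^2)"
 unfolding sq_def by (simp add: power2_eq_square algebra_simps)
 also have "... = sq (%x. h x - ?P x) + 2 * (I01 x. (h x - ?P x) * (?P x - s x)) + sq (%x. ?P x - s x)" unfolding sq_def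
 by (simp add: bmeas_integrable bmeas_intros bP bs h)
 finally have "sq (%x. h x - s x) = sq (%x. h x - ?P x) + sq (%x. s x - ?P x)" by (simp add: cross sq_minus_commute[of s])
 then show "sq (%x. h x - ?P x) <= sq (%x. h x - s x)" "sq (%x. s x - ?P x) <= sq (%x. h x - s x)"
 using sq_nonneg[of "%x. h x - ?P x"] sq_nonneg[of "%x. s x - ?P x"] by linarith+
qed

section \<open>Spline approximation of smooth functions\<close>

definition is_prim :: "(real => real) => (real => real) => bool" where
 "is_prim f g \<longleftrightarrow> (\<exists>c. \<forall>x\<in>{0..1}. f x = c + (I01 z. indicator {..x} z * g z))"

lemma bmeas_indicator_mult: "A \<in> sets borel ==> bmeas g ==> bmeas (%z. indicator A z * g z)" by (intro bmeas_mult bmeas_indicator)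

lemma is_prim_diff:
 assumes "is_prim f g" "is_prim f' g'" "bmeas g" "bmeas g'"
 shows "is_prim (%x. f x - f' x) (%x. g x - g' x)"
proof -
 obtain c c' where c: "\<forall>x\<in>{0..1}. f x = c + (I01 z. indicator {..x} z * g z)"
 "\<forall>x\<in>{0..1}. f' x = c' + (I01 z. indicator {..x} z * g' z)" using assms unfolding is_prim_def by blast
 have "(I01 z. indicator {..x} z * (g z - g' z))
  = (I01 z. indicator {..x} z * g z) - (I01 z. indicator {..x} z * g' z)" for x unfolding right_diff_distrib
 by (rule lint_diff) (intro bmeas_integrable bmeas_indicator_mult assms, simp)+
 then show ?thesis unfolding is_prim_def using c by (intro exI[of _ "c - c'"]) simp
qed

lemma measure_lborel01_Icc_le:
 assumes "a <= b" shows "measure lborel01 ({a..b} \<inter> {0..1}) <= b - a"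
proof -
 have "measure lborel01 ({a..b} \<inter> {0..1}) = measure lborel ({a..b} \<inter> {0..1})" by (rule measure_restrict_space) auto
 also have "... <= measure lborel {a..b}" by (rule measure_mono_fmeasurable) (auto simp: fmeasurable_def emeasure_lborel_Icc_eq)
 finally show ?thesis using assms by simp
qed

lemma integral_indicator_window_le:
 assumes "0 <= \<delta>" shows "(I01 z. indicator {x-\<delta>..x+\<delta>} z) <= 2 * \<delta>"
proof -
 have "(I01 z. indicator {x-\<delta>..x+\<delta>} z) = measure lborel01 ({x-\<delta>..x+\<delta>} \<inter> space lborel01)"
 by (rule Bochner_Integration.integral_indicator)
 then show ?thesis using measure_lborel01_Icc_le[of "x-\<delta>" "x+\<delta>"] assms by simp
qed

lemma is_prim_increment:
 assumes "is_prim f g" and g: "bmeas g" and xy: "x \<in> {0..1}" "y \<in> {0..1}" "\<bar>x - y\<bar> <= \<delta>"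
 shows "(f x - f y)^2 <= 2 * \<delta> * (I01 z. indicator {x-\<delta>..x+\<delta>} z * (g z)^2)"
proof -
 let ?W = "{x-\<delta>..x+\<delta>}"
 have d: "0 <= \<delta>" using xy by linarith
 obtain c where c: "\<forall>x\<in>{0..1}. f x = c + (I01 z. indicator {..x} z * g z)" using assms unfolding is_prim_def by blast
 have "f x - f y = (I01 z. indicator {..x} z * g z - indicator {..y} z * g z)" using c xy by (subst lint_diff)
  (auto intro!: bmeas_integrable bmeas_indicator_mult g)
 also have "\<bar>\<dots>\<bar> <= (I01 z. \<bar>indicator {..x} z * g z - indicator {..y} z * g z\<bar>)" by (rule integral_abs_bound)
 also have "... <= (I01 z. indicator ?W z * (indicator ?W z * \<bar>g z\<bar>))"
 proof (rule integral_mono)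
 show "\<bar>indicator {..x} z * g z - indicator {..y} z * g z\<bar> <= indicator ?W z * (indicator ?W z * \<bar>g z\<bar>)" for z
  using xy by (auto split: split_indicator)
 qed (auto intro!: bmeas_integrable bmeas_intros bmeas_indicator_mult bmeas_indicator g)
 finally have "(f x - f y)^2 <= (I01 z. indicator ?W z * (indicator ?W z * \<bar>g z\<bar>))^2" by (metis abs_ge_zero power2_abs power_mono)
 also have "... <= sq (indicator ?W) * sq (%z. indicator ?W z * \<bar>g z\<bar>)"
 by (rule cauchy_schwarz_U) (auto intro!: bmeas_intros bmeas_indicator_mult bmeas_indicator g)
 also have "sq (indicator ?W) = (I01 z. indicator ?W z)" unfolding sq_def by (intro lint_cong refl) (auto split: split_indicator)
 also have "sq (%z. indicator ?W z * \<bar>g z\<bar>) = (I01 z. indicator ?W z * (g z)^2)"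
 unfolding sq_def by (intro lint_cong refl) (auto split: split_indicator)
 also have "(I01 z. indicator ?W z) * (I01 z. indicator ?W z * (g z)^2)
  <= 2 * \<delta> * (I01 z. indicator ?W z * (g z)^2)" by (intro mult_right_mono integral_indicator_window_le[OF d] integral_nonneg_AE) auto
 finally show ?thesis .
qed

lemma window_le_sq:
 assumes "bmeas g" shows "(I01 z. indicator {x-\<delta>..x+\<delta>} z * (g z)^2) <= sq g" unfolding sq_def by (rule integral_mono)
 (auto intro!: bmeas_integrable bmeas_intros bmeas_indicator_mult assms split: split_indicator)

lemma is_prim_bmeas:
 assumes "is_prim f g" "bmeas g" shows "continuous_on {0..1} f" and "bmeas f"
proof -
 show "continuous_on {0..1} f"
 proof (subst continuous_on_iff, intro ballI allI impI)
 fix x e :: real assume x: "x \<in> {0..1}" and "0 < e"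
 define d where "d = e^2 / (2 * (sq g + 1)) / 2"
 have s: "0 < sq g + 1" using sq_nonneg[of g] by linarith
 then have "0 < d" using \<open>0 < e\<close> by (simp add: d_def)
 moreover have "dist (f y) (f x) < e" if y: "y \<in> {0..1}" "dist y x < d" for y
 proof -
  have "(f x - f y)^2 <= 2 * d * (I01 z. indicator {x-d..x+d} z * (g z)^2)"
  by (rule is_prim_increment[OF assms x y(1)]) (use y in \<open>simp add: dist_real_def abs_minus_commute\<close>)
  also have "... <= 2 * d * sq g" using \<open>0 < d\<close> by (intro mult_left_mono window_le_sq assms) auto
  also have "... <= 2 * d * (sq g + 1)" using \<open>0 < d\<close> by simp
  also have "... = e^2 / 2" using s by (simp add: d_def field_simps)
  also have "... < e^2" using \<open>0 < e\<close> by simp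
  finally have "\<bar>f x - f y\<bar> < e" using \<open>0 < e\<close> by (metis abs_of_pos abs_le_square_iff not_le)
  then show ?thesis by (simp add: dist_real_def abs_minus_commute)
 qed
 ultimately show "\<exists>d>0. \<forall>y\<in>{0..1}. dist y x < d --> dist (f y) (f x) < e" by blast
 qed
 then show "bmeas f" by (rule bmeas_continuous_on)
qed

lemma measurable_window:
 assumes "bmeas g"
 shows "(%x. \<integral>z. indicator {x-\<delta>..x+\<delta>} z * (g z)^2 \<partial>lborel01) \<in> borel_measurable lborel01"
 and "(I01 x. (I01 z. indicator {x-\<delta>..x+\<delta>} z * (g z)^2))
  = (I01 z. (I01 x. indicator {x-\<delta>..x+\<delta>} z * (g z)^2))"
proof -
 obtain B where B: "!!x. x \<in> {0..1} ==> \<bar>g x\<bar> <= B" using assms unfolding bmeas_def by blast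
 have eq: "indicator {x-\<delta>..x+\<delta>} z = (indicator {v. \<bar>fst v - snd v\<bar> <= \<delta>} (x, z) :: real)" for x z
 by (auto simp: indicator_def)
 have id[measurable]: "(%x. x) \<in> borel_measurable lborel01" by (rule measurable_lborel01I) simp
 have m1: "fst \<in> borel_measurable (lborel01 \<Otimes>\<^sub>M lborel01)" "snd \<in> borel_measurable (lborel01 \<Otimes>\<^sub>M lborel01)"
 using measurable_compose[OF measurable_fst id, of lborel01] measurable_compose[OF measurable_snd id, of lborel01] by (auto simp: comp_def)
 have [measurable]: "(%v. indicator {v. \<bar>fst v - snd v\<bar> <= \<delta>} v :: real) \<in> borel_measurable (lborel01 \<Otimes>\<^sub>M lborel01)"
 proof -
 have "(%v. indicator {..\<delta>} \<bar>fst v - snd v\<bar> :: real) \<in> borel_measurable (lborel01 \<Otimes>\<^sub>M lborel01)"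
  by (rule measurable_compose[of _ _ borel]) (use m1 in \<open>auto intro!: borel_measurable_abs borel_measurable_diff\<close>)
 then show ?thesis by (simp add: indicator_def)
 qed
 have [measurable]: "g \<in> borel_measurable lborel01" using assms by (rule bmeas_measurable)
 have M: "(%v. indicator {v. \<bar>fst v - snd v\<bar> <= \<delta>} v * (g (snd v))^2) \<in> borel_measurable (lborel01 \<Otimes>\<^sub>M lborel01)"
 by measurable
 then have M': "(%(x, z). indicator {x-\<delta>..x+\<delta>} z * (g z)^2) \<in> borel_measurable (lborel01 \<Otimes>\<^sub>M lborel01)"
 by (simp add: eq case_prod_beta')
 show "(%x. \<integral>z. indicator {x-\<delta>..x+\<delta>} z * (g z)^2 \<partial>lborel01) \<in> borel_measurable lborel01"
 by (rule U.borel_measurable_lebesgue_integral[OF M'])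
 have "integrable (lborel01 \<Otimes>\<^sub>M lborel01) (%(x, z). indicator {x-\<delta>..x+\<delta>} z * (g z)^2)"
 proof (rule UU.P.integrable_const_bound[OF _ M', where B="B^2"])
 have "\<bar>indicator {x-\<delta>..x+\<delta>} z * (g z)^2\<bar> <= B^2" if "z \<in> {0..1}" for x z
  using power_mono[OF B[OF that] abs_ge_zero, of 2] by (auto split: split_indicator)
 then show "AE v in lborel01 \<Otimes>\<^sub>M lborel01. norm (case v of (x, z) => indicator {x-\<delta>..x+\<delta>} z * (g z)^2) <= B^2"
  by (intro AE_I2) (auto simp: space_pair_measure)
 qed
 from UU.Fubini_integral[OF this]
 show "(I01 x. (I01 z. indicator {x-\<delta>..x+\<delta>} z * (g z)^2))
  = (I01 z. (I01 x. indicator {x-\<delta>..x+\<delta>} z * (g z)^2))" by simp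
qed

lemma integral_window_le:
 assumes g: "bmeas g" and d: "0 <= \<delta>"
 shows "(I01 x. (I01 z. indicator {x-\<delta>..x+\<delta>} z * (g z)^2)) <= 2 * \<delta> * sq g"
proof -
 have eq: "(%x. indicator {x-\<delta>..x+\<delta>} z * (g z)^2) = (%x. (g z)\<^sup>2 * indicator {z-\<delta>..z+\<delta>} x)" for z
 by (auto simp: fun_eq_iff indicator_def)
 have "(I01 z. (I01 x. indicator {x-\<delta>..x+\<delta>} z * (g z)^2)) <= (I01 z. 2 * \<delta> * (g z)^2)"
 proof (rule integral_mono_AE')
 show "AE z in lborel01. (I01 x. indicator {x-\<delta>..x+\<delta>} z * (g z)^2) <= 2 * \<delta> * (g z)^2"
 proof (intro AE_I2)
  fix z
  have "(g z)^2 * (I01 x. indicator {z-\<delta>..z+\<delta>} x) <= (g z)^2 * (2 * \<delta>)" by (intro mult_left_mono integral_indicator_window_le d) auto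
  then show "(I01 x. indicator {x-\<delta>..x+\<delta>} z * (g z)^2) <= 2 * \<delta> * (g z)^2" unfolding eq by (simp add: mult_ac)
 qed
 show "integrable lborel01 (%z. 2 * \<delta> * (g z)^2)" by (intro bmeas_integrable bmeas_intros g)
 show "AE z in lborel01. 0 <= 2 * \<delta> * (g z)^2" using d by auto
 qed
 also have "... = 2 * \<delta> * sq g" by (simp add: sq_def)
 finally show ?thesis unfolding measurable_window(2)[OF g] .
qed

text \<open>Sampling \<open>f\<close> near the support of each basis function gives a spline whose error at \<open>x\<close> is, by
 the partition of unity, an average of increments of \<open>f\<close> over distances of the order of the cell.\<close>

lemma spline_sampling_error:
 assumes r: "1 <= r" and prim: "is_prim f g" and g: "bmeas g"
 shows "\<exists>s\<in>spline_space r j. sq (%x. f x - s x) <= 4 * (real r)^2 / 4 ^ j * sq g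
 & (2 <= r --> (\<forall>x\<in>{0..1}. (f x - s x)\<^sup>2 <= 2 * real r / 2 ^ j * sq g))"
proof -
 define \<delta> where "\<delta> = real r / 2 ^ j"
 have d: "0 <= \<delta>" by (simp add: \<delta>_def)
 define W where "W x = (I01 z. indicator {x-\<delta>..x+\<delta>} z * (g z)^2)" for x
 have W0: "0 <= W x" for x unfolding W_def by (rule integral_nonneg_AE) auto
 define \<xi> :: "int => real" where "\<xi> l = max 0 (min 1 (of_int l / 2 ^ j))" for l
 define s where "s = spline_comb r j (%l. f (\<xi> l))"
 have s: "s \<in> spline_space r j" by (simp add: s_def spline_comb_in_space)
 have pt: "(f x - s x)^2 <= 2 * \<delta> * W x" if x: "x \<in> {0..1}" "x < 1 \<or> 2 <= r" for x
 proof -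
 have pu: "(\<Sum>l\<in>spline_index r j. bspline_scaled r j l x) = 1"
 proof -
  have "(\<Sum>l=- int r + 1..2 ^ j - 1. bspline r (2 ^ j * x - of_int l)) = 1"
  proof (rule bspline_partition_of_unity[OF r])
  show "2 ^ j * x < real_of_int (2 ^ j - 1) + 1 \<or> 2 <= r & 2 ^ j * x <= real_of_int (2 ^ j - 1) + 1" using x by auto
  qed (use x in auto)
  then show ?thesis by (simp add: spline_index_def bspline_scaled_def)
 qed
 have inc: "bspline_scaled r j l x * \<bar>f x - f (\<xi> l)\<bar> <= bspline_scaled r j l x * sqrt (2 * \<delta> * W x)" for l
 proof (cases "bspline_scaled r j l x = 0")
  case False
  then have "0 <= 2 ^ j * x - of_int l" "2 ^ j * x - of_int l < real r"
  using bspline_support[OF r, of "2 ^ j * x - of_int l"] unfolding bspline_scaled_def by force+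
  moreover have "x - of_int l / 2 ^ j = (2 ^ j * x - of_int l) / 2 ^ j" by (simp add: diff_divide_distrib)
  ultimately have "of_int l / 2 ^ j <= x" "x - of_int l / 2 ^ j <= \<delta>"
  unfolding \<delta>_def by (simp_all add: divide_right_mono divide_le_eq mult.commute)
  then have "\<bar>x - \<xi> l\<bar> <= \<delta>" using x unfolding \<xi>_def by auto
  moreover have "\<xi> l \<in> {0..1}" by (simp add: \<xi>_def)
  ultimately have "(f x - f (\<xi> l))^2 <= 2 * \<delta> * W x" unfolding W_def using is_prim_increment[OF prim g x(1)] by blast
  then have "\<bar>f x - f (\<xi> l)\<bar> <= sqrt (2 * \<delta> * W x)" by (metis real_sqrt_abs real_sqrt_le_mono)
  then show ?thesis by (intro mult_left_mono bspline_scaled_nonneg r)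
 qed simp
 have "f x - s x = (\<Sum>l\<in>spline_index r j. bspline_scaled r j l x * (f x - f (\<xi> l)))"
  using pu by (simp add: s_def spline_comb_def right_diff_distrib sum_subtractf mult.commute
   flip: sum_distrib_left sum_distrib_right)
 also have "\<bar>\<dots>\<bar> <= (\<Sum>l\<in>spline_index r j. bspline_scaled r j l x * sqrt (2 * \<delta> * W x))"
  using inc by (intro order_trans[OF sum_abs] sum_mono) (simp add: abs_mult bspline_scaled_nonneg[OF r])
 also have "... = sqrt (2 * \<delta> * W x)" using pu by (simp flip: sum_distrib_right)
 finally have "\<bar>f x - s x\<bar>\<^sup>2 <= (sqrt (2 * \<delta> * W x))^2" by (intro power_mono) auto
 then show ?thesis using d W0[of x] by simp
 qed
 have bf: "bmeas (%x. f x - s x)" by (intro bmeas_diff is_prim_bmeas[OF prim g] bmeas_spline_space[OF r s])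
 have bW: "bmeas W" using measurable_window(1)[OF g, of \<delta>] window_le_sq[OF g, of _ \<delta>] W0
 by (intro bmeasI[of _ "sq g"]) (auto simp: W_def[abs_def])
 have "sq (%x. f x - s x) <= (I01 x. 2 * \<delta> * W x)" unfolding sq_def
 proof (rule integral_mono_AE)
 have "AE x in lborel. x ~= (1::real)" by (rule AE_lborel_singleton)
 then show "AE x in lborel01. (f x - s x)\<^sup>2 <= 2 * \<delta> * W x" unfolding AE_lborel01_iff by eventually_elim (use pt in auto)
 qed (intro bmeas_integrable bmeas_intros bf bW)+
 also have "... = 2 * \<delta> * (I01 x. W x)" by simp
 also have "... <= 2 * \<delta> * (2 * \<delta> * sq g)" unfolding W_def by (intro mult_left_mono integral_window_le g d) (use d in auto)
 also have "... = 4 * (real r)^2 / 4 ^ j * sq g"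
 proof -
 have "(4::real) ^ j = 2 ^ j * 2 ^ j" by (simp flip: power_mult_distrib)
 then show ?thesis by (simp add: \<delta>_def power2_eq_square)
 qed
 finally have 1: "sq (%x. f x - s x) <= 4 * (real r)^2 / 4 ^ j * sq g" .
 have "(f x - s x)^2 <= 2 * real r / 2 ^ j * sq g" if "x \<in> {0..1}" "2 <= r" for x
 proof -
 have "(f x - s x)^2 <= 2 * \<delta> * W x" using pt that by blast
 also have "... <= 2 * \<delta> * sq g" unfolding W_def by (intro mult_left_mono window_le_sq g) (use d in auto)
 finally show ?thesis by (simp add: \<delta>_def)
 qed
 with 1 s show ?thesis by blast
qed

lemma bspline_scaled_primitive:
 assumes r: "1 <= r" and x: "x \<in> {0..1}"
 shows "(I01 z. indicator {..x} z * bspline_scaled r j l z)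
 = (bspline_cdf r (2 ^ j * x - of_int l) - bspline_cdf r (- of_int l)) / 2 ^ j"
proof -
 have "bspline_cdf r (2 ^ j * x - of_int l) - bspline_cdf r (- of_int l)
 = (\<integral>y. indicator {- of_int l<..2 ^ j * x - of_int l} y * bspline r y \<partial>lborel)" by (rule bspline_cdf_diff[OF r]) (use x in simp)
 also have "... = 2 ^ j * (\<integral>z. indicator {- of_int l<..2 ^ j * x - of_int l} (- of_int l + 2 ^ j * z)
  * bspline r (- of_int l + 2 ^ j * z) \<partial>lborel)" by (subst lborel_integral_real_affine[of "2 ^ j" _ "- of_int l"]) auto
 also have "(%z::real. indicator {- of_int l<..2 ^ j * x - of_int l} (- of_int l + 2 ^ j * z) :: real) = indicator {0<..x}"
 by (simp add: fun_eq_iff indicator_def zero_less_mult_iff not_less[of "2 ^ j"])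
 also have "(\<integral>z. indicator {0<..x} z * bspline r (- of_int l + 2 ^ j * z) \<partial>lborel)
  = (\<integral>z. indicator {0..1} z * (indicator {..x} z * bspline_scaled r j l z) \<partial>lborel)"
 proof (rule integral_cong_AE)
 have "(%z. bspline r (- of_int l + 2 ^ j * z)) \<in> borel_measurable borel" by (rule measurable_compose[OF _ bspline_measurable[OF r]]) auto
 then show "(%z. indicator {0<..x} z * bspline r (- of_int l + 2 ^ j * z)) \<in> borel_measurable lborel" by (auto intro!: borel_measurable_times)
 show "(%z. indicator {0..1} z * (indicator {..x} z * bspline_scaled r j l z)) \<in> borel_measurable lborel"
  using bspline_scaled_measurable[OF r, of j l] by (auto intro!: borel_measurable_times)
 have "AE z in lborel. z ~= (0::real)" by (rule AE_lborel_singleton)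
 then show "AE z in lborel. indicator {0<..x} z * bspline r (- of_int l + 2 ^ j * z)
  = indicator {0..1} z * (indicator {..x} z * bspline_scaled r j l z)"
  by eventually_elim (use x in \<open>auto simp: bspline_scaled_def split: split_indicator\<close>)
 qed
 also have "... = (I01 z. indicator {..x} z * bspline_scaled r j l z)" by (subst integral_restrict_space) auto
 finally show ?thesis by simp
qed

lemma spline_space_primitive:
 assumes r: "1 <= r" and s: "s \<in> spline_space r j"
 shows "\<exists>t\<in>spline_space (Suc r) j. is_prim t s"
proof -
 let ?I = "spline_index r j" and ?J = "spline_index (Suc r) j"
 obtain c where c: "!!x. x \<in> {0..1} ==> s x = spline_comb r j c x" using s unfolding spline_space_def by blast
 define t where "t = spline_comb (Suc r) j (%m. (\<Sum>l\<in>?I. if l <= m then c l / 2 ^ j else 0))"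
 have t: "t x = (\<Sum>l\<in>?I. c l / 2 ^ j * bspline_cdf r (2 ^ j * x - of_int l))" if x: "x \<in> {0..1}" for x
 proof -
 have "t x = (\<Sum>l\<in>?I. \<Sum>m\<in>?J. (if l <= m then c l / 2 ^ j else 0) * bspline_scaled (Suc r) j m x)"
  unfolding t_def spline_comb_def sum_distrib_right by (rule sum.swap)
 also have "... = (\<Sum>l\<in>?I. c l / 2 ^ j * (\<Sum>m=l..2 ^ j - 1. bspline (Suc r) (2 ^ j * x - of_int m)))"
 proof (rule sum.cong[OF refl])
  fix l assume l: "l \<in> ?I"
  have "(\<Sum>m\<in>?J. (if l <= m then c l / 2 ^ j else 0) * bspline_scaled (Suc r) j m x)
  = (\<Sum>m\<in>{l..2 ^ j - 1}. c l / 2 ^ j * bspline (Suc r) (2 ^ j * x - of_int m))"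
  by (rule sum.mono_neutral_cong_right) (use l in \<open>auto simp: spline_index_def bspline_scaled_def\<close>)
  then show "(\<Sum>m\<in>?J. (if l <= m then c l / 2 ^ j else 0) * bspline_scaled (Suc r) j m x)
  = c l / 2 ^ j * (\<Sum>m=l..2 ^ j - 1. bspline (Suc r) (2 ^ j * x - of_int m))" by (simp only: sum_distrib_left)
 qed
 also have "... = (\<Sum>l\<in>?I. c l / 2 ^ j * bspline_cdf r (2 ^ j * x - of_int l))"
 proof (intro sum.cong refl arg_cong2[where f="(*)"])
  fix l assume l: "l \<in> ?I"
  have "(\<Sum>m=l..2 ^ j - 1. bspline (Suc r) (2 ^ j * x - of_int m))
  = bspline_cdf r (2 ^ j * x - of_int l) - bspline_cdf r (2 ^ j * x - of_int (2 ^ j - 1 + 1))"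
  by (rule bspline_cdf_telescope[OF r]) (use l in \<open>auto simp: spline_index_def\<close>)
  also have "bspline_cdf r (2 ^ j * x - of_int (2 ^ j - 1 + 1)) = 0" by (rule bspline_cdf_nonpos[OF r]) (use x in simp)
  finally show "(\<Sum>m=l..2 ^ j - 1. bspline (Suc r) (2 ^ j * x - of_int m)) = bspline_cdf r (2 ^ j * x - of_int l)" by simp
 qed
 finally show ?thesis .
 qed
 have "is_prim t s" unfolding is_prim_def
 proof (intro exI[of _ "t 0"] ballI)
 fix x :: real assume x: "x \<in> {0..1}"
 have "(I01 z. indicator {..x} z * s z)
  = (I01 z. (\<Sum>l\<in>?I. c l * (indicator {..x} z * bspline_scaled r j l z)))"
  by (intro lint_cong refl) (simp add: c spline_comb_def sum_distrib_left mult_ac)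
 also have "... = (\<Sum>l\<in>?I. c l * ((bspline_cdf r (2 ^ j * x - of_int l) - bspline_cdf r (- of_int l)) / 2 ^ j))" by (subst lint_sum)
  (auto intro!: bmeas_integrable bmeas_intros bmeas_indicator_mult bmeas_bspline_scaled r
   simp: bspline_scaled_primitive[OF r x])
 also have "... = t x - t 0" using t[OF x] t[of 0] by (simp add: sum_subtractf[symmetric] algebra_simps diff_divide_distrib)
 finally show "t x = t 0 + (I01 z. indicator {..x} z * s z)" by simp
 qed
 moreover have "t \<in> spline_space (Suc r) j" by (simp add: t_def spline_comb_in_space)
 ultimately show ?thesis by blast
qed

text \<open>Approximating the derivative by a spline and integrating that spline leaves a remainder with a
 small derivative, to which sampling applies again: each step gains the factor of one cell width.\<close>

lemma jackson_chain:
 assumes "1 <= a" "a <= r" "!!i. i < a ==> is_prim (f i) (f (Suc i))" "bmeas (f a)"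
 shows "\<exists>s\<in>spline_space r j. sq (%x. f 0 x - s x) <= (4 * (real r)^2 / 4 ^ j) ^ a * sq (f a)
 & (2 <= r --> (\<forall>x\<in>{0..1}. (f 0 x - s x)\<^sup>2 <= 2 * real r / 2 ^ j * (4 * (real r)^2 / 4 ^ j) ^ (a - 1) * sq (f a)))" using assms
proof (induction a arbitrary: r f rule: dec_induct)
 case base
 then show ?case using spline_sampling_error[of r "f 0" "f 1" j] by simp
next
 case (step a)
 then obtain q where q: "r = Suc q" "a <= q" by (cases r) auto
 have q1: "1 <= q" "1 <= r" using q step.hyps by auto
 have bf1: "bmeas (f 1)"
 proof (rule is_prim_bmeas(2))
 show "is_prim (f 1) (f 2)" using step.prems(2)[of 1] step.hyps by (simp add: numeral_2_eq_2)
 show "bmeas (f 2)"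
 proof -
  have "i <= a ==> bmeas (f (Suc a - i))" for i
  proof (induction i)
  case 0 then show ?case using step.prems(3) by simp
  next
  case (Suc i)
  then have "is_prim (f (Suc a - Suc i)) (f (Suc a - i))" using step.prems(2)[of "Suc a - Suc i"] by (simp add: Suc_diff_le)
  then show ?case using Suc is_prim_bmeas(2) by auto
  qed
  from this[of "a - 1"] show ?thesis using step.hyps by (simp add: numeral_2_eq_2 Suc_diff_le)
 qed
 qed
 have "\<exists>s\<in>spline_space q j. sq (%x. f 1 x - s x) <= (4 * (real q)^2 / 4 ^ j) ^ a * sq (f (Suc a))"
 using step.IH[OF q(2), of "%i. f (Suc i)"] step.prems by auto
 then obtain s1 where s1: "s1 \<in> spline_space q j"
 "sq (%x. f 1 x - s1 x) <= (4 * (real q)^2 / 4 ^ j) ^ a * sq (f (Suc a))" by blast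
 have "(4 * (real q)^2 / 4 ^ j) ^ a * sq (f (Suc a)) <= (4 * (real r)^2 / 4 ^ j) ^ a * sq (f (Suc a))"
 by (intro mult_right_mono power_mono divide_right_mono mult_left_mono) (auto simp: q)
 then have s1': "sq (%x. f 1 x - s1 x) <= (4 * (real r)^2 / 4 ^ j) ^ a * sq (f (Suc a))" using s1 by linarith
 obtain t where t: "t \<in> spline_space r j" "is_prim t s1" using spline_space_primitive[OF q1(1) s1(1)] q by blast
 have bs1: "bmeas s1" by (rule bmeas_spline_space[OF q1(1) s1(1)])
 have prim: "is_prim (%x. f 0 x - t x) (%x. f 1 x - s1 x)" by (rule is_prim_diff[OF _ t(2) bf1 bs1]) (use step.prems(2)[of 0] in simp)
 obtain s2 where s2: "s2 \<in> spline_space r j"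
 "sq (%x. f 0 x - t x - s2 x) <= 4 * (real r)^2 / 4 ^ j * sq (%x. f 1 x - s1 x)"
 "2 <= r --> (\<forall>x\<in>{0..1}. (f 0 x - t x - s2 x)\<^sup>2 <= 2 * real r / 2 ^ j * sq (%x. f 1 x - s1 x))"
 using spline_sampling_error[OF q1(2) prim bmeas_diff[OF bf1 bs1], of j] by blast
 have "4 * (real r)^2 / 4 ^ j * sq (%x. f 1 x - s1 x) <= 4 * (real r)^2 / 4 ^ j * ((4 * (real r)^2 / 4 ^ j) ^ a * sq (f (Suc a)))"
 by (intro mult_left_mono s1') auto
 then have A: "sq (%x. f 0 x - (t x + s2 x)) <= (4 * (real r)^2 / 4 ^ j) ^ Suc a * sq (f (Suc a))" using s2(2) by (simp add: diff_diff_eq mult.assoc)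
 have "2 * real r / 2 ^ j * sq (%x. f 1 x - s1 x) <= 2 * real r / 2 ^ j * ((4 * (real r)^2 / 4 ^ j) ^ a * sq (f (Suc a)))"
 by (intro mult_left_mono s1') auto
 then have B: "2 <= r --> (\<forall>x\<in>{0..1}. (f 0 x - (t x + s2 x))\<^sup>2
 <= 2 * real r / 2 ^ j * (4 * (real r)^2 / 4 ^ j) ^ (Suc a - 1) * sq (f (Suc a)))"
 using s2(3) by (fastforce simp: diff_diff_eq mult.assoc intro: order_trans)
 show ?case by (intro bexI[where x="%x. t x + s2 x"] conjI A B spline_space_add[OF t(1) s2(1)])
qed

section \<open>Smoothing by iterated differences\<close>

primrec steklov :: "nat => real => (real => real) => real => real" where
 "steklov 0 d h = h"
| "steklov (Suc n) d h = (%y. \<integral>v. steklov n d h (y + d * v) \<partial>lborel01)"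

lemma fdiff_funpow_eq:
 "(fdiff z ^^ a) h x = (\<Sum>k\<le>a. (-1) ^ (a - k) * real (a choose k) * h (x + real k * z))"
proof (induction a arbitrary: x)
 case 0
 then show ?case by simp
next
 case (Suc a)
 let ?t = "%a k. (-1) ^ (a - k) * real (a choose k)"
 have "(fdiff z ^^ Suc a) h x = (fdiff z ^^ a) h (x + z) - (fdiff z ^^ a) h x" by (simp add: fdiff_def)
 also have "... = (\<Sum>k\<le>a. ?t a k * h (x + real (Suc k) * z)) - (\<Sum>k\<le>a. ?t a k * h (x + real k * z))"
 unfolding Suc.IH by (simp add: algebra_simps)
 also have "(\<Sum>k\<le>a. ?t a k * h (x + real k * z))
  = ?t a 0 * h x + (\<Sum>k\<le>a. ?t a (Suc k) * h (x + real (Suc k) * z))"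
 proof -
 have "(\<Sum>k\<le>a. ?t a k * h (x + real k * z)) = (\<Sum>k\<le>Suc a. ?t a k * h (x + real k * z))" by simp
 also have "... = ?t a 0 * h x + (\<Sum>k\<le>a. ?t a (Suc k) * h (x + real (Suc k) * z))" by (subst sum.atMost_Suc_shift) simp
 finally show ?thesis .
 qed
 also have "(\<Sum>k\<le>a. ?t a k * h (x + real (Suc k) * z)) - (?t a 0 * h x + (\<Sum>k\<le>a. ?t a (Suc k) * h (x + real (Suc k) * z)))
  = ?t (Suc a) 0 * h x + (\<Sum>k\<le>a. ?t (Suc a) (Suc k) * h (x + real (Suc k) * z))"
 proof -
 have "?t a k - ?t a (Suc k) = ?t (Suc a) (Suc k)" if "k <= a" for k
 proof (cases "k = a")
  case False
  then have "a - k = Suc (a - Suc k)" using that by simp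
  then show ?thesis by (simp add: algebra_simps)
 qed simp
 then have "(\<Sum>k\<le>a. ?t (Suc a) (Suc k) * h (x + real (Suc k) * z))
  = (\<Sum>k\<le>a. (?t a k - ?t a (Suc k)) * h (x + real (Suc k) * z))" by (intro sum.cong refl) simp
 then show ?thesis by (simp add: left_diff_distrib sum_subtractf)
 qed
 also have "... = (\<Sum>k\<le>Suc a. ?t (Suc a) k * h (x + real k * z))" by (subst sum.atMost_Suc_shift) simp
 finally show ?case .
qed

lemma fdiff_funpow_scale: "(fdiff z ^^ a) (%y. f y / c) = (%y. (fdiff z ^^ a) f y / c)" by (auto simp: fun_eq_iff fdiff_funpow_eq sum_divide_distrib)

lemma fdiff_funpow_Suc:
 "(fdiff z ^^ Suc a) F = (%x. (fdiff z ^^ a) F (x + z) - (fdiff z ^^ a) F x)" unfolding funpow.simps o_apply by (rule fdiff_def)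

lemma fdiff_funpow_deriv:
 assumes "!!y. (F has_real_derivative f y) (at y)"
 shows "((fdiff z ^^ a) F has_real_derivative (fdiff z ^^ a) f y) (at y)"
proof (induction a arbitrary: y)
 case 0
 then show ?case using assms by simp
next
 case (Suc a)
 have "((%y. (fdiff z ^^ a) F (y + z)) has_real_derivative (fdiff z ^^ a) f (y + z)) (at y)" using Suc[of "y + z"] by (simp only: DERIV_shift)
 from DERIV_diff[OF this Suc[of y]] show ?case unfolding fdiff_funpow_Suc .
qed

lemma integral_FTC_lborel01:
 assumes d: "!!y. (F has_real_derivative f y) (at y)" and c: "continuous_on UNIV f" and x: "x \<in> {0..1}"
 shows "(I01 z. indicator {..x} z * f z) = F x - F 0"
proof -
 have "(I01 z. indicator {..x} z * f z) = (\<integral>z. f z * indicator {0..x} z \<partial>lborel)" by (subst integral_restrict_space)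
  (use x in \<open>auto intro!: lint_cong split: split_indicator\<close>)
 also have "... = F x - F 0" by (rule integral_FTC_Icc_real) (use x d c in \<open>auto simp: continuous_on_eq_continuous_at\<close>)
 finally show ?thesis .
qed

lemma average_deriv:
 assumes c: "continuous_on UNIV S" and d: "d ~= 0"
 shows "((%y. \<integral>v. S (y + d * v) \<partial>lborel01) has_real_derivative fdiff d S y / d) (at y)"
proof -
 have "\<exists>G. \<forall>x. -\<infinity> < ereal x --> ereal x < \<infinity> --> (G has_vector_derivative S x) (at x)"
 by (rule einterval_antiderivative) (use c in \<open>auto simp: continuous_on_eq_continuous_at\<close>)
 then obtain G where G: "!!x. (G has_real_derivative S x) (at x)" by (auto simp: has_real_derivative_iff_has_vector_derivative)
 have eq: "(I01 v. S (y + d * v)) = (G (y + d) - G y) / d" for y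
 proof -
 have "((%v. G (y + d * v) / d) has_real_derivative S (y + d * v)) (at v)" for v
 proof -
  have "((%v. G (y + d * v)) has_real_derivative S (y + d * v) * d) (at v)" by (rule DERIV_chain2[OF G]) (auto intro!: derivative_eq_intros)
  from DERIV_cdivide[OF this, of d] show ?thesis using d by simp
 qed
 moreover have "continuous_on UNIV (%v. S (y + d * v))" by (rule continuous_on_compose2[OF c]) (auto intro!: continuous_intros)
 ultimately have "(I01 v. indicator {..1} v * S (y + d * v)) = G (y + d * 1) / d - G (y + d * 0) / d" by (rule integral_FTC_lborel01) simp
 also have "(I01 v. indicator {..1} v * S (y + d * v)) = (I01 v. S (y + d * v))" by (rule lint_cong) auto
 finally show ?thesis by (simp add: diff_divide_distrib)
 qed
 have "((%y. (G (y + d) - G y) / d) has_real_derivative (S (y + d) - S y) / d) (at y)"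
 by (intro DERIV_cdivide DERIV_diff G) (use G[of "y + d"] in \<open>simp only: DERIV_shift\<close>)
 then show ?thesis by (simp add: eq fdiff_def)
qed

lemma steklov_continuous:
 assumes "continuous_on UNIV h" "d ~= 0" shows "continuous_on UNIV (steklov n d h)"
proof (induction n)
 case 0
 then show ?case using assms by simp
next
 case (Suc n)
 then show ?case using average_deriv[OF Suc assms(2)] DERIV_isCont by (fastforce simp: continuous_on_eq_continuous_at)
qed

lemma steklov_bspline:
 assumes c: "continuous_on UNIV h" and b: "!!x. \<bar>h x\<bar> <= B" and d: "d ~= 0" and n: "1 <= n"
 shows "steklov n d h y = (\<integral>u. bspline n u * h (y + d * u) \<partial>lborel)" using n
proof (induction n arbitrary: y rule: dec_induct)
 case base
 have [measurable]: "h \<in> borel_measurable borel" by (rule meas_contI[OF c])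
 have "(I01 v. h (y + d * v)) = (\<integral>u. indicator {0..1} u * h (y + d * u) \<partial>lborel)" by (subst integral_restrict_space) auto
 also have "... = (\<integral>u. bspline 1 u * h (y + d * u) \<partial>lborel)"
 proof (rule integral_cong_AE)
 have "AE u in lborel. u ~= (1::real)" by (rule AE_lborel_singleton)
 then show "AE u in lborel. indicator {0..1} u * h (y + d * u) = bspline 1 u * h (y + d * u)"
  by eventually_elim (auto simp: bspline_1 split: split_indicator)
 show "(%u. bspline 1 u * h (y + d * u)) \<in> borel_measurable lborel" by (simp add: bspline_1)
 qed measurable
 finally show ?case by simp
next
 case (step n)
 have [measurable]: "h \<in> borel_measurable borel" by (rule meas_contI[OF c])
 note [measurable] = bspline_measurable[OF step.hyps(1)]
 have intN: "integrable lborel (%u. B * bspline n u)" by (intro integrable_mult_right bspline_integrable step.hyps)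
 have bN: "\<bar>bspline n u * h x\<bar> <= B * bspline n u" for u x using mult_right_mono[OF b[of x] bspline_nonneg[OF step.hyps(1), of u]]
 by (simp add: abs_mult bspline_nonneg[OF step.hyps(1)] mult.commute)
 have B0: "0 <= B" using b[of 0] by linarith
 let ?f = "%v u. indicator {0..1} v * (bspline n u * h (y + d * v + d * u))"
 have i1: "integrable lborel (?f v)" for v
 proof (rule lint_bound[OF intN])
 show "AE u in lborel. norm (?f v u) <= norm (B * bspline n u)" using bN B0 by (auto split: split_indicator simp: bspline_nonneg[OF step.hyps(1)])
 qed measurable
 have int1: "integrable (lborel \<Otimes>\<^sub>M lborel) (case_prod ?f)"
 proof (rule lborel_pair.Fubini_integrable)
 show "integrable lborel (%v. \<integral>u. norm (case_prod ?f (v, u)) \<partial>lborel)"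
 proof (rule lint_bound[of _ "%v. B * indicator {0..1} v"])
  show "AE v in lborel. norm (\<integral>u. norm (case_prod ?f (v, u)) \<partial>lborel) <= norm (B * indicator {0..1::real} v)"
  proof (intro AE_I2)
  fix v :: real
  have "(\<integral>u. \<bar>?f v u\<bar> \<partial>lborel) <= (\<integral>u. indicator {0..1} v * (B * bspline n u) \<partial>lborel)"
   by (rule integral_mono) (use i1 intN bN in \<open>auto split: split_indicator\<close>)
  also have "... = B * indicator {0..1} v" by (simp add: bspline_mass[OF step.hyps(1)])
  finally show "norm (\<integral>u. norm (case_prod ?f (v, u)) \<partial>lborel) <= norm (B * indicator {0..1} v)"
   using B0 by (simp add: abs_of_nonneg integral_nonneg_AE)
  qed
 qed (auto simp: emeasure_lborel_Icc_eq)
 qed (use i1 in auto)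
 have "steklov (Suc n) d h y = (\<integral>v. indicator {0..1} v * (\<integral>u. bspline n u * h (y + d * v + d * u) \<partial>lborel) \<partial>lborel)"
 by (simp add: step.IH integral_restrict_space)
 also have "... = (\<integral>v. (\<integral>u. ?f v u \<partial>lborel) \<partial>lborel)" by simp
 also have "... = (\<integral>u. (\<integral>v. ?f v u \<partial>lborel) \<partial>lborel)" by (rule lborel_pair.Fubini_integral[OF int1, symmetric])
 also have "... = (\<integral>u. (\<integral>w. indicator {0..1} (w - u) * (bspline n u * h (y + d * w)) \<partial>lborel) \<partial>lborel)"
 proof (rule lint_cong[OF refl])
 fix u :: real
 show "(\<integral>v. ?f v u \<partial>lborel) = (\<integral>w. indicator {0..1} (w - u) * (bspline n u * h (y + d * w)) \<partial>lborel)"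
  by (subst lborel_integral_real_affine[of 1 _ "- u"]) (auto simp: algebra_simps)
 qed
 also have "... = (\<integral>w. (\<integral>u. indicator {0..1} (w - u) * (bspline n u * h (y + d * w)) \<partial>lborel) \<partial>lborel)"
 proof (rule lborel_pair.Fubini_integral[symmetric])
 let ?g = "%w u. indicator {0..1} (w - u) * (bspline n u * h (y + d * w))"
 show "integrable (lborel \<Otimes>\<^sub>M lborel) (%(u, w). ?g w u)"
 proof (rule lborel_pair.Fubini_integrable)
  have ind: "(%w. indicator {0..1} (w - u) :: real) = indicator {u..u + 1}" for u :: real by (auto simp: fun_eq_iff indicator_def)
  have i2: "integrable lborel (%w. indicator {0..1} (w - u) * (bspline n u * B))" for u
  by (intro integrable_mult_left) (simp add: ind emeasure_lborel_Icc_eq)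
  have i3: "integrable lborel (%w. ?g w u)" for u
  proof (rule lint_bound[OF i2[of u]])
  have "norm (?g w u) <= norm (indicator {0..1} (w - u) * (bspline n u * B))" for w
   using mult_left_mono[OF b[of "y + d * w"] bspline_nonneg[OF step.hyps(1), of u]] B0
   by (simp add: abs_mult bspline_nonneg[OF step.hyps(1)] mult_left_mono)
  then show "AE w in lborel. norm (?g w u) <= norm (indicator {0..1} (w - u) * (bspline n u * B))" by (rule AE_I2)
  qed measurable
  show "AE u in lborel. integrable lborel (%w. case (u, w) of (u, w) => ?g w u)" using i3 by simp
  show "integrable lborel (%u. \<integral>w. norm (case (u, w) of (u, w) => ?g w u) \<partial>lborel)"
  proof (rule lint_bound[OF intN])
  show "AE u in lborel. norm (\<integral>w. norm (case (u, w) of (u, w) => ?g w u) \<partial>lborel) <= norm (B * bspline n u)"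
  proof (intro AE_I2)
   fix u
   have "(\<integral>w. \<bar>?g w u\<bar> \<partial>lborel) <= (\<integral>w. indicator {0..1} (w - u) * (bspline n u * B) \<partial>lborel)"
   proof (rule integral_mono[OF integrable_abs[OF i3] i2])
    show "\<bar>?g w u\<bar> <= indicator {0..1} (w - u) * (bspline n u * B)" for w
    using mult_left_mono[OF b[of "y + d * w"] bspline_nonneg[OF step.hyps(1), of u]] by (simp add: abs_mult bspline_nonneg[OF step.hyps(1)] mult_left_mono)
   qed
   also have "... = B * bspline n u" by (simp add: ind)
   finally show "norm (\<integral>w. norm (case (u, w) of (u, w) => ?g w u) \<partial>lborel) <= norm (B * bspline n u)"
    using B0 by (simp add: abs_of_nonneg integral_nonneg_AE bspline_nonneg[OF step.hyps(1)])
  qed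
  qed measurable
 qed measurable
 qed
 also have "... = (\<integral>w. bspline (Suc n) w * h (y + d * w) \<partial>lborel)"
 proof (rule lint_cong[OF refl])
 fix w
 have "(\<integral>u. indicator {0..1} (w - u) * (bspline n u * h (y + d * w)) \<partial>lborel)
  = (\<integral>u. indicator {0..1} (w - u) * bspline n u \<partial>lborel) * h (y + d * w)" by (simp flip: mult.assoc)
 also have "(\<integral>u. indicator {0..1} (w - u) * bspline n u \<partial>lborel) = (\<integral>u. indicator {w - 1<..w} u * bspline n u \<partial>lborel)"
 proof (rule integral_cong_AE)
  have "AE u in lborel. u ~= w - 1" by (rule AE_lborel_singleton)
  then show "AE u in lborel. indicator {0..1} (w - u) * bspline n u = indicator {w - 1<..w} u * bspline n u"
  by eventually_elim (auto split: split_indicator)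
 qed measurable
 finally show "(\<integral>u. indicator {0..1} (w - u) * (bspline n u * h (y + d * w)) \<partial>lborel) = bspline (Suc n) w * h (y + d * w)"
  by (simp add: bspline_eq_window[OF step.hyps(1)])
 qed
 finally show ?case .
qed

text \<open>Jensen's inequality for the square and the probability density \<open>bspline a\<close>: the variance is
 nonnegative.\<close>

lemma bspline_jensen_square:
 assumes a: "1 <= a" and m: "\<phi> \<in> borel_measurable borel" and b: "!!u. \<bar>\<phi> u\<bar> <= B"
 shows "(\<integral>u. bspline a u * \<phi> u \<partial>lborel)^2 <= (\<integral>u. indicator {0..real a} u * (\<phi> u)^2 \<partial>lborel)"
proof -
 note [measurable] = m bspline_measurable[OF a]
 have B0: "0 <= B" using b[of 0] by linarith
 have b2: "(\<phi> u)^2 <= B^2" for u using power_mono[OF b[of u] abs_ge_zero, of 2] by simp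
 have i1: "integrable lborel (%u. bspline a u * \<phi> u)"
 proof (rule lint_bound[of _ "%u. B * bspline a u"])
 show "AE u in lborel. norm (bspline a u * \<phi> u) <= norm (B * bspline a u)"
  using b B0 by (intro AE_I2) (simp add: abs_mult mult.commute[of B] mult_left_mono)
 qed (auto intro!: bspline_integrable a)
 have i2: "integrable lborel (%u. bspline a u * (\<phi> u)^2)"
 proof (rule lint_bound[of _ "%u. B\<^sup>2 * bspline a u"])
 show "AE u in lborel. norm (bspline a u * (\<phi> u)^2) <= norm (B^2 * bspline a u)"
  using b2 by (intro AE_I2) (simp add: abs_mult mult.commute[of "B^2"] mult_left_mono)
 qed (auto intro!: bspline_integrable a)
 have i3: "integrable lborel (%u. indicator {0..real a} u * (\<phi> u)^2)"
 proof (rule lint_bound[of _ "%u. B\<^sup>2 * indicator {0..real a} u"])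
 show "AE u in lborel. norm (indicator {0..real a} u * (\<phi> u)^2) <= norm (B^2 * indicator {0..real a} u)"
  using b2 by (intro AE_I2) (simp split: split_indicator)
 qed auto
 let ?m = "\<integral>u. bspline a u * \<phi> u \<partial>lborel"
 have "0 <= (\<integral>u. bspline a u * (\<phi> u - ?m)^2 \<partial>lborel)" by (rule integral_nonneg_AE) (simp add: bspline_nonneg[OF a])
 also have "... = (\<integral>u. bspline a u * (\<phi> u)^2 - 2 * ?m * (bspline a u * \<phi> u) + ?m\<^sup>2 * bspline a u \<partial>lborel)"
 by (intro lint_cong refl) (simp add: power2_eq_square algebra_simps)
 also have "... = (\<integral>u. bspline a u * (\<phi> u)^2 \<partial>lborel) - 2 * ?m * ?m + ?m\<^sup>2"
 using i1 i2 bspline_integrable[OF a] by (simp add: bspline_mass[OF a])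
 finally have "?m\<^sup>2 <= (\<integral>u. bspline a u * (\<phi> u)^2 \<partial>lborel)" by (simp add: power2_eq_square)
 also have "... <= (\<integral>u. indicator {0..real a} u * (\<phi> u)^2 \<partial>lborel)"
 proof (rule integral_mono[OF i2 i3])
 fix u
 have "bspline a u <= indicator {0..real a} u" using bspline_le_1[OF a, of u] bspline_support[OF a, of u] by (auto split: split_indicator)
 then show "bspline a u * (\<phi> u)^2 <= indicator {0..real a} u * (\<phi> u)^2" by (rule mult_right_mono) simp
 qed
 finally show ?thesis .
qed

lemma fdiff_funpow_continuous:
 assumes "continuous_on UNIV h" shows "continuous_on UNIV ((fdiff z ^^ a) h)" unfolding fdiff_funpow_eq[abs_def]
 by (intro continuous_intros continuous_on_compose2[OF assms]) auto

lemma fdiff_funpow_joint_measurable: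
 assumes "h \<in> borel_measurable borel"
 shows "(%p. (fdiff (snd p) ^^ a) h (fst p :: real)) \<in> borel_measurable (borel \<Otimes>\<^sub>M borel)"
proof -
 note [measurable] = assms
 show ?thesis unfolding fdiff_funpow_eq by measurable
qed

lemma fdiff_funpow_abs_le:
 assumes "!!x. \<bar>h x\<bar> <= B" shows "\<bar>(fdiff z ^^ a) h x\<bar> <= 2 ^ a * B"
proof -
 have "\<bar>(fdiff z ^^ a) h x\<bar> <= (\<Sum>k\<le>a. real (a choose k) * B)" unfolding fdiff_funpow_eq
 by (rule order_trans[OF sum_abs]) (intro sum_mono, simp add: abs_mult assms mult_left_mono power_abs)
 also have "... = 2 ^ a * B" unfolding sum_distrib_right[symmetric] by (metis choose_row_sum of_nat_numeral of_nat_power of_nat_sum)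
 finally show ?thesis .
qed

lemma fdiff_funpow_modulus:
 assumes a: "1 <= a" and e: "!!k. k <= a ==> \<bar>h (x + real k * z) - h x\<bar> <= e"
 shows "\<bar>(fdiff z ^^ a) h x\<bar> <= 2 ^ a * e"
proof -
 have "(\<Sum>k\<le>a. (-1) ^ (a - k) * real (a choose k)) = 0"
 proof -
 have "(\<Sum>k\<le>a. (-1) ^ (a - k) * real (a choose k)) = (\<Sum>k\<le>a. (-1) ^ k * real (a choose k))"
  by (rule sum.reindex_bij_witness[of _ "%k. a - k" "%k. a - k"]) (auto simp: binomial_symmetric[symmetric])
 then show ?thesis using choose_alternating_sum[of a, where 'a=real] a by simp
 qed
 then have "(fdiff z ^^ a) h x = (\<Sum>k\<le>a. (-1) ^ (a - k) * real (a choose k) * (h (x + real k * z) - h x))"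
 by (simp add: fdiff_funpow_eq right_diff_distrib sum_subtractf flip: sum_distrib_right)
 also have "\<bar>\<dots>\<bar> <= (\<Sum>k\<le>a. real (a choose k) * e)"
 by (rule order_trans[OF sum_abs]) (intro sum_mono, simp add: abs_mult e mult_left_mono power_abs)
 also have "... = 2 ^ a * e" unfolding sum_distrib_right[symmetric] by (metis choose_row_sum of_nat_numeral of_nat_power of_nat_sum)
 finally show ?thesis .
qed

lemma bmeas_iter_diff:
 assumes c: "continuous_on UNIV h" and b: "!!x. \<bar>h x\<bar> <= B" shows "bmeas (iter_diff a z h)"
proof -
 have [measurable]: "(fdiff z ^^ a) h \<in> borel_measurable borel" by (intro meas_contI fdiff_funpow_continuous c)
 have eq: "iter_diff a z h = (%x. indicator {0..1} x * indicator {0..1} (x + real a * z) * (fdiff z ^^ a) h x)"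
 by (auto simp: fun_eq_iff iter_diff_def indicator_def)
 have "iter_diff a z h \<in> borel_measurable borel" unfolding eq by measurable
 moreover have "\<bar>iter_diff a z h x\<bar> <= 2 ^ a * B" for x
 proof -
 have "\<bar>(fdiff z ^^ a) h x\<bar> <= 2 ^ a * B" by (rule fdiff_funpow_abs_le[OF b])
 moreover from this have "0 <= 2 ^ a * B" by (rule order_trans[OF abs_ge_zero])
 ultimately show ?thesis by (simp add: iter_diff_def)
 qed
 ultimately show ?thesis by (intro bmeasI[of _ "2 ^ a * B"]) (auto intro: measurable_lborel01I)
qed

lemma unit_interval_step:
 assumes t: "0 < t" "b * t <= (1::real)" "0 <= b" and x: "x \<in> {0..1}" "x + z / t \<in> {0..1}"
 shows "x + b * z \<in> {0..1}"
proof -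
 have "x + b * z = (1 - b * t) *\<^sub>R x + (b * t) *\<^sub>R (x + z / t)" using t by (simp add: algebra_simps)
 then show ?thesis using convexD[OF convex_real_interval(5)[of 0 1] x, of "1 - b * t" "b * t"] t by (simp add: mult_nonneg_nonneg)
qed
text \<open>With the step \<open>t (v - x)\<close> the nodes \<open>x, x + t (v - x), \<dots>\<close> stay in the unit interval for every
 \<open>v\<close> in it, where \<open>h\<close> is given.  Averaged over \<open>v\<close>, these differences are controlled by those with a fixed step.\<close>

lemma averaged_difference_bound:
 assumes c: "continuous_on UNIV h" and b: "!!x. \<bar>h x\<bar> <= B" and a: "1 <= a"
 and t: "0 < t" "real a * t <= 1 / 2" and \<tau>: "0 <= \<tau>" and L: "0 <= L"
 and H: "!!z. z ~= 0 ==> \<bar>z\<bar> < 1 ==> sq (iter_diff a z h) <= L * \<bar>z\<bar> powr (2 * \<tau>)"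
 shows "(\<integral>\<^sup>+x. indicator {0..1} x *
  (\<integral>\<^sup>+u. indicator {0..real a} u * ennreal (((fdiff (t * (u / real a - x)) ^^ a) h x)^2) \<partial>lborel) \<partial>lborel)
 <= ennreal (2 * real a * (L * t powr (2 * \<tau>)))"
proof -
 have hm[measurable]: "h \<in> borel_measurable borel" by (rule meas_contI[OF c])
 have tl: "t <= 1 / 2" using t a mult_right_mono[of 1 "real a" t] by linarith
 define \<phi> where "\<phi> x z = ennreal (((fdiff z ^^ a) h x)^2)" for x z
 have \<phi>m[measurable]: "(%p. \<phi> (fst p) (snd p)) \<in> borel_measurable (borel \<Otimes>\<^sub>M borel)"
 unfolding \<phi>_def using fdiff_funpow_joint_measurable[OF hm, of a] by measurable
 have \<phi>m2: "(%u. \<phi> x (f u)) \<in> borel_measurable borel" if "f \<in> borel_measurable borel" for x and f :: "real => real"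
 using measurable_compose[OF measurable_Pair[OF measurable_const that] \<phi>m] by simp
 have inner: "(\<integral>\<^sup>+u. indicator {0..real a} u * \<phi> x (t * (u / real a - x)) \<partial>lborel)
 = ennreal (real a / t) * (\<integral>\<^sup>+z. indicator {0..1} (x + z / t) * \<phi> x z \<partial>lborel)" for x
 proof -
 have "(%u. indicator {0..real a} u * \<phi> x (t * (u / real a - x))) \<in> borel_measurable borel"
  by (intro borel_measurable_times_ennreal \<phi>m2) auto
 then have "(\<integral>\<^sup>+u. indicator {0..real a} u * \<phi> x (t * (u / real a - x)) \<partial>lborel)
  = ennreal (real a / t) * (\<integral>\<^sup>+z. indicator {0..real a} (real a * x + real a / t * z)
  * \<phi> x (t * ((real a * x + real a / t * z) / real a - x)) \<partial>lborel)"
  using a t by (subst nn_integral_real_affine[of _ "real a / t" "real a * x"]) auto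
 also have "(%z. indicator {0..real a} (real a * x + real a / t * z) * \<phi> x (t * ((real a * x + real a / t * z) / real a - x)))
  = (%z. indicator {0..1} (x + z / t) * \<phi> x z)"
 proof
  fix z
  have "real a * x + real a / t * z = real a * (x + z / t)" by (simp add: distrib_left)
  moreover have "t * (real a * (x + z / t) / real a - x) = z" using a t by simp
  moreover have "real a * (x + z / t) \<in> {0..real a} \<longleftrightarrow> x + z / t \<in> {0..1}"
  using a by (auto simp: zero_le_mult_iff mult_le_cancel_left1)
  ultimately show "indicator {0..real a} (real a * x + real a / t * z) * \<phi> x (t * ((real a * x + real a / t * z) / real a - x))
   = indicator {0..1} (x + z / t) * \<phi> x z" by (simp only: indicator_def)
 qed
 finally show ?thesis .
 qed
 have "(\<integral>\<^sup>+x. (\<integral>\<^sup>+z. indicator {0..1} x * (indicator {0..1} (x + z / t) * \<phi> x z) \<partial>lborel) \<partial>lborel)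
 = (\<integral>\<^sup>+z. (\<integral>\<^sup>+x. indicator {0..1} x * (indicator {0..1} (x + z / t) * \<phi> x z) \<partial>lborel) \<partial>lborel)"
 by (rule lborel_pair.Fubini'[symmetric]) measurable
 also have "... <= (\<integral>\<^sup>+z. ennreal (L * t powr (2 * \<tau>)) * indicator {-t..t} z \<partial>lborel)"
 proof (rule nn_integral_mono)
 fix z :: real
 show "(\<integral>\<^sup>+x. indicator {0..1} x * (indicator {0..1} (x + z / t) * \<phi> x z) \<partial>lborel)
  <= ennreal (L * t powr (2 * \<tau>)) * indicator {-t..t} z"
 proof (cases "z \<in> {-t..t} & z ~= 0")
  case True
  then have z: "z ~= 0" "\<bar>z\<bar> <= t" "\<bar>z\<bar> < 1" using tl by auto
  have "(\<integral>\<^sup>+x. indicator {0..1} x * (indicator {0..1} (x + z / t) * \<phi> x z) \<partial>lborel)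
   <= (\<integral>\<^sup>+x. ennreal ((iter_diff a z h x)^2) * indicator {0..1} x \<partial>lborel)"
  proof (rule nn_integral_mono)
  fix x
  have "x + real a * z \<in> {0..1}" if "x \<in> {0..1}" "x + z / t \<in> {0..1}" by (rule unit_interval_step[OF t(1) _ _ that]) (use t in simp_all)
  then have "iter_diff a z h x = (fdiff z ^^ a) h x" if "x \<in> {0..1}" "x + z / t \<in> {0..1}"
   using that by (simp only: iter_diff_def simp_thms if_True)
  then show "indicator {0..1} x * (indicator {0..1} (x + z / t) * \<phi> x z)
   <= ennreal ((iter_diff a z h x)^2) * indicator {0..1} x" by (cases "x \<in> {0..1}"; cases "x + z / t \<in> {0..1}")
    (simp_all only: \<phi>_def indicator_simps not_False_eq_True mult_1_left mult_1_right mult_zero_left mult_zero_right order_refl zero_le)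
  qed
  also have "... = (\<integral>\<^sup>+x. ennreal ((iter_diff a z h x)^2) \<partial>lborel01)" by (subst nn_integral_restrict_space) auto
  also have "... = ennreal (sq (iter_diff a z h))"
  unfolding sq_def by (intro nn_integral_eq_integral bmeas_integrable bmeas_power2 bmeas_iter_diff[OF c b]) auto
  also have "... <= ennreal (L * t powr (2 * \<tau>))"
  proof (rule ennreal_leI)
  have "sq (iter_diff a z h) <= L * \<bar>z\<bar> powr (2 * \<tau>)" by (rule H[OF z(1,3)])
  also have "... <= L * t powr (2 * \<tau>)" by (intro mult_left_mono powr_mono2) (use z \<tau> L in simp_all)
  finally show "sq (iter_diff a z h) <= L * t powr (2 * \<tau>)" .
  qed
  finally show ?thesis using True by simp
 next
  case False
  show ?thesis
  proof (cases "z = 0")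
  case True
  have "(fdiff 0 ^^ a) h x = 0" for x using fdiff_funpow_modulus[OF a, of h x 0 0] by simp
  then show ?thesis by (simp add: \<phi>_def True)
  next
  case nz: False
  then have "z < - t \<or> t < z" using False by auto
  then have zt: "z / t < - 1 \<or> 1 < z / t" using t by (simp add: divide_less_eq less_divide_eq)
  have "indicator {0..1} x * (indicator {0..1} (x + z / t) * \<phi> x z) = 0" for x
  proof (cases "x \<in> {0..1}")
   case True
   then have "x + z / t \<notin> {0..1}" using zt unfolding atLeastAtMost_iff by linarith
   then show ?thesis by (simp only: indicator_simps not_False_eq_True mult_zero_left mult_zero_right)
  qed (simp only: indicator_simps not_False_eq_True mult_zero_left)
  then have "(%x. indicator {0..1} x * (indicator {0..1} (x + z / t) * \<phi> x z)) = (%x. 0)" by (rule ext)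
  then show ?thesis by (simp only: nn_integral_const) simp
  qed
 qed
 qed
 also have "... = ennreal (L * t powr (2 * \<tau>)) * ennreal (2 * t)" using t by (subst nn_integral_cmult_indicator) (auto simp: emeasure_lborel_Icc_eq)
 finally have X: "(\<integral>\<^sup>+x. (\<integral>\<^sup>+z. indicator {0..1} x * (indicator {0..1} (x + z / t) * \<phi> x z) \<partial>lborel) \<partial>lborel)
  <= ennreal (L * t powr (2 * \<tau>)) * ennreal (2 * t)" .
 have "(\<integral>\<^sup>+x. indicator {0..1} x * (\<integral>\<^sup>+u. indicator {0..real a} u * \<phi> x (t * (u / real a - x)) \<partial>lborel) \<partial>lborel)
 = (\<integral>\<^sup>+x. ennreal (real a / t) * (\<integral>\<^sup>+z. indicator {0..1} x * (indicator {0..1} (x + z / t) * \<phi> x z) \<partial>lborel) \<partial>lborel)"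
 proof (rule nn_integral_cong)
 fix x
 have m: "(%z. indicator {0..1} (x + z / t) * \<phi> x z) \<in> borel_measurable lborel"
  using \<phi>m2[of "%z. z" x] by (auto intro!: borel_measurable_times_ennreal)
 show "indicator {0..1} x * (\<integral>\<^sup>+u. indicator {0..real a} u * \<phi> x (t * (u / real a - x)) \<partial>lborel)
  = ennreal (real a / t) * (\<integral>\<^sup>+z. indicator {0..1} x * (indicator {0..1} (x + z / t) * \<phi> x z) \<partial>lborel)"
  unfolding inner nn_integral_cmult[OF m] by (rule mult.left_commute)
 qed
 also have "... = ennreal (real a / t) * (\<integral>\<^sup>+x. (\<integral>\<^sup>+z. indicator {0..1} x * (indicator {0..1} (x + z / t) * \<phi> x z) \<partial>lborel) \<partial>lborel)"
 by (rule nn_integral_cmult) measurable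
 also have "... <= ennreal (real a / t) * (ennreal (L * t powr (2 * \<tau>)) * ennreal (2 * t))" by (rule mult_left_mono[OF X]) simp
 also have "... = ennreal (real a / t * (L * t powr (2 * \<tau>) * (2 * t)))"
 proof -
 have "0 <= L * t powr (2 * \<tau>)" "0 <= 2 * t" "0 <= real a / t" using t L by simp_all
 then show ?thesis by (simp only: ennreal_mult mult_nonneg_nonneg)
 qed
 also have "real a / t * (L * t powr (2 * \<tau>) * (2 * t)) = 2 * real a * (L * t powr (2 * \<tau>))" using t by simp
 finally show ?thesis unfolding \<phi>_def .
qed

lemma sq_dilation_le:
 assumes m: "\<psi> \<in> borel_measurable borel" and c: "1 / 2 <= c" "c <= 1" and b: "!!x. \<bar>\<psi> x\<bar> <= B" and g: "bmeas g"
 and le: "!!y. 0 <= y ==> y <= c ==> \<bar>\<psi> y\<bar> <= \<bar>g y\<bar>"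
 shows "sq (%x. \<psi> (c * x)) <= 2 * sq g"
proof -
 note [measurable] = m
 have b2: "(\<psi> u)^2 <= B^2" for u using power_mono[OF b[of u] abs_ge_zero, of 2] by simp
 have "sq (%x. \<psi> (c * x)) = (\<integral>x. indicator {0..1} x * (\<psi> (c * x))^2 \<partial>lborel)"
 unfolding sq_def by (subst integral_restrict_space) auto
 also have "(%x. indicator {0..1} x * (\<psi> (c * x))^2) = (%x. indicator {0..c} (0 + c * x) * (\<psi> (0 + c * x))^2)"
 using c by (auto simp: fun_eq_iff indicator_def zero_le_mult_iff mult_le_cancel_left1)
 also have "(\<integral>x. indicator {0..c} (0 + c * x) * (\<psi> (0 + c * x))^2 \<partial>lborel)
  = (1 / c) * (\<integral>y. indicator {0..c} y * (\<psi> y)^2 \<partial>lborel)"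
 using c by (subst lborel_integral_real_affine[of c "%y. indicator {0..c} y * (\<psi> y)^2" 0]) auto
 also have "(\<integral>y. indicator {0..c} y * (\<psi> y)^2 \<partial>lborel) = (I01 y. indicator {0..c} y * (\<psi> y)^2)"
 using c by (subst integral_restrict_space) (auto intro!: lint_cong split: split_indicator)
 also have "... <= sq g" unfolding sq_def
 proof (rule integral_mono)
 show "integrable lborel01 (%y. indicator {0..c} y * (\<psi> y)^2)"
  by (intro bmeas_integrable bmeas_indicator_mult bmeas_power2 bmeasI[of _ B]) (auto intro: b)
 show "integrable lborel01 (%y. (g y)\<^sup>2)" by (intro bmeas_integrable bmeas_power2 g)
 show "indicator {0..c} y * (\<psi> y)^2 <= (g y)^2" for y using le[of y] by (auto simp: abs_le_square_iff split: split_indicator)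
 qed
 finally have "sq (%x. \<psi> (c * x)) <= 1 / c * sq g" using c by (simp add: divide_right_mono)
 also have "... <= 2 * sq g" using c by (intro mult_right_mono) (auto simp: divide_le_eq)
 finally show ?thesis .
qed

lemma sq_sum_le:
 assumes "finite I" "!!i. i \<in> I ==> bmeas (f i)"
 shows "sq (%x. \<Sum>i\<in>I. f i x) <= real (card I) * (\<Sum>i\<in>I. sq (f i))"
proof -
 have "sq (%x. \<Sum>i\<in>I. f i x) <= (I01 x. real (card I) * (\<Sum>i\<in>I. (f i x)\<^sup>2))" unfolding sq_def
 proof (rule integral_mono)
 show "(\<Sum>i\<in>I. f i x)^2 <= real (card I) * (\<Sum>i\<in>I. (f i x)\<^sup>2)" for x using Cauchy_Schwarz_ineq_sum[of "%_. 1" "%i. f i x" I] by simp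
 qed (intro bmeas_integrable bmeas_intros assms, assumption)+
 also have "... = real (card I) * (\<Sum>i\<in>I. sq (f i))" unfolding sq_def by (simp add: bmeas_integrable bmeas_power2 assms)
 finally show ?thesis .
qed

lemma is_prim_of_deriv:
 assumes "!!y. (F has_real_derivative f y) (at y)" "continuous_on UNIV f"
 shows "is_prim F f" unfolding is_prim_def by (rule exI[of _ "F 0"]) (simp add: integral_FTC_lborel01[OF assms])

text \<open>The smoothed function replaces \<open>h\<close> by averages of the remaining terms of an \<open>a\<close>-th difference
 with step \<open>t (v - x)\<close>; those averages are \<open>a\<close>-fold integral means, whose \<open>a\<close>-th derivatives are
 \<open>a\<close>-th differences again.\<close>

lemma smooth_approximant:
 assumes c: "continuous_on UNIV h" and b: "!!x. \<bar>h x\<bar> <= B" and a: "1 <= a"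
 and t: "0 < t" "real a * t <= 1 / 2" and \<tau>: "0 <= \<tau>" and L: "0 <= L"
 and H: "!!z. z ~= 0 ==> \<bar>z\<bar> < 1 ==> sq (iter_diff a z h) <= L * \<bar>z\<bar> powr (2 * \<tau>)"
 shows "\<exists>f. (\<forall>i<a. is_prim (f i) (f (Suc i))) & bmeas (f a)
 & sq (%x. h x - f 0 x) <= 2 * real a * (L * t powr (2 * \<tau>))
 & sq (f a) <= 2 * (real a)^2 * 4 ^ a * (real a / t) ^ (2 * a) * (L * t powr (2 * \<tau>))
 & (\<forall>e. (\<forall>x y. \<bar>x - y\<bar> <= real a * t --> \<bar>h x - h y\<bar> <= e) --> (\<forall>x\<in>{0..1}. \<bar>h x - f 0 x\<bar> <= 2 ^ a * e))"
proof -
 have hm[measurable]: "h \<in> borel_measurable borel" by (rule meas_contI[OF c])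
 define \<gamma> where "\<gamma> k = 1 - real k * t" for k
 define \<delta> where "\<delta> k = real k * t / real a" for k
 define \<sigma> where "\<sigma> k = - ((-1) ^ k * real (a choose k))" for k
 define f where "f i x = (\<Sum>k\<in>{1..a}. \<sigma> k * ((\<gamma> k / \<delta> k) ^ i * (fdiff (\<delta> k) ^^ i) (steklov (a - i) (\<delta> k) h) (\<gamma> k * x)))"
 for i x
 have \<delta>0: "0 < \<delta> k" if "k \<in> {1..a}" for k using that t a by (auto simp: \<delta>_def)
 have kt: "real k * t <= 1 / 2" if "k \<in> {1..a}" for k
 proof -
 have "real k * t <= real a * t" using that t by (intro mult_right_mono) auto
 then show ?thesis using t(2) by linarith
 qed
 have \<gamma>1: "1 / 2 <= \<gamma> k" "\<gamma> k <= 1" if "k \<in> {1..a}" for k using kt[OF that] t by (auto simp: \<gamma>_def)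
 have F_cont: "continuous_on UNIV ((fdiff (\<delta> k) ^^ i) (steklov n (\<delta> k) h))" if "k \<in> {1..a}" for k i n
 using \<delta>0[OF that] by (intro fdiff_funpow_continuous steklov_continuous c) auto
 have prim: "is_prim (f i) (f (Suc i))" if i: "i < a" for i
 proof (rule is_prim_of_deriv)
 show "continuous_on UNIV (f (Suc i))" unfolding f_def[abs_def] by (intro continuous_intros continuous_on_compose2[OF F_cont]) auto
 fix y
 have "((%x. \<sigma> k * ((\<gamma> k / \<delta> k) ^ i * (fdiff (\<delta> k) ^^ i) (steklov (a - i) (\<delta> k) h) (\<gamma> k * x))) has_real_derivative
  \<sigma> k * ((\<gamma> k / \<delta> k) ^ Suc i * (fdiff (\<delta> k) ^^ Suc i) (steklov (a - Suc i) (\<delta> k) h) (\<gamma> k * y))) (at y)"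
  if k: "k \<in> {1..a}" for k
 proof -
  let ?S = "steklov (a - Suc i) (\<delta> k) h"
  have eq: "a - i = Suc (a - Suc i)" using i by simp
  have "(steklov (a - i) (\<delta> k) h has_real_derivative fdiff (\<delta> k) ?S z / \<delta> k) (at z)" for z
  unfolding eq steklov.simps using \<delta>0[OF k] by (intro average_deriv steklov_continuous c) auto
  then have "((fdiff (\<delta> k) ^^ i) (steklov (a - i) (\<delta> k) h) has_real_derivative
   (fdiff (\<delta> k) ^^ i) (%z. fdiff (\<delta> k) ?S z / \<delta> k) z) (at z)" for z by (rule fdiff_funpow_deriv)
  moreover have "(fdiff (\<delta> k) ^^ i) (%z. fdiff (\<delta> k) ?S z / \<delta> k) = (%z. (fdiff (\<delta> k) ^^ Suc i) ?S z / \<delta> k)"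
  unfolding fdiff_funpow_scale funpow_Suc_right o_apply by simp
  ultimately have D: "((fdiff (\<delta> k) ^^ i) (steklov (a - i) (\<delta> k) h) has_real_derivative
   (fdiff (\<delta> k) ^^ Suc i) ?S z / \<delta> k) (at z)" for z by simp
  have "((%x. (fdiff (\<delta> k) ^^ i) (steklov (a - i) (\<delta> k) h) (\<gamma> k * x)) has_real_derivative
   (fdiff (\<delta> k) ^^ Suc i) ?S (\<gamma> k * y) / \<delta> k * \<gamma> k) (at y)" by (rule DERIV_chain2[OF D]) (auto intro!: derivative_eq_intros)
  from DERIV_cmult[OF DERIV_cmult[OF this, of "(\<gamma> k / \<delta> k) ^ i"], of "\<sigma> k"]
  show ?thesis by (simp add: mult_ac del: funpow.simps)
 qed
 then show "(f i has_real_derivative f (Suc i) y) (at y)" unfolding f_def[abs_def] by (intro DERIV_sum) auto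
 qed
 have fa_cont: "continuous_on UNIV (f a)" unfolding f_def[abs_def] by (intro continuous_intros continuous_on_compose2[OF F_cont]) auto
 have bfa: "bmeas (f a)" by (rule bmeas_continuous_on[OF continuous_on_subset[OF fa_cont]]) simp
 have f0_cont: "continuous_on UNIV (f 0)" unfolding f_def[abs_def] by (intro continuous_intros continuous_on_compose2[OF F_cont]) auto
 define \<zeta> where "\<zeta> x u = t * (u / real a - x)" for x u
 have m\<phi>: "(%u. (fdiff (\<zeta> x u) ^^ a) h x) \<in> borel_measurable borel" for x
 using measurable_compose[OF measurable_Pair[OF measurable_const, of x borel "\<zeta> x" borel borel]
  fdiff_funpow_joint_measurable[OF hm, of a]] by (simp add: \<zeta>_def[abs_def])
 \<comment> \<open>the term \<open>k = 0\<close> of the difference is \<open>h x\<close> itself, the others make up \<open>f 0\<close>\<close>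
 have err: "h x - f 0 x = (\<integral>u. bspline a u * ((-1) ^ a * (fdiff (\<zeta> x u) ^^ a) h x) \<partial>lborel)" for x
 proof -
 have iN: "integrable lborel (%u. bspline a u * h (y + e * u))" for y e
 proof (rule lint_bound[of _ "%u. B * bspline a u"])
  note [measurable] = bspline_measurable[OF a]
  show "(%u. bspline a u * h (y + e * u)) \<in> borel_measurable lborel" by measurable
  have B0: "0 <= B" using b[of 0] by linarith
  show "AE u in lborel. norm (bspline a u * h (y + e * u)) <= norm (B * bspline a u)"
  using b B0 by (intro AE_I2) (simp add: abs_mult mult.commute[of B] mult_left_mono)
 qed (intro integrable_mult_right bspline_integrable a)
 have "f 0 x = (\<Sum>k\<in>{1..a}. \<sigma> k * (\<integral>u. bspline a u * h (\<gamma> k * x + \<delta> k * u) \<partial>lborel))" unfolding f_def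
  by (intro sum.cong refl) (use \<delta>0 in \<open>auto simp: steklov_bspline[OF c b _ a] less_imp_neq[THEN not_sym]\<close>)
 also have "... = (\<integral>u. (\<Sum>k\<in>{1..a}. \<sigma> k * (bspline a u * h (\<gamma> k * x + \<delta> k * u))) \<partial>lborel)"
  by (subst lint_sum) (auto intro!: integrable_mult_right iN)
 finally have "h x - f 0 x = (\<integral>u. bspline a u * h x \<partial>lborel)
  - (\<integral>u. (\<Sum>k\<in>{1..a}. \<sigma> k * (bspline a u * h (\<gamma> k * x + \<delta> k * u))) \<partial>lborel)"
  by (simp add: bspline_mass[OF a])
 also have "... = (\<integral>u. bspline a u * h x - (\<Sum>k\<in>{1..a}. \<sigma> k * (bspline a u * h (\<gamma> k * x + \<delta> k * u))) \<partial>lborel)"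
  by (rule lint_diff[symmetric])
  (intro integrable_mult_left bspline_integrable a lint_summable integrable_mult_right iN)+
 also have "... = (\<integral>u. bspline a u * ((-1) ^ a * (fdiff (\<zeta> x u) ^^ a) h x) \<partial>lborel)"
 proof (rule lint_cong[OF refl])
  fix u
  have node: "\<gamma> k * x + \<delta> k * u = x + real k * \<zeta> x u" for k by (simp add: \<gamma>_def \<delta>_def \<zeta>_def algebra_simps)
  have "(-1) ^ a * (fdiff (\<zeta> x u) ^^ a) h x = (\<Sum>k\<le>a. (-1) ^ k * real (a choose k) * h (x + real k * \<zeta> x u))"
  unfolding fdiff_funpow_eq sum_distrib_left
  proof (intro sum.cong refl)
  fix k assume "k \<in> {..a}"
  then have "(-1) ^ a * (-1) ^ (a - k) = ((-1) ^ k :: real)"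
   by (metis (no_types) atMost_iff le_add_diff_inverse minus_one_mult_self mult.assoc mult.right_neutral power_add)
  then show "(-1) ^ a * ((-1) ^ (a - k) * real (a choose k) * h (x + real k * \<zeta> x u))
    = (-1) ^ k * real (a choose k) * h (x + real k * \<zeta> x u)" by (simp flip: mult.assoc)
  qed
  also have "... = h x - (\<Sum>k\<in>{1..a}. \<sigma> k * h (\<gamma> k * x + \<delta> k * u))"
  proof -
  have "{..a} = insert 0 {1..a}" by auto
  then show ?thesis by (simp add: node \<sigma>_def sum_negf)
  qed
  finally show "bspline a u * h x - (\<Sum>k\<in>{1..a}. \<sigma> k * (bspline a u * h (\<gamma> k * x + \<delta> k * u)))
   = bspline a u * ((-1) ^ a * (fdiff (\<zeta> x u) ^^ a) h x)" by (simp add: right_diff_distrib sum_distrib_left mult_ac)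
 qed
 finally show ?thesis .
 qed
 have bnd: "\<bar>(-1) ^ a * (fdiff z ^^ a) h x\<bar> <= 2 ^ a * B" for z x using fdiff_funpow_abs_le[of h B a z x, OF b] by (simp add: abs_mult power_abs)
 have "(\<integral>\<^sup>+x. ennreal ((h x - f 0 x)^2) \<partial>lborel01) <= ennreal (2 * real a * (L * t powr (2 * \<tau>)))"
 proof -
 have "(\<integral>\<^sup>+x. ennreal ((h x - f 0 x)^2) \<partial>lborel01) = (\<integral>\<^sup>+x. indicator {0..1} x * ennreal ((h x - f 0 x)^2) \<partial>lborel)"
  by (subst nn_integral_restrict_space) (auto simp: mult.commute)
 also have "... <= (\<integral>\<^sup>+x. indicator {0..1} x *
  (\<integral>\<^sup>+u. indicator {0..real a} u * ennreal (((fdiff (t * (u / real a - x)) ^^ a) h x)^2) \<partial>lborel) \<partial>lborel)"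
 proof (intro nn_integral_mono mult_left_mono)
  fix x :: real
  let ?\<phi> = "%u. (-1) ^ a * (fdiff (\<zeta> x u) ^^ a) h x"
  have "(h x - f 0 x)^2 <= (\<integral>u. indicator {0..real a} u * (?\<phi> u)^2 \<partial>lborel)"
  unfolding err by (rule bspline_jensen_square[OF a _ bnd]) (intro borel_measurable_times m\<phi>, simp)
  also have "... = (\<integral>u. indicator {0..real a} u * ((fdiff (\<zeta> x u) ^^ a) h x)^2 \<partial>lborel)"
  by (simp add: power_mult_distrib flip: power_mult)
  finally have "ennreal ((h x - f 0 x)^2) <= ennreal (\<integral>u. indicator {0..real a} u * ((fdiff (\<zeta> x u) ^^ a) h x)^2 \<partial>lborel)"
  by (rule ennreal_leI)
  also have "... = (\<integral>\<^sup>+u. ennreal (indicator {0..real a} u * ((fdiff (\<zeta> x u) ^^ a) h x)^2) \<partial>lborel)"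
  proof (rule nn_integral_eq_integral[symmetric])
  show "integrable lborel (%u. indicator {0..real a} u * ((fdiff (\<zeta> x u) ^^ a) h x)^2)"
  proof (rule lint_bound[of _ "%u. (2 ^ a * B)\<^sup>2 * indicator {0..real a} u"])
   show "(%u. indicator {0..real a} u * ((fdiff (\<zeta> x u) ^^ a) h x)^2) \<in> borel_measurable lborel"
    using m\<phi>[of x] by (auto intro!: borel_measurable_times borel_measurable_power)
   have "((fdiff (\<zeta> x u) ^^ a) h x)^2 <= (2 ^ a * B)^2" for u
    using power_mono[OF fdiff_funpow_abs_le[of h B a "\<zeta> x u" x, OF b] abs_ge_zero, of 2] by simp
   then show "AE u in lborel. norm (indicator {0..real a} u * ((fdiff (\<zeta> x u) ^^ a) h x)^2)
    <= norm ((2 ^ a * B)^2 * indicator {0..real a} u)" by (intro AE_I2) (simp split: split_indicator)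
  qed (intro integrable_mult_right, simp)
  qed simp
  also have "... = (\<integral>\<^sup>+u. indicator {0..real a} u * ennreal (((fdiff (t * (u / real a - x)) ^^ a) h x)^2) \<partial>lborel)"
  by (intro nn_integral_cong) (simp add: \<zeta>_def split: split_indicator)
  finally show "ennreal ((h x - f 0 x)^2)
   <= (\<integral>\<^sup>+u. indicator {0..real a} u * ennreal (((fdiff (t * (u / real a - x)) ^^ a) h x)^2) \<partial>lborel)" .
 qed simp
 also have "... <= ennreal (2 * real a * (L * t powr (2 * \<tau>)))" by (rule averaged_difference_bound[OF c b a t \<tau> L H])
 finally show ?thesis .
 qed
 moreover have "(\<integral>\<^sup>+x. ennreal ((h x - f 0 x)^2) \<partial>lborel01) = ennreal (sq (%x. h x - f 0 x))" unfolding sq_def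
 by (intro nn_integral_eq_integral bmeas_integrable bmeas_power2 bmeas_diff
  bmeas_continuous_on[OF continuous_on_subset[OF c]] bmeas_continuous_on[OF continuous_on_subset[OF f0_cont]]) auto
 ultimately have 1: "sq (%x. h x - f 0 x) <= 2 * real a * (L * t powr (2 * \<tau>))" using L by (simp add: ennreal_le_iff)
 have "sq (f a) <= real (card {1..a}) * (\<Sum>k\<in>{1..a}. sq (%x. \<sigma> k * ((\<gamma> k / \<delta> k) ^ a * (fdiff (\<delta> k) ^^ a) h (\<gamma> k * x))))"
 proof -
 have "f a = (%x. \<Sum>k\<in>{1..a}. \<sigma> k * ((\<gamma> k / \<delta> k) ^ a * (fdiff (\<delta> k) ^^ a) h (\<gamma> k * x)))"
  by (simp add: f_def fun_eq_iff)
 moreover have "bmeas (%x. \<sigma> k * ((\<gamma> k / \<delta> k) ^ a * (fdiff (\<delta> k) ^^ a) h (\<gamma> k * x)))" for k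
  by (intro bmeas_continuous_on continuous_intros continuous_on_compose2[OF fdiff_funpow_continuous[OF c]]) auto
 ultimately show ?thesis using sq_sum_le[of "{1..a}"] by simp
 qed
 also have "... <= real (card {1..a}) * (\<Sum>k\<in>{1..a}. 4 ^ a * ((real a / t) ^ (2 * a) * (2 * (L * t powr (2 * \<tau>)))))"
 proof (intro mult_left_mono sum_mono)
 fix k assume k: "k \<in> {1..a}"
 have s2: "(\<sigma> k)^2 <= 4 ^ a"
 proof -
  have "real (a choose k) <= real (\<Sum>k\<le>a. a choose k)" unfolding of_nat_le_iff by (rule member_le_sum) (use k in auto)
  then have "real (a choose k) <= 2 ^ a" by (simp add: choose_row_sum)
  then have "(real (a choose k))^2 <= (2 ^ a)^2" by (intro power_mono) auto
  also have "((2::real) ^ a)^2 = 4 ^ a" by (simp add: power2_eq_square flip: power_mult_distrib)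
  finally show ?thesis by (simp add: \<sigma>_def power_mult_distrib flip: power_mult)
 qed
 have ratio: "((\<gamma> k / \<delta> k) ^ a)^2 <= (real a / t) ^ (2 * a)"
 proof -
  have "t * 1 <= t * real k" using k t by (intro mult_left_mono) auto
  then have "\<gamma> k / \<delta> k <= 1 / (t / real a)" using \<gamma>1[OF k] \<delta>0[OF k] t a
  by (intro frac_le) (auto simp: \<delta>_def divide_right_mono mult.commute)
  then have "\<gamma> k / \<delta> k <= real a / t" by simp
  then have "(\<gamma> k / \<delta> k) ^ (2 * a) <= (real a / t) ^ (2 * a)" using \<gamma>1[OF k] \<delta>0[OF k] by (intro power_mono) auto
  then show ?thesis by (simp add: power_mult[symmetric] mult.commute)
 qed
 have "sq (%x. (fdiff (\<delta> k) ^^ a) h (\<gamma> k * x)) <= 2 * sq (iter_diff a (\<delta> k) h)"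
 proof (rule sq_dilation_le[OF _ \<gamma>1[OF k]])
  show "(fdiff (\<delta> k) ^^ a) h \<in> borel_measurable borel" by (intro meas_contI fdiff_funpow_continuous c)
  show "\<bar>(fdiff (\<delta> k) ^^ a) h x\<bar> <= 2 ^ a * B" for x by (rule fdiff_funpow_abs_le[OF b])
  show "bmeas (iter_diff a (\<delta> k) h)" by (rule bmeas_iter_diff[OF c b])
  show "\<bar>(fdiff (\<delta> k) ^^ a) h y\<bar> <= \<bar>iter_diff a (\<delta> k) h y\<bar>" if "0 <= y" "y <= \<gamma> k" for y
  proof -
  have "y + real a * \<delta> k <= 1" using that a by (simp add: \<delta>_def \<gamma>_def)
  moreover have "0 <= y + real a * \<delta> k" "y <= 1" using that \<delta>0[OF k] \<gamma>1[OF k] by auto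
  ultimately show ?thesis using that by (simp add: iter_diff_def)
  qed
 qed
 also have "... <= 2 * (L * t powr (2 * \<tau>))"
 proof -
  have "\<delta> k <= t" using k a t by (auto simp: \<delta>_def divide_le_eq mult.commute[of t])
  moreover have "t < 1" using t a mult_right_mono[of 1 "real a" t] by linarith
  ultimately have "sq (iter_diff a (\<delta> k) h) <= L * \<bar>\<delta> k\<bar> powr (2 * \<tau>)" using \<delta>0[OF k] by (intro H) auto
  also have "... <= L * t powr (2 * \<tau>)" using \<delta>0[OF k] \<open>\<delta> k <= t\<close> L \<tau> by (intro mult_left_mono powr_mono2) auto
  finally show ?thesis by simp
 qed
 finally have d: "sq (%x. (fdiff (\<delta> k) ^^ a) h (\<gamma> k * x)) <= 2 * (L * t powr (2 * \<tau>))" .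
 show "sq (%x. \<sigma> k * ((\<gamma> k / \<delta> k) ^ a * (fdiff (\<delta> k) ^^ a) h (\<gamma> k * x)))
  <= 4 ^ a * ((real a / t) ^ (2 * a) * (2 * (L * t powr (2 * \<tau>))))" unfolding sq_cmult by (intro mult_mono s2 ratio d) (use t in auto)
 qed simp
 also have "... = 2 * (real a)^2 * 4 ^ a * (real a / t) ^ (2 * a) * (L * t powr (2 * \<tau>))" by (simp add: power2_eq_square mult_ac)
 finally have 2: "sq (f a) <= 2 * (real a)^2 * 4 ^ a * (real a / t) ^ (2 * a) * (L * t powr (2 * \<tau>))" .
 have 3: "\<bar>h x - f 0 x\<bar> <= 2 ^ a * e"
 if e: "!!x y. \<bar>x - y\<bar> <= real a * t ==> \<bar>h x - h y\<bar> <= e" and x: "x \<in> {0..1}" for e x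
 proof -
 let ?\<phi> = "%u. (-1) ^ a * (fdiff (\<zeta> x u) ^^ a) h x"
 have e0: "0 <= e" using e[of 0 0] t by simp
 have "\<bar>bspline a u * ?\<phi> u\<bar> <= bspline a u * (2 ^ a * e)" for u
 proof (cases "bspline a u = 0")
  case False
  then have u: "0 <= u" "u < real a" using bspline_support[OF a, of u] by force+
  have "0 <= u / real a" "u / real a <= 1" using u a by simp_all
  then have "\<bar>u / real a - x\<bar> <= 1" using x unfolding atLeastAtMost_iff by linarith
  then have z: "\<bar>\<zeta> x u\<bar> <= t" using t by (simp add: \<zeta>_def abs_mult mult_left_le)
  have "\<bar>(fdiff (\<zeta> x u) ^^ a) h x\<bar> <= 2 ^ a * e"
  proof (rule fdiff_funpow_modulus[OF a])
  fix k assume "k <= a"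
  then have "real k * \<bar>\<zeta> x u\<bar> <= real a * t" using z by (intro mult_mono) auto
  then show "\<bar>h (x + real k * \<zeta> x u) - h x\<bar> <= e" by (intro e) (simp add: abs_mult)
  qed
  then show ?thesis by (simp add: abs_mult power_abs bspline_nonneg[OF a] mult_left_mono)
 qed simp
 then have "\<bar>\<integral>u. bspline a u * ?\<phi> u \<partial>lborel\<bar> <= (\<integral>u. bspline a u * (2 ^ a * e) \<partial>lborel)"
  by (intro order_trans[OF integral_abs_bound] integral_mono_AE' integrable_mult_left bspline_integrable a)
  (auto simp: e0 bspline_nonneg[OF a])
 then show ?thesis unfolding err by (simp add: bspline_mass[OF a])
 qed
 show ?thesis by (rule exI[of _ f]) (use prim bfa 1 2 3 in blast)
qed

text \<open>Jackson's inequality: smooth on the scale of one cell, then approximate the smooth function.\<close>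

lemma jackson:
 assumes c: "continuous_on UNIV h" and b: "!!x. \<bar>h x\<bar> <= B" and a: "1 <= a" "a <= r" and \<tau>: "0 <= \<tau>" and L: "0 <= L"
 and H: "!!z. z ~= 0 ==> \<bar>z\<bar> < 1 ==> sq (iter_diff a z h) <= L * \<bar>z\<bar> powr (2 * \<tau>)"
 obtains C where "0 <= C"
 "!!j e. (!!x y. \<bar>x - y\<bar> <= 1 / 2 ^ j ==> \<bar>h x - h y\<bar> <= e) ==>
  \<exists>s\<in>spline_space r j. sq (%x. h x - s x) <= C * (2 ^ j) powr (- 2 * \<tau>)
  & (2 <= r --> (\<forall>x\<in>{0..1}. (h x - s x)\<^sup>2 <= C * (2 ^ j * (2 ^ j) powr (- 2 * \<tau>)) + 2 * (2 ^ a * e)^2))"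
proof -
 have a0: "0 < real a" using a by simp
 define T where "T = (1 / (2 * real a)) powr (2 * \<tau>)"
 define E where "E = 2 * (real a)^2 * 4 ^ a * (2 * (real a)^2) ^ (2 * a) * (L * T)"
 define C1 where "C1 = 2 * (2 * real a * (L * T)) + 2 * ((4 * (real r)^2) ^ a * E)"
 define C2 where "C2 = 2 * (2 * real r * (4 * (real r)^2) ^ (a - 1) * E)"
 have nn: "0 <= T" "0 <= E" "0 <= C1" "0 <= C2" using L by (auto simp: T_def E_def C1_def C2_def intro!: add_nonneg_nonneg mult_nonneg_nonneg)
 show ?thesis
 proof (rule that[of "C1 + C2"])
 show "0 <= C1 + C2" using nn by simp
 fix j e assume e: "!!x y. \<bar>x - y\<bar> <= 1 / 2 ^ j ==> \<bar>h x - h y\<bar> <= e"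
 define t where "t = 1 / (2 * real a) / 2 ^ j"
 have t0: "0 < t" using a0 by (simp add: t_def)
 have at: "real a * t = 1 / 2 / 2 ^ j" using a0 by (simp add: t_def)
 have "1 / 2 / 2 ^ j <= (1 / 2 :: real)" by (simp add: divide_le_eq)
 then have t1: "real a * t <= 1 / 2" using at by simp
 have t2: "real a * t <= 1 / 2 ^ j" unfolding at by (rule divide_right_mono) auto
 have tp: "t powr (2 * \<tau>) = T * (2 ^ j) powr (- 2 * \<tau>)" using a0 unfolding t_def T_def by (subst powr_divide) (simp_all add: powr_minus_divide)
 obtain f where prim: "!!i. i < a ==> is_prim (f i) (f (Suc i))" and bfa: "bmeas (f a)"
  and f1: "sq (%x. h x - f 0 x) <= 2 * real a * (L * t powr (2 * \<tau>))"
  and f2: "sq (f a) <= 2 * (real a)^2 * 4 ^ a * (real a / t) ^ (2 * a) * (L * t powr (2 * \<tau>))"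
  and f3: "!!e. (!!x y. \<bar>x - y\<bar> <= real a * t ==> \<bar>h x - h y\<bar> <= e) ==> (\<forall>x\<in>{0..1}. \<bar>h x - f 0 x\<bar> <= 2 ^ a * e)"
  using smooth_approximant[OF c b a(1) t0 t1 \<tau> L H] by blast
 let ?P = "(2 ^ j) powr (- 2 * \<tau>)"
 have four: "(4::real) ^ j = 2 ^ j * 2 ^ j" by (simp flip: power_mult_distrib)
 have rt: "real a / t = 2 * (real a)^2 * 2 ^ j" using a0 by (simp add: t_def power2_eq_square)
 have "((2::real) ^ j) ^ (2 * a) = (4 ^ j) ^ a" unfolding power_mult power2_eq_square four ..
 then have pw: "(real a / t) ^ (2 * a) = (2 * (real a)^2) ^ (2 * a) * (4 ^ j) ^ a" unfolding rt power_mult_distrib[of "2 * (real a)^2"] by (simp only:)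
 have fa: "sq (f a) <= E * (4 ^ j) ^ a * ?P" using f2 unfolding E_def tp pw by (simp only: mult.assoc mult.left_commute mult.commute)
 obtain s where s: "s \<in> spline_space r j" and s1: "sq (%x. f 0 x - s x) <= (4 * (real r)^2 / 4 ^ j) ^ a * sq (f a)"
  and s2: "2 <= r --> (\<forall>x\<in>{0..1}. (f 0 x - s x)\<^sup>2 <= 2 * real r / 2 ^ j * (4 * (real r)^2 / 4 ^ j) ^ (a - 1) * sq (f a))"
  using jackson_chain[OF a prim bfa, of j] by blast
 have "(4 * (real r)^2 / 4 ^ j) ^ a * sq (f a) <= (4 * (real r)^2 / 4 ^ j) ^ a * (E * (4 ^ j) ^ a * ?P)" by (intro mult_left_mono fa) auto
 also have "... = (4 * (real r)^2) ^ a * E * ?P" by (simp add: power_divide)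
 finally have s1': "sq (%x. f 0 x - s x) <= (4 * (real r)^2) ^ a * E * ?P" using s1 by linarith
 have bf0: "bmeas (f 0)"
 proof -
  obtain q where q: "a = Suc q" using a by (cases a) auto
  have "i <= a ==> bmeas (f (a - i))" for i
  proof (induction i)
  case (Suc i)
  then have "is_prim (f (a - Suc i)) (f (a - i))" using prim[of "a - Suc i"] by (simp add: Suc_diff_Suc)
  then show ?case using Suc is_prim_bmeas(2) by auto
  qed (use bfa in simp)
  from this[of a] show ?thesis by simp
 qed
 have bh: "bmeas h" by (rule bmeas_continuous_on[OF continuous_on_subset[OF c]]) simp
 have bs: "bmeas s" by (rule bmeas_spline_space[OF _ s]) (use a in simp)
 have "sq (%x. h x - s x) = sq (%x. (h x - f 0 x) + (f 0 x - s x))" by simp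
 also have "... <= 2 * sq (%x. h x - f 0 x) + 2 * sq (%x. f 0 x - s x)" by (intro sq_add_le bmeas_diff bh bf0 bs)
 also have "... <= 2 * (2 * real a * (L * (T * ?P))) + 2 * ((4 * (real r)^2) ^ a * E * ?P)" using f1 s1' unfolding tp by linarith
 also have "... = C1 * ?P" by (simp add: C1_def algebra_simps)
 also have "... <= (C1 + C2) * ?P" using nn by (intro mult_right_mono) auto
 finally have A: "sq (%x. h x - s x) <= (C1 + C2) * ?P" .
 have Bd: "(h x - s x)^2 <= (C1 + C2) * (2 ^ j * ?P) + 2 * (2 ^ a * e)^2" if r: "2 <= r" and x: "x \<in> {0..1}" for x
 proof -
  have "\<bar>h x - f 0 x\<bar> <= 2 ^ a * e" using f3[of e] e t2 x by (meson order_trans)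
  then have h1: "(h x - f 0 x)^2 <= (2 ^ a * e)^2" using power_mono[of "\<bar>h x - f 0 x\<bar>" "2 ^ a * e" 2] by simp
  have "(f 0 x - s x)^2 <= 2 * real r / 2 ^ j * (4 * (real r)^2 / 4 ^ j) ^ (a - 1) * sq (f a)" using s2 r x by blast
  also have "... <= 2 * real r / 2 ^ j * (4 * (real r)^2 / 4 ^ j) ^ (a - 1) * (E * (4 ^ j) ^ a * ?P)" by (intro mult_left_mono fa) auto
  also have "... = 2 * real r * (4 * (real r)^2) ^ (a - 1) * E * (2 ^ j * ?P)"
  proof -
  have "((4::real) ^ j) ^ a = (4 ^ j) ^ (a - 1) * (2 ^ j * 2 ^ j)" using a by (cases a) (simp_all add: four)
  then show ?thesis by (simp add: power_divide)
  qed
  finally have "2 * (f 0 x - s x)^2 <= 2 * (2 * real r * (4 * (real r)^2) ^ (a - 1) * E * (2 ^ j * ?P))" by (rule mult_left_mono) simp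
  then have "2 * (f 0 x - s x)^2 <= C2 * (2 ^ j * ?P)" unfolding C2_def by (simp only: mult.assoc)
  moreover have "(h x - s x)^2 <= 2 * (h x - f 0 x)^2 + 2 * (f 0 x - s x)^2" using sum_sq_le[of "h x - f 0 x" "f 0 x - s x"] by simp
  moreover have "C2 * (2 ^ j * ?P) <= (C1 + C2) * (2 ^ j * ?P)" using nn by (intro mult_right_mono) auto
  ultimately show ?thesis using h1 by linarith
 qed
 show "\<exists>s\<in>spline_space r j. sq (%x. h x - s x) <= (C1 + C2) * ?P
  & (2 <= r --> (\<forall>x\<in>{0..1}. (h x - s x)\<^sup>2 <= (C1 + C2) * (2 ^ j * ?P) + 2 * (2 ^ a * e)^2))" using A Bd s by blast
 qed
qed

definition clamp01 :: "(real => real) => real => real" where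
 "clamp01 h x = h (max 0 (min 1 x))"

lemma clamp01_eq: "x \<in> {0..1} ==> clamp01 h x = h x" by (simp add: clamp01_def)

lemma clamp01_continuous: "continuous_on {0..1} h ==> continuous_on UNIV (clamp01 h)" unfolding clamp01_def[abs_def]
 by (rule continuous_on_compose2[of "{0..1}" h]) (auto intro!: continuous_intros)

lemma clamp01_bounded:
 assumes "continuous_on {0..1} h" obtains B where "!!x. \<bar>clamp01 h x\<bar> <= B"
proof -
 obtain B where "\<forall>x\<in>{0..1}. \<bar>h x\<bar> <= B" using bmeas_continuous_on[OF assms] unfolding bmeas_def by blast
 then show ?thesis by (intro that[of B]) (simp add: clamp01_def)
qed

lemma iter_diff_cong:
 assumes "!!x. x \<in> {0..1} ==> g x = h x" shows "iter_diff a z g = iter_diff a z h"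
proof
 fix x
 show "iter_diff a z g x = iter_diff a z h x"
 proof (cases "x \<in> {0..1} & x + real a * z \<in> {0..1}")
 case True
 have "x + real k * z \<in> {0..1}" if "k <= a" for k
 proof (cases "0 <= z")
  case z: True
  have "0 <= real k * z" "real k * z <= real a * z" using that z by (auto intro: mult_right_mono)
  then show ?thesis using True unfolding atLeastAtMost_iff by linarith
 next
  case z: False
  have "real k * z <= 0" "real a * z <= real k * z" using that z by (auto simp: mult_le_0_iff intro: mult_right_mono_neg)
  then show ?thesis using True unfolding atLeastAtMost_iff by linarith
 qed
 then have "(fdiff z ^^ a) g x = (fdiff z ^^ a) h x" unfolding fdiff_funpow_eq by (intro sum.cong refl) (use assms in auto)
 then show ?thesis by (simp only: iter_diff_def)
 qed (simp only: iter_diff_def if_False)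
qed

lemma clamp01_modulus:
 assumes "continuous_on {0..1} h" "0 < e"
 obtains d where "0 < d" "!!x y. \<bar>x - y\<bar> <= d ==> \<bar>clamp01 h x - clamp01 h y\<bar> <= e"
proof -
 have "uniformly_continuous_on {0..1} h" by (rule compact_uniformly_continuous[OF assms(1)]) simp
 then obtain d where d: "0 < d" "!!x y. x \<in> {0..1} ==> y \<in> {0..1} ==> dist y x < d ==> dist (h y) (h x) < e"
 unfolding uniformly_continuous_on_def using assms(2) by metis
 have "\<bar>clamp01 h x - clamp01 h y\<bar> <= e" if "\<bar>x - y\<bar> <= d / 2" for x y
 proof -
 have "\<bar>max 0 (min 1 x) - max 0 (min 1 y)\<bar> <= \<bar>x - y\<bar>" by (simp add: max_def min_def)
 then have "dist (max 0 (min 1 x)) (max 0 (min 1 y)) < d" using that d(1) unfolding dist_real_def by linarith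
 then have "dist (h (max 0 (min 1 x))) (h (max 0 (min 1 y))) < e" by (intro d(2)) auto
 then show ?thesis by (simp add: clamp01_def dist_real_def)
 qed
 then show ?thesis using d(1) by (intro that[of "d / 2"]) auto
qed

text \<open>A spline close to \<open>h\<close> in both norms differs from the projection by a spline with a small \<open>L\<^sup>2\<close>
 norm, and on splines the two norms are within a factor of \<open>2 powr (j / 2)\<close>.\<close>

lemma spline_proj_rates:
 assumes h: "continuous_on {0..1} h" and r: "2 <= r" and a: "1 <= a" "a <= r" and \<tau>: "0 <= \<tau>" and L: "0 <= L"
 and H: "!!z. z ~= 0 ==> \<bar>z\<bar> < 1 ==> sq (iter_diff a z h) <= L * \<bar>z\<bar> powr (2 * \<tau>)"
 shows "\<exists>C\<ge>0. \<forall>j. sq (%x. h x - spline_proj r j h x) <= C * (2 ^ j) powr (- 2 * \<tau>)"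
 and "1 / 2 < \<tau> ==> 0 < e ==> \<forall>\<^sub>F j in sequentially. \<forall>x\<in>{0..1}. \<bar>h x - spline_proj r j h x\<bar> <= e"
proof -
 let ?h = "clamp01 h"
 have eq: "?h x = h x" if "x \<in> {0..1}" for x using that by (rule clamp01_eq)
 obtain B where B: "!!x. \<bar>?h x\<bar> <= B" by (rule clamp01_bounded[OF h]) (rule that)
 have c: "continuous_on UNIV ?h" by (rule clamp01_continuous[OF h])
 have "iter_diff a z ?h = iter_diff a z h" for z by (rule iter_diff_cong[OF eq])
 then have H': "!!z. z ~= 0 ==> \<bar>z\<bar> < 1 ==> sq (iter_diff a z ?h) <= L * \<bar>z\<bar> powr (2 * \<tau>)" using H by simp
 have r1: "1 <= r" using r by simp
 have bh: "bmeas h" by (rule bmeas_continuous_on[OF h])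
 obtain C where C: "0 <= C"
 "!!j e. (!!x y. \<bar>x - y\<bar> <= 1 / 2 ^ j ==> \<bar>?h x - ?h y\<bar> <= e) ==>
  \<exists>s\<in>spline_space r j. sq (%x. ?h x - s x) <= C * (2 ^ j) powr (- 2 * \<tau>)
  & (2 <= r --> (\<forall>x\<in>{0..1}. (?h x - s x)\<^sup>2 <= C * (2 ^ j * (2 ^ j) powr (- 2 * \<tau>)) + 2 * (2 ^ a * e)^2))"
 by (rule jackson[OF c B a \<tau> L H']) (auto intro: that)
 have sq_eq: "sq (%x. ?h x - s x) = sq (%x. h x - s x)" for s by (rule sq_cong) (simp add: eq)
 have J: "\<exists>s\<in>spline_space r j. sq (%x. h x - s x) <= C * (2 ^ j) powr (- 2 * \<tau>)
  & (\<forall>x\<in>{0..1}. (h x - s x)\<^sup>2 <= C * (2 ^ j * (2 ^ j) powr (- 2 * \<tau>)) + 2 * (2 ^ a * e)^2)"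
 if "!!x y. \<bar>x - y\<bar> <= 1 / 2 ^ j ==> \<bar>?h x - ?h y\<bar> <= e" for j e using C(2)[OF that] r by (simp add: sq_eq eq)
 have "sq (%x. h x - spline_proj r j h x) <= C * (2 ^ j) powr (- 2 * \<tau>)" for j
 proof -
 have "\<bar>?h x - ?h y\<bar> <= 2 * B" for x y using B[of x] B[of y] by linarith
 then obtain s where s: "s \<in> spline_space r j" "sq (%x. h x - s x) <= C * (2 ^ j) powr (- 2 * \<tau>)" using J[of j "2 * B"] by blast
 show ?thesis using spline_proj_best(1)[OF r1 bh s(1)] s(2) by linarith
 qed
 then show "\<exists>C\<ge>0. \<forall>j. sq (%x. h x - spline_proj r j h x) <= C * (2 ^ j) powr (- 2 * \<tau>)" using C(1) by blast
 assume t: "1 / 2 < \<tau>" and e: "0 < e"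
 define e1 where "e1 = e / (4 * 2 ^ a)"
 have e1: "0 < e1" using e by (simp add: e1_def)
 obtain d where d: "0 < d" "!!x y. \<bar>x - y\<bar> <= d ==> \<bar>?h x - ?h y\<bar> <= e1" by (rule clamp01_modulus[OF h e1]) (rule that)
 obtain N where N: "0 < N" "!!j s x. s \<in> spline_space r j ==> x \<in> {0..1} ==> (s x)^2 <= N * 2 ^ j * sq s" by (rule spline_sup_le[OF r]) (rule that)
 have lim0: "(%j. (2 ^ j :: real) * (2 ^ j) powr (- 2 * \<tau>)) ---> 0"
 proof -
 have "(2 ^ j :: real) * (2 ^ j) powr (- 2 * \<tau>) = (2 powr (1 - 2 * \<tau>)) ^ j" for j
 proof -
  have "(2 ^ j :: real) = 2 powr real j" by (simp add: powr_realpow)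
  then show ?thesis by (simp add: powr_powr powr_add[symmetric] powr_realpow[symmetric] algebra_simps)
 qed
 moreover have "2 powr (1 - 2 * \<tau>) < (1::real)" using powr_less_mono[of "1 - 2 * \<tau>" 0 "2::real"] t by simp
 ultimately show ?thesis by (simp add: LIMSEQ_realpow_zero)
 qed
 have ev1: "\<forall>\<^sub>F j in sequentially. (2 * C + 2 * (N * C)) * ((2 ^ j :: real) * (2 ^ j) powr (- 2 * \<tau>)) < e^2 / 2"
 proof -
 have "(%j. (2 * C + 2 * (N * C)) * ((2 ^ j :: real) * (2 ^ j) powr (- 2 * \<tau>))) ---> (2 * C + 2 * (N * C)) * 0"
  by (intro tendsto_mult tendsto_const lim0)
 then show ?thesis by (rule order_tendstoD) (use e in simp)
 qed
 have ev2: "\<forall>\<^sub>F j in sequentially. 1 / 2 ^ j < d"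
 proof -
 have "(%j. 1 / 2 ^ j :: real) ---> 0" using LIMSEQ_realpow_zero[of "1/2::real"] by (simp add: power_one_over)
 then show ?thesis by (rule order_tendstoD) (rule d(1))
 qed
 show "\<forall>\<^sub>F j in sequentially. \<forall>x\<in>{0..1}. \<bar>h x - spline_proj r j h x\<bar> <= e" using ev1 ev2
 proof eventually_elim
 case (elim j)
 let ?P = "(2 ^ j) powr (- 2 * \<tau>)"
 have "\<bar>?h x - ?h y\<bar> <= e1" if "\<bar>x - y\<bar> <= 1 / 2 ^ j" for x y using d(2)[of x y] that elim(2) by linarith
 then obtain s where s: "s \<in> spline_space r j" "sq (%x. h x - s x) <= C * ?P"
  "!!x. x \<in> {0..1} ==> (h x - s x)^2 <= C * (2 ^ j * ?P) + 2 * (2 ^ a * e1)^2" using J[of j e1] by blast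
 have "2 ^ a * e1 = e / 4" by (simp add: e1_def)
 then have e14: "4 * (2 ^ a * e1)^2 = e^2 / 4" by (simp only: power_divide) simp
 show ?case
 proof
  fix x :: real assume x: "x \<in> {0..1}"
  have "(s x - spline_proj r j h x)^2 <= N * 2 ^ j * sq (%x. s x - spline_proj r j h x)"
  by (rule N(2)[OF spline_space_diff[OF s(1) spline_proj_in_space[OF r1 bh]] x])
  also have "... <= N * 2 ^ j * (C * ?P)" using spline_proj_best(2)[OF r1 bh s(1)] s(2) N(1) by (intro mult_left_mono) auto
  finally have 1: "(s x - spline_proj r j h x)^2 <= N * C * (2 ^ j * ?P)" by (simp only: mult.assoc mult.left_commute)
  have "(h x - spline_proj r j h x)^2 <= 2 * (h x - s x)^2 + 2 * (s x - spline_proj r j h x)^2"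
  using sum_sq_le[of "h x - s x" "s x - spline_proj r j h x"] by simp
  also have "... <= 2 * (C * (2 ^ j * ?P) + 2 * (2 ^ a * e1)^2) + 2 * (N * C * (2 ^ j * ?P))" by (intro add_mono mult_left_mono s(3)[OF x] 1) auto
  also have "... = (2 * C + 2 * (N * C)) * (2 ^ j * ?P) + e^2 / 4" using e14 by (simp add: distrib_right mult.assoc)
  also have "... <= e^2" using elim(1) e zero_le_power2[of e] by linarith
  finally have "\<bar>h x - spline_proj r j h x\<bar> <= \<bar>e\<bar>" by (simp only: abs_le_square_iff)
  then show "\<bar>h x - spline_proj r j h x\<bar> <= e" using e by simp
 qed
 qed
qed

section \<open>Lowering the order of differences\<close>

lemma fdiff_double_funpow:
 "\<exists>c. \<forall>z F x. (fdiff (2 * z) ^^ m) F x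
 = 2 ^ m * (fdiff z ^^ m) F x + (\<Sum>i<m. c i * (fdiff z ^^ Suc m) F (x + real i * z))"
proof (induction m)
 case 0
 then show ?case by simp
next
 case (Suc m)
 then obtain c where c: "!!z F x. (fdiff (2 * z) ^^ m) F x
 = 2 ^ m * (fdiff z ^^ m) F x + (\<Sum>i<m. c i * (fdiff z ^^ Suc m) F (x + real i * z))" by blast
 define c' where "c' i = (if i = 0 then 2 ^ m else c (i - 1)) + (if i < m then c i else 0)" for i
 have "(fdiff (2 * z) ^^ Suc m) F x
 = 2 ^ Suc m * (fdiff z ^^ Suc m) F x + (\<Sum>i<Suc m. c' i * (fdiff z ^^ Suc (Suc m)) F (x + real i * z))" for z F x
 proof -
 let ?D = "%n. (fdiff z ^^ n) F"
 have G: "fdiff (2 * z) F = (%x. fdiff z F (x + z) + fdiff z F x)" by (simp add: fdiff_def fun_eq_iff algebra_simps)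
 have lin: "(fdiff z ^^ n) (%x. fdiff z F (x + z) + fdiff z F x) y = ?D (Suc n) (y + z) + ?D (Suc n) y" for n y
 proof -
  have "(fdiff z ^^ n) (%x. fdiff z F (x + z) + fdiff z F x) y
   = (fdiff z ^^ n) (fdiff z F) (y + z) + (fdiff z ^^ n) (fdiff z F) y" unfolding fdiff_funpow_eq by (simp add: sum.distrib distrib_left add_ac)
  then show ?thesis by (simp only: funpow_Suc_right o_apply)
 qed
 have step: "?D (Suc n) (y + z) = ?D n (y + z + z) - ?D n (y + z)" "?D (Suc n) y = ?D n (y + z) - ?D n y" for n y by (simp_all only: fdiff_funpow_Suc)
 have "(fdiff (2 * z) ^^ Suc m) F x = (fdiff (2 * z) ^^ m) (%x. fdiff z F (x + z) + fdiff z F x) x" unfolding funpow_Suc_right o_apply G ..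
 also have "... = 2 ^ m * (?D (Suc m) (x + z) + ?D (Suc m) x)
  + (\<Sum>i<m. c i * (?D (Suc (Suc m)) (x + real i * z + z) + ?D (Suc (Suc m)) (x + real i * z)))" unfolding c lin ..
 also have "?D (Suc m) (x + z) = ?D (Suc m) x + ?D (Suc (Suc m)) x" unfolding fdiff_funpow_Suc[of "Suc m"] by simp
 also have "2 ^ m * (?D (Suc m) x + ?D (Suc (Suc m)) x + ?D (Suc m) x)
  + (\<Sum>i<m. c i * (?D (Suc (Suc m)) (x + real i * z + z) + ?D (Suc (Suc m)) (x + real i * z)))
  = 2 ^ Suc m * ?D (Suc m) x + (2 ^ m * ?D (Suc (Suc m)) x
  + (\<Sum>i<m. c i * ?D (Suc (Suc m)) (x + real (Suc i) * z)) + (\<Sum>i<m. c i * ?D (Suc (Suc m)) (x + real i * z)))"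
  by (simp add: algebra_simps sum.distrib del: funpow.simps)
 also have "2 ^ m * ?D (Suc (Suc m)) x + (\<Sum>i<m. c i * ?D (Suc (Suc m)) (x + real (Suc i) * z))
  = (\<Sum>i<Suc m. (if i = 0 then 2 ^ m else c (i - 1)) * ?D (Suc (Suc m)) (x + real i * z))" by (subst sum.lessThan_Suc_shift) (simp del: funpow.simps)
 also have "(\<Sum>i<m. c i * ?D (Suc (Suc m)) (x + real i * z))
  = (\<Sum>i<Suc m. (if i < m then c i else 0) * ?D (Suc (Suc m)) (x + real i * z))" by (simp del: funpow.simps)
 finally show ?thesis unfolding c'_def distrib_right sum.distrib .
 qed
 then show ?case by blast
qed

definition left_diff_sq :: "real => nat => real => (real => real) => real" where
 "left_diff_sq c k z g = (\<integral>x. indicator {0..c} x * ((fdiff z ^^ k) g x)^2 \<partial>lborel)"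

lemma left_diff_integrable:
 assumes c: "continuous_on UNIV g" and b: "!!x. \<bar>g x\<bar> <= B"
 shows "integrable lborel (%x. indicator {0..c} x * ((fdiff z ^^ k) g (x + y))^2)"
proof (rule lint_bound[of _ "%x. (2 ^ k * B)\<^sup>2 * indicator {0..c} x"])
 have "(fdiff z ^^ k) g \<in> borel_measurable borel" by (intro meas_contI fdiff_funpow_continuous c)
 then have [measurable]: "(%x. (fdiff z ^^ k) g (x + y)) \<in> borel_measurable borel" by measurable
 show "(%x. indicator {0..c} x * ((fdiff z ^^ k) g (x + y))^2) \<in> borel_measurable lborel" by measurable
 have "((fdiff z ^^ k) g x)^2 <= (2 ^ k * B)^2" for x using power_mono[OF fdiff_funpow_abs_le[of g B k z x, OF b] abs_ge_zero, of 2] by simp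
 then show "AE x in lborel. norm (indicator {0..c} x * ((fdiff z ^^ k) g (x + y))^2) <= norm ((2 ^ k * B)^2 * indicator {0..c} x)"
 by (intro AE_I2) (simp split: split_indicator)
qed (intro integrable_mult_right, simp add: emeasure_lborel_Icc_eq)

lemma left_diff_sq_le:
 assumes c: "continuous_on UNIV g" and b: "!!x. \<bar>g x\<bar> <= B" and "0 <= c" "c <= 1"
 shows "left_diff_sq c k z g <= (2 ^ k * B)^2"
proof -
 have "((fdiff z ^^ k) g x)^2 <= (2 ^ k * B)^2" for x using power_mono[OF fdiff_funpow_abs_le[of g B k z x, OF b] abs_ge_zero, of 2] by simp
 then have "left_diff_sq c k z g <= (\<integral>x. (2 ^ k * B)\<^sup>2 * indicator {0..c} x \<partial>lborel)" unfolding left_diff_sq_def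
 using left_diff_integrable[OF c b, of c k z 0] by (intro integral_mono) (auto simp: emeasure_lborel_Icc_eq split: split_indicator)
 also have "... = (2 ^ k * B)^2 * c" using assms by simp
 also have "... <= (2 ^ k * B)^2" using assms by (intro mult_left_le) auto
 finally show ?thesis .
qed

lemma square_add_weighted:
 assumes "1 < \<rho>" shows "((x::real) + y)^2 <= \<rho> * x^2 + \<rho> / (\<rho> - 1) * y^2"
proof -
 have "0 <= ((\<rho> - 1) * x - y)^2 / (\<rho> - 1)" using assms by simp
 also have "... = (\<rho> - 1) * x^2 - 2 * x * y + y^2 / (\<rho> - 1)" using assms by (simp add: power2_eq_square field_simps)
 finally have "2 * x * y <= (\<rho> - 1) * x^2 + y^2 / (\<rho> - 1)" by simp
 moreover have "\<rho> / (\<rho> - 1) * y^2 = y^2 + y^2 / (\<rho> - 1)" using assms by (simp add: field_simps)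
 ultimately show ?thesis by (simp add: power2_sum left_diff_distrib)
qed

text \<open>Marchaud's argument: doubling the step expresses the difference of order \<open>k\<close> through \<open>2 ^ k\<close>
 times itself up to differences of order \<open>k + 1\<close>.  Since \<open>s < 1 <= k\<close>, iterating the resulting
 inequality contracts.\<close>

lemma marchaud_step:
 assumes g: "continuous_on UNIV g" and b: "!!x. \<bar>g x\<bar> <= B" and k: "1 <= k"
 and z0: "0 < z0" and c: "0 <= c" "c <= 1" "c + real k * z0 <= c'" and s: "0 < s" "s < 1" and L: "0 <= L"
 and H: "!!z. 0 < z ==> z <= z0 ==> left_diff_sq c' (Suc k) z g <= L * z powr (2 * s)"
 shows "\<exists>M\<ge>0. \<forall>z. 0 < z --> z <= z0 --> left_diff_sq c k z g <= M * z powr (2 * s)"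
proof -
 obtain \<beta> where \<beta>: "!!z x. (fdiff (2 * z) ^^ k) g x
 = 2 ^ k * (fdiff z ^^ k) g x + (\<Sum>i<k. \<beta> i * (fdiff z ^^ Suc k) g (x + real i * z))" using fdiff_double_funpow[of k] by blast
 define \<rho> where "\<rho> = 2 powr (1 - s)"
 have \<rho>: "1 < \<rho>" using s by (simp add: \<rho>_def)
 define K where "K = \<rho> / (\<rho> - 1) * (\<Sum>i<k. (\<beta> i)\<^sup>2) * real k"
 have \<rho>K: "0 <= \<rho> / (\<rho> - 1) * (\<Sum>i<k. (\<beta> i)\<^sup>2)" using \<rho> by (intro mult_nonneg_nonneg divide_nonneg_pos sum_nonneg) auto
 then have K: "0 <= K" unfolding K_def by (rule mult_nonneg_nonneg) simp
 have rec: "4 ^ k * left_diff_sq c k z g <= \<rho> * left_diff_sq c k (2 * z) g + K * (L * z powr (2 * s))" if z: "0 < z" "z <= z0" for z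
 proof -
 let ?D = "%i x. (fdiff z ^^ Suc k) g (x + real i * z)"
 have shift: "(\<integral>x. indicator {0..c} x * (?D i x)^2 \<partial>lborel) <= L * z powr (2 * s)" if "i < k" for i
 proof -
  have iz: "0 <= real i * z" "real i * z <= real k * z0" using that z by (auto intro!: mult_mono)
  have "(\<integral>x. indicator {0..c} x * (?D i x)^2 \<partial>lborel)
  = (\<integral>x. indicator {0..c} (x - real i * z) * ((fdiff z ^^ Suc k) g x)^2 \<partial>lborel)"
  by (subst lborel_integral_real_affine[of 1 _ "- (real i * z)"]) (auto simp: add.commute)
  also have "... <= left_diff_sq c' (Suc k) z g" unfolding left_diff_sq_def
  proof (rule integral_mono_AE')
  show "integrable lborel (%x. indicator {0..c'} x * ((fdiff z ^^ Suc k) g x)^2)"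
   using left_diff_integrable[OF g b, of c' "Suc k" z 0] by (simp only: add_0_right)
  have "indicator {0..c} (x - real i * z) <= (indicator {0..c'} x :: real)" for x using iz c by (auto simp: indicator_def)
  then show "AE x in lborel. indicator {0..c} (x - real i * z) * ((fdiff z ^^ Suc k) g x)^2
    <= indicator {0..c'} x * ((fdiff z ^^ Suc k) g x)^2" by (intro AE_I2 mult_right_mono) auto
  qed auto
  also have "... <= L * z powr (2 * s)" by (rule H[OF z])
  finally show ?thesis .
 qed
 have pt: "4 ^ k * ((fdiff z ^^ k) g x)^2 <= \<rho> * ((fdiff (2 * z) ^^ k) g x)^2
  + \<rho> / (\<rho> - 1) * (\<Sum>i<k. (\<beta> i)\<^sup>2) * (\<Sum>i<k. (?D i x)\<^sup>2)" for x
 proof -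
  have "4 ^ k * ((fdiff z ^^ k) g x)^2 = (2 ^ k * (fdiff z ^^ k) g x)^2"
  proof -
  have "(4::real) ^ k = (2 ^ k)^2" by (simp add: power2_eq_square flip: power_mult_distrib)
  then show ?thesis by (simp only: power_mult_distrib)
  qed
  also have "... = ((fdiff (2 * z) ^^ k) g x + - (\<Sum>i<k. \<beta> i * ?D i x))^2" unfolding \<beta> by simp
  also have "... <= \<rho> * ((fdiff (2 * z) ^^ k) g x)^2 + \<rho> / (\<rho> - 1) * (- (\<Sum>i<k. \<beta> i * ?D i x))^2"
  by (rule square_add_weighted[OF \<rho>])
  also have "... <= \<rho> * ((fdiff (2 * z) ^^ k) g x)^2
   + \<rho> / (\<rho> - 1) * ((\<Sum>i<k. (\<beta> i)\<^sup>2) * (\<Sum>i<k. (?D i x)\<^sup>2))"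
  unfolding power2_minus by (intro add_left_mono mult_left_mono Cauchy_Schwarz_ineq_sum) (use \<rho> in simp)
  finally show ?thesis by (simp only: mult.assoc)
 qed
 have i1: "integrable lborel (%x. indicator {0..c} x * ((fdiff z ^^ k) g x)^2)" for z using left_diff_integrable[OF g b, of c k z 0] by simp
 note i2 = left_diff_integrable[OF g b, of c "Suc k" z]
 have "4 ^ k * left_diff_sq c k z g = (\<integral>x. 4 ^ k * (indicator {0..c} x * ((fdiff z ^^ k) g x)^2) \<partial>lborel)"
  unfolding left_diff_sq_def by simp
 also have "... <= (\<integral>x. \<rho> * (indicator {0..c} x * ((fdiff (2 * z) ^^ k) g x)^2)
  + \<rho> / (\<rho> - 1) * (\<Sum>i<k. (\<beta> i)\<^sup>2) * (\<Sum>i<k. indicator {0..c} x * (?D i x)^2) \<partial>lborel)"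
 proof (rule integral_mono)
  fix x
  show "4 ^ k * (indicator {0..c} x * ((fdiff z ^^ k) g x)^2) <= \<rho> * (indicator {0..c} x * ((fdiff (2 * z) ^^ k) g x)^2)
  + \<rho> / (\<rho> - 1) * (\<Sum>i<k. (\<beta> i)\<^sup>2) * (\<Sum>i<k. indicator {0..c} x * (?D i x)^2)"
  using pt[of x] by (cases "x \<in> {0..c}") simp_all
 qed (intro integrable_mult_right lint_addable lint_summable i1 i2)+
 also have "... = \<rho> * left_diff_sq c k (2 * z) g
  + \<rho> / (\<rho> - 1) * (\<Sum>i<k. (\<beta> i)\<^sup>2) * (\<Sum>i<k. \<integral>x. indicator {0..c} x * (?D i x)^2 \<partial>lborel)"
 proof -
  have iS: "integrable lborel (%x. \<Sum>i<k. indicator {0..c} x * (?D i x)^2)" by (intro lint_summable i2)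
  have "(\<integral>x. (\<Sum>i<k. indicator {0..c} x * (?D i x)^2) \<partial>lborel) = (\<Sum>i<k. \<integral>x. indicator {0..c} x * (?D i x)^2 \<partial>lborel)"
  by (intro lint_sum i2)
  then show ?thesis unfolding left_diff_sq_def lint_add[OF integrable_mult_right[OF i1] integrable_mult_right[OF iS]]
   integral_mult_right_zero by (simp only:)
 qed
 also have "... <= \<rho> * left_diff_sq c k (2 * z) g + \<rho> / (\<rho> - 1) * (\<Sum>i<k. (\<beta> i)\<^sup>2) * (\<Sum>i<k. L * z powr (2 * s))"
  by (intro add_left_mono mult_left_mono sum_mono shift) (use \<rho>K in auto)
 also have "... = \<rho> * left_diff_sq c k (2 * z) g + K * (L * z powr (2 * s))" by (simp add: K_def mult.assoc)
 finally show ?thesis .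
 qed
 define \<theta> where "\<theta> = \<rho> * 4 powr s"
 have "\<theta> = 2 powr (1 + s)"
 proof -
 have "(4::real) powr s = 2 powr (2 * s)" using powr_powr[of 2 2 s] by simp
 then show ?thesis by (simp add: \<theta>_def \<rho>_def add.commute flip: powr_add)
 qed
 also have "... < 2 powr 2" using s by (intro powr_less_mono) auto
 finally have \<theta>4: "\<theta> < 4" by simp
 have "(4::real) <= 4 ^ k" using k by (metis one_le_numeral power_increasing power_one_right)
 then have gap: "0 < 4 ^ k - \<theta>" using \<theta>4 by linarith
 define M where "M = max ((2 ^ k * B)^2 / (z0 / 2) powr (2 * s)) (K * L / (4 ^ k - \<theta>))"
 have M0: "0 <= M" unfolding M_def by (simp add: le_max_iff_disj)
 have "K * L <= (4 ^ k - \<theta>) * M"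
 proof -
 have "(4 ^ k - \<theta>) * (K * L / (4 ^ k - \<theta>)) <= (4 ^ k - \<theta>) * M" unfolding M_def using gap by (intro mult_left_mono max.cobounded2) simp
 then show ?thesis using gap by simp
 qed
 then have M1: "\<theta> * M + K * L <= 4 ^ k * M" by (simp add: algebra_simps)
 have "z0 / 2 ^ n / 2 < z ==> z <= z0 / 2 ^ n ==> left_diff_sq c k z g <= M * z powr (2 * s)" for n z
 proof (induction n arbitrary: z)
 case 0
 then have z: "z0 / 2 < z" by simp
 have "left_diff_sq c k z g <= (2 ^ k * B)^2" by (rule left_diff_sq_le[OF g b c(1,2)])
 also have "... = (2 ^ k * B)^2 / (z0 / 2) powr (2 * s) * (z0 / 2) powr (2 * s)" using z0 by simp
 also have "... <= M * z powr (2 * s)" by (intro mult_mono powr_mono2) (use z z0 s M0 in \<open>auto simp: M_def\<close>)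
 finally show ?case .
 next
 case (Suc n)
 have z: "0 < z" using Suc.prems(1) z0 by (meson divide_pos_pos less_trans zero_less_numeral zero_less_power)
 have "z0 / 2 ^ Suc n <= z0" using z0 by (simp add: divide_le_eq one_le_power del: power_Suc)
 then have zz0: "z <= z0" using Suc.prems(2) by linarith
 have IH: "left_diff_sq c k (2 * z) g <= M * (2 * z) powr (2 * s)" by (rule Suc.IH) (use Suc.prems in \<open>simp_all add: field_simps\<close>)
 have p2: "(2 * z) powr (2 * s) = 4 powr s * z powr (2 * s)"
 proof -
  have "(2::real) powr (2 * s) = 4 powr s" using powr_powr[of 2 2 s] by simp
  then show ?thesis using z by (simp add: powr_mult)
 qed
 have "4 ^ k * left_diff_sq c k z g <= \<rho> * (M * (2 * z) powr (2 * s)) + K * (L * z powr (2 * s))"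
  using rec[OF z zz0] mult_left_mono[OF IH, of \<rho>] \<rho> by linarith
 also have "... = (\<theta> * M + K * L) * z powr (2 * s)" unfolding p2 \<theta>_def by (simp add: algebra_simps)
 also have "... <= 4 ^ k * M * z powr (2 * s)" by (intro mult_right_mono M1) simp
 finally have "4 ^ k * left_diff_sq c k z g <= 4 ^ k * (M * z powr (2 * s))" by (simp only: mult.assoc)
 then show ?case by (rule mult_left_le_imp_le) simp
 qed
 moreover have "\<exists>n. z0 / 2 ^ n / 2 < z & z <= z0 / 2 ^ n" if z: "0 < z" "z <= z0" for z
 proof -
 obtain m where "z0 / z < 2 ^ m" using real_arch_pow[of 2 "z0 / z"] by auto
 then have ex: "\<exists>n. z0 / 2 ^ n / 2 < z" using z z0 by (intro exI[of _ m]) (simp add: field_simps)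
 define n where "n = (LEAST n. z0 / 2 ^ n / 2 < z)"
 have 1: "z0 / 2 ^ n / 2 < z" unfolding n_def by (rule LeastI_ex[OF ex])
 have 2: "z <= z0 / 2 ^ n"
 proof (cases n)
  case (Suc m)
  then have "\<not> z0 / 2 ^ m / 2 < z" unfolding n_def by (metis lessI not_less_Least)
  then show ?thesis by (simp add: Suc field_simps)
 qed (use z in simp)
 show ?thesis using 1 2 by blast
 qed
 ultimately show ?thesis using M0 by blast
qed

lemma marchaud_left:
 assumes g: "continuous_on UNIV g" and b: "!!x. \<bar>g x\<bar> <= B" and a: "1 <= a" and s: "0 < s" "s < 1" and L: "0 <= L"
 and H: "!!z. z ~= 0 ==> \<bar>z\<bar> < 1 ==> sq (iter_diff a z g) <= L * \<bar>z\<bar> powr (2 * s)"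
 shows "\<exists>M\<ge>0. \<forall>z. 0 < z --> z <= 1 / (4 * (real a)^2) --> left_diff_sq (1 / 2) 1 z g <= M * z powr (2 * s)"
proof -
 define z0 where "z0 = 1 / (4 * (real a)^2)"
 define c where "c k = 3 / 4 - (real a - real k) / (4 * real a)" for k
 have a0: "0 < real a" using a by simp
 have z0: "0 < z0" using a0 by (simp add: z0_def)
 have az0: "real a * z0 = 1 / (4 * real a)" using a0 by (simp add: z0_def power2_eq_square)
 have cc: "c k + real k * z0 <= c (Suc k)" if "k <= a" for k
 proof -
 have "real k * z0 <= real a * z0" using that z0 by (intro mult_right_mono) auto
 moreover have "c (Suc k) = c k + 1 / (4 * real a)" using a0 by (simp add: c_def field_simps)
 ultimately show ?thesis using az0 by linarith
 qed
 have half: "(real a - real k) / (4 * real a) <= 1 / 4" "0 <= (real a - real k) / (4 * real a)" if "k <= a" for k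
 using a0 that by (auto simp: divide_le_eq)
 have cb: "1 / 2 <= c k" "c k <= 3 / 4" if "k <= a" for k
 proof -
 have "1 / 2 <= 3 / 4 - q & 3 / 4 - q <= 3 / 4" if "q <= 1 / 4" "0 <= q" for q :: real using that by simp
 from this[OF half[OF that]] show "1 / 2 <= c k" "c k <= 3 / 4" unfolding c_def by blast+
 qed
 have "i < a ==> \<exists>M\<ge>0. \<forall>z. 0 < z --> z <= z0 --> left_diff_sq (c (a - i)) (a - i) z g <= M * z powr (2 * s)" for i
 proof (induction i)
 case 0
 have "left_diff_sq (c a) a z g <= L * z powr (2 * s)" if z: "0 < z" "z <= z0" for z
 proof -
  have "1 <= (real a)^2" using a by (intro one_le_power) simp
  then have "1 < 4 * (real a)^2" by linarith
  then have "z0 < 1" unfolding z0_def using a0 by (simp add: divide_less_eq)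
  have "real a * z <= real a * z0" using z a0 by simp
  also have "... <= 1 / 4" using a az0 a0 by (simp add: divide_le_eq)
  finally have az: "real a * z <= 1 / 4" .
  have ca: "c a = 3 / 4" by (simp add: c_def)
  have "left_diff_sq (c a) a z g = (I01 x. indicator {0..c a} x * ((fdiff z ^^ a) g x)^2)" unfolding left_diff_sq_def ca
  by (subst integral_restrict_space) (auto intro!: lint_cong split: split_indicator)
  also have "... <= sq (iter_diff a z g)" unfolding sq_def
  proof (rule integral_mono)
  show "integrable lborel01 (%x. indicator {0..c a} x * ((fdiff z ^^ a) g x)^2)"
   by (intro bmeas_integrable bmeas_indicator_mult bmeas_power2 bmeas_continuous_on
    continuous_on_subset[OF fdiff_funpow_continuous[OF g]]) auto
  show "integrable lborel01 (%x. (iter_diff a z g x)\<^sup>2)" by (intro bmeas_integrable bmeas_power2 bmeas_iter_diff[OF g b])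
  show "indicator {0..c a} x * ((fdiff z ^^ a) g x)^2 <= (iter_diff a z g x)^2" for x
  proof (cases "x \<in> {0..3/4}")
   case True
   then have "x \<in> {0..1}" "x + real a * z \<in> {0..1}" using az z a0 by (auto intro!: add_nonneg_nonneg)
   then have "iter_diff a z g x = (fdiff z ^^ a) g x" by (simp only: iter_diff_def simp_thms if_True)
   then show ?thesis by (simp split: split_indicator)
  qed (simp add: ca)
  qed
  also have "... <= L * \<bar>z\<bar> powr (2 * s)" using z \<open>z0 < 1\<close> by (intro H) auto
  finally show ?thesis using z by simp
 qed
 then show ?case using L by auto
 next
 case (Suc i)
 then obtain M where M: "0 <= M"
  "!!z. 0 < z ==> z <= z0 ==> left_diff_sq (c (a - i)) (a - i) z g <= M * z powr (2 * s)" by force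
 have eq: "a - i = Suc (a - Suc i)" using Suc.prems by simp
 show ?case
 proof (rule marchaud_step[OF g b _ z0 _ _ _ s M(1)])
  show "1 <= a - Suc i" using Suc.prems by simp
  show "0 <= c (a - Suc i)" "c (a - Suc i) <= 1" using cb[of "a - Suc i"] by auto
  show "c (a - Suc i) + real (a - Suc i) * z0 <= c (a - i)" unfolding eq using Suc.prems by (intro cc) auto
  show "left_diff_sq (c (a - i)) (Suc (a - Suc i)) z g <= M * z powr (2 * s)" if "0 < z" "z <= z0" for z using M(2)[OF that] unfolding eq .
 qed
 qed
 from this[of "a - 1"] obtain M where M: "0 <= M"
 "!!z. 0 < z ==> z <= z0 ==> left_diff_sq (c 1) 1 z g <= M * z powr (2 * s)" using a by auto
 have "left_diff_sq (1 / 2) 1 z g <= left_diff_sq (c 1) 1 z g" for z unfolding left_diff_sq_def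
 proof (rule integral_mono)
 show "integrable lborel (%x. indicator {0..d} x * ((fdiff z ^^ 1) g x)^2)" for d
  using left_diff_integrable[OF g b, of d 1 z 0] by (simp only: add_0_right)
 then show "integrable lborel (%x. indicator {0..d} x * ((fdiff z ^^ 1) g x)^2)" for d .
 show "indicator {0..1/2} x * ((fdiff z ^^ 1) g x)^2 <= indicator {0..c 1} x * ((fdiff z ^^ 1) g x)^2" for x
  using cb[of 1] a by (intro mult_right_mono) (auto split: split_indicator)
 qed
 then show ?thesis using M unfolding z0_def[symmetric] by (meson order_trans)
qed

lemma sq_reflect:
 assumes "f \<in> borel_measurable borel" shows "sq (%x. f (1 - x)) = sq f"
proof -
 note [measurable] = assms
 have "sq f = (\<integral>x. indicator {0..1} x * (f x)^2 \<partial>lborel)" unfolding sq_def by (subst integral_restrict_space) auto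
 also have "... = (\<integral>x. indicator {0..1} (1 + (-1) * x) * (f (1 + (-1) * x))^2 \<partial>lborel)"
 by (subst lborel_integral_real_affine[of "-1" _ 1]) auto
 also have "... = (\<integral>x. indicator {0..1} x * (f (1 - x))^2 \<partial>lborel)" by (intro lint_cong refl) (auto split: split_indicator)
 also have "... = sq (%x. f (1 - x))" unfolding sq_def by (subst integral_restrict_space) auto
 finally show ?thesis by simp
qed

lemma iter_diff_measurable:
 assumes "continuous_on UNIV g" shows "iter_diff a z g \<in> borel_measurable borel"
proof -
 have [measurable]: "(fdiff z ^^ a) g \<in> borel_measurable borel" by (intro meas_contI fdiff_funpow_continuous assms)
 have "iter_diff a z g = (%x. indicator {0..1} x * indicator {0..1} (x + real a * z) * (fdiff z ^^ a) g x)"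
 by (auto simp: fun_eq_iff iter_diff_def indicator_def)
 moreover have "... \<in> borel_measurable borel" by measurable
 ultimately show ?thesis by simp
qed

lemma iter_diff_reflect:
 assumes "continuous_on UNIV g"
 shows "sq (iter_diff a z (%x. g (1 - x))) = sq (iter_diff a (- z) g)"
proof -
 have "iter_diff a z (%x. g (1 - x)) x = iter_diff a (- z) g (1 - x)" for x
 proof -
 have "(fdiff z ^^ a) (%x. g (1 - x)) x = (fdiff (- z) ^^ a) g (1 - x)" unfolding fdiff_funpow_eq by (simp add: diff_diff_eq)
 moreover have "x \<in> {0..1} & x + real a * z \<in> {0..1} \<longleftrightarrow> 1 - x \<in> {0..1} & 1 - x + real a * (- z) \<in> {0..1}" by auto
 ultimately show ?thesis by (simp only: iter_diff_def)
 qed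
 then have "iter_diff a z (%x. g (1 - x)) = (%x. iter_diff a (- z) g (1 - x))" by (rule ext)
 then show ?thesis by (simp only: sq_reflect[OF iter_diff_measurable[OF assms]])
qed

lemma iter_diff_one_split:
 assumes g: "continuous_on UNIV g" and b: "!!x. \<bar>g x\<bar> <= B" and z: "0 < z"
 shows "sq (iter_diff 1 z g) <= left_diff_sq (1 / 2) 1 z g + left_diff_sq (1 / 2) 1 z (%x. g (1 - x))"
proof -
 have g': "continuous_on UNIV (%x. g (1 - x))" by (rule continuous_on_compose2[OF g]) (auto intro!: continuous_intros)
 have b': "\<bar>g (1 - x)\<bar> <= B" for x by (rule b)
 note [measurable] = meas_contI[OF g]
 have i1: "integrable lborel (%x. indicator {0..1/2} x * (g (x + z) - g x)^2)" using left_diff_integrable[OF g b, of "1/2" 1 z 0] by (simp add: fdiff_def)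
 have i2: "integrable lborel (%y. indicator {0..1/2} y * (g (1 - (y + z)) - g (1 - y))^2)"
 using left_diff_integrable[OF g' b', of "1/2" 1 z 0] by (simp add: fdiff_def)
 have b2: "(g (x + z) - g x)^2 <= (2 * B)^2" for x
 proof -
 have "\<bar>g (x + z) - g x\<bar> <= 2 * B" using b[of "x + z"] b[of x] by linarith
 from power_mono[OF this abs_ge_zero, of 2] show ?thesis by simp
 qed
 have i3: "integrable lborel (%x. indicator {1/2<..1 - z} x * (g (x + z) - g x)^2)"
 proof (rule lint_bound[of _ "%x. (2 * B)\<^sup>2 * indicator {0..1::real} x"])
 show "AE x in lborel. norm (indicator {1/2<..1 - z} x * (g (x + z) - g x)^2) <= norm ((2 * B)^2 * indicator {0..1::real} x)"
  using b2 z by (intro AE_I2) (auto split: split_indicator)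
 show "(%x. indicator {1/2<..1 - z} x * (g (x + z) - g x)^2) \<in> borel_measurable lborel" using meas_contI[OF g] by measurable
 show "integrable lborel (%x. (2 * B)\<^sup>2 * indicator {0..1::real} x)"
  by (intro integrable_mult_right integrable_real_indicator) (simp_all add: emeasure_lborel_Icc_eq)
 qed
 have "sq (iter_diff 1 z g) = (\<integral>x. indicator {0..1 - z} x * (g (x + z) - g x)^2 \<partial>lborel)" unfolding sq_def using z
 by (subst integral_restrict_space)
  (auto intro!: lint_cong simp: iter_diff_def fdiff_def split: split_indicator)
 also have "... <= (\<integral>x. indicator {0..1/2} x * (g (x + z) - g x)^2 + indicator {1/2<..1 - z} x * (g (x + z) - g x)^2 \<partial>lborel)"
 by (rule integral_mono_AE') (auto intro!: lint_addable i1 i3 AE_I2 split: split_indicator)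
 also have "... = left_diff_sq (1 / 2) 1 z g + (\<integral>x. indicator {1/2<..1 - z} x * (g (x + z) - g x)^2 \<partial>lborel)"
 unfolding left_diff_sq_def by (subst lint_add[OF i1 i3]) (simp add: fdiff_def)
 also have "(\<integral>x. indicator {1/2<..1 - z} x * (g (x + z) - g x)^2 \<partial>lborel)
 = (\<integral>y. indicator {1/2<..1 - z} ((1 - z) + (-1) * y) * (g ((1 - z) + (-1) * y + z) - g ((1 - z) + (-1) * y))^2 \<partial>lborel)"
 by (subst lborel_integral_real_affine[of "-1" _ "1 - z"]) auto
 also have "... <= (\<integral>y. indicator {0..1/2} y * (g (1 - (y + z)) - g (1 - y))^2 \<partial>lborel)"
 proof (rule integral_mono_AE'[OF i2])
 show "AE y in lborel. indicator {1/2<..1 - z} ((1 - z) + (-1) * y) * (g ((1 - z) + (-1) * y + z) - g ((1 - z) + (-1) * y))^2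
  <= indicator {0..1/2} y * (g (1 - (y + z)) - g (1 - y))^2"
 proof (rule AE_I2)
  fix y
  have "indicator {1/2<..1 - z} ((1 - z) + (-1) * y) <= (indicator {0..1/2} y :: real)" using z by (auto simp: indicator_def)
  moreover have "(1 - z) + (-1) * y + z = 1 - y" "(1 - z) + (-1) * y = 1 - (y + z)" by simp_all
  ultimately show "indicator {1/2<..1 - z} ((1 - z) + (-1) * y) * (g ((1 - z) + (-1) * y + z) - g ((1 - z) + (-1) * y))^2
  <= indicator {0..1/2} y * (g (1 - (y + z)) - g (1 - y))^2" by (simp only: power2_commute[of "g (1 - y)"] mult_right_mono zero_le_power2)
 qed
 qed auto
 also have "... = left_diff_sq (1 / 2) 1 z (%x. g (1 - x))" unfolding left_diff_sq_def by (simp add: fdiff_def)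
 finally show ?thesis by simp
qed

lemma marchaud:
 assumes h: "continuous_on {0..1} h" and a: "1 <= a" and s: "0 < s" "s < 1" "s <= \<sigma>" and L: "0 <= L"
 and H: "!!z. z ~= 0 ==> \<bar>z\<bar> < 1 ==> sq (iter_diff a z h) <= L * \<bar>z\<bar> powr (2 * \<sigma>)"
 shows "\<exists>M\<ge>0. \<forall>z. z ~= 0 --> \<bar>z\<bar> < 1 --> sq (iter_diff 1 z h) <= M * \<bar>z\<bar> powr (2 * s)"
proof -
 let ?g = "clamp01 h" and ?g' = "%x. clamp01 h (1 - x)"
 have eq: "?g x = h x" if "x \<in> {0..1}" for x using that by (rule clamp01_eq)
 obtain B where B: "!!x. \<bar>?g x\<bar> <= B" by (rule clamp01_bounded[OF h]) (rule that)
 have B0: "0 <= B" using B[of 0] by linarith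
 have g: "continuous_on UNIV ?g" by (rule clamp01_continuous[OF h])
 have g': "continuous_on UNIV ?g'" by (rule continuous_on_compose2[OF g]) (auto intro!: continuous_intros)
 have B': "\<bar>?g' x\<bar> <= B" for x by (rule B)
 have itd: "iter_diff k z ?g = iter_diff k z h" for k z by (rule iter_diff_cong[OF eq])
 have Hg: "sq (iter_diff a z ?g) <= L * \<bar>z\<bar> powr (2 * s)" if "z ~= 0" "\<bar>z\<bar> < 1" for z
 proof -
 have "\<bar>z\<bar> powr (2 * \<sigma>) <= \<bar>z\<bar> powr (2 * s)" using that s by (intro powr_mono') auto
 then have "L * \<bar>z\<bar> powr (2 * \<sigma>) <= L * \<bar>z\<bar> powr (2 * s)" using L by (rule mult_left_mono)
 then show ?thesis using H[OF that] unfolding itd by linarith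
 qed
 have Hg': "sq (iter_diff a z ?g') <= L * \<bar>z\<bar> powr (2 * s)" if "z ~= 0" "\<bar>z\<bar> < 1" for z
 using Hg[of "- z"] that unfolding iter_diff_reflect[OF g] by simp
 define z0 where "z0 = 1 / (4 * (real a)^2)"
 have z0: "0 < z0" using a by (simp add: z0_def)
 obtain M1 where M1: "0 <= M1" "!!z. 0 < z ==> z <= z0 ==> left_diff_sq (1 / 2) 1 z ?g <= M1 * z powr (2 * s)"
 using marchaud_left[OF g B a s(1,2) L Hg] unfolding z0_def by blast
 obtain M2 where M2: "0 <= M2" "!!z. 0 < z ==> z <= z0 ==> left_diff_sq (1 / 2) 1 z ?g' <= M2 * z powr (2 * s)"
 using marchaud_left[OF g' B' a s(1,2) L Hg'] unfolding z0_def by blast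
 define M where "M = M1 + M2 + (2 * B)^2 / z0 powr (2 * s)"
 have M: "0 <= M" "M1 + M2 <= M" "(2 * B)^2 / z0 powr (2 * s) <= M" using M1 M2 by (auto simp: M_def)
 have pos: "sq (iter_diff 1 z ?g) <= (M1 + M2) * z powr (2 * s)" "sq (iter_diff 1 z ?g') <= (M1 + M2) * z powr (2 * s)" if z: "0 < z" "z <= z0" for z
 proof -
 have refl2: "(%x. ?g' (1 - x)) = ?g" by simp
 show "sq (iter_diff 1 z ?g) <= (M1 + M2) * z powr (2 * s)" using iter_diff_one_split[OF g B z(1)] M1(2)[OF z] M2(2)[OF z] by (simp only: distrib_right)
 show "sq (iter_diff 1 z ?g') <= (M1 + M2) * z powr (2 * s)"
  using iter_diff_one_split[OF g' B' z(1)] M1(2)[OF z] M2(2)[OF z] unfolding refl2 distrib_right by linarith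
 qed
 have "sq (iter_diff 1 z h) <= M * \<bar>z\<bar> powr (2 * s)" if z: "z ~= 0" "\<bar>z\<bar> < 1" for z
 proof (cases "\<bar>z\<bar> <= z0")
 case True
 have "sq (iter_diff 1 z ?g) <= (M1 + M2) * \<bar>z\<bar> powr (2 * s)"
 proof (cases "0 < z")
  case True
  then show ?thesis using pos(1)[of z] \<open>\<bar>z\<bar> <= z0\<close> by simp
 next
  case False
  then show ?thesis using pos(2)[of "- z"] \<open>\<bar>z\<bar> <= z0\<close> z iter_diff_reflect[OF g, of 1 "- z"] by simp
 qed
 also have "... <= M * \<bar>z\<bar> powr (2 * s)" by (intro mult_right_mono M) simp
 finally show ?thesis unfolding itd .
 next
 case False
 have "\<bar>iter_diff 1 z ?g x\<bar> <= 2 * B" for x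
 proof -
  have "\<bar>?g (x + z) - ?g x\<bar> <= 2 * B" using B[of "x + z"] B[of x] by linarith
  then show ?thesis using B0 by (simp add: iter_diff_def fdiff_def)
 qed
 then have "(iter_diff 1 z ?g x)^2 <= (2 * B)^2" for x using power_mono[of "\<bar>iter_diff 1 z ?g x\<bar>" "2 * B" 2] by simp
 then have "sq (iter_diff 1 z ?g) <= (2 * B)^2" by (intro sq_le_const bmeas_iter_diff[OF g B])
 also have "... = (2 * B)^2 / z0 powr (2 * s) * z0 powr (2 * s)" using z0 by simp
 also have "... <= M * \<bar>z\<bar> powr (2 * s)" using False z0 s by (intro mult_mono M powr_mono2) auto
 finally show ?thesis unfolding itd .
 qed
 then show ?thesis using M(1) by blast
qed

lemma cont_besov_differences:
 assumes h: "h \<in> cont_besov s" and s: "0 < s" "s < real r"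
 obtains a L where "1 <= a" "a <= r" "0 <= L" "continuous_on {0..1} h"
 "!!z. z ~= 0 ==> \<bar>z\<bar> < 1 ==> sq (iter_diff a z h) <= L * \<bar>z\<bar> powr (2 * s)"
proof -
 define a where "a = (LEAST a::nat. s < real a)"
 have "s < real a" unfolding a_def by (rule LeastI[of _ r]) (rule s(2))
 then have a1: "1 <= a" using s(1) by (cases a) auto
 have ar: "a <= r" unfolding a_def by (rule Least_le) (rule s(2))
 have c: "continuous_on {0..1} h" and fin: "besov_norm s h < \<infinity>" using h by (auto simp: cont_besov_def besov_def)
 let ?S = "SUP z\<in>{z. z ~= 0 & \<bar>z\<bar> < 1}. ennreal (\<bar>z\<bar> powr (- s) * norm2 (iter_diff a z h))"
 have "?S <= besov_norm s h" unfolding besov_norm_def Let_def a_def by simp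
 then have S: "?S < \<infinity>" using fin by (rule le_less_trans)
 define K where "K = enn2real ?S"
 have K: "?S = ennreal K" "0 <= K" using S by (auto simp: K_def)
 have "sq (iter_diff a z h) <= K^2 * \<bar>z\<bar> powr (2 * s)" if z: "z ~= 0" "\<bar>z\<bar> < 1" for z
 proof -
 have "ennreal (\<bar>z\<bar> powr (- s) * norm2 (iter_diff a z h)) <= ?S" by (rule SUP_upper) (use z in simp)
 then have "\<bar>z\<bar> powr (- s) * norm2 (iter_diff a z h) <= K" using K by (simp add: ennreal_le_iff)
 then have "\<bar>z\<bar> powr s * (\<bar>z\<bar> powr (- s) * norm2 (iter_diff a z h)) <= \<bar>z\<bar> powr s * K" by (rule mult_left_mono) simp
 moreover have "\<bar>z\<bar> powr s * (\<bar>z\<bar> powr (- s) * norm2 (iter_diff a z h)) = norm2 (iter_diff a z h)"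
  using z by (simp add: mult.assoc[symmetric] powr_add[symmetric])
 ultimately have n: "norm2 (iter_diff a z h) <= \<bar>z\<bar> powr s * K" by simp
 have n0: "norm2 (iter_diff a z h) = sqrt (sq (iter_diff a z h))" by (simp add: norm2_def sq_def)
 have "(norm2 (iter_diff a z h))^2 <= (\<bar>z\<bar> powr s * K)^2" by (rule power_mono[OF n]) (simp add: n0)
 moreover have "(\<bar>z\<bar> powr s)^2 = \<bar>z\<bar> powr (2 * s)" by (simp add: power2_eq_square flip: powr_add)
 ultimately show ?thesis by (simp add: n0 power_mult_distrib mult.commute)
 qed
 then show ?thesis using a1 ar c by (intro that[of a "K^2"]) auto
qed

lemma cont_besov_first_differences:
 assumes h: "h \<in> cont_besov \<sigma>" and s: "0 < s" "s < 1" "s <= \<sigma>"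
 shows "\<exists>M\<ge>0. \<forall>z. z ~= 0 --> \<bar>z\<bar> < 1 --> sq (iter_diff 1 z h) <= M * \<bar>z\<bar> powr (2 * s)"
proof -
 obtain r where r: "\<sigma> < real r" using reals_Archimedean2 by blast
 have "0 < \<sigma>" using s by simp
 then obtain a L where "1 <= a" "a <= r" "0 <= L" "continuous_on {0..1} h"
 "!!z. z ~= 0 ==> \<bar>z\<bar> < 1 ==> sq (iter_diff a z h) <= L * \<bar>z\<bar> powr (2 * \<sigma>)" using cont_besov_differences[OF h _ r] by metis
 then show ?thesis using s by (intro marchaud[of h a s \<sigma> L]) auto
qed

lemma continuous_pos_lower_bound:
 fixes f :: "real => real"
 assumes "continuous_on {0..1} f" "!!x. x \<in> {0..1} ==> 0 < f x"
 obtains m where "0 < m" "!!x. x \<in> {0..1} ==> m <= f x"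
proof -
 obtain x where "x \<in> {0..1}" "\<forall>y\<in>{0..1}. f x <= f y" using continuous_attains_inf[of "{0..1::real}" f] assms(1) by auto
 then show ?thesis using assms(2) by (intro that[of "f x"]) auto
qed

lemma quotient_first_differences:
 assumes g: "continuous_on {0..1} g" and f: "continuous_on {0..1} f" and pos: "!!x. x \<in> {0..1} ==> 0 < f x"
 and Mg: "0 <= Mg" "!!z. z ~= 0 ==> \<bar>z\<bar> < 1 ==> sq (iter_diff 1 z g) <= Mg * \<bar>z\<bar> powr (2 * s)"
 and Mf: "0 <= Mf" "!!z. z ~= 0 ==> \<bar>z\<bar> < 1 ==> sq (iter_diff 1 z f) <= Mf * \<bar>z\<bar> powr (2 * s)"
 shows "\<exists>M\<ge>0. \<forall>z. z ~= 0 --> \<bar>z\<bar> < 1 --> sq (iter_diff 1 z (%x. g x / f x)) <= M * \<bar>z\<bar> powr (2 * s)"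
proof -
 obtain m where m: "0 < m" "!!x. x \<in> {0..1} ==> m <= f x" by (rule continuous_pos_lower_bound[OF f pos]) (auto intro: that)
 obtain G where G: "\<forall>x\<in>{0..1}. \<bar>g x\<bar> <= G" using bmeas_continuous_on[OF g] unfolding bmeas_def by blast
 have G0: "0 <= G" using G[rule_format, of 0] by simp
 have w: "continuous_on {0..1} (%x. g x / f x)" using pos by (intro continuous_on_divide g f) (auto simp: less_le)
 have bm: "bmeas (iter_diff 1 z u)" if u: "continuous_on {0..1} u" for u z
 proof -
 obtain B where "!!x. \<bar>clamp01 u x\<bar> <= B" by (rule clamp01_bounded[OF u]) (rule that)
 then have "bmeas (iter_diff 1 z (clamp01 u))" by (rule bmeas_iter_diff[OF clamp01_continuous[OF u]])
 then show ?thesis using iter_diff_cong[of "clamp01 u" u 1 z, OF clamp01_eq] by simp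
 qed
 have "sq (iter_diff 1 z (%x. g x / f x)) <= (2 / m^2 * Mg + 2 * (G / m^2)^2 * Mf) * \<bar>z\<bar> powr (2 * s)" if z: "z ~= 0" "\<bar>z\<bar> < 1" for z
 proof -
 have "\<bar>iter_diff 1 z (%x. g x / f x) x\<bar> <= \<bar>1 / m * \<bar>iter_diff 1 z g x\<bar> + G / m^2 * \<bar>iter_diff 1 z f x\<bar>\<bar>" for x
 proof (cases "x \<in> {0..1} & x + real 1 * z \<in> {0..1}")
  case True
  let ?y = "x + z"
  have xy: "x \<in> {0..1}" "?y \<in> {0..1}" using True by auto
  have fx: "0 < f x" "m <= f x" "0 < f ?y" "m <= f ?y" using pos m xy by auto
  have "iter_diff 1 z (%x. g x / f x) x = g ?y / f ?y - g x / f x" using True by (simp only: iter_diff_def simp_thms if_True) (simp add: fdiff_def)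
  also have "... = (g ?y - g x) / f ?y - g x * (f ?y - f x) / (f x * f ?y)" using fx by (simp add: field_simps)
  also have "\<bar>\<dots>\<bar> <= \<bar>(g ?y - g x) / f ?y\<bar> + \<bar>g x * (f ?y - f x) / (f x * f ?y)\<bar>" by (rule abs_triangle_ineq4)
  also have "\<bar>(g ?y - g x) / f ?y\<bar> <= \<bar>g ?y - g x\<bar> / m" unfolding abs_divide using fx m by (intro frac_le) auto
  also have "\<bar>g x * (f ?y - f x) / (f x * f ?y)\<bar> <= (G * \<bar>f ?y - f x\<bar>) / (m * m)"
  proof -
  have "\<bar>g x * (f ?y - f x) / (f x * f ?y)\<bar> = \<bar>g x\<bar> * \<bar>f ?y - f x\<bar> / (f x * f ?y)" using fx by (simp add: abs_mult)
  also have "... <= (G * \<bar>f ?y - f x\<bar>) / (m * m)" by (intro frac_le mult_mono) (use fx m(1) G xy(1) G0 in simp_all)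
  finally show ?thesis .
  qed
  finally have "\<bar>iter_diff 1 z (%x. g x / f x) x\<bar> <= \<bar>g ?y - g x\<bar> / m + G * \<bar>f ?y - f x\<bar> / (m * m)" by simp
  moreover have "iter_diff 1 z g x = g ?y - g x" "iter_diff 1 z f x = f ?y - f x"
  using True by (simp_all only: iter_diff_def simp_thms if_True) (simp_all add: fdiff_def)
  ultimately show ?thesis by (simp add: power2_eq_square)
 qed (simp only: iter_diff_def if_False abs_zero abs_ge_zero)
 then have "sq (iter_diff 1 z (%x. g x / f x)) <= sq (%x. 1 / m * \<bar>iter_diff 1 z g x\<bar> + G / m^2 * \<bar>iter_diff 1 z f x\<bar>)"
  by (intro sq_mono bmeas_intros bm w g f)
 also have "... <= 2 * sq (%x. 1 / m * \<bar>iter_diff 1 z g x\<bar>) + 2 * sq (%x. G / m^2 * \<bar>iter_diff 1 z f x\<bar>)"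
  by (intro sq_add_le bmeas_intros bm w g f)
 also have "... = 2 / m^2 * sq (iter_diff 1 z g) + 2 * (G / m^2)^2 * sq (iter_diff 1 z f)" unfolding sq_cmult by (simp add: sq_def power_divide)
 also have "... <= 2 / m^2 * (Mg * \<bar>z\<bar> powr (2 * s)) + 2 * (G / m^2)^2 * (Mf * \<bar>z\<bar> powr (2 * s))"
  by (intro add_mono mult_left_mono Mg Mf z) auto
 finally show ?thesis by (simp only: distrib_right mult.assoc)
 qed
 moreover have "0 <= 2 / m^2 * Mg + 2 * (G / m^2)^2 * Mf" using Mg Mf by (intro add_nonneg_nonneg mult_nonneg_nonneg) auto
 ultimately show ?thesis by blast
qed

text \<open>The quotient inherits some smoothness above one half, possibly less than that of either function.\<close>

lemma quotient_proj_rate: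
 assumes g: "g \<in> cont_besov \<sigma>" and f: "f \<in> cont_besov \<tau>" and pos: "!!x. x \<in> {0..1} ==> 0 < f x"
 and \<sigma>: "1 / 2 < \<sigma>" and \<tau>: "1 / 2 < \<tau>" and r: "2 <= r"
 obtains s C where "1 / 2 < s" "0 <= C"
 "!!j. sq (%x. g x / f x - spline_proj r j (%x. g x / f x) x) <= C * (2 ^ j) powr (- 2 * s)"
proof -
 define s where "s = min (3 / 4) (min \<sigma> \<tau>)"
 have s: "1 / 2 < s" "0 < s" "s < 1" "s <= \<sigma>" "s <= \<tau>" using \<sigma> \<tau> by (auto simp: s_def)
 have gc: "continuous_on {0..1} g" and fc: "continuous_on {0..1} f" using g f by (auto simp: cont_besov_def)
 obtain Mg where Mg: "0 <= Mg" "!!z. z ~= 0 ==> \<bar>z\<bar> < 1 ==> sq (iter_diff 1 z g) <= Mg * \<bar>z\<bar> powr (2 * s)"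
 using cont_besov_first_differences[OF g s(2,3,4)] by blast
 obtain Mf where Mf: "0 <= Mf" "!!z. z ~= 0 ==> \<bar>z\<bar> < 1 ==> sq (iter_diff 1 z f) <= Mf * \<bar>z\<bar> powr (2 * s)"
 using cont_besov_first_differences[OF f s(2,3,5)] by blast
 obtain M where M: "0 <= M"
 "!!z. z ~= 0 ==> \<bar>z\<bar> < 1 ==> sq (iter_diff 1 z (%x. g x / f x)) <= M * \<bar>z\<bar> powr (2 * s)"
 using quotient_first_differences[OF gc fc pos Mg Mf] by blast
 have "continuous_on {0..1} (%x. g x / f x)" using pos by (intro continuous_on_divide gc fc) (auto simp: less_le)
 from spline_proj_rates(1)[OF this r _ _ _ M] obtain C where "0 <= C"
 "\<forall>j. sq (%x. g x / f x - spline_proj r j (%x. g x / f x) x) <= C * (2 ^ j) powr (- 2 * s)" using r s by auto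
 then show ?thesis using s(1) by (intro that[of s C]) auto
qed

section \<open>Gradients and Hessians as measurable functions\<close>

lemma differentiable_GDERIV:
 fixes f :: "real ^ 'b => real"
 assumes "f differentiable (at \<theta>)"
 shows "GDERIV f \<theta> :> gradient f \<theta>"
proof -
 obtain f' where f': "(f has_derivative f') (at \<theta>)" using assms unfolding differentiable_def by blast
 then have lin: "linear f'" by (rule has_derivative_linear)
 have "f' = (%h. h \<bullet> (\<Sum>b\<in>Basis. f' b *\<^sub>R b))"
 proof
 fix h
 have "f' h = f' (\<Sum>b\<in>Basis. (h \<bullet> b) *\<^sub>R b)" by (simp only: euclidean_representation)
 also have "... = (\<Sum>b\<in>Basis. (h \<bullet> b) * f' b)" using lin by (simp add: linear_sum linear_scale)
 also have "... = h \<bullet> (\<Sum>b\<in>Basis. f' b *\<^sub>R b)" by (simp add: inner_sum_right mult.commute)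
 finally show "f' h = h \<bullet> (\<Sum>b\<in>Basis. f' b *\<^sub>R b)" .
 qed
 then have "GDERIV f \<theta> :> (\<Sum>b\<in>Basis. f' b *\<^sub>R b)" using f' unfolding gderiv_def by metis
 then show ?thesis using gradient_eqI by metis
qed

lemma C2_on_ballD:
 fixes f :: "real ^ 'b => real"
 assumes "C2_on U f" "open U" "\<theta> \<in> U"
 shows "(f has_derivative (%h. h \<bullet> gradient f \<theta>)) (at \<theta>)"
 and "(gradient f has_derivative (%h. hessian f \<theta> *v h)) (at \<theta>)"
proof -
 have "f differentiable (at \<theta>)" "gradient f differentiable (at \<theta>)"
 using assms unfolding C2_on_def by (auto simp: differentiable_on_eq_differentiable_at)
 then show "(f has_derivative (%h. h \<bullet> gradient f \<theta>)) (at \<theta>)"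
 "(gradient f has_derivative (%h. hessian f \<theta> *v h)) (at \<theta>)" using differentiable_GDERIV[of f \<theta>] unfolding gderiv_def hessian_def
 by (auto simp: jacobian_works)
qed

lemma line_has_derivative:
 fixes F :: "real ^ 'b => 'c::real_normed_vector"
 assumes "(F has_derivative F') (at (\<theta> + t *\<^sub>R h))"
 shows "((%s. F (\<theta> + s *\<^sub>R h)) has_derivative (%s. F' (s *\<^sub>R h))) (at t)"
proof -
 have "((%s. \<theta> + s *\<^sub>R h) has_derivative (%s. s *\<^sub>R h)) (at t)" using has_derivative_add[OF has_derivative_const[of \<theta>]
  bounded_linear.has_derivative[OF bounded_linear_scaleR_left has_derivative_ident]] by simp
 from has_derivative_compose[OF this, of F F', OF assms] show ?thesis .
qed

lemma difference_quotient_tendsto: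
 fixes F :: "real ^ 'b => 'c::real_normed_vector"
 assumes "(F has_derivative F') (at \<theta>)"
 shows "(%n. real (Suc n) *\<^sub>R (F (\<theta> + (1 / real (Suc n)) *\<^sub>R v) - F \<theta>)) ---> F' v"
proof -
 have "((%s. F (\<theta> + s *\<^sub>R v)) has_derivative (%s. F' (s *\<^sub>R v))) (at 0)" by (rule line_has_derivative) (use assms in simp)
 then have L: "(%s. norm (F (\<theta> + s *\<^sub>R v) - F \<theta> - F' (s *\<^sub>R v)) / norm s) \<midarrow>0\<rightarrow> 0"
 unfolding has_derivative_at by simp
 have eq: "norm (F (\<theta> + s *\<^sub>R v) - F \<theta> - F' (s *\<^sub>R v)) / norm s = norm ((F (\<theta> + s *\<^sub>R v) - F \<theta>) /\<^sub>R s - F' v)"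
 if "s ~= 0" for s :: real
 proof -
 have "F' (s *\<^sub>R v) = s *\<^sub>R F' v" by (rule linear_scale[OF has_derivative_linear[OF assms]])
 then have "(F (\<theta> + s *\<^sub>R v) - F \<theta>) /\<^sub>R s - F' v = (F (\<theta> + s *\<^sub>R v) - F \<theta> - F' (s *\<^sub>R v)) /\<^sub>R s"
  unfolding scaleR_diff_right using that by simp
 then have "norm ((F (\<theta> + s *\<^sub>R v) - F \<theta>) /\<^sub>R s - F' v) = \<bar>inverse s\<bar> * norm (F (\<theta> + s *\<^sub>R v) - F \<theta> - F' (s *\<^sub>R v))"
  by (simp only: norm_scaleR)
 then show ?thesis unfolding divide_inverse real_norm_def abs_inverse by (simp only: mult.commute)
 qed
 have "(%s. norm ((F (\<theta> + s *\<^sub>R v) - F \<theta>) /\<^sub>R s - F' v)) \<midarrow>0\<rightarrow> 0"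
 by (rule iffD1[OF LIM_equal L]) (intro allI impI, rule eq)
 then have lim: "((%s. (F (\<theta> + s *\<^sub>R v) - F \<theta>) /\<^sub>R s) \<longlongrightarrow> F' v) (at 0)"
 by (rule LIM_zero_cancel[OF tendsto_norm_zero_cancel])
 have "filterlim (%n. 1 / real (Suc n)) (at 0) sequentially" by (rule filterlim_atI[OF LIMSEQ_Suc[OF lim_1_over_n]]) simp
 from filterlim_compose[OF lim this]
 have "(%n. (F (\<theta> + (1 / real (Suc n)) *\<^sub>R v) - F \<theta>) /\<^sub>R (1 / real (Suc n))) ---> F' v" .
 then show ?thesis by (simp del: of_nat_Suc)
qed

lemma measurable_by_difference_quotients:
 fixes F :: "real ^ 'b => real => 'c::euclidean_space"
 assumes U: "open U" "\<theta> \<in> U" and m: "!!\<theta>. \<theta> \<in> U ==> F \<theta> \<in> borel_measurable lborel01"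
 and d: "!!x. x \<in> {0..1} ==> ((%\<theta>. F \<theta> x) has_derivative F' x) (at \<theta>)"
 shows "(%x. F' x v) \<in> borel_measurable lborel01"
proof -
 let ?t = "%n. \<theta> + (1 / real (Suc n)) *\<^sub>R v"
 have "?t ---> \<theta> + 0 *\<^sub>R v" by (rule tendsto_add[OF tendsto_const tendsto_scaleR[OF LIMSEQ_Suc[OF lim_1_over_n] tendsto_const]])
 then have "\<forall>\<^sub>F n in sequentially. ?t n \<in> U" using topological_tendstoD[of ?t "\<theta> + 0 *\<^sub>R v" sequentially U] U by simp
 then obtain N where N: "!!n. N <= n ==> ?t n \<in> U" unfolding eventually_sequentially by blast
 show ?thesis
 proof (rule borel_measurable_LIMSEQ_metric)
 show "(%x. real (Suc (n + N)) *\<^sub>R (F (?t (n + N)) x - F \<theta> x)) \<in> borel_measurable lborel01" for n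
  by (rule borel_measurable_scaleR[OF borel_measurable_const borel_measurable_diff[OF m[OF N] m[OF U(2)]]]) simp
 fix x assume "x \<in> space lborel01"
 then show "(%n. real (Suc (n + N)) *\<^sub>R (F (?t (n + N)) x - F \<theta> x)) ---> F' x v"
  using LIMSEQ_ignore_initial_segment[OF difference_quotient_tendsto[OF d, of x v], of N] by (simp only: space_lborel01)
 qed
qed

lemma borel_measurable_vecI:
 fixes f :: "'a => ('c::euclidean_space) ^ 'b"
 assumes "!!i. (%x. f x $ i) \<in> borel_measurable M"
 shows "f \<in> borel_measurable M"
proof (subst borel_measurable_euclidean_space, rule ballI)
 fix b :: "'c ^ 'b" assume "b \<in> Basis"
 then obtain i u where "b = axis i u" by (auto simp: Basis_vec_def)
 then show "(%x. f x \<bullet> b) \<in> borel_measurable M" using assms[of i] by (simp add: inner_axis)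
qed

lemma SUP_countable_dense:
 fixes F :: "real ^ 'b => real"
 assumes U: "open U" and D: "!!X. open X ==> X ~= {} ==> \<exists>d\<in>D. d \<in> X" and c: "continuous_on U F"
 shows "(SUP \<theta>\<in>U. ennreal (F \<theta>)) = (SUP \<theta>\<in>D \<inter> U. ennreal (F \<theta>))"
proof (rule antisym)
 let ?S = "SUP \<theta>\<in>D \<inter> U. ennreal (F \<theta>)"
 show "(SUP \<theta>\<in>U. ennreal (F \<theta>)) <= ?S"
 proof (rule SUP_least, rule ccontr)
 fix \<theta> assume "\<theta> \<in> U" "\<not> ennreal (F \<theta>) <= ?S"
 let ?X = "(%\<theta>. ennreal (F \<theta>)) -` {?S<..} \<inter> U"
 have "open ?X" using continuous_on_ennreal[OF c] U by (simp add: continuous_on_open_vimage)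
 moreover have "\<theta> \<in> ?X" using \<open>\<theta> \<in> U\<close> \<open>\<not> ennreal (F \<theta>) <= ?S\<close> by simp
 ultimately obtain d where "d \<in> D" "d \<in> ?X" using D by blast
 then have "ennreal (F d) <= ?S" by (intro SUP_upper) auto
 then show False using \<open>d \<in> ?X\<close> by auto
 qed
qed (rule SUP_subset_mono, auto)

lemma onorm_matrix_continuous: "continuous_on UNIV (%A :: real ^ 'b ^ 'b. onorm ((*v) A))"
proof -
 let ?C = "real (CARD('b) * CARD('b))"
 have le: "onorm ((*v) A) <= onorm ((*v) B) + ?C * norm (A - B)" for A B :: "real ^ 'b ^ 'b"
 proof -
 have "onorm ((*v) A) = onorm (%v. B *v v + (A - B) *v v)" by (simp add: matrix_vector_mult_diff_rdistrib)
 also have "... <= onorm ((*v) B) + onorm ((*v) (A - B))" by (rule onorm_triangle) auto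
 also have "onorm ((*v) (A - B)) <= (\<Sum>i\<in>UNIV. \<Sum>j\<in>UNIV. \<bar>(A - B) $ i $ j\<bar>)" by (rule onorm_le_matrix_component_sum)
 also have "... <= (\<Sum>i\<in>(UNIV :: 'b set). \<Sum>j\<in>(UNIV :: 'b set). norm (A - B))"
  by (intro sum_mono order_trans[OF component_le_norm_cart Finite_Cartesian_Product.norm_nth_le])
 also have "... = ?C * norm (A - B)" by simp
 finally show ?thesis by simp
 qed
 have "?C-lipschitz_on UNIV (%A :: real ^ 'b ^ 'b. onorm ((*v) A))"
 proof (rule lipschitz_onI)
 fix A B :: "real ^ 'b ^ 'b"
 show "dist (onorm ((*v) A)) (onorm ((*v) B)) <= ?C * dist A B" using le[of A B] le[of B A] by (simp add: dist_norm norm_minus_commute abs_le_iff)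
 qed simp
 then show ?thesis by (rule lipschitz_on_continuous_on)
qed

text \<open>The supremum over the ball of a function that is continuous in the parameter is a countable
 supremum, hence measurable; a finite integral then gives an integrable majorant.\<close>

lemma integrable_majorant:
 fixes F :: "real ^ 'b => real => real"
 assumes U: "open U" and m: "!!\<theta>. \<theta> \<in> U ==> F \<theta> \<in> borel_measurable lborel01"
 and c: "!!x. x \<in> {0..1} ==> continuous_on U (%\<theta>. F \<theta> x)"
 and fin: "(\<integral>\<^sup>+x. (SUP \<theta>\<in>U. ennreal (F \<theta> x)) \<partial>lborel01) < \<infinity>"
 obtains H where "integrable lborel01 H" "!!x. 0 <= H x" "AE x in lborel01. \<forall>\<theta>\<in>U. F \<theta> x <= H x"
proof -
 obtain D :: "(real ^ 'b) set" where D: "countable D" "!!X. open X ==> X ~= {} ==> \<exists>d\<in>D. d \<in> X" by (rule countable_dense_setE) (rule that)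
 define S where "S x = (SUP \<theta>\<in>D \<inter> U. ennreal (F \<theta> x))" for x
 have eq: "(SUP \<theta>\<in>U. ennreal (F \<theta> x)) = S x" if "x \<in> {0..1}" for x
 unfolding S_def by (rule SUP_countable_dense[OF U D(2) c[OF that]])
 have Sm[measurable]: "S \<in> borel_measurable lborel01" unfolding S_def[abs_def] using D(1) m by (intro borel_measurable_SUP) auto
 have "(\<integral>\<^sup>+x. S x \<partial>lborel01) = (\<integral>\<^sup>+x. (SUP \<theta>\<in>U. ennreal (F \<theta> x)) \<partial>lborel01)"
 by (rule nn_integral_cong) (simp add: eq)
 then have fin': "(\<integral>\<^sup>+x. S x \<partial>lborel01) < \<infinity>" using fin by simp
 then have AE: "AE x in lborel01. S x ~= \<infinity>" by (intro nn_integral_PInf_AE) auto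
 define H where "H x = enn2real (S x)" for x
 have "(\<integral>\<^sup>+x. ennreal (H x) \<partial>lborel01) = (\<integral>\<^sup>+x. S x \<partial>lborel01)"
 by (rule nn_integral_cong_AE) (use AE in \<open>auto simp: H_def top.not_eq_extremum elim!: AE_mp\<close>)
 then have "integrable lborel01 H" using fin' by (intro integrableI_nonneg) (auto simp: H_def[abs_def])
 moreover have "AE x in lborel01. \<forall>\<theta>\<in>U. F \<theta> x <= H x" using AE AE_space
 proof eventually_elim
 case (elim x)
 show ?case
 proof
  fix \<theta> assume "\<theta> \<in> U"
  then have "ennreal (F \<theta> x) <= S x" using eq[of x] elim(2) by (metis SUP_upper space_lborel01)
  also have "S x = ennreal (H x)" using elim(1) by (simp add: H_def top.not_eq_extremum)
  finally show "F \<theta> x <= H x" by (simp add: H_def ennreal_le_iff)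
 qed
 qed
 ultimately show ?thesis by (intro that[of H]) (auto simp: H_def)
qed

lemma posdef_coercive:
 fixes J :: "real ^ 'b ^ 'b"
 assumes "pos_def J"
 obtains c where "0 < c" "!!h. c * (norm h)^2 <= h \<bullet> (J *v h)"
proof -
 let ?f = "%h. h \<bullet> (J *v h)"
 have c: "continuous_on (sphere 0 1) ?f" by (intro continuous_intros matrix_vector_mult_linear_continuous_on)
 have ne: "sphere 0 1 ~= ({} :: (real ^ 'b) set)" by (simp add: sphere_eq_empty)
 obtain u where u: "u \<in> sphere 0 1" "!!h. h \<in> sphere 0 1 ==> ?f u <= ?f h" using continuous_attains_inf[OF compact_sphere ne c] by blast
 have "u ~= 0" using u(1) by auto
 then have pos: "0 < ?f u" using assms by (auto simp: pos_def_def)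
 have "?f u * (norm h)^2 <= ?f h" for h
 proof (cases "h = 0")
 case False
 have "?f u <= ?f (h /\<^sub>R norm h)" by (rule u(2)) (use False in simp)
 also have "... = ?f h / (norm h)^2" by (simp add: matrix_vector_mult_scaleR power2_eq_square divide_inverse)
 finally show ?thesis using False by (simp add: pos_le_divide_eq)
 qed simp
 then show ?thesis using pos that by blast
qed

text \<open>Comparing the values of the objective at its minimizer and at the minimizer of the quadratic suffices,
 since the quadratic grows away from its minimum.\<close>

lemma near_quadratic_minimizer:
 fixes J :: "real ^ 'b ^ 'b"
 assumes sym: "transpose J = J" and co: "!!h. c * (norm h)^2 <= h \<bullet> (J *v h)" and c: "0 < c" and eps: "0 <= \<epsilon>" "4 * \<epsilon> <= c"
 and hs: "J *v k = - G" and \<Psi>h: "\<bar>\<Psi> h - (2 * (G \<bullet> h) + h \<bullet> (J *v h))\<bar> <= \<epsilon> * (norm h)^2"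
 and \<Psi>k: "\<bar>\<Psi> k - (2 * (G \<bullet> k) + k \<bullet> (J *v k))\<bar> <= \<epsilon> * (norm k)^2" and min: "\<Psi> h <= \<Psi> k"
 shows "(norm (h - k))^2 <= 6 * \<epsilon> / c * (norm k)^2"
proof -
 have symm: "x \<bullet> (J *v y) = y \<bullet> (J *v x)" for x y
 proof -
 have "x \<bullet> (J *v y) = (transpose J *v x) \<bullet> y" by (simp add: dot_lmul_matrix[symmetric] transpose_matrix_vector)
 then show ?thesis by (simp add: sym inner_commute)
 qed
 have G: "G = - (J *v k)" using hs by simp
 have quad: "(h - k) \<bullet> (J *v (h - k)) = (2 * (G \<bullet> h) + h \<bullet> (J *v h)) - (2 * (G \<bullet> k) + k \<bullet> (J *v k))"
 unfolding G using symm[of h k] by (simp add: matrix_vector_mult_diff_distrib inner_diff_left inner_diff_right inner_commute)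
 have "norm h <= norm (h - k) + norm k" using norm_triangle_ineq[of "h - k" k] by simp
 then have "(norm h)^2 <= (norm (h - k) + norm k)^2" by (intro power_mono) auto
 also have "... <= 2 * (norm (h - k))^2 + 2 * (norm k)^2" by (rule sum_sq_le)
 finally have nh: "\<epsilon> * (norm h)^2 <= \<epsilon> * (2 * (norm (h - k))^2 + 2 * (norm k)^2)" by (rule mult_left_mono) (rule eps)
 have "c * (norm (h - k))^2 <= \<epsilon> * (norm h)^2 + \<epsilon> * (norm k)^2" using co[of "h - k"] quad \<Psi>h \<Psi>k min by linarith
 then have "c * (norm (h - k))^2 <= 2 * \<epsilon> * (norm (h - k))^2 + 3 * \<epsilon> * (norm k)^2" using nh by (simp add: algebra_simps)
 moreover have "2 * \<epsilon> * (norm (h - k))^2 <= c / 2 * (norm (h - k))^2" using eps by (intro mult_right_mono) auto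
 ultimately have "c / 2 * (norm (h - k))^2 <= 3 * \<epsilon> * (norm k)^2" by linarith
 then show ?thesis using c by (simp add: field_simps)
qed

section \<open>Minimisers of the weighted distance\<close>

lemma taylor_bounds:
 fixes F :: "real ^ 'b => real"
 assumes C2: "C2_on (ball \<theta>0 \<rho>) F" and h: "norm h < \<rho>"
 and D: "!!\<theta>. \<theta> \<in> ball \<theta>0 \<rho> ==> (norm (gradient F \<theta>))^2 <= D"
 and H: "!!\<theta>. \<theta> \<in> ball \<theta>0 \<rho> ==> onorm ((*v) (hessian F \<theta>)) <= H"
 shows "(F (\<theta>0 + h) - F \<theta>0)^2 <= (norm h)^2 * D"
 and "\<bar>F (\<theta>0 + h) - F \<theta>0 - h \<bullet> gradient F \<theta>0\<bar> <= (norm h)^2 * H"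
proof -
 have inb: "\<theta>0 + t *\<^sub>R h \<in> ball \<theta>0 \<rho>" if "0 <= t" "t <= 1" for t
 proof -
 have "\<bar>t\<bar> * norm h <= 1 * norm h" using that by (intro mult_right_mono) auto
 then show ?thesis using h by (simp add: dist_norm)
 qed
 have d1: "((%s. F (\<theta>0 + s *\<^sub>R h)) has_real_derivative h \<bullet> gradient F (\<theta>0 + t *\<^sub>R h)) (at t)" if "0 <= t" "t <= 1" for t
 by (rule has_derivative_imp_has_field_derivative[OF line_has_derivative[OF C2_on_ballD(1)[OF C2 open_ball inb[OF that]]]])
  (simp only: inner_scaleR_left mult.commute)
 have d2: "((%s. h \<bullet> gradient F (\<theta>0 + s *\<^sub>R h)) has_real_derivative h \<bullet> (hessian F (\<theta>0 + t *\<^sub>R h) *v h)) (at t)"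
 if "0 <= t" "t <= 1" for t
 proof -
 have "((%s. gradient F (\<theta>0 + s *\<^sub>R h)) has_derivative (%s. hessian F (\<theta>0 + t *\<^sub>R h) *v (s *\<^sub>R h))) (at t)"
  by (rule line_has_derivative[OF C2_on_ballD(2)[OF C2 open_ball inb[OF that]]])
 from has_derivative_inner_right[OF this, of h] show ?thesis by (rule has_derivative_imp_has_field_derivative)
  (simp only: matrix_vector_mult_scaleR inner_scaleR_right mult.commute)
 qed
 obtain t where t: "0 < t" "t < 1" "F (\<theta>0 + 1 *\<^sub>R h) - F (\<theta>0 + 0 *\<^sub>R h) = (1 - 0) * (h \<bullet> gradient F (\<theta>0 + t *\<^sub>R h))"
 using MVT2[of 0 1 "%s. F (\<theta>0 + s *\<^sub>R h)" "%t. h \<bullet> gradient F (\<theta>0 + t *\<^sub>R h)"] d1 by auto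
 then have Fd: "F (\<theta>0 + h) - F \<theta>0 = h \<bullet> gradient F (\<theta>0 + t *\<^sub>R h)" by simp
 have "\<bar>F (\<theta>0 + h) - F \<theta>0\<bar> <= norm h * norm (gradient F (\<theta>0 + t *\<^sub>R h))" unfolding Fd by (rule Cauchy_Schwarz_ineq2)
 from power_mono[OF this abs_ge_zero, of 2]
 have "(F (\<theta>0 + h) - F \<theta>0)^2 <= (norm h)^2 * (norm (gradient F (\<theta>0 + t *\<^sub>R h)))^2" by (simp add: power_mult_distrib)
 also have "... <= (norm h)^2 * D" using t by (intro mult_left_mono D inb) auto
 finally show "(F (\<theta>0 + h) - F \<theta>0)^2 <= (norm h)^2 * D" .
 obtain u where u: "0 < u" "u < t" "h \<bullet> gradient F (\<theta>0 + t *\<^sub>R h) - h \<bullet> gradient F (\<theta>0 + 0 *\<^sub>R h)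
  = (t - 0) * (h \<bullet> (hessian F (\<theta>0 + u *\<^sub>R h) *v h))"
 using MVT2[of 0 t "%s. h \<bullet> gradient F (\<theta>0 + s *\<^sub>R h)" "%u. h \<bullet> (hessian F (\<theta>0 + u *\<^sub>R h) *v h)"] d2 t by auto
 have ub: "\<theta>0 + u *\<^sub>R h \<in> ball \<theta>0 \<rho>" using u t by (intro inb) auto
 have "\<bar>h \<bullet> (hessian F (\<theta>0 + u *\<^sub>R h) *v h)\<bar> <= norm h * norm (hessian F (\<theta>0 + u *\<^sub>R h) *v h)"
 by (rule Cauchy_Schwarz_ineq2)
 also have "... <= norm h * (onorm ((*v) (hessian F (\<theta>0 + u *\<^sub>R h))) * norm h)" by (intro mult_left_mono onorm) auto
 also have "... <= norm h * (H * norm h)" by (intro mult_left_mono mult_right_mono H ub) auto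
 finally have q: "\<bar>h \<bullet> (hessian F (\<theta>0 + u *\<^sub>R h) *v h)\<bar> <= (norm h)^2 * H" by (simp add: power2_eq_square mult_ac)
 have "\<bar>F (\<theta>0 + h) - F \<theta>0 - h \<bullet> gradient F \<theta>0\<bar> = t * \<bar>h \<bullet> (hessian F (\<theta>0 + u *\<^sub>R h) *v h)\<bar>"
 using u t by (simp add: Fd abs_mult)
 also have "... <= 1 * \<bar>h \<bullet> (hessian F (\<theta>0 + u *\<^sub>R h) *v h)\<bar>" using t by (intro mult_right_mono) auto
 finally show "\<bar>F (\<theta>0 + h) - F \<theta>0 - h \<bullet> gradient F \<theta>0\<bar> <= (norm h)^2 * H" using q by simp
qed

locale density_family =
 fixes \<Theta> :: "(real ^ 'b) set" and p :: "real ^ 'b => real => real" and \<theta>0 :: "real ^ 'b" and \<rho> :: real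
 assumes compact_\<Theta>: "compact \<Theta>" and \<theta>0_in: "\<theta>0 \<in> \<Theta>"
 and identifiable: "!!\<theta>. \<theta> \<in> \<Theta> ==> AE x in lborel01. p \<theta> x = p \<theta>0 x ==> \<theta> = \<theta>0"
 and cont_\<theta>: "!!x. x \<in> {0..1} ==> continuous_on \<Theta> (%\<theta>. p \<theta> x)"
 and cont_x: "!!\<theta>. \<theta> \<in> \<Theta> ==> continuous_on {0..1} (p \<theta>)"
 and mass: "!!\<theta>. \<theta> \<in> \<Theta> ==> (I01 x. p \<theta> x) = 1" and pos: "!!x. x \<in> {0..1} ==> 0 < p \<theta>0 x"
 and \<rho>: "0 < \<rho>" "ball \<theta>0 \<rho> \<subseteq> \<Theta>"
 and C2: "!!x. x \<in> {0..1} ==> C2_on (ball \<theta>0 \<rho>) (%\<theta>. p \<theta> x)"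
 and fin_gradient: "(\<integral>\<^sup>+x. (SUP \<theta>\<in>ball \<theta>0 \<rho>. ennreal ((norm (gradient (%\<theta>. p \<theta> x) \<theta>))^2)) \<partial>lborel01) < \<infinity>"
 and fin_hessian: "(\<integral>\<^sup>+x. (SUP \<theta>\<in>ball \<theta>0 \<rho>. ennreal (onorm ((*v) (hessian (%\<theta>. p \<theta> x) \<theta>)))) \<partial>lborel01) < \<infinity>"
 and cont_gradient: "!!i. continuous_on {0..1} (%x. gradient (%\<theta>. p \<theta> x) \<theta>0 $ i)"
 and posdef: "pos_def (information_matrix p \<theta>0)"
begin

definition grad0 :: "real => real ^ 'b" where
 "grad0 x = gradient (%\<theta>. p \<theta> x) \<theta>0"

abbreviation J :: "real ^ 'b ^ 'b" where "J \<equiv> information_matrix p \<theta>0"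

lemma bmeas_p: "\<theta> \<in> \<Theta> ==> bmeas (p \<theta>)" by (rule bmeas_continuous_on[OF cont_x])

lemma cont_grad0: "continuous_on {0..1} (%x. grad0 x $ i)" unfolding grad0_def by (rule cont_gradient)

lemma inner_grad0: "h \<bullet> grad0 x = (\<Sum>i\<in>UNIV. h $ i * grad0 x $ i)" by (simp add: inner_vec_def)

lemma cont_inner_grad0: "continuous_on {0..1} (%x. h \<bullet> grad0 x)" unfolding inner_grad0 by (intro continuous_intros cont_grad0)

lemma in_\<Theta>: "norm h < \<rho> ==> \<theta>0 + h \<in> \<Theta>" using \<rho>(2) by (auto simp: dist_norm)

lemma gradient_measurable:
 assumes "\<theta> \<in> ball \<theta>0 \<rho>" shows "(%x. gradient (%\<theta>. p \<theta> x) \<theta>) \<in> borel_measurable lborel01"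
proof (rule borel_measurable_vecI)
 fix i
 have "(%x. axis i 1 \<bullet> gradient (%\<theta>. p \<theta> x) \<theta>) \<in> borel_measurable lborel01"
 by (rule measurable_by_difference_quotients[OF open_ball assms _ C2_on_ballD(1)[OF C2 open_ball assms]])
  (use bmeas_measurable[OF bmeas_p] \<rho>(2) in auto)
 then show "(%x. gradient (%\<theta>. p \<theta> x) \<theta> $ i) \<in> borel_measurable lborel01" by (simp add: inner_axis inner_commute[of "axis i 1"])
qed

lemma hessian_measurable:
 assumes "\<theta> \<in> ball \<theta>0 \<rho>" shows "(%x. hessian (%\<theta>. p \<theta> x) \<theta>) \<in> borel_measurable lborel01"
proof (rule borel_measurable_vecI, rule borel_measurable_vecI)
 fix i k
 have "(%x. hessian (%\<theta>. p \<theta> x) \<theta> *v axis k 1) \<in> borel_measurable lborel01"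
 by (rule measurable_by_difference_quotients[OF open_ball assms gradient_measurable C2_on_ballD(2)[OF C2 open_ball assms]])
 from borel_measurable_inner[OF this borel_measurable_const[of "axis i 1"]]
 show "(%x. hessian (%\<theta>. p \<theta> x) \<theta> $ i $ k) \<in> borel_measurable lborel01"
 by (simp add: inner_axis matrix_vector_mult_basis column_def)
qed

lemma majorants:
 obtains D H where "integrable lborel01 D" "integrable lborel01 H" "!!x. 0 <= D x" "!!x. 0 <= H x"
 "AE x in lborel01. \<forall>h. norm h < \<rho> --> (p (\<theta>0 + h) x - p \<theta>0 x)^2 <= (norm h)^2 * D x
  & \<bar>p (\<theta>0 + h) x - p \<theta>0 x - h \<bullet> grad0 x\<bar> <= (norm h)^2 * H x & (h \<bullet> grad0 x)^2 <= (norm h)^2 * D x"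
proof -
 have c1: "continuous_on (ball \<theta>0 \<rho>) (%\<theta>. (norm (gradient (%\<theta>. p \<theta> x) \<theta>))\<^sup>2)" if "x \<in> {0..1}" for x
 by (intro continuous_on_power continuous_on_norm differentiable_imp_continuous_on) (use C2[OF that] in \<open>simp add: C2_on_def\<close>)
 have c2: "continuous_on (ball \<theta>0 \<rho>) (%\<theta>. onorm ((*v) (hessian (%\<theta>. p \<theta> x) \<theta>)))" if "x \<in> {0..1}" for x
 by (rule continuous_on_compose2[OF onorm_matrix_continuous]) (use C2[OF that] in \<open>auto simp: C2_on_def\<close>)
 have m1: "(%x. (norm (gradient (%\<theta>. p \<theta> x) \<theta>))\<^sup>2) \<in> borel_measurable lborel01" if "\<theta> \<in> ball \<theta>0 \<rho>" for \<theta>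
 using measurable_compose[OF gradient_measurable[OF that], of "%v. (norm v)\<^sup>2" borel] by simp
 have m2: "(%x. onorm ((*v) (hessian (%\<theta>. p \<theta> x) \<theta>))) \<in> borel_measurable lborel01" if "\<theta> \<in> ball \<theta>0 \<rho>" for \<theta>
 by (rule measurable_compose[OF hessian_measurable[OF that] meas_contI[OF onorm_matrix_continuous]])
 obtain D where D: "integrable lborel01 D" "!!x. 0 <= D x"
 "AE x in lborel01. \<forall>\<theta>\<in>ball \<theta>0 \<rho>. (norm (gradient (%\<theta>. p \<theta> x) \<theta>))\<^sup>2 <= D x"
 using integrable_majorant[OF open_ball m1 c1 fin_gradient] by blast
 obtain H where H: "integrable lborel01 H" "!!x. 0 <= H x"
 "AE x in lborel01. \<forall>\<theta>\<in>ball \<theta>0 \<rho>. onorm ((*v) (hessian (%\<theta>. p \<theta> x) \<theta>)) <= H x"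
 using integrable_majorant[OF open_ball m2 c2 fin_hessian] by blast
 have "AE x in lborel01. \<forall>h. norm h < \<rho> --> (p (\<theta>0 + h) x - p \<theta>0 x)^2 <= (norm h)^2 * D x
  & \<bar>p (\<theta>0 + h) x - p \<theta>0 x - h \<bullet> grad0 x\<bar> <= (norm h)^2 * H x & (h \<bullet> grad0 x)^2 <= (norm h)^2 * D x"
 using D(3) H(3) AE_space
 proof eventually_elim
 case (elim x)
 have x: "x \<in> {0..1}" using elim(3) by simp
 show ?case
 proof (intro allI impI)
  fix h :: "real ^ 'b" assume h: "norm h < \<rho>"
  have "\<bar>h \<bullet> grad0 x\<bar> <= norm h * norm (grad0 x)" by (rule Cauchy_Schwarz_ineq2)
  from power_mono[OF this abs_ge_zero, of 2]
  have "(h \<bullet> grad0 x)^2 <= (norm h)^2 * (norm (grad0 x))^2" by (simp add: power_mult_distrib)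
  also have "... <= (norm h)^2 * D x" using elim(1) \<rho>(1) by (intro mult_left_mono) (auto simp: grad0_def)
  finally have "(h \<bullet> grad0 x)^2 <= (norm h)^2 * D x" .
  then show "(p (\<theta>0 + h) x - p \<theta>0 x)^2 <= (norm h)^2 * D x
  & \<bar>p (\<theta>0 + h) x - p \<theta>0 x - h \<bullet> grad0 x\<bar> <= (norm h)^2 * H x & (h \<bullet> grad0 x)^2 <= (norm h)^2 * D x"
  using taylor_bounds[OF C2[OF x] h, of "D x" "H x"] elim by (auto simp: grad0_def)
 qed
 qed
 then show ?thesis using D H that by blast
qed

lemma integral_inner_grad0: "(I01 x. h \<bullet> grad0 x) = 0"
proof -
 obtain D H where H: "integrable lborel01 H" "!!x. 0 <= H x"
 and AE: "AE x in lborel01. \<forall>h. norm h < \<rho> --> (p (\<theta>0 + h) x - p \<theta>0 x)^2 <= (norm h)^2 * D x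
  & \<bar>p (\<theta>0 + h) x - p \<theta>0 x - h \<bullet> grad0 x\<bar> <= (norm h)^2 * H x & (h \<bullet> grad0 x)^2 <= (norm h)^2 * D x"
 by (rule majorants) (rule that)
 let ?K = "(norm h)^2 * (I01 x. H x)"
 let ?a = "\<integral>x. h \<bullet> grad0 x \<partial>lborel01"
 have bg: "bmeas (%x. h \<bullet> grad0 x)" for h by (rule bmeas_continuous_on[OF cont_inner_grad0])
 have small: "\<bar>?a\<bar> <= s * ?K" if s: "0 < s" "s * norm h < \<rho>" for s
 proof -
 have ns: "norm (s *\<^sub>R h) < \<rho>" using s by simp
 have bp: "bmeas (%x. p (\<theta>0 + s *\<^sub>R h) x - p \<theta>0 x)" by (intro bmeas_diff bmeas_p in_\<Theta>[OF ns] \<theta>0_in)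
 have "(I01 x. p (\<theta>0 + s *\<^sub>R h) x - p \<theta>0 x) = 0" using mass[OF in_\<Theta>[OF ns]] mass[OF \<theta>0_in]
  by (simp add: bmeas_integrable bmeas_p in_\<Theta>[OF ns] \<theta>0_in)
 then have "(I01 x. (p (\<theta>0 + s *\<^sub>R h) x - p \<theta>0 x) - (s *\<^sub>R h) \<bullet> grad0 x) = - (s * ?a)"
  unfolding lint_diff[OF bmeas_integrable[OF bp] bmeas_integrable[OF bg]] by simp
 then have "s * \<bar>?a\<bar> = \<bar>\<integral>x. (p (\<theta>0 + s *\<^sub>R h) x - p \<theta>0 x) - (s *\<^sub>R h) \<bullet> grad0 x \<partial>lborel01\<bar>"
  using s by (simp add: abs_mult)
 also have "... <= (I01 x. \<bar>(p (\<theta>0 + s *\<^sub>R h) x - p \<theta>0 x) - (s *\<^sub>R h) \<bullet> grad0 x\<bar>)" by (rule integral_abs_bound)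
 also have "... <= (I01 x. (norm (s *\<^sub>R h))\<^sup>2 * H x)"
 proof (rule integral_mono_AE)
  show "integrable lborel01 (%x. \<bar>(p (\<theta>0 + s *\<^sub>R h) x - p \<theta>0 x) - (s *\<^sub>R h) \<bullet> grad0 x\<bar>)"
  by (intro bmeas_integrable bmeas_abs bmeas_diff bp bg)
  show "AE x in lborel01. \<bar>(p (\<theta>0 + s *\<^sub>R h) x - p \<theta>0 x) - (s *\<^sub>R h) \<bullet> grad0 x\<bar> <= (norm (s *\<^sub>R h))^2 * H x"
  using AE by eventually_elim (use ns in blast)
 qed (intro integrable_mult_right H)
 also have "... = s * (s * ?K)" using s by (simp add: power_mult_distrib power2_eq_square mult_ac)
 finally show ?thesis by (rule mult_left_le_imp_le) (rule s(1))
 qed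
 have "((%s. s * ?K) \<longlongrightarrow> 0 * ?K) (at_right 0)" by (intro tendsto_intros)
 moreover have "\<forall>\<^sub>F s in at_right 0. \<bar>?a\<bar> <= s * ?K"
 proof -
 have "((%s. s * norm h) \<longlongrightarrow> 0 * norm h) (at_right 0)" by (intro tendsto_intros)
 then have "\<forall>\<^sub>F s in at_right 0. s * norm h < \<rho>" by (rule order_tendstoD) (use \<rho> in simp)
 then show ?thesis using eventually_at_right_less[of 0] by eventually_elim (rule small)
 qed
 ultimately have "\<bar>?a\<bar> <= 0 * ?K" by (intro tendsto_lowerbound[where F="at_right (0::real)"]) auto
 then show ?thesis by simp
qed

lemma information_quadratic: "h \<bullet> (J *v h) = (I01 x. (h \<bullet> grad0 x)\<^sup>2 / p \<theta>0 x)"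
 and information_entry: "J $ i $ k = (I01 x. grad0 x $ i * grad0 x $ k / p \<theta>0 x)"
proof -
 let ?M = "%x. (\<chi> i k. grad0 x $ i * grad0 x $ k / p \<theta>0 x) :: real ^ 'b ^ 'b"
 have c: "continuous_on {0..1} (%x. grad0 x $ i * grad0 x $ k / p \<theta>0 x)" for i k
 by (intro continuous_on_divide continuous_on_mult cont_grad0 cont_x \<theta>0_in) (use pos in force)
 have "continuous_on {0..1} ?M" by (intro continuous_on_vec_lambda c)
 then have "integrable lborel01 ?M"
 proof -
 assume cM: "continuous_on {0..1} ?M"
 have "compact (?M ` {0..1})" by (rule compact_continuous_image[OF cM]) simp
 then have "bounded (?M ` {0..1})" by (rule compact_imp_bounded)
 then obtain B where B: "\<forall>y\<in>?M ` {0..1}. norm y <= B" unfolding bounded_iff by blast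
 have "?M \<in> borel_measurable lborel01" by (intro borel_measurable_vecI) (use bmeas_measurable[OF bmeas_continuous_on[OF c]] in simp)
 then show ?thesis by (rule U.integrable_const_bound[rotated]) (use B in \<open>auto intro!: AE_I2\<close>)
 qed
 then have int: "integrable lborel01 ?M" .
 have J: "J = (I01 x. ?M x)" unfolding information_matrix_def grad0_def Let_def ..
 have entry: "J $ i $ k = (I01 x. grad0 x $ i * grad0 x $ k / p \<theta>0 x)" for i k
 proof -
 have bl: "bounded_linear (%A :: real ^ 'b ^ 'b. A $ i $ k)" by (rule bounded_linear_compose[OF bounded_linear_vec_nth bounded_linear_vec_nth])
 show ?thesis unfolding J using integral_bounded_linear[OF bl int] by simp
 qed
 then show "J $ i $ k = (I01 x. grad0 x $ i * grad0 x $ k / p \<theta>0 x)" .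
 have "h \<bullet> (J *v h) = (\<Sum>i\<in>UNIV. \<Sum>k\<in>UNIV. (h $ i * h $ k) * J $ i $ k)"
 by (simp add: inner_vec_def matrix_vector_mult_def sum_distrib_left mult_ac)
 also have "... = (I01 x. (\<Sum>i\<in>UNIV. \<Sum>k\<in>UNIV. (h $ i * h $ k) * (grad0 x $ i * grad0 x $ k / p \<theta>0 x)))"
 proof -
 have I: "integrable lborel01 (%x. (h $ i * h $ k) * (grad0 x $ i * grad0 x $ k / p \<theta>0 x))" for i k
  by (intro integrable_mult_right bmeas_integrable bmeas_continuous_on c)
 show ?thesis unfolding entry by (subst lint_sum, intro lint_summable I,
   rule sum.cong[OF refl], subst lint_sum[OF I])
  (simp only: integral_mult_right_zero)
 qed
 also have "... = (I01 x. (h \<bullet> grad0 x)\<^sup>2 / p \<theta>0 x)" unfolding inner_grad0 power2_eq_square sum_product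
 by (simp add: sum_divide_distrib mult_ac)
 finally show "h \<bullet> (J *v h) = (I01 x. (h \<bullet> grad0 x)\<^sup>2 / p \<theta>0 x)" .
qed

text \<open>A sequence of parameters along which the distance to the true density vanishes has only the
 true parameter as limit point, by Fatou's lemma and identifiability; compactness of the parameter
 set does the rest.\<close>

lemma separation:
 assumes "0 < e" shows "\<exists>\<zeta>>0. \<forall>\<theta>\<in>\<Theta>. sq (%x. p \<theta>0 x - p \<theta> x) <= \<zeta> --> norm (\<theta> - \<theta>0) < e"
proof (rule ccontr)
 assume "\<not> ?thesis"
 then have "\<forall>n::nat. \<exists>\<theta>\<in>\<Theta>. sq (%x. p \<theta>0 x - p \<theta> x) <= 1 / real (Suc n) & e <= norm (\<theta> - \<theta>0)"
 by (meson not_less zero_less_divide_1_iff of_nat_0_less_iff zero_less_Suc)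
 then obtain t where t: "!!n. t n \<in> \<Theta>" "!!n. sq (%x. p \<theta>0 x - p (t n) x) <= 1 / real (Suc n)"
 "!!n. e <= norm (t n - \<theta>0)" by metis
 obtain \<theta> r where r: "\<theta> \<in> \<Theta>" "strict_mono r" "(t \<circ> r) ---> \<theta>"
 using compact_\<Theta>[unfolded compact_def, rule_format, of t] t(1) by blast
 let ?u = "%n x. ennreal ((p \<theta>0 x - p (t (r n)) x)^2)"
 have b: "bmeas (%x. p \<theta>0 x - p (t n) x)" for n by (intro bmeas_diff bmeas_p t \<theta>0_in)
 have [measurable]: "?u n \<in> borel_measurable lborel01" for n using bmeas_measurable[OF bmeas_power2[OF b[of "r n"]]] by measurable
 have "(\<integral>\<^sup>+x. liminf (%n. ?u n x) \<partial>lborel01) <= liminf (%n. \<integral>\<^sup>+x. ?u n x \<partial>lborel01)"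
 by (rule nn_integral_liminf) measurable
 also have "(%n. \<integral>\<^sup>+x. ?u n x \<partial>lborel01) = (%n. ennreal (sq (%x. p \<theta>0 x - p (t (r n)) x)))"
 unfolding sq_def by (intro ext nn_integral_eq_integral bmeas_integrable bmeas_power2 b) auto
 also have "liminf \<dots> = 0"
 proof -
 have "(%n. sq (%x. p \<theta>0 x - p (t n) x)) ---> 0"
 proof (rule tendsto_sandwich[of "%_. 0" _ _ "%n. 1 / real (Suc n)"])
  show "(%n. 1 / real (Suc n)) ---> 0" by (rule LIMSEQ_Suc[OF lim_1_over_n])
 qed (use t(2) in auto)
 then have "(%n. sq (%x. p \<theta>0 x - p (t (r n)) x)) ---> 0" using LIMSEQ_subseq_LIMSEQ[OF _ r(2)] by (fastforce simp: comp_def)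
 then have "(%n. ennreal (sq (%x. p \<theta>0 x - p (t (r n)) x))) ---> ennreal 0" by (rule tendsto_ennrealI)
 from lim_imp_Liminf[OF _ this] show ?thesis by simp
 qed
 finally have z: "(\<integral>\<^sup>+x. liminf (%n. ?u n x) \<partial>lborel01) = 0" by simp
 have lim: "liminf (%n. ?u n x) = ennreal ((p \<theta>0 x - p \<theta> x)^2)" if x: "x \<in> {0..1}" for x
 proof (rule lim_imp_Liminf)
 have "(%n. p (t (r n)) x) ---> p \<theta> x" using continuous_on_tendsto_compose[OF cont_\<theta>[OF x] r(3) r(1)] t(1) by (simp add: comp_def)
 then show "(%n. ?u n x) ---> ennreal ((p \<theta>0 x - p \<theta> x)^2)" by (intro tendsto_ennrealI tendsto_intros)
 qed simp
 have "(\<integral>\<^sup>+x. ennreal ((p \<theta>0 x - p \<theta> x)^2) \<partial>lborel01) = (\<integral>\<^sup>+x. liminf (%n. ?u n x) \<partial>lborel01)"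
 by (rule nn_integral_cong) (simp only: lim space_lborel01)
 then have "(\<integral>\<^sup>+x. ennreal ((p \<theta>0 x - p \<theta> x)^2) \<partial>lborel01) = 0" using z by simp
 moreover have "(%x. ennreal ((p \<theta>0 x - p \<theta> x)^2)) \<in> borel_measurable lborel01"
 using bmeas_measurable[OF bmeas_power2[OF bmeas_diff[OF bmeas_p[OF \<theta>0_in] bmeas_p[OF r(1)]]]] by measurable
 ultimately have "AE x in lborel01. ennreal ((p \<theta>0 x - p \<theta> x)^2) = 0" by (simp add: nn_integral_0_iff_AE)
 then have "AE x in lborel01. p \<theta> x = p \<theta>0 x" by eventually_elim simp
 then have "\<theta> = \<theta>0" by (rule identifiable[OF r(1)])
 moreover have "e <= norm (\<theta> - \<theta>0)"
 proof (rule tendsto_lowerbound)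
 show "(%n. norm ((t \<circ> r) n - \<theta>0)) ---> norm (\<theta> - \<theta>0)" by (intro tendsto_intros r(3))
 qed (use t(3) in auto)
 ultimately show False using assms by simp
qed

end

context density_family
begin

definition cross_moment :: "(real => real) => real ^ 'b" where
 "cross_moment q = (\<chi> i. \<integral>x. (q x - p \<theta>0 x) * (grad0 x $ i / p \<theta>0 x) \<partial>lborel01)"

text \<open>The minimum bounds the difference between the squared increment of the density and its squared
 linear part: the gradient bound makes it integrable, the Hessian bound makes it vanish with the radius.\<close>

lemma truncated_majorant_tendsto:
 assumes "integrable lborel01 D" "integrable lborel01 H" "!!x. 0 <= D x" "!!x. 0 <= H x"
 shows "(%n. \<integral>x. min (D x) (2 * (1 / real (Suc n)) * (H x * sqrt (D x))) \<partial>lborel01) ---> 0"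
proof -
 have [measurable]: "D \<in> borel_measurable lborel01" "H \<in> borel_measurable lborel01" using assms by auto
 have "(%n. \<integral>x. min (D x) (2 * (1 / real (Suc n)) * (H x * sqrt (D x))) \<partial>lborel01) ---> (I01 x. 0)"
 proof (rule integral_dominated_convergence[where w=D])
 show "AE x in lborel01. (%n. min (D x) (2 * (1 / real (Suc n)) * (H x * sqrt (D x)))) ---> 0"
 proof (rule AE_I2)
  fix x
  have "(%n. min (D x) (2 * (1 / real (Suc n)) * (H x * sqrt (D x)))) ---> min (D x) (2 * 0 * (H x * sqrt (D x)))"
  by (intro tendsto_min tendsto_mult tendsto_const LIMSEQ_Suc[OF lim_1_over_n])
  then show "(%n. min (D x) (2 * (1 / real (Suc n)) * (H x * sqrt (D x)))) ---> 0"
  using assms(3)[of x] by (simp only: mult_zero_right mult_zero_left min_absorb2)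
 qed
 show "AE x in lborel01. norm (min (D x) (2 * (1 / real (Suc n)) * (H x * sqrt (D x)))) <= D x" for n
 proof (rule AE_I2)
  fix x
  have "0 <= 2 * (1 / real (Suc n)) * (H x * sqrt (D x))" using assms(3,4)[of x] by (intro mult_nonneg_nonneg) auto
  then show "norm (min (D x) (2 * (1 / real (Suc n)) * (H x * sqrt (D x)))) <= D x" using assms(3)[of x] by simp
 qed
 show "(%x. 0) \<in> borel_measurable lborel01" by measurable
 show "(%x. min (D x) (2 * (1 / real (Suc n)) * (H x * sqrt (D x)))) \<in> borel_measurable lborel01" for n by measurable
 qed (rule assms(1))
 then show ?thesis by simp
qed

text \<open>The linear part of the expansion is exact.  In the remainder the second-order Taylor term enters
 only through its product with \<open>p \<theta>0 - q\<close>, because all densities have mass one.\<close>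

lemma objective_expansion:
 assumes D: "integrable lborel01 D" "!!x. 0 <= D x" and H: "integrable lborel01 H" "!!x. 0 <= H x"
 and AE: "AE x in lborel01. \<forall>h. norm h < \<rho> --> (p (\<theta>0 + h) x - p \<theta>0 x)^2 <= (norm h)^2 * D x
  & \<bar>p (\<theta>0 + h) x - p \<theta>0 x - h \<bullet> grad0 x\<bar> <= (norm h)^2 * H x & (h \<bullet> grad0 x)^2 <= (norm h)^2 * D x"
 and m: "0 < m" "!!x. x \<in> {0..1} ==> m <= p \<theta>0 x"
 and q: "continuous_on {0..1} q" "!!x. x \<in> {0..1} ==> \<bar>q x - p \<theta>0 x\<bar> <= \<delta>" and \<delta>: "\<delta> <= m / 2"
 and h: "norm h < \<rho>" "norm h <= \<eta>"
 shows "\<bar>(I01 x. (q x - p (\<theta>0 + h) x)\<^sup>2 / q x) - (I01 x. (q x - p \<theta>0 x)\<^sup>2 / q x)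
  - (2 * (I01 x. p \<theta>0 x / q x * (h \<bullet> grad0 x)) + h \<bullet> (J *v h))\<bar>
 <= (4 * \<delta> / m * (I01 x. H x) + 2 / m * (I01 x. min (D x) (2 * \<eta> * (H x * sqrt (D x))))
  + 2 * \<delta> / m^2 * (I01 x. D x)) * (norm h)^2"
proof -
 let ?f = "p \<theta>0"
 define d where "d x = p (\<theta>0 + h) x - ?f x" for x
 define e where "e x = d x - h \<bullet> grad0 x" for x
 define \<psi> where "\<psi> x = min (D x) (2 * \<eta> * (H x * sqrt (D x)))" for x
 have qm: "m / 2 <= q x" if "x \<in> {0..1}" for x using q(2)[OF that] m(2)[OF that] \<delta> by linarith
 have qpos: "0 < q x" if "x \<in> {0..1}" for x using qm[OF that] m(1) by linarith
 have \<delta>0: "0 <= \<delta>" using q(2)[of 0] by simp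
 have \<eta>0: "0 <= \<eta>" using h by (meson norm_ge_zero order_trans)
 have cf: "continuous_on {0..1} ?f" and ch: "continuous_on {0..1} (p (\<theta>0 + h))" by (intro cont_x \<theta>0_in in_\<Theta> h)+
 have cd: "continuous_on {0..1} d" unfolding d_def by (intro continuous_intros cf ch)
 have ce: "continuous_on {0..1} e" unfolding e_def by (intro continuous_intros cd cont_inner_grad0)
 note cg = cont_inner_grad0[of h]
 have nzq: "\<forall>x\<in>{0..1}. q x ~= 0" and nzf: "\<forall>x\<in>{0..1}. ?f x ~= 0" using qpos pos by force+
 have I: "integrable lborel01 u" if "continuous_on {0..1} u" for u :: "real => real" by (rule bmeas_integrable[OF bmeas_continuous_on[OF that]])
 have e0: "(I01 x. e x) = 0"
 proof -
 have "(I01 x. d x) = 0" unfolding d_def lint_diff[OF I[OF ch] I[OF cf]] using mass[OF in_\<Theta>[OF h(1)]] mass[OF \<theta>0_in] by simp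
 then show ?thesis unfolding e_def lint_diff[OF I[OF cd] I[OF cg]] by (simp add: integral_inner_grad0)
 qed
 have d0: "(I01 x. d x) = 0" unfolding d_def lint_diff[OF I[OF ch] I[OF cf]] using mass[OF in_\<Theta>[OF h(1)]] mass[OF \<theta>0_in] by simp
 let ?R = "%x. 2 * ((?f x - q x) / q x * e x) + ((d x)^2 - (h \<bullet> grad0 x)\<^sup>2) / q x + (h \<bullet> grad0 x)^2 * ((?f x - q x) / (q x * ?f x))"
 have cR: "continuous_on {0..1} ?R" by (intro continuous_intros q(1) cf ce cd cg nzq) (use nzq nzf in auto)
 have c1: "continuous_on {0..1} (%x. (q x - p (\<theta>0 + h) x)\<^sup>2 / q x)" "continuous_on {0..1} (%x. (q x - ?f x)\<^sup>2 / q x)"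
 "continuous_on {0..1} (%x. ?f x / q x * (h \<bullet> grad0 x))" "continuous_on {0..1} (%x. (h \<bullet> grad0 x)\<^sup>2 / ?f x)"
 by (intro continuous_intros q(1) cf ch cg nzq nzf)+
 have pt: "(q x - p (\<theta>0 + h) x)^2 / q x - (q x - ?f x)\<^sup>2 / q x
  - (2 * (?f x / q x * (h \<bullet> grad0 x)) + (h \<bullet> grad0 x)^2 / ?f x) = ?R x + 2 * e x - 2 * d x" if x: "x \<in> {0..1}" for x
 proof -
 have ph: "p (\<theta>0 + h) x = ?f x + d x" "e x = d x - h \<bullet> grad0 x" by (simp_all add: d_def e_def)
 show ?thesis unfolding ph using qpos[OF x] pos[OF x] by (simp add: field_simps power2_eq_square)
 qed
 have "(I01 x. (q x - p (\<theta>0 + h) x)\<^sup>2 / q x) - (I01 x. (q x - ?f x)\<^sup>2 / q x)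
  - (2 * (I01 x. ?f x / q x * (h \<bullet> grad0 x)) + h \<bullet> (J *v h))
 = (I01 x. (q x - p (\<theta>0 + h) x)\<^sup>2 / q x - (q x - ?f x)\<^sup>2 / q x
  - (2 * (?f x / q x * (h \<bullet> grad0 x)) + (h \<bullet> grad0 x)^2 / ?f x))" unfolding information_quadratic
 using I[OF c1(1)] I[OF c1(2)] I[OF c1(3)] I[OF c1(4)] by (simp only: lint_diff lint_add Bochner_Integration.integrable_diff
  lint_addable integrable_mult_right integral_mult_right_zero)
 also have "... = (I01 x. ?R x + 2 * e x - 2 * d x)" by (rule lint_cong[OF refl]) (use pt in \<open>simp only: space_lborel01\<close>)
 also have "... = (I01 x. ?R x)" using I[OF cR] I[OF ce] I[OF cd] e0 d0 by (simp only: lint_diff lint_add Bochner_Integration.integrable_diff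
  lint_addable integrable_mult_right integral_mult_right_zero mult_zero_right add_0_right diff_zero)
 finally have expansion: "(I01 x. (q x - p (\<theta>0 + h) x)\<^sup>2 / q x) - (I01 x. (q x - ?f x)\<^sup>2 / q x)
  - (2 * (I01 x. ?f x / q x * (h \<bullet> grad0 x)) + h \<bullet> (J *v h)) = (I01 x. ?R x)" .
 have "\<bar>\<integral>x. ?R x \<partial>lborel01\<bar> <= (I01 x. \<bar>?R x\<bar>)" by (rule integral_abs_bound)
 also have "... <= (I01 x. (norm h)\<^sup>2 * (4 * \<delta> / m * H x + 2 / m * \<psi> x + 2 * \<delta> / m^2 * D x))"
 proof (rule integral_mono_AE)
 show "integrable lborel01 (%x. \<bar>?R x\<bar>)" by (intro integrable_abs I cR)
 have [measurable]: "D \<in> borel_measurable lborel01" "H \<in> borel_measurable lborel01" using D H by auto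
 have "integrable lborel01 \<psi>"
 proof (rule lint_bound[OF D(1)])
  have "0 <= 2 * \<eta> * (H x * sqrt (D x))" for x using \<eta>0 D(2)[of x] H(2)[of x] by (intro mult_nonneg_nonneg) auto
  then show "AE x in lborel01. norm (\<psi> x) <= norm (D x)" using D(2) by (intro AE_I2) (simp add: \<psi>_def)
  show "\<psi> \<in> borel_measurable lborel01" unfolding \<psi>_def[abs_def] by measurable
 qed
 then show "integrable lborel01 (%x. (norm h)\<^sup>2 * (4 * \<delta> / m * H x + 2 / m * \<psi> x + 2 * \<delta> / m^2 * D x))"
  by (intro integrable_mult_right lint_addable D H)
 show "AE x in lborel01. \<bar>?R x\<bar> <= (norm h)^2 * (4 * \<delta> / m * H x + 2 / m * \<psi> x + 2 * \<delta> / m^2 * D x)" using AE AE_space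
 proof eventually_elim
  case (elim x)
  have x: "x \<in> {0..1}" using elim(2) by simp
  let ?n = "norm h" and ?g = "h \<bullet> grad0 x"
  have b: "(d x)^2 <= ?n\<^sup>2 * D x" "\<bar>e x\<bar> <= ?n\<^sup>2 * H x" "?g\<^sup>2 <= ?n\<^sup>2 * D x"
  using elim(1) h(1) by (auto simp: d_def e_def)
  have sq_le: "\<bar>u\<bar> <= ?n * sqrt (D x)" if "u^2 <= ?n\<^sup>2 * D x" for u
  proof -
  have "sqrt (u^2) <= sqrt (?n\<^sup>2 * D x)" using that by (rule real_sqrt_le_mono)
  then show ?thesis by (simp add: real_sqrt_mult)
  qed
  have qx: "m / 2 <= q x" "0 < q x" "m <= ?f x" "\<bar>?f x - q x\<bar> <= \<delta>"
  using qm[OF x] qpos[OF x] m(2)[OF x] q(2)[OF x] by (simp_all add: abs_minus_commute)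
  have r1: "\<bar>(?f x - q x) / q x\<bar> <= \<delta> / (m / 2)" unfolding abs_divide using qx m(1) by (intro frac_le) auto
  have "\<bar>2 * ((?f x - q x) / q x * e x)\<bar> <= 2 * (\<delta> / (m / 2) * (?n\<^sup>2 * H x))"
  unfolding abs_mult[of 2] abs_mult[of "(?f x - q x) / q x"] abs_numeral using m(1) \<delta>0 by (intro mult_left_mono mult_mono r1 b) auto
  then have t1: "\<bar>2 * ((?f x - q x) / q x * e x)\<bar> <= ?n\<^sup>2 * (4 * \<delta> / m * H x)" by (simp add: mult_ac)
  have "\<bar>(d x)^2 - ?g\<^sup>2\<bar> <= ?n\<^sup>2 * D x" using b(1,3) zero_le_power2[of "d x"] zero_le_power2[of ?g] by linarith
  moreover have "\<bar>(d x)^2 - ?g\<^sup>2\<bar> <= ?n\<^sup>2 * (2 * \<eta> * (H x * sqrt (D x)))"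
  proof -
  have "(d x)^2 - ?g\<^sup>2 = e x * (d x + ?g)" by (simp add: e_def power2_eq_square algebra_simps)
  then have "\<bar>(d x)^2 - ?g\<^sup>2\<bar> = \<bar>e x\<bar> * \<bar>d x + ?g\<bar>" by (simp only: abs_mult)
  also have "... <= (?n\<^sup>2 * H x) * (2 * (?n * sqrt (D x)))" using b(2) sq_le[OF b(1)] sq_le[OF b(3)] abs_triangle_ineq[of "d x" ?g] H(2)[of x]
   by (intro mult_mono) auto
  also have "... <= (?n\<^sup>2 * H x) * (2 * (\<eta> * sqrt (D x)))" using h(2) H(2)[of x] D(2)[of x] by (intro mult_left_mono mult_right_mono) auto
  also have "... = ?n\<^sup>2 * (2 * \<eta> * (H x * sqrt (D x)))" by (simp only: mult_ac)
  finally show ?thesis .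
  qed
  ultimately have dg: "\<bar>(d x)^2 - ?g\<^sup>2\<bar> <= ?n\<^sup>2 * \<psi> x" unfolding \<psi>_def by (simp add: min_def)
  have "\<bar>((d x)^2 - ?g\<^sup>2) / q x\<bar> <= (?n\<^sup>2 * \<psi> x) / (m / 2)"
  unfolding abs_divide using dg qx m(1) order_trans[OF abs_ge_zero dg] by (intro frac_le) auto
  then have t2: "\<bar>((d x)^2 - ?g\<^sup>2) / q x\<bar> <= ?n\<^sup>2 * (2 / m * \<psi> x)" by (simp add: mult_ac)
  have r3: "\<bar>(?f x - q x) / (q x * ?f x)\<bar> <= \<delta> / (m / 2 * m)"
  unfolding abs_divide abs_mult using qx m(1) by (intro frac_le mult_mono) auto
  have "\<bar>?g\<^sup>2 * ((?f x - q x) / (q x * ?f x))\<bar> <= (?n\<^sup>2 * D x) * (\<delta> / (m / 2 * m))"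
  unfolding abs_mult[of "?g\<^sup>2"] using D(2)[of x] b(3) r3 by (intro mult_mono) auto
  then have t3: "\<bar>?g\<^sup>2 * ((?f x - q x) / (q x * ?f x))\<bar> <= ?n\<^sup>2 * (2 * \<delta> / m^2 * D x)" by (simp add: power2_eq_square mult_ac)
  have "\<bar>a + b + c\<bar> <= a' + b' + c'" if "\<bar>a\<bar> <= a'" "\<bar>b\<bar> <= b'" "\<bar>c\<bar> <= c'" for a b c a' b' c' :: real
  using that by linarith
  from this[OF t1 t2 t3] show ?case by (simp only: distrib_left)
 qed
 qed
 also have "... = (4 * \<delta> / m * (I01 x. H x) + 2 / m * (I01 x. \<psi> x) + 2 * \<delta> / m^2 * (I01 x. D x)) * (norm h)^2"
 proof -
 have [measurable]: "D \<in> borel_measurable lborel01" "H \<in> borel_measurable lborel01" using D H by auto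
 have i\<psi>: "integrable lborel01 \<psi>"
 proof (rule lint_bound[OF D(1)])
  have "0 <= 2 * \<eta> * (H x * sqrt (D x))" for x using \<eta>0 D(2)[of x] H(2)[of x] by (intro mult_nonneg_nonneg) auto
  then show "AE x in lborel01. norm (\<psi> x) <= norm (D x)" using D(2) by (intro AE_I2) (simp add: \<psi>_def)
  show "\<psi> \<in> borel_measurable lborel01" unfolding \<psi>_def[abs_def] by measurable
 qed
 have "(I01 x. 4 * \<delta> / m * H x + 2 / m * \<psi> x + 2 * \<delta> / m^2 * D x)
  = 4 * \<delta> / m * (I01 x. H x) + 2 / m * (I01 x. \<psi> x) + 2 * \<delta> / m^2 * (I01 x. D x)" using D(1) H(1) i\<psi>
  by (simp only: lint_add lint_addable integrable_mult_right integral_mult_right_zero)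
 then show ?thesis by (simp only: integral_mult_right_zero mult.commute)
 qed
 finally show ?thesis unfolding expansion unfolding \<psi>_def .
qed

text \<open>Replacing the weight \<open>p \<theta>0 / q\<close> by its first-order expansion in
 \<open>q - p \<theta>0\<close> costs a squared error; the zeroth-order term vanishes because the
 densities have constant mass.\<close>

lemma linear_coefficient:
 assumes m: "0 < m" "!!x. x \<in> {0..1} ==> m <= p \<theta>0 x" and q: "continuous_on {0..1} q" "!!x. x \<in> {0..1} ==> m / 2 <= q x"
 and B: "!!i x. x \<in> {0..1} ==> \<bar>grad0 x $ i\<bar> <= B"
 defines "G \<equiv> (\<chi> i. \<integral>x. p \<theta>0 x / q x * (grad0 x $ i) \<partial>lborel01)"
 shows "G \<bullet> h = (I01 x. p \<theta>0 x / q x * (h \<bullet> grad0 x))"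
 and "norm (G + cross_moment q) <= real CARD('b) * (2 * B / m^2 * sq (%x. q x - p \<theta>0 x))"
proof -
 let ?f = "p \<theta>0"
 have qpos: "0 < q x" if "x \<in> {0..1}" for x using q(2)[OF that] m(1) by linarith
 have nzq: "\<forall>x\<in>{0..1}. q x ~= 0" and nzf: "\<forall>x\<in>{0..1}. ?f x ~= 0" using qpos pos by force+
 have cf: "continuous_on {0..1} ?f" by (rule cont_x[OF \<theta>0_in])
 have I: "integrable lborel01 u" if "continuous_on {0..1} u" for u :: "real => real" by (rule bmeas_integrable[OF bmeas_continuous_on[OF that]])
 have c1: "continuous_on {0..1} (%x. ?f x / q x * (grad0 x $ i))" for i by (intro continuous_intros cf q(1) cont_grad0 nzq)
 have "G \<bullet> h = (\<Sum>i\<in>UNIV. \<integral>x. h $ i * (?f x / q x * (grad0 x $ i)) \<partial>lborel01)"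
 unfolding inner_vec_def G_def vec_lambda_beta inner_real_def integral_mult_right_zero by (intro sum.cong refl mult.commute)
 also have "... = (I01 x. (\<Sum>i\<in>UNIV. h $ i * (?f x / q x * (grad0 x $ i))))" by (rule lint_sum[symmetric]) (intro integrable_mult_right I c1)
 also have "... = (I01 x. ?f x / q x * (h \<bullet> grad0 x))" unfolding inner_grad0 sum_distrib_left
 by (intro lint_cong sum.cong refl) (simp only: mult.left_commute)
 finally show "G \<bullet> h = (I01 x. ?f x / q x * (h \<bullet> grad0 x))" .
 have "\<bar>(G + cross_moment q) $ i\<bar> <= 2 * B / m^2 * sq (%x. q x - ?f x)" for i
 proof -
 have B0: "0 <= B" using B[of 0 i] by simp
 have c2: "continuous_on {0..1} (%x. (q x - ?f x) * (grad0 x $ i / ?f x))" by (intro continuous_intros cf q(1) cont_grad0 nzf)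
 have c3: "continuous_on {0..1} (%x. (q x - ?f x)\<^sup>2 * (grad0 x $ i / (?f x * q x)))"
  by (intro continuous_intros cf q(1) cont_grad0) (use nzf nzq in auto)
 have g0: "(I01 x. grad0 x $ i) = 0" using integral_inner_grad0[of "axis i 1"] by (simp add: inner_axis inner_commute[of "axis i 1"])
 have pt: "?f x / q x * (grad0 x $ i) + (q x - ?f x) * (grad0 x $ i / ?f x)
  = grad0 x $ i + (q x - ?f x)^2 * (grad0 x $ i / (?f x * q x))" if x: "x \<in> {0..1}" for x
  using qpos[OF x] pos[OF x] by (simp add: field_simps power2_eq_square)
 have "(G + cross_moment q) $ i = (I01 x. ?f x / q x * (grad0 x $ i) + (q x - ?f x) * (grad0 x $ i / ?f x))"
  unfolding lint_add[OF I[OF c1] I[OF c2]] by (simp add: G_def cross_moment_def)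
 also have "... = (I01 x. grad0 x $ i + (q x - ?f x)^2 * (grad0 x $ i / (?f x * q x)))"
  by (rule lint_cong[OF refl]) (use pt in \<open>simp only: space_lborel01\<close>)
 also have "... = (I01 x. (q x - ?f x)\<^sup>2 * (grad0 x $ i / (?f x * q x)))" unfolding lint_add[OF I[OF cont_grad0] I[OF c3]] g0 by simp
 finally have eq: "(G + cross_moment q) $ i = (I01 x. (q x - ?f x)\<^sup>2 * (grad0 x $ i / (?f x * q x)))" .
 have "\<bar>\<integral>x. (q x - ?f x)\<^sup>2 * (grad0 x $ i / (?f x * q x)) \<partial>lborel01\<bar>
  <= (I01 x. \<bar>(q x - ?f x)^2 * (grad0 x $ i / (?f x * q x))\<bar>)" by (rule integral_abs_bound)
 also have "... <= (I01 x. 2 * B / m^2 * (q x - ?f x)^2)"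
 proof (rule integral_mono)
  show "integrable lborel01 (%x. \<bar>(q x - ?f x)^2 * (grad0 x $ i / (?f x * q x))\<bar>)" by (intro integrable_abs I c3)
  show "integrable lborel01 (%x. 2 * B / m^2 * (q x - ?f x)^2)" by (intro I continuous_intros q(1) cf)
  fix x assume "x \<in> space lborel01"
  then have x: "x \<in> {0..1}" by simp
  have "\<bar>grad0 x $ i / (?f x * q x)\<bar> = \<bar>grad0 x $ i\<bar> / (?f x * q x)" using qpos[OF x] pos[OF x] by (simp add: abs_mult)
  also have "... <= B / (m * (m / 2))" by (intro frac_le mult_mono B x m(2) q(2)) (use m(1) B0 pos[OF x] in auto)
  also have "... = 2 * B / m^2" by (simp add: power2_eq_square)
  finally have "(q x - ?f x)^2 * \<bar>grad0 x $ i / (?f x * q x)\<bar> <= (q x - ?f x)^2 * (2 * B / m^2)" by (rule mult_left_mono) simp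
  then show "\<bar>(q x - ?f x)^2 * (grad0 x $ i / (?f x * q x))\<bar> <= 2 * B / m^2 * (q x - ?f x)^2" by (simp only: abs_mult abs_power2 mult.commute)
 qed
 also have "... = 2 * B / m^2 * sq (%x. q x - ?f x)" unfolding sq_def by (rule integral_mult_right_zero)
 finally show ?thesis unfolding eq .
 qed
 then have "(\<Sum>i\<in>UNIV. \<bar>(G + cross_moment q) $ i\<bar>) <= (\<Sum>i\<in>(UNIV::'b set). 2 * B / m^2 * sq (%x. q x - ?f x))"
 by (intro sum_mono)
 then show "norm (G + cross_moment q) <= real CARD('b) * (2 * B / m^2 * sq (%x. q x - ?f x))" using norm_le_l1_cart[of "G + cross_moment q"] by simp
qed

end

lemma posdef_inverse:
 fixes J :: "real ^ 'b ^ 'b"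
 assumes "pos_def J"
 shows "J ** matrix_inv J = mat 1" and "matrix_inv J ** J = mat 1"
proof -
 have "x = 0" if "J *v x = 0" for x
 proof (rule ccontr)
 assume "x ~= 0"
 then have "0 < x \<bullet> (J *v x)" using assms unfolding pos_def_def by blast
 then show False using that by simp
 qed
 then have "\<exists>B. B ** J = mat 1" using matrix_left_invertible_ker[of J] by blast
 then have "invertible J" using invertible_left_inverse[of J] by blast
 then have "J ** matrix_inv J = mat 1 & matrix_inv J ** J = mat 1" unfolding invertible_def matrix_inv_def by (rule someI_ex)
 then show "J ** matrix_inv J = mat 1" "matrix_inv J ** J = mat 1" by blast+
qed

context density_family
begin

text \<open>Up to an error of smaller order the objective is a quadratic in the parameter with
 matrix \<open>J\<close>, whose minimizer is linear in the deviation of \<open>q\<close>. Uniform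
 closeness of \<open>q\<close> to the true density first forces the minimizer into the region of the
 expansion.\<close>

theorem minimizer_expansion:
 "\<exists>C\<ge>0. \<forall>\<epsilon>>0. \<exists>\<delta>>0. \<forall>q \<theta>. continuous_on {0..1} q --> (\<forall>x\<in>{0..1}. \<bar>q x - p \<theta>0 x\<bar> <= \<delta>) --> \<theta> \<in> \<Theta> -->
 (\<forall>\<theta>'\<in>\<Theta>. (I01 x. (q x - p \<theta> x)\<^sup>2 / q x) <= (I01 x. (q x - p \<theta>' x)\<^sup>2 / q x)) -->
 norm (\<theta> - \<theta>0 - matrix_inv J *v cross_moment q) <= \<epsilon> * norm (cross_moment q) + C * sq (%x. q x - p \<theta>0 x)"
proof -
 let ?f = "p \<theta>0"
 have cf: "continuous_on {0..1} ?f" by (rule cont_x[OF \<theta>0_in])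
 obtain D H where D: "integrable lborel01 D" "!!x. 0 <= D x" and H: "integrable lborel01 H" "!!x. 0 <= H x"
 and AE: "AE x in lborel01. \<forall>h. norm h < \<rho> --> (p (\<theta>0 + h) x - p \<theta>0 x)^2 <= (norm h)^2 * D x
  & \<bar>p (\<theta>0 + h) x - p \<theta>0 x - h \<bullet> grad0 x\<bar> <= (norm h)^2 * H x & (h \<bullet> grad0 x)^2 <= (norm h)^2 * D x"
 by (rule majorants) (rule that)
 obtain x0 where "x0 \<in> {0..1}" "\<forall>y\<in>{0..1}. ?f x0 <= ?f y" using continuous_attains_inf[of "{0..1::real}" ?f] cf by auto
 then obtain m where m: "0 < m" "!!x. x \<in> {0..1} ==> m <= ?f x" using pos by blast
 obtain M where M: "\<forall>x\<in>{0..1}. \<bar>?f x\<bar> <= M" using bmeas_continuous_on[OF cf] unfolding bmeas_def by blast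
 have M0: "0 <= M" using M[rule_format, of 0] by simp
 have "\<forall>i. \<exists>B. \<forall>x\<in>{0..1}. \<bar>grad0 x $ i\<bar> <= B" using bmeas_continuous_on[OF cont_grad0] unfolding bmeas_def by blast
 then obtain Bi where Bi: "!!i x. x \<in> {0..1} ==> \<bar>grad0 x $ i\<bar> <= Bi i" by metis
 define B where "B = (\<Sum>i\<in>UNIV. \<bar>Bi i\<bar>)"
 have B: "\<bar>grad0 x $ i\<bar> <= B" if "x \<in> {0..1}" for i x
 proof -
 have "\<bar>grad0 x $ i\<bar> <= \<bar>Bi i\<bar>" using Bi[OF that, of i] by linarith
 also have "... <= B" unfolding B_def by (rule member_le_sum) auto
 finally show ?thesis .
 qed
 have B0: "0 <= B" unfolding B_def by (rule sum_nonneg) simp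
 obtain c where c: "0 < c" "!!h. c * (norm h)^2 <= h \<bullet> (J *v h)" by (rule posdef_coercive[OF posdef]) (rule that)
 have symJ: "transpose J = J" using posdef unfolding pos_def_def by blast
 have Jinv: "J *v (matrix_inv J *v y) = y" for y by (simp only: matrix_vector_mul_assoc posdef_inverse(1)[OF posdef] matrix_vector_mul_lid)
 have inv_le: "norm (matrix_inv J *v y) <= norm y / c" for y
 proof (cases "matrix_inv J *v y = 0")
 case False
 let ?k = "matrix_inv J *v y"
 have "c * (norm ?k)^2 <= ?k \<bullet> y" using c(2)[of ?k] unfolding Jinv .
 also have "... <= norm ?k * norm y" by (rule norm_cauchy_schwarz)
 finally have "norm ?k * (c * norm ?k) <= norm ?k * norm y" by (simp only: power2_eq_square mult_ac)
 then have "c * norm ?k <= norm y" using False by simp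
 then show ?thesis using c(1) by (simp only: pos_le_divide_eq mult.commute)
 qed (use c(1) in simp)
 define C1 where "C1 = real CARD('b) * (2 * B / m^2)"
 have C1: "0 <= C1" using B0 by (simp add: C1_def)
 define IH ID where "IH = (I01 x. H x)" and "ID = (I01 x. D x)"
 show ?thesis
 proof (rule exI[of _ "2 * C1 / c"], intro conjI allI impI)
 show "0 <= 2 * C1 / c" using C1 c(1) by simp
 fix \<epsilon> :: real assume \<epsilon>: "0 < \<epsilon>"
 define \<epsilon>2 where "\<epsilon>2 = min 1 (\<epsilon> * c)"
 have \<epsilon>2: "0 < \<epsilon>2" "\<epsilon>2 <= 1" "\<epsilon>2 <= \<epsilon> * c" using \<epsilon> c(1) by (auto simp: \<epsilon>2_def)
 define \<epsilon>1 where "\<epsilon>1 = min (c / 4) (c * \<epsilon>2\<^sup>2 / 6)"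
 have \<epsilon>1: "0 < \<epsilon>1" "\<epsilon>1 <= c / 4" "\<epsilon>1 <= c * \<epsilon>2\<^sup>2 / 6" using \<epsilon>2(1) c(1) by (auto simp: \<epsilon>1_def)
 have "\<forall>\<^sub>F n in sequentially. 2 / m * (I01 x. min (D x) (2 * (1 / real (Suc n)) * (H x * sqrt (D x)))) < \<epsilon>1 / 2"
 proof (rule order_tendstoD)
  show "(%n. 2 / m * (I01 x. min (D x) (2 * (1 / real (Suc n)) * (H x * sqrt (D x))))) ---> 2 / m * 0"
  by (rule tendsto_mult[OF tendsto_const truncated_majorant_tendsto[OF D(1) H(1) D(2) H(2)]])
 qed (use \<epsilon>1(1) in simp)
 moreover have "\<forall>\<^sub>F n in sequentially. 1 / real (Suc n) < \<rho>" by (rule order_tendstoD(2)[OF LIMSEQ_Suc[OF lim_1_over_n] \<rho>(1)])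
 ultimately have "\<forall>\<^sub>F n in sequentially. 2 / m * (I01 x. min (D x) (2 * (1 / real (Suc n)) * (H x * sqrt (D x)))) < \<epsilon>1 / 2
  & 1 / real (Suc n) < \<rho>" by (rule eventually_conj)
 then obtain n0 where n0: "2 / m * (I01 x. min (D x) (2 * (1 / real (Suc n0)) * (H x * sqrt (D x)))) < \<epsilon>1 / 2"
  "1 / real (Suc n0) < \<rho>" using eventually_happens'[OF sequentially_bot] by blast
 define \<eta> where "\<eta> = 1 / real (Suc n0)"
 have \<eta>: "0 < \<eta>" "\<eta> < \<rho>" using n0(2) by (simp_all add: \<eta>_def)
 obtain \<zeta> where \<zeta>: "0 < \<zeta>" "!!\<theta>. \<theta> \<in> \<Theta> ==> sq (%x. ?f x - p \<theta> x) <= \<zeta> ==> norm (\<theta> - \<theta>0) < \<eta>"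
  using separation[OF \<eta>(1)] by blast
 have lim: "\<forall>\<^sub>F \<delta> in at_right 0. F \<delta> < K" if "(F \<longlongrightarrow> 0) (at_right 0)" "0 < K" for F :: "real => real" and K
  by (rule order_tendstoD(2)[OF that])
 have e1: "\<forall>\<^sub>F \<delta> in at_right (0::real). \<delta> < m / 2" by (rule lim) (use m(1) in \<open>auto intro!: tendsto_eq_intros\<close>)
 have e2: "\<forall>\<^sub>F \<delta> in at_right (0::real). 4 * \<delta> / m * IH + 2 * \<delta> / m^2 * ID < \<epsilon>1 / 2"
  by (rule lim) (use m(1) \<epsilon>1(1) in \<open>auto intro!: tendsto_eq_intros\<close>)
 have e3: "\<forall>\<^sub>F \<delta> in at_right (0::real). 2 * \<delta>^2 + 2 * ((M + m) * (2 / m * \<delta>^2)) < \<zeta>"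
  by (rule lim) (use \<zeta>(1) m(1) in \<open>auto intro!: tendsto_eq_intros\<close>)
 have e4: "\<forall>\<^sub>F \<delta> in at_right (0::real). (real CARD('b) * (\<delta> * (B / m)) + C1 * \<delta>^2) / c < \<eta>"
  by (rule lim) (use \<eta>(1) c(1) m(1) in \<open>auto intro!: tendsto_eq_intros\<close>)
 have "\<forall>\<^sub>F \<delta> in at_right (0::real). 0 < \<delta> & \<delta> < m / 2 & 4 * \<delta> / m * IH + 2 * \<delta> / m^2 * ID < \<epsilon>1 / 2
  & 2 * \<delta>^2 + 2 * ((M + m) * (2 / m * \<delta>^2)) < \<zeta> & (real CARD('b) * (\<delta> * (B / m)) + C1 * \<delta>^2) / c < \<eta>"
  by (intro eventually_conj eventually_at_right_less e1 e2 e3 e4)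
 then obtain \<delta> where \<delta>: "0 < \<delta>" "\<delta> < m / 2" "4 * \<delta> / m * IH + 2 * \<delta> / m^2 * ID < \<epsilon>1 / 2"
  "2 * \<delta>^2 + 2 * ((M + m) * (2 / m * \<delta>^2)) < \<zeta>" "(real CARD('b) * (\<delta> * (B / m)) + C1 * \<delta>^2) / c < \<eta>"
  using eventually_happens'[OF trivial_limit_at_right_real] by blast
 show "\<exists>\<delta>>0. \<forall>q \<theta>. continuous_on {0..1} q --> (\<forall>x\<in>{0..1}. \<bar>q x - p \<theta>0 x\<bar> <= \<delta>) --> \<theta> \<in> \<Theta> -->
 (\<forall>\<theta>'\<in>\<Theta>. (I01 x. (q x - p \<theta> x)\<^sup>2 / q x) <= (I01 x. (q x - p \<theta>' x)\<^sup>2 / q x)) -->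
 norm (\<theta> - \<theta>0 - matrix_inv J *v cross_moment q) <= \<epsilon> * norm (cross_moment q) + 2 * C1 / c * sq (%x. q x - p \<theta>0 x)"
 proof (intro exI[of _ \<delta>] conjI allI impI)
  show "0 < \<delta>" by (rule \<delta>(1))
  fix q \<theta>
  assume q: "continuous_on {0..1} q" and q\<delta>': "\<forall>x\<in>{0..1}. \<bar>q x - p \<theta>0 x\<bar> <= \<delta>" and \<theta>: "\<theta> \<in> \<Theta>"
  and min': "\<forall>\<theta>'\<in>\<Theta>. (I01 x. (q x - p \<theta> x)\<^sup>2 / q x) <= (I01 x. (q x - p \<theta>' x)\<^sup>2 / q x)"
  let ?Q = "%\<theta>. \<integral>x. (q x - p \<theta> x)\<^sup>2 / q x \<partial>lborel01"
  have q\<delta>: "\<bar>q x - ?f x\<bar> <= \<delta>" if "x \<in> {0..1}" for x using q\<delta>' that by blast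
  have \<delta>m: "\<delta> <= m / 2" using \<delta>(2) by simp
  have qm: "m / 2 <= q x" if "x \<in> {0..1}" for x using q\<delta>[OF that] m(2)[OF that] \<delta>m by linarith
  have qpos: "0 < q x" if "x \<in> {0..1}" for x using qm[OF that] m(1) by linarith
  have qM: "q x <= M + m" if "x \<in> {0..1}" for x using q\<delta>[OF that] M[rule_format, OF that] \<delta>m m(1) by linarith
  have nzq: "\<forall>x\<in>{0..1}. q x ~= 0" using qpos by force
  have I: "integrable lborel01 (%x. (q x - p \<theta> x)\<^sup>2 / q x)" if "\<theta> \<in> \<Theta>" for \<theta>
  by (intro bmeas_integrable bmeas_continuous_on continuous_intros q cont_x that nzq)
  have sqd: "sq (%x. q x - ?f x) <= \<delta>^2"
  proof (rule sq_le_const)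
  show "bmeas (%x. q x - ?f x)" by (intro bmeas_diff bmeas_continuous_on q cf)
  show "(q x - ?f x)^2 <= \<delta>^2" if "x \<in> {0..1}" for x using power_mono[OF q\<delta>[OF that] abs_ge_zero, of 2] by simp
  qed
  have "?Q \<theta>0 <= 2 / m * \<delta>^2"
  proof (rule U.integral_le_const[OF I[OF \<theta>0_in]])
  have "(q x - ?f x)^2 / q x <= 2 / m * \<delta>^2" if x: "x \<in> {0..1}" for x
  proof -
   have "(q x - ?f x)^2 / q x <= \<delta>^2 / (m / 2)" using qm[OF x] m(1) power_mono[OF q\<delta>[OF x] abs_ge_zero, of 2] by (intro frac_le) auto
   then show ?thesis by (simp add: mult.commute)
  qed
  then show "AE x in lborel01. (q x - ?f x)\<^sup>2 / q x <= 2 / m * \<delta>^2" by (intro AE_I2) simp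
  qed
  then have Q\<theta>: "?Q \<theta> <= 2 / m * \<delta>^2" using min' \<theta>0_in by force
  have "sq (%x. q x - p \<theta> x) <= (I01 x. (M + m) * ((q x - p \<theta> x)^2 / q x))" unfolding sq_def
  proof (rule integral_mono)
  show "integrable lborel01 (%x. (q x - p \<theta> x)\<^sup>2)" by (intro bmeas_integrable bmeas_continuous_on continuous_intros q cont_x \<theta>)
  show "integrable lborel01 (%x. (M + m) * ((q x - p \<theta> x)^2 / q x))" by (intro integrable_mult_right I \<theta>)
  fix x assume "x \<in> space lborel01"
  then have x: "x \<in> {0..1}" by simp
  have "(q x - p \<theta> x)^2 = q x * ((q x - p \<theta> x)^2 / q x)" using qpos[OF x] by simp
  also have "... <= (M + m) * ((q x - p \<theta> x)^2 / q x)" by (intro mult_right_mono qM x) (use qpos[OF x] in simp)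
  finally show "(q x - p \<theta> x)^2 <= (M + m) * ((q x - p \<theta> x)^2 / q x)" .
  qed
  also have "... = (M + m) * ?Q \<theta>" by (rule integral_mult_right_zero)
  also have "... <= (M + m) * (2 / m * \<delta>^2)" using M0 m(1) by (intro mult_left_mono Q\<theta>) simp
  finally have sq\<theta>: "sq (%x. q x - p \<theta> x) <= (M + m) * (2 / m * \<delta>^2)" .
  have "sq (%x. ?f x - p \<theta> x) = sq (%x. (?f x - q x) + (q x - p \<theta> x))" by simp
  also have "... <= 2 * sq (%x. ?f x - q x) + 2 * sq (%x. q x - p \<theta> x)" by (intro sq_add_le bmeas_diff bmeas_continuous_on q cf cont_x \<theta>)
  also have "... <= \<zeta>" using sqd sq\<theta> \<delta>(4) unfolding sq_minus_commute[of ?f q] by linarith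
  finally have h\<eta>: "norm (\<theta> - \<theta>0) < \<eta>" by (rule \<zeta>(2)[OF \<theta>])
  define G where "G = (\<chi> i. \<integral>x. ?f x / q x * (grad0 x $ i) \<partial>lborel01)"
  define k where "k = matrix_inv J *v (- G)"
  define A where "A = cross_moment q"
  have Gh: "G \<bullet> h = (I01 x. ?f x / q x * (h \<bullet> grad0 x))" for h unfolding G_def by (rule linear_coefficient(1)[OF m q qm B])
  have GA: "norm (G + A) <= C1 * sq (%x. q x - ?f x)" using linear_coefficient(2)[OF m q qm B] unfolding G_def A_def C1_def by (simp only: mult.assoc)
  have nA: "norm A <= real CARD('b) * (\<delta> * (B / m))"
  proof -
  have "\<bar>A $ i\<bar> <= \<delta> * (B / m)" for i
  proof -
   have cA: "continuous_on {0..1} (%x. (q x - ?f x) * (grad0 x $ i / ?f x))" by (intro continuous_intros q cf cont_grad0) (use pos in force)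
   have "\<bar>A $ i\<bar> <= (I01 x. \<bar>(q x - ?f x) * (grad0 x $ i / ?f x)\<bar>)"
    unfolding A_def cross_moment_def vec_lambda_beta by (rule integral_abs_bound)
   also have "... <= \<delta> * (B / m)"
   proof (rule U.integral_le_const)
    show "integrable lborel01 (%x. \<bar>(q x - ?f x) * (grad0 x $ i / ?f x)\<bar>)" by (intro integrable_abs bmeas_integrable bmeas_continuous_on cA)
    have "\<bar>(q x - ?f x) * (grad0 x $ i / ?f x)\<bar> <= \<delta> * (B / m)" if x: "x \<in> {0..1}" for x unfolding abs_mult abs_divide
    by (intro mult_mono frac_le q\<delta> B x) (use \<delta>(1) m x B0 order_trans[OF m(2)[OF x] abs_ge_self] in auto)
    then show "AE x in lborel01. \<bar>(q x - ?f x) * (grad0 x $ i / ?f x)\<bar> <= \<delta> * (B / m)" by (intro AE_I2) simp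
   qed
   finally show ?thesis .
  qed
  then have "(\<Sum>i\<in>UNIV. \<bar>A $ i\<bar>) <= (\<Sum>i\<in>(UNIV :: 'b set). \<delta> * (B / m))" by (intro sum_mono)
  then show ?thesis using norm_le_l1_cart[of A] by simp
  qed
  have GAd: "C1 * sq (%x. q x - ?f x) <= C1 * \<delta>^2" by (intro mult_left_mono sqd C1)
  have "norm G <= norm (G + A) + norm A" using norm_triangle_ineq4[of "G + A" A] by simp
  then have nG: "norm G <= real CARD('b) * (\<delta> * (B / m)) + C1 * \<delta>^2" using GA nA GAd by linarith
  have "norm k <= norm G / c" using inv_le[of "- G"] by (simp only: k_def norm_minus_cancel)
  also have "... <= (real CARD('b) * (\<delta> * (B / m)) + C1 * \<delta>^2) / c" by (intro divide_right_mono nG) (use c(1) in simp)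
  finally have k\<eta>: "norm k < \<eta>" using \<delta>(5) by linarith
  let ?h = "\<theta> - \<theta>0"
  define \<kappa> where "\<kappa> = 4 * \<delta> / m * IH + 2 / m * (I01 x. min (D x) (2 * \<eta> * (H x * sqrt (D x)))) + 2 * \<delta> / m^2 * ID"
  have \<kappa>: "\<kappa> <= \<epsilon>1" using n0(1) \<delta>(3) unfolding \<kappa>_def \<eta>_def[symmetric] by linarith
  have exp: "\<bar>(?Q (\<theta>0 + h) - ?Q \<theta>0) - (2 * (G \<bullet> h) + h \<bullet> (J *v h))\<bar> <= \<epsilon>1 * (norm h)^2" if h: "norm h < \<eta>" for h
  proof -
  have "\<bar>(?Q (\<theta>0 + h) - ?Q \<theta>0) - (2 * (G \<bullet> h) + h \<bullet> (J *v h))\<bar> <= \<kappa> * (norm h)^2"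
   unfolding Gh \<kappa>_def IH_def ID_def by (rule objective_expansion[OF D H AE m q q\<delta> \<delta>m]) (use h \<eta>(2) in auto)
  also have "... <= \<epsilon>1 * (norm h)^2" by (intro mult_right_mono \<kappa>) simp
  finally show ?thesis .
  qed
  have kin: "\<theta>0 + k \<in> \<Theta>" by (rule in_\<Theta>) (use k\<eta> \<eta>(2) in linarith)
  have "(norm (?h - k))^2 <= 6 * \<epsilon>1 / c * (norm k)^2"
  proof (rule near_quadratic_minimizer[OF symJ c(2) c(1)])
  show "0 <= \<epsilon>1" "4 * \<epsilon>1 <= c" using \<epsilon>1 by simp_all
  show "J *v k = - G" unfolding k_def by (rule Jinv)
  show "\<bar>(?Q (\<theta>0 + ?h) - ?Q \<theta>0) - (2 * (G \<bullet> ?h) + ?h \<bullet> (J *v ?h))\<bar> <= \<epsilon>1 * (norm ?h)^2" by (rule exp[OF h\<eta>])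
  show "\<bar>(?Q (\<theta>0 + k) - ?Q \<theta>0) - (2 * (G \<bullet> k) + k \<bullet> (J *v k))\<bar> <= \<epsilon>1 * (norm k)^2" by (rule exp[OF k\<eta>])
  show "?Q (\<theta>0 + ?h) - ?Q \<theta>0 <= ?Q (\<theta>0 + k) - ?Q \<theta>0" using min'[rule_format, OF kin] by simp
  qed
  also have "... <= \<epsilon>2\<^sup>2 * (norm k)^2"
  proof (rule mult_right_mono)
  have "6 * \<epsilon>1 <= c * \<epsilon>2\<^sup>2" using \<epsilon>1(3) by linarith
  then show "6 * \<epsilon>1 / c <= \<epsilon>2\<^sup>2" using c(1) by (simp only: pos_divide_le_eq mult.commute)
  qed simp
  finally have "(norm (?h - k))^2 <= (\<epsilon>2 * norm k)^2" by (simp only: power_mult_distrib)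
  then have hk: "norm (?h - k) <= \<epsilon>2 * norm k" by (rule power2_le_imp_le) (use \<epsilon>2(1) in simp)
  define r where "r = C1 * sq (%x. q x - ?f x) / c"
  have r0: "0 <= r" unfolding r_def using C1 c(1) by simp
  have kA: "norm (k - matrix_inv J *v A) <= r"
  proof -
  have "k - matrix_inv J *v A = matrix_inv J *v (- (G + A))" unfolding k_def matrix_vector_mult_diff_distrib[symmetric] by simp
  then have "norm (k - matrix_inv J *v A) <= norm (G + A) / c" using inv_le[of "- (G + A)"] by (simp only: norm_minus_cancel)
  also have "... <= r" unfolding r_def using c(1) by (intro divide_right_mono GA) simp
  finally show ?thesis .
  qed
  have nk: "norm k <= norm A / c + r" using norm_triangle_ineq[of "k - matrix_inv J *v A" "matrix_inv J *v A"] kA inv_le[of A] by simp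
  have "norm (?h - matrix_inv J *v A) <= norm (?h - k) + norm (k - matrix_inv J *v A)" by (rule norm_diff_triangle_le[OF order_refl order_refl])
  also have "... <= \<epsilon>2 * (norm A / c + r) + r" using hk kA mult_left_mono[OF nk, of \<epsilon>2] \<epsilon>2(1) by linarith
  also have "... <= \<epsilon> * norm A + 2 * r"
  proof -
  have "\<epsilon>2 * (norm A / c) <= (\<epsilon> * c) * (norm A / c)" by (intro mult_right_mono \<epsilon>2(3)) (use c(1) in simp)
  also have "... = \<epsilon> * norm A" using c(1) by simp
  finally have "\<epsilon>2 * (norm A / c) <= \<epsilon> * norm A" .
  moreover have "\<epsilon>2 * r <= 1 * r" by (intro mult_right_mono \<epsilon>2(2) r0)
  ultimately show ?thesis by (simp only: distrib_left mult_1)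
  qed
  finally show "norm (\<theta> - \<theta>0 - matrix_inv J *v cross_moment q) <= \<epsilon> * norm (cross_moment q) + 2 * C1 / c * sq (%x. q x - p \<theta>0 x)"
  unfolding A_def r_def by (simp only: times_divide_eq_left times_divide_eq_right mult.assoc)
 qed
 qed
qed

end

section \<open>Weak convergence in Euclidean space through characteristic functions\<close>

inductive_set trig_algebra :: "((real ^ 'b) => real) set" where
 const: "(%_. c) \<in> trig_algebra"
| cos: "(%x. cos (t \<bullet> x)) \<in> trig_algebra"
| sin: "(%x. sin (t \<bullet> x)) \<in> trig_algebra"
| add: "f \<in> trig_algebra ==> g \<in> trig_algebra ==> (%x. f x + g x) \<in> trig_algebra"
| mult: "f \<in> trig_algebra ==> g \<in> trig_algebra ==> (%x. f x * g x) \<in> trig_algebra"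

lemma trig_algebra_continuous: "f \<in> trig_algebra ==> continuous_on S f" by (induction rule: trig_algebra.induct) (auto intro!: continuous_intros)

lemma trig_algebra_bounded: "f \<in> trig_algebra ==> \<exists>B. \<forall>x. \<bar>f x\<bar> <= B"
proof (induction rule: trig_algebra.induct)
 case (add f g)
 then obtain A B where "\<forall>x. \<bar>f x\<bar> <= A" "\<forall>x. \<bar>g x\<bar> <= B" by blast
 then have "\<forall>x. \<bar>f x + g x\<bar> <= A + B" by (meson abs_triangle_ineq add_mono order_trans)
 then show ?case by blast
next
 case (mult f g)
 then obtain A B where AB: "\<forall>x. \<bar>f x\<bar> <= A" "\<forall>x. \<bar>g x\<bar> <= B" by blast
 have "\<bar>f x * g x\<bar> <= A * B" for x unfolding abs_mult by (rule mult_mono) (use AB order_trans[OF abs_ge_zero] in blast)+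
 then show ?case by blast
qed (auto intro: exI[of _ 1])

lemma trig_algebra_polynomial:
 assumes "real_polynomial_function P" "q \<in> trig_algebra"
 shows "(%x. P (q x) :: real) \<in> trig_algebra" using assms(1)
proof (induction rule: real_polynomial_function.induct)
 case (linear P)
 have "P u = u * P 1" for u using linear_scale[OF bounded_linear.linear[OF linear], of u 1] by simp
 then have "(%x. P (q x)) = (%x. q x * P 1)" by (intro ext)
 then show ?case using trig_algebra.mult[OF assms(2) trig_algebra.const] by simp
qed (auto intro: trig_algebra.intros)

text \<open>A continuous function is close on a ball to a trigonometric polynomial; composing the latter with
 a polynomial close to a truncation keeps the approximation and bounds it everywhere.\<close>

lemma trig_approximation:
 fixes f :: "real ^ 'b => real"
 assumes f: "continuous_on UNIV f" "!!x. \<bar>f x\<bar> <= F" and e: "0 < e" "e <= 1"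
 obtains g where "g \<in> trig_algebra" "!!x. x \<in> cball 0 R ==> \<bar>f x - g x\<bar> <= 2 * e" "!!x. \<bar>g x\<bar> <= F + 2"
proof -
 interpret function_ring_on "trig_algebra :: (real ^ 'b => real) set" "cball 0 R"
 proof
 fix x y :: "real ^ 'b" assume "x ~= y"
 define t where "t = (pi / (norm (x - y))^2) *\<^sub>R (x - y)"
 have "t \<bullet> x - t \<bullet> y = t \<bullet> (x - y)" by (simp only: inner_diff_right)
 also have "... = pi" using \<open>x ~= y\<close> by (simp add: t_def flip: power2_norm_eq_inner)
 finally have tx: "t \<bullet> x = t \<bullet> y + pi" by simp
 show "\<exists>f\<in>trig_algebra. f x ~= f y"
 proof (rule ccontr)
  assume "\<not> ?thesis"
  then have eq: "\<forall>f\<in>trig_algebra. f x = f y" by simp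
  have "cos (t \<bullet> x) = cos (t \<bullet> y)" "sin (t \<bullet> x) = sin (t \<bullet> y)"
  using bspec[OF eq trig_algebra.cos[of t]] bspec[OF eq trig_algebra.sin[of t]] by simp_all
  then have "cos (t \<bullet> y) = 0" "sin (t \<bullet> y) = 0" by (simp_all add: tx)
  then show False using sin_cos_squared_add[of "t \<bullet> y"] by simp
 qed
 qed (auto intro: trig_algebra.intros trig_algebra_continuous)
 obtain q where q: "q \<in> trig_algebra" "!!x. x \<in> cball 0 R ==> \<bar>f x - q x\<bar> < e"
 using Stone_Weierstrass_basic[OF continuous_on_subset[OF f(1)] e(1)] by auto
 obtain B where B: "!!x. \<bar>q x\<bar> <= B" using trig_algebra_bounded[OF q(1)] by blast
 define \<kappa> where "\<kappa> u = max (- (F + 1)) (min (F + 1) u)" for u :: real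
 have F0: "0 <= F" using f(2)[of 0] by linarith
 obtain P where P: "real_polynomial_function P" "!!u. u \<in> {-B..B} ==> \<bar>\<kappa> u - P u\<bar> < e"
 proof (rule Stone_Weierstrass_real_polynomial_function[of "{-B..B}" \<kappa> e])
 show "continuous_on {-B..B} \<kappa>" unfolding \<kappa>_def by (intro continuous_intros)
 qed (use e(1) in auto)
 have qB: "q x \<in> {-B..B}" for x using B[of x] by (simp add: abs_le_iff)
 show ?thesis
 proof (rule that[of "%x. P (q x)"])
 show "(%x. P (q x)) \<in> trig_algebra" by (rule trig_algebra_polynomial[OF P(1) q(1)])
 show "\<bar>f x - P (q x)\<bar> <= 2 * e" if x: "x \<in> cball 0 R" for x
 proof -
  have "\<kappa> (q x) = q x" using q(2)[OF x] f(2)[of x] e(2) unfolding \<kappa>_def by linarith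
  then show ?thesis using P(2)[OF qB[of x]] q(2)[OF x] by linarith
 qed
 show "\<bar>P (q x)\<bar> <= F + 2" for x
 proof -
  have "\<bar>\<kappa> (q x)\<bar> <= F + 1" using F0 unfolding \<kappa>_def by linarith
  then show ?thesis using P(2)[OF qB[of x]] e(2) by linarith
 qed
 qed
qed

lemma bounded_continuous_integrable:
 fixes f :: "real ^ 'b => real"
 assumes "prob_space N" "sets N = sets borel" "continuous_on UNIV f" "!!x. \<bar>f x\<bar> <= B"
 shows "integrable N f"
proof -
 interpret prob_space N by fact
 have "f \<in> borel_measurable N" using meas_contI[OF assms(3)] by (simp add: measurable_cong_sets[OF assms(2) refl])
 then show ?thesis by (intro integrable_const_bound[of _ B]) (use assms(4) in auto)
qed

text \<open>The functions whose product with every \<open>cos\<close> and \<open>sin\<close> has a convergent integral are stable under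
 multiplication by further cosines and sines, by the product formulas.\<close>

lemma trig_algebra_convergence:
 fixes \<mu> :: "nat => (real ^ 'b) measure"
 assumes \<mu>: "!!n. prob_space (\<mu> n)" "!!n. sets (\<mu> n) = sets borel" and \<nu>: "prob_space \<nu>" "sets \<nu> = sets borel"
 and c: "!!t. (%n. \<integral>x. cos (t \<bullet> x) \<partial>\<mu> n) ---> (\<integral>x. cos (t \<bullet> x) \<partial>\<nu>)"
 and s: "!!t. (%n. \<integral>x. sin (t \<bullet> x) \<partial>\<mu> n) ---> (\<integral>x. sin (t \<bullet> x) \<partial>\<nu>)"
 and f: "f \<in> trig_algebra"
 shows "(%n. \<integral>x. f x \<partial>\<mu> n) ---> (\<integral>x. f x \<partial>\<nu>)"
proof -
 define conv where "conv g \<longleftrightarrow> (%n. \<integral>x. g x \<partial>\<mu> n) ---> (\<integral>x. g x \<partial>\<nu>)" for g :: "real ^ 'b => real"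
 define T where "T = (trig_algebra :: (real ^ 'b => real) set)"
 have int: "integrable (\<mu> n) g" "integrable \<nu> g" if "g \<in> T" for g n
 using trig_algebra_bounded[of g] bounded_continuous_integrable[OF \<mu>(1) \<mu>(2) trig_algebra_continuous]
  bounded_continuous_integrable[OF \<nu> trig_algebra_continuous] that unfolding T_def by blast+
 have conv_add: "conv (%x. g x + h x)" if "g \<in> T" "h \<in> T" "conv g" "conv h" for g h using tendsto_add[OF that(3,4)[unfolded conv_def]] that(1,2)
 unfolding conv_def by (simp only: lint_add[OF int(1) int(1)] lint_add[OF int(2) int(2)])
 have conv_scale: "conv (%x. a * g x)" if "conv g" for g a
 using tendsto_mult[OF tendsto_const[of a] that[unfolded conv_def]] unfolding conv_def by (simp only: integral_mult_right_zero)
 define Mod where "Mod = {g \<in> T. \<forall>t. conv (%x. g x * cos (t \<bullet> x)) & conv (%x. g x * sin (t \<bullet> x))}"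
 have TC: "(%x. g x * cos (t \<bullet> x)) \<in> T" "(%x. g x * sin (t \<bullet> x)) \<in> T" if "g \<in> T" for g t
 using that unfolding T_def by (auto intro: trig_algebra.intros)
 have Mod_add: "(%x. g x + h x) \<in> Mod" if "g \<in> Mod" "h \<in> Mod" for g h
 proof -
 have gh: "g \<in> T" "h \<in> T" using that by (auto simp: Mod_def)
 have "conv (%x. g x * cos (t \<bullet> x) + h x * cos (t \<bullet> x))" "conv (%x. g x * sin (t \<bullet> x) + h x * sin (t \<bullet> x))" for t
 proof -
  have c: "conv (%x. g x * cos (t \<bullet> x))" "conv (%x. h x * cos (t \<bullet> x))"
  and s: "conv (%x. g x * sin (t \<bullet> x))" "conv (%x. h x * sin (t \<bullet> x))" using that unfolding Mod_def by blast+
  show "conv (%x. g x * cos (t \<bullet> x) + h x * cos (t \<bullet> x))" by (rule conv_add[OF TC(1)[OF gh(1)] TC(1)[OF gh(2)] c])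
  show "conv (%x. g x * sin (t \<bullet> x) + h x * sin (t \<bullet> x))" by (rule conv_add[OF TC(2)[OF gh(1)] TC(2)[OF gh(2)] s])
 qed
 moreover have "(%x. g x + h x) \<in> T" using gh unfolding T_def by (rule trig_algebra.add)
 ultimately show ?thesis unfolding Mod_def mem_Collect_eq distrib_right by blast
 qed
 have Mod_scale: "(%x. a * g x) \<in> Mod" if "g \<in> Mod" for g a
 proof -
 have "conv (%x. a * (g x * cos (t \<bullet> x)))" for t by (rule conv_scale) (use that in \<open>simp only: Mod_def mem_Collect_eq\<close>)
 moreover have "conv (%x. a * (g x * sin (t \<bullet> x)))" for t by (rule conv_scale) (use that in \<open>simp only: Mod_def mem_Collect_eq\<close>)
 moreover have "(%x. a * g x) \<in> T" using trig_algebra.mult[OF trig_algebra.const, of g a] that unfolding Mod_def T_def by blast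
 ultimately show ?thesis unfolding Mod_def mem_Collect_eq mult.assoc by blast
 qed
 have conv_pair: "conv (%x. (1/2) * (u x) + b * (v x))" if "u \<in> T" "v \<in> T" "conv u" "conv v" for u v b
 proof (rule conv_add)
 show "(%x. (1/2) * u x) \<in> T" "(%x. b * v x) \<in> T" using that trig_algebra.mult[OF trig_algebra.const] unfolding T_def by blast+
 qed (rule conv_scale[OF that(3)], rule conv_scale[OF that(4)])
 have Mod_cos: "(%x. cos (r \<bullet> x) * g x) \<in> Mod" and Mod_sin: "(%x. sin (r \<bullet> x) * g x) \<in> Mod" if g: "g \<in> Mod" for g r
 proof -
 have gT: "g \<in> T" and gc: "!!t. conv (%x. g x * cos (t \<bullet> x))" and gs: "!!t. conv (%x. g x * sin (t \<bullet> x))"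
  using g unfolding Mod_def by blast+
 have eq1: "cos (r \<bullet> x) * g x * cos (t \<bullet> x) = (1/2) * (g x * cos ((r - t) \<bullet> x)) + (1/2) * (g x * cos ((r + t) \<bullet> x))" for t x
  by (simp add: inner_diff_left inner_add_left cos_add cos_diff algebra_simps)
 have eq2: "cos (r \<bullet> x) * g x * sin (t \<bullet> x) = (1/2) * (g x * sin ((r + t) \<bullet> x)) + (-1/2) * (g x * sin ((r - t) \<bullet> x))" for t x
  by (simp add: inner_diff_left inner_add_left sin_add sin_diff algebra_simps)
 have eq3: "sin (r \<bullet> x) * g x * cos (t \<bullet> x) = (1/2) * (g x * sin ((r + t) \<bullet> x)) + (1/2) * (g x * sin ((r - t) \<bullet> x))" for t x
  by (simp add: inner_diff_left inner_add_left sin_add sin_diff algebra_simps)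
 have eq4: "sin (r \<bullet> x) * g x * sin (t \<bullet> x) = (1/2) * (g x * cos ((r - t) \<bullet> x)) + (-1/2) * (g x * cos ((r + t) \<bullet> x))" for t x
  by (simp add: inner_diff_left inner_add_left cos_add cos_diff algebra_simps)
 have "(%x. cos (r \<bullet> x) * g x) \<in> T" "(%x. sin (r \<bullet> x) * g x) \<in> T" using gT unfolding T_def by (auto intro: trig_algebra.intros)
 moreover have "conv (%x. cos (r \<bullet> x) * g x * cos (t \<bullet> x))" for t unfolding eq1 by (rule conv_pair[OF TC(1)[OF gT] TC(1)[OF gT] gc gc])
 moreover have "conv (%x. cos (r \<bullet> x) * g x * sin (t \<bullet> x))" for t unfolding eq2 by (rule conv_pair[OF TC(2)[OF gT] TC(2)[OF gT] gs gs])
 moreover have "conv (%x. sin (r \<bullet> x) * g x * cos (t \<bullet> x))" for t unfolding eq3 by (rule conv_pair[OF TC(2)[OF gT] TC(2)[OF gT] gs gs])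
 moreover have "conv (%x. sin (r \<bullet> x) * g x * sin (t \<bullet> x))" for t unfolding eq4 by (rule conv_pair[OF TC(1)[OF gT] TC(1)[OF gT] gc gc])
 ultimately show "(%x. cos (r \<bullet> x) * g x) \<in> Mod" "(%x. sin (r \<bullet> x) * g x) \<in> Mod" unfolding Mod_def by blast+
 qed
 have "\<forall>g\<in>Mod. (%x. f x * g x) \<in> Mod" using f
 proof (induction rule: trig_algebra.induct)
 case (const a)
 then show ?case using Mod_scale by blast
 next
 case (cos t)
 then show ?case using Mod_cos by blast
 next
 case (sin t)
 then show ?case using Mod_sin by blast
 next
 case (add f g)
 show ?case
 proof
  fix u assume u: "u \<in> Mod"
  have "(%x. f x * u x + g x * u x) \<in> Mod" using Mod_add add.IH u by blast
  then show "(%x. (f x + g x) * u x) \<in> Mod" by (simp only: distrib_right)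
 qed
 next
 case (mult f g)
 show ?case
 proof
  fix u assume u: "u \<in> Mod"
  have "(%x. f x * (g x * u x)) \<in> Mod" by (rule bspec[OF mult.IH(1) bspec[OF mult.IH(2) u]])
  then show "(%x. f x * g x * u x) \<in> Mod" by (simp only: mult.assoc)
 qed
 qed
 moreover have "(%_. 1) \<in> Mod" by (simp add: Mod_def conv_def T_def c s trig_algebra.const)
 ultimately have "(%x. f x * 1) \<in> Mod" by (rule bspec)
 then have "conv (%x. f x * 1 * cos (0 \<bullet> x))" unfolding Mod_def by blast
 then show ?thesis by (simp add: conv_def)
qed

lemma tail_small:
 fixes N :: "(real ^ 'b) measure"
 assumes "prob_space N" "sets N = sets borel" "0 < e"
 shows "\<exists>R. measure N {x. R < norm x} <= e"
proof -
 interpret prob_space N by fact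
 have "(%n. measure N {x. real n < norm x}) ---> measure N (\<Inter>n. {x. real n < norm x})"
 proof (rule finite_Lim_measure_decseq)
 show "range (%n. {x. real n < norm x}) \<subseteq> sets N" unfolding assms(2) by auto
 show "decseq (%n. {x :: real ^ 'b. real n < norm x})" by (auto simp: decseq_def)
 qed
 moreover have "(\<Inter>n. {x :: real ^ 'b. real n < norm x}) = {}"
 proof -
 have "\<exists>n. \<not> real n < norm x" for x :: "real ^ 'b" using reals_Archimedean2[of "norm x"] less_asym by blast
 then show ?thesis by (simp add: set_eq_iff)
 qed
 ultimately have "(%n. measure N {x. real n < norm x}) ---> 0" by simp
 then have "\<forall>\<^sub>F n in sequentially. measure N {x. real n < norm x} < e" by (rule order_tendstoD) fact
 then show ?thesis using eventually_happens'[OF sequentially_bot] less_imp_le by blast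
qed

text \<open>Tightness confines all measures to one ball up to a small mass; there a test function is
 replaced by a bounded trigonometric polynomial, whose integrals converge.\<close>

theorem weak_conv_from_trig:
 fixes \<mu> :: "nat => (real ^ 'b) measure"
 assumes \<mu>: "!!n. prob_space (\<mu> n)" "!!n. sets (\<mu> n) = sets borel" and \<nu>: "prob_space \<nu>" "sets \<nu> = sets borel"
 and c: "!!t. (%n. \<integral>x. cos (t \<bullet> x) \<partial>\<mu> n) ---> (\<integral>x. cos (t \<bullet> x) \<partial>\<nu>)"
 and s: "!!t. (%n. \<integral>x. sin (t \<bullet> x) \<partial>\<mu> n) ---> (\<integral>x. sin (t \<bullet> x) \<partial>\<nu>)"
 and tight: "!!e. 0 < e ==> \<exists>R. \<forall>\<^sub>F n in sequentially. measure (\<mu> n) {x. R < norm x} <= e"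
 shows "weak_conv_to \<mu> \<nu>" unfolding weak_conv_to_def
proof (intro allI impI)
 fix f :: "real ^ 'b => real" assume "continuous_on UNIV f & bounded (range f)"
 then obtain F where f: "continuous_on UNIV f" "!!x. \<bar>f x\<bar> <= F" unfolding bounded_iff by auto
 have F0: "0 <= F" using f(2)[of 0] by linarith
 show "(%n. \<integral>x. f x \<partial>\<mu> n) ---> (\<integral>x. f x \<partial>\<nu>)"
 proof (rule LIMSEQ_I)
 fix \<epsilon> :: real assume \<epsilon>: "0 < \<epsilon>"
 define e where "e = min 1 (\<epsilon> / (6 * (F + 2)))"
 have F2: "0 < 6 * (F + 2)" using F0 by simp
 have e: "0 < e" "e <= 1" using \<epsilon> F2 by (simp_all add: e_def)
 have "e <= \<epsilon> / (6 * (F + 2))" unfolding e_def by simp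
 then have e3: "e * (6 * (F + 2)) <= \<epsilon>" by (simp only: pos_le_divide_eq[OF F2])
 obtain R1 where R1: "\<forall>\<^sub>F n in sequentially. measure (\<mu> n) {x. R1 < norm x} <= e" using tight[OF e(1)] by blast
 obtain R2 where R2: "measure \<nu> {x. R2 < norm x} <= e" using tail_small[OF \<nu> e(1)] by blast
 define R where "R = max R1 R2"
 obtain g where g: "g \<in> trig_algebra" "!!x. x \<in> cball 0 R ==> \<bar>f x - g x\<bar> <= 2 * e" "!!x. \<bar>g x\<bar> <= F + 2"
  by (rule trig_approximation[OF f e(1,2)]) (rule that)
 have approx: "\<bar>(\<integral>x. f x \<partial>N) - (\<integral>x. g x \<partial>N)\<bar> <= 2 * e + (2 * F + 2) * e"
  if N: "prob_space N" "sets N = sets borel" and tail: "measure N {x. R' < norm x} <= e" "R' <= R" for N R'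
 proof -
  interpret prob_space N by (rule N(1))
  have A: "{x. R < norm x} \<in> sets N" unfolding N(2) by simp
  have i: "integrable N f" "integrable N g"
  by (rule bounded_continuous_integrable[OF N f]) (rule bounded_continuous_integrable[OF N trig_algebra_continuous[OF g(1)] g(3)])
  have "\<bar>(\<integral>x. f x \<partial>N) - (\<integral>x. g x \<partial>N)\<bar> = \<bar>\<integral>x. f x - g x \<partial>N\<bar>" using i by simp
  also have "... <= (\<integral>x. \<bar>f x - g x\<bar> \<partial>N)" by (rule integral_abs_bound)
  also have "... <= (\<integral>x. 2 * e + (2 * F + 2) * indicator {x. R < norm x} x \<partial>N)"
  proof (rule integral_mono)
  show "\<bar>f x - g x\<bar> <= 2 * e + (2 * F + 2) * indicator {x. R < norm x} x" for x
   using g(2)[of x] f(2)[of x] g(3)[of x] e(1) by (cases "R < norm x") (auto simp: indicator_def)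
  qed (use i A in \<open>auto intro!: lint_addable integrable_mult_right simp: emeasure_eq_measure\<close>)
  also have "... = 2 * e + (2 * F + 2) * measure N {x. R < norm x}"
  proof -
  have sN: "space N = UNIV" using sets_eq_imp_space_eq[OF N(2)] by simp
  have pN: "measure N UNIV = 1" using prob_space unfolding sN .
  show ?thesis using A by (subst lint_add) (auto simp: sN pN emeasure_eq_measure)
  qed
  also have "... <= 2 * e + (2 * F + 2) * e"
  proof -
  have "measure N {x. R < norm x} <= measure N {x. R' < norm x}" by (rule finite_measure_mono) (use tail(2) N(2) in auto)
  then show ?thesis using tail(1) F0 by (intro add_left_mono mult_left_mono) auto
  qed
  finally show ?thesis .
 qed
 have "(%n. \<integral>x. g x \<partial>\<mu> n) ---> (\<integral>x. g x \<partial>\<nu>)" by (rule trig_algebra_convergence[OF \<mu> \<nu> c s g(1)])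
 then have "\<forall>\<^sub>F n in sequentially. dist (\<integral>x. g x \<partial>\<mu> n) (\<integral>x. g x \<partial>\<nu>) < e" by (rule tendstoD) (rule e(1))
 then have "\<forall>\<^sub>F n in sequentially. \<bar>(\<integral>x. f x \<partial>\<mu> n) - (\<integral>x. f x \<partial>\<nu>)\<bar> < \<epsilon>"
  using R1
 proof eventually_elim
  case (elim n)
  define c where "c = 2 * e + (2 * F + 2) * e"
  have "2 * (2 * e + (2 * F + 2) * e) + e < e * (6 * (F + 2))" using e(1) F0 by (simp add: algebra_simps) (use mult_nonneg_nonneg[of F e] in linarith)
  then have "2 * c + e < \<epsilon>" using e3 unfolding c_def by (rule less_le_trans)
  moreover have "\<bar>(\<integral>x. f x \<partial>\<mu> n) - (\<integral>x. g x \<partial>\<mu> n)\<bar> <= c"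
  unfolding c_def by (rule approx[OF \<mu> elim(2)]) (simp add: R_def)
  moreover have "\<bar>(\<integral>x. f x \<partial>\<nu>) - (\<integral>x. g x \<partial>\<nu>)\<bar> <= c"
  unfolding c_def by (rule approx[OF \<nu> R2]) (simp add: R_def)
  ultimately show ?case using elim(1) unfolding dist_real_def by linarith
 qed
 then show "\<exists>no. \<forall>n\<ge>no. norm ((\<integral>x. f x \<partial>\<mu> n) - (\<integral>x. f x \<partial>\<nu>)) < \<epsilon>"
  unfolding eventually_sequentially real_norm_def .
 qed
qed

section \<open>Nondegenerate normal distributions\<close>

lemma inner_transpose: "x \<bullet> (transpose V *v y) = (V *v x) \<bullet> (y :: real ^ 'b)" for V :: "real ^ 'b ^ 'b"
proof -
 have "x \<bullet> (transpose V *v y) = (x v* transpose V) \<bullet> y" by (rule dot_lmul_matrix[symmetric])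
 also have "x v* transpose V = transpose (transpose V) *v x" by (rule transpose_matrix_vector[symmetric])
 finally show ?thesis by (simp only: transpose_transpose)
qed

text \<open>Gram-Schmidt for the inner product with matrix \<open>J\<close>.\<close>

lemma posdef_orthonormal:
 fixes J :: "real ^ 'b ^ 'b"
 assumes "pos_def J"
 shows "\<exists>V :: real ^ 'b ^ 'b. transpose V ** J ** V = mat 1"
proof -
 have sym: "x \<bullet> (J *v y) = y \<bullet> (J *v x)" for x y
 proof -
 have tJ: "transpose J = J" using assms unfolding pos_def_def by blast
 have "x \<bullet> (J *v y) = (x v* J) \<bullet> y" by (rule dot_lmul_matrix[symmetric])
 also have "... = (transpose J *v x) \<bullet> y" by (simp only: transpose_matrix_vector)
 finally show ?thesis unfolding tJ by (simp only: inner_commute)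
 qed
 have "k <= CARD('b) ==> \<exists>f :: nat => real ^ 'b. \<forall>i<k. \<forall>j<k. f i \<bullet> (J *v f j) = (if i = j then 1 else 0)" for k
 proof (induction k)
 case (Suc k)
 then obtain f :: "nat => real ^ 'b" where f: "!!i j. i < k ==> j < k ==> f i \<bullet> (J *v f j) = (if i = j then 1 else 0)" by (metis Suc_leD)
 let ?S = "(%i. J *v f i) ` {..<k}"
 have "dim ?S <= card ?S" by (rule dim_le_card') simp
 also have "... <= k" using card_image_le[of "{..<k}"] by simp
 also have "... < DIM(real ^ 'b)" using Suc.prems by simp
 finally obtain v where v: "v ~= 0" "!!y. y \<in> span ?S ==> orthogonal v y" using orthogonal_to_subspace_exists[of ?S] by blast
 have pos: "0 < v \<bullet> (J *v v)" using assms v(1) unfolding pos_def_def by blast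
 define w where "w = (1 / sqrt (v \<bullet> (J *v v))) *\<^sub>R v"
 have ww: "w \<bullet> (J *v w) = 1" using pos by (simp add: w_def matrix_vector_mult_scaleR)
 have wf: "w \<bullet> (J *v f i) = 0" if "i < k" for i using v(2)[OF span_base, of "J *v f i"] that by (simp add: w_def orthogonal_def)
 have "\<forall>i<Suc k. \<forall>j<Suc k. (f(k := w)) i \<bullet> (J *v (f(k := w)) j) = (if i = j then 1 else 0)"
 proof (intro allI impI)
  fix i j assume "i < Suc k" "j < Suc k"
  then consider "i < k" "j < k" | "i = k" "j < k" | "i < k" "j = k" | "i = k" "j = k" unfolding less_Suc_eq by blast
  then show "(f(k := w)) i \<bullet> (J *v (f(k := w)) j) = (if i = j then 1 else 0)"
  proof cases
  case 1 then show ?thesis using f by simp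
  next
  case 2 then show ?thesis using wf[of j] by simp
  next
  case 3 then show ?thesis using sym[of "f i" w] wf[of i] by simp
  next
  case 4 then show ?thesis using ww by simp
  qed
 qed
 then show ?case by blast
 qed simp
 from this[OF order_refl] obtain f :: "nat => real ^ 'b"
 where f: "!!i j. i < CARD('b) ==> j < CARD('b) ==> f i \<bullet> (J *v f j) = (if i = j then 1 else 0)" by blast
 obtain h :: "'b => nat" where h: "bij_betw h UNIV {..<CARD('b)}" using ex_bij_betw_finite_nat[of "UNIV :: 'b set"] by (auto simp: atLeast0LessThan)
 define V :: "real ^ 'b ^ 'b" where "V = (\<chi> r c. f (h c) $ r)"
 have col: "V *v axis c 1 = f (h c)" for c by (simp add: V_def matrix_vector_mult_basis column_def vec_eq_iff)
 have "(transpose V ** J ** V) $ a $ c = mat 1 $ a $ c" for a c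
 proof -
 have "(transpose V ** J ** V) $ a $ c = axis a 1 \<bullet> ((transpose V ** J ** V) *v axis c 1)"
  by (simp add: matrix_vector_mult_basis column_def inner_axis')
 also have "... = axis a 1 \<bullet> (transpose V *v (J *v (V *v axis c 1)))" by (simp only: matrix_vector_mul_assoc matrix_mul_assoc)
 also have "... = (V *v axis a 1) \<bullet> (J *v (V *v axis c 1))" by (rule inner_transpose)
 also have "... = (if h a = h c then 1 else 0)" unfolding col by (rule f) (use h in \<open>auto simp: bij_betw_def\<close>)
 also have "... = mat 1 $ a $ c" using h by (auto simp: mat_def bij_betw_def inj_def)
 finally show ?thesis .
 qed
 then have "transpose V ** J ** V = mat 1" by (simp only: vec_eq_iff simp_thms)
 then show ?thesis by blast
qed

text \<open>Invertible matrices are products of diagonal ones, coordinate swaps and shears; the first two map boxes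
 to boxes, and a shear translates one coordinate by an amount that depends on the others only.\<close>

lemma nn_integral_linear_substitution:
 fixes A :: "real ^ 'b ^ 'b" and g :: "real ^ 'b => ennreal"
 assumes A: "det A ~= 0" and g: "g \<in> borel_measurable borel"
 shows "(\<integral>\<^sup>+x. g x \<partial>lborel) = ennreal \<bar>det A\<bar> * (\<integral>\<^sup>+x. g (A *v x) \<partial>lborel)"
proof -
 define Q where "Q A \<longleftrightarrow> (det A ~= 0 --> (\<forall>g\<in>borel_measurable borel.
  (\<integral>\<^sup>+x. g x \<partial>lborel) = ennreal \<bar>det A\<bar> * (\<integral>\<^sup>+x. g (A *v x) \<partial>lborel)))" for A :: "real ^ 'b ^ 'b"
 have mA: "(*v) A \<in> borel_measurable borel" for A :: "real ^ 'b ^ 'b"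
 by (intro meas_contI linear_continuous_on linear_conv_bounded_linear[THEN iffD1] matrix_vector_mul_linear)
 have mcomp: "(%x. h (A *v x)) \<in> borel_measurable borel" if "h \<in> borel_measurable borel" for h :: "real ^ 'b => ennreal" and A :: "real ^ 'b ^ 'b"
 by (rule measurable_compose[OF mA that])
 have BA: "Basis = range (%i :: 'b. axis i (1::real))" by (auto simp: Basis_vec_def)
 have injA: "inj (%i :: 'b. axis i (1::real))" by (auto simp: inj_def axis_eq_axis)
 have prodA: "(\<Prod>b\<in>Basis. F b) = (\<Prod>i\<in>UNIV. F (axis i 1))" for F :: "real ^ 'b => real"
 unfolding BA by (rule prod.reindex[OF injA, unfolded comp_def])
 have preserve: "Q A" if d: "\<bar>det A\<bar> = 1" and l: "lborel = distr lborel borel ((*v) A)" for A unfolding Q_def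
 proof (intro impI ballI)
 fix g :: "real ^ 'b => ennreal" assume g: "g \<in> borel_measurable borel"
 have "(\<integral>\<^sup>+x. g x \<partial>lborel) = (\<integral>\<^sup>+x. g x \<partial>distr lborel borel ((*v) A))"
  by (rule arg_cong[of _ _ "%L. \<integral>\<^sup>+x. g x \<partial>L", OF l])
 also have "... = (\<integral>\<^sup>+x. g (A *v x) \<partial>lborel)" by (rule nn_integral_distr) (use mA g in simp_all)
 finally show "(\<integral>\<^sup>+x. g x \<partial>lborel) = ennreal \<bar>det A\<bar> * (\<integral>\<^sup>+x. g (A *v x) \<partial>lborel)" unfolding d by simp
 qed
 have mult: "Q (A ** B)" if QA: "Q A" and QB: "Q B" for A B unfolding Q_def
 proof (intro impI ballI)
 fix g :: "real ^ 'b => ennreal" assume d: "det (A ** B) ~= 0" and g: "g \<in> borel_measurable borel"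
 have dA: "det A ~= 0" and dB: "det B ~= 0" using d by (auto simp: det_mul)
 have "(\<integral>\<^sup>+x. g x \<partial>lborel) = ennreal \<bar>det A\<bar> * (\<integral>\<^sup>+x. g (A *v x) \<partial>lborel)"
  by (rule bspec[OF mp[OF QA[unfolded Q_def] dA] g])
 also have "(\<integral>\<^sup>+x. g (A *v x) \<partial>lborel) = ennreal \<bar>det B\<bar> * (\<integral>\<^sup>+x. g (A *v (B *v x)) \<partial>lborel)"
  by (rule bspec[OF mp[OF QB[unfolded Q_def] dB] mcomp[OF g]])
 finally show "(\<integral>\<^sup>+x. g x \<partial>lborel) = ennreal \<bar>det (A ** B)\<bar> * (\<integral>\<^sup>+x. g (A ** B *v x) \<partial>lborel)"
  by (simp add: det_mul abs_mult ennreal_mult matrix_vector_mul_assoc mult.assoc)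
 qed
 have diag: "Q A" if z: "!!i j. i ~= j ==> A $ i $ j = 0" for A unfolding Q_def
 proof (intro impI ballI)
 fix g :: "real ^ 'b => ennreal" assume d: "det A ~= 0" and g: "g \<in> borel_measurable borel"
 have dA: "det A = (\<Prod>i\<in>UNIV. A $ i $ i)" by (rule det_diagonal) (rule z)
 define c where "c b = (A *v b) \<bullet> b" for b
 have Ai: "(A *v x) $ i = A $ i $ i * x $ i" for x i
 proof -
  have "(A *v x) $ i = (\<Sum>j\<in>UNIV. if j = i then A $ i $ i * x $ i else 0)"
  unfolding matrix_vector_mult_def vec_lambda_beta by (rule sum.cong) (use z in auto)
  then show ?thesis by simp
 qed
 have ci: "c (axis i 1) = A $ i $ i" for i by (simp add: c_def inner_axis Ai)
 have c0: "c b ~= 0" if "b \<in> Basis" for b using that d unfolding dA BA by (auto simp: ci)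
 have T: "0 + (\<Sum>b\<in>Basis. (c b * (x \<bullet> b)) *\<^sub>R b) = A *v x" for x
 proof (rule euclidean_eqI)
  fix b :: "real ^ 'b" assume b: "b \<in> Basis"
  then obtain i where i: "b = axis i 1" unfolding BA by blast
  have "(0 + (\<Sum>b\<in>Basis. (c b * (x \<bullet> b)) *\<^sub>R b)) \<bullet> b = c b * (x \<bullet> b)" using b by simp
  then show "(0 + (\<Sum>b\<in>Basis. (c b * (x \<bullet> b)) *\<^sub>R b)) \<bullet> b = (A *v x) \<bullet> b" unfolding i ci by (simp add: inner_axis Ai)
 qed
 have pc: "(\<Prod>b\<in>Basis. \<bar>c b\<bar>) = \<bar>det A\<bar>" unfolding dA prodA ci abs_prod ..
 have "lborel = density (distr lborel borel ((*v) A)) (%_. ennreal \<bar>det A\<bar>)" using lborel_affine_euclidean[of c 0, OF c0] unfolding T pc .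
 then have "(\<integral>\<^sup>+x. g x \<partial>lborel) = (\<integral>\<^sup>+x. g x \<partial>density (distr lborel borel ((*v) A)) (%_. ennreal \<bar>det A\<bar>))"
  by (rule arg_cong[of _ _ "%L. \<integral>\<^sup>+x. g x \<partial>L"])
 also have "... = (\<integral>\<^sup>+x. ennreal \<bar>det A\<bar> * g x \<partial>distr lborel borel ((*v) A))"
  by (rule nn_integral_density) (use g in simp_all)
 also have "... = (\<integral>\<^sup>+x. ennreal \<bar>det A\<bar> * g (A *v x) \<partial>lborel)" by (rule nn_integral_distr) (use mA g in simp_all)
 also have "... = ennreal \<bar>det A\<bar> * (\<integral>\<^sup>+x. g (A *v x) \<partial>lborel)" by (rule nn_integral_cmult) (use mcomp[OF g] in simp)
 finally show "(\<integral>\<^sup>+x. g x \<partial>lborel) = ennreal \<bar>det A\<bar> * (\<integral>\<^sup>+x. g (A *v x) \<partial>lborel)" .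
 qed
 have swap: "Q (\<chi> i j. mat 1 $ i $ Transposition.transpose m n j)" for m n :: 'b
 proof -
 let ?s = "Transposition.transpose m n" and ?P = "(\<chi> i j. mat 1 $ i $ Transposition.transpose m n j) :: real ^ 'b ^ 'b"
 have iff: "(i = ?s j) = (j = ?s i)" for i j by (metis transpose_involutory)
 have P: "(?P *v x) $ i = x $ ?s i" for x i
 proof -
  have "(?P *v x) $ i = (\<Sum>j\<in>UNIV. if j = ?s i then x $ j else 0)"
  unfolding matrix_vector_mult_def vec_lambda_beta mat_def by (rule sum.cong) (auto simp: iff)
  then show ?thesis by simp
 qed
 have "?P ** ?P = mat 1" unfolding matrix_eq by (simp add: vec_eq_iff P flip: matrix_vector_mul_assoc)
 then have "det ?P * det ?P = 1" using det_mul[of ?P ?P] by simp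
 then have d: "\<bar>det ?P\<bar> = 1" using abs_square_eq_1[of "det ?P"] by (simp add: power2_eq_square)
 have bij: "bij_betw ?s UNIV UNIV" by (rule bij_betw_byWitness[of _ ?s]) auto
 show ?thesis
 proof (rule preserve[OF d], rule lborel_eqI)
  fix l u :: "real ^ 'b" assume lu: "!!b. b \<in> Basis ==> l \<bullet> b <= u \<bullet> b"
  have lui: "l $ i <= u $ i" for i using lu[of "axis i 1"] unfolding BA by (simp add: inner_axis)
  have v: "(*v) ?P -` box l u = box (?P *v l) (?P *v u)"
  proof (intro set_eqI)
  fix x
  have "(\<forall>i. l $ i < x $ ?s i & x $ ?s i < u $ i) \<longleftrightarrow> (\<forall>i. l $ ?s i < x $ i & x $ i < u $ ?s i)"
   by (metis transpose_involutory)
  then show "x \<in> (*v) ?P -` box l u \<longleftrightarrow> x \<in> box (?P *v l) (?P *v u)" by (simp add: mem_box_cart P)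
  qed
  have "emeasure (distr lborel borel ((*v) ?P)) (box l u) = emeasure lborel ((*v) ?P -` box l u)" using mA[of ?P] by (simp add: emeasure_distr)
  also have "... = (\<Prod>b\<in>Basis. (?P *v u - ?P *v l) \<bullet> b)"
  unfolding v by (rule emeasure_lborel_box) (use lui in \<open>auto simp: BA inner_axis P\<close>)
  also have "(\<Prod>b\<in>Basis. (?P *v u - ?P *v l) \<bullet> b) = (\<Prod>i\<in>UNIV. (%i. u $ i - l $ i) (?s i))"
  unfolding prodA by (simp add: inner_axis P)
  also have "... = (\<Prod>i\<in>UNIV. u $ i - l $ i)" by (rule prod.reindex_bij_betw[OF bij])
  also have "... = (\<Prod>b\<in>Basis. (u - l) \<bullet> b)" unfolding prodA by (simp add: inner_axis)
  finally show "emeasure (distr lborel borel ((*v) ?P)) (box l u) = (\<Prod>b\<in>Basis. (u - l) \<bullet> b)" .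
 qed simp
 qed
 have shear: "Q (\<chi> i j. of_bool (i = m & j = n \<or> i = j))" if mn: "m ~= n" for m n :: 'b
 proof -
 let ?S = "(\<chi> i j. of_bool (i = m & j = n \<or> i = j)) :: real ^ 'b ^ 'b"
 let ?a = "axis m 1 :: real ^ 'b"
 define I where "I = Basis - {?a}"
 have I: "finite I" "?a \<notin> I" "insert ?a I = Basis" by (auto simp: I_def BA)
 have S: "?S *v x = x + (x $ n) *\<^sub>R ?a" for x
 proof -
  have "(?S *v x) $ i = (\<Sum>j\<in>UNIV. (if j = i then x $ i else 0) + (if j = n then (if i = m then x $ n else 0) else 0))" for i
  unfolding matrix_vector_mult_def vec_lambda_beta by (rule sum.cong) (use mn in auto)
  then show ?thesis by (simp add: vec_eq_iff sum.distrib axis_def)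
 qed
 have Sk: "?S = (\<chi> k. if k = m then row m (mat 1) + 1 *s row n (mat 1) else row k (mat 1))" using mn by (auto simp: vec_eq_iff row_def mat_def)
 have d: "det ?S = 1" using det_row_operation[OF mn, of "mat 1 :: real ^ 'b ^ 'b" 1] unfolding Sk det_I .
 interpret product_sigma_finite "%_ :: real ^ 'b. lborel :: real measure" by standard
 have slice: "(\<integral>\<^sup>+x. h x \<partial>lborel) = (\<integral>\<^sup>+x. \<integral>\<^sup>+y. h (y *\<^sub>R ?a + (\<Sum>b\<in>I. x b *\<^sub>R b)) \<partial>lborel \<partial>(\<Pi>\<^sub>M b\<in>I. lborel))"
  if h: "h \<in> borel_measurable borel" for h :: "real ^ 'b => ennreal"
 proof -
  have eq: "(\<Sum>b\<in>Basis. (x(?a := y)) b *\<^sub>R b) = y *\<^sub>R ?a + (\<Sum>b\<in>I. x b *\<^sub>R b)" for x y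
  proof -
  have "(\<Sum>b\<in>I. (x(?a := y)) b *\<^sub>R b) = (\<Sum>b\<in>I. x b *\<^sub>R b)" by (rule sum.cong) (use I(2) in auto)
  then show ?thesis unfolding I(3)[symmetric] using I(1,2) by simp
  qed
  have m: "(%f. \<Sum>b\<in>Basis. f b *\<^sub>R b) \<in> measurable (\<Pi>\<^sub>M b\<in>Basis. lborel) (borel :: (real ^ 'b) measure)" by measurable
  have "(\<integral>\<^sup>+x. h x \<partial>lborel) = (\<integral>\<^sup>+x. h x \<partial>distr (\<Pi>\<^sub>M b\<in>Basis. lborel) borel (%f. \<Sum>b\<in>Basis. f b *\<^sub>R b))"
  by (rule arg_cong[of _ _ "%L. \<integral>\<^sup>+x. h x \<partial>L", OF lborel_eq])
  also have "... = (\<integral>\<^sup>+f. h (\<Sum>b\<in>Basis. f b *\<^sub>R b) \<partial>(\<Pi>\<^sub>M b\<in>insert ?a I. lborel))"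
  unfolding I(3) by (rule nn_integral_distr[OF m]) (use h in simp)
  also have "... = (\<integral>\<^sup>+x. \<integral>\<^sup>+y. h (\<Sum>b\<in>Basis. (x(?a := y)) b *\<^sub>R b) \<partial>lborel \<partial>(\<Pi>\<^sub>M b\<in>I. lborel))"
  by (rule product_nn_integral_insert[OF I(1,2)]) (unfold I(3), rule measurable_compose[OF m h])
  finally show ?thesis unfolding eq .
 qed
 show ?thesis unfolding Q_def
 proof (intro impI ballI)
  fix g :: "real ^ 'b => ennreal" assume g: "g \<in> borel_measurable borel"
  have inner: "(\<integral>\<^sup>+y. g (?S *v (y *\<^sub>R ?a + w)) \<partial>lborel) = (\<integral>\<^sup>+y. g (y *\<^sub>R ?a + w) \<partial>lborel)" for w
  proof -
  have eq: "(w $ n + 1 * y) *\<^sub>R ?a + w = ?S *v (y *\<^sub>R ?a + w)" for y unfolding S using mn by (simp add: vec_eq_iff axis_def)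
  have mw: "(%y. y *\<^sub>R ?a + w) \<in> borel_measurable borel" by measurable
  have "(\<integral>\<^sup>+y. g (y *\<^sub>R ?a + w) \<partial>lborel) = ennreal \<bar>1\<bar> * (\<integral>\<^sup>+y. g ((w $ n + 1 * y) *\<^sub>R ?a + w) \<partial>lborel)"
   by (rule nn_integral_real_affine[OF measurable_compose[OF mw g]]) simp
  then show ?thesis unfolding eq by simp
  qed
  show "(\<integral>\<^sup>+x. g x \<partial>lborel) = ennreal \<bar>det ?S\<bar> * (\<integral>\<^sup>+x. g (?S *v x) \<partial>lborel)"
  unfolding d slice[OF g] slice[OF mcomp[OF g]] inner by simp
 qed
 qed
 have "Q A"
 proof (rule induct_matrix_elementary_alt[of Q])
 show "Q A" if "row i A = 0" for A i using det_zero_row(2)[OF that] unfolding Q_def by blast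
 qed (use mult diag swap shear in blast)+
 then show ?thesis using A g unfolding Q_def by blast
qed

lemma lborel_invertible_image:
 fixes V W :: "real ^ 'b ^ 'b"
 assumes VW: "V ** W = mat 1" "W ** V = mat 1"
 shows "lborel = density (distr lborel borel ((*v) V)) (%_. ennreal \<bar>det V\<bar>)"
proof (rule measure_eqI)
 have d: "det V ~= 0" using arg_cong[OF VW(1), of det] by (auto simp: det_mul)
 have mV: "(*v) V \<in> borel_measurable borel" by (intro meas_contI linear_continuous_on linear_conv_bounded_linear[THEN iffD1] matrix_vector_mul_linear)
 fix S :: "(real ^ 'b) set" assume "S \<in> sets lborel"
 then have S: "S \<in> sets borel" by simp
 have "emeasure lborel S = (\<integral>\<^sup>+x. indicator S x \<partial>lborel)" using S by simp
 also have "... = ennreal \<bar>det V\<bar> * (\<integral>\<^sup>+x. indicator S (V *v x) \<partial>lborel)"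
 by (rule nn_integral_linear_substitution[OF d]) (use S in simp)
 also have "(\<integral>\<^sup>+x. indicator S (V *v x) \<partial>lborel) = (\<integral>\<^sup>+x. indicator S x \<partial>distr lborel borel ((*v) V))"
 by (rule nn_integral_distr[symmetric]) (use mV S in simp_all)
 also have "... = emeasure (distr lborel borel ((*v) V)) S" using S by simp
 finally show "emeasure lborel S = emeasure (density (distr lborel borel ((*v) V)) (%_. ennreal \<bar>det V\<bar>)) S"
 using S by (simp add: emeasure_density_const)
qed simp

definition std_gaussian :: "(real ^ 'b) measure" where
 "std_gaussian = density lborel (%z. ennreal (\<Prod>b\<in>Basis. std_normal_density (z \<bullet> b)))"

lemma std_gaussian_char:
 fixes s :: "real ^ 'b"
 shows "(\<integral>z. exp (\<i> * complex_of_real (s \<bullet> z)) \<partial>std_gaussian) = complex_of_real (exp (- (s \<bullet> s) / 2))"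
proof -
 interpret product_sigma_finite "%_ :: real ^ 'b. lborel :: real measure" by standard
 let ?g = "%b u. std_normal_density u *\<^sub>R exp (\<i> * complex_of_real ((s \<bullet> b) * u))"
 have D: "real_distribution std_normal_distribution" by (rule real_dist_normal_dist)
 have b: "integrable lborel (?g b)" "(\<integral>u. ?g b u \<partial>lborel) = complex_of_real (exp (- (s \<bullet> b)\<^sup>2 / 2))" for b
 proof -
 interpret real_distribution std_normal_distribution by (rule D)
 have "integrable std_normal_distribution (%u. exp (\<i> * complex_of_real ((s \<bullet> b) * u)))" by (intro integrable_const_bound[of _ 1]) auto
 then show "integrable lborel (?g b)" by (subst (asm) integrable_density) auto
 have "(\<integral>u. ?g b u \<partial>lborel) = char std_normal_distribution (s \<bullet> b)" unfolding char_def by (subst integral_density) auto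
 then show "(\<integral>u. ?g b u \<partial>lborel) = complex_of_real (exp (- (s \<bullet> b)\<^sup>2 / 2))" by (simp add: char_std_normal_distribution)
 qed
 have prodexp: "(\<Prod>b\<in>Basis. std_normal_density (z \<bullet> b)) *\<^sub>R exp (\<i> * complex_of_real (s \<bullet> z)) = (\<Prod>b\<in>Basis. ?g b (z \<bullet> b))" for z
 proof -
 have "exp (\<i> * complex_of_real (s \<bullet> z)) = exp (\<Sum>b\<in>Basis. \<i> * complex_of_real ((s \<bullet> b) * (z \<bullet> b)))"
  by (simp add: euclidean_inner[of s z] sum_distrib_left)
 also have "... = (\<Prod>b\<in>Basis. exp (\<i> * complex_of_real ((s \<bullet> b) * (z \<bullet> b))))" by (rule exp_sum) simp
 finally show ?thesis by (simp add: prod.distrib scaleR_conv_of_real)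
 qed
 have "(\<integral>z. exp (\<i> * complex_of_real (s \<bullet> z)) \<partial>std_gaussian) = (\<integral>z. (\<Prod>b\<in>Basis. ?g b (z \<bullet> b)) \<partial>lborel)"
 unfolding std_gaussian_def by (subst integral_density) (auto simp: prod_nonneg prodexp)
 also have "... = (\<integral>f. (\<Prod>b\<in>Basis. ?g b ((\<Sum>c\<in>Basis. f c *\<^sub>R c) \<bullet> b)) \<partial>(\<Pi>\<^sub>M b\<in>Basis. lborel))"
 by (subst lborel_eq[where 'a = "real ^ 'b"], subst integral_distr) auto
 also have "... = (\<integral>f. (\<Prod>b\<in>Basis. ?g b (f b)) \<partial>(\<Pi>\<^sub>M b\<in>Basis. lborel))"
 by (intro lint_cong prod.cong refl) (simp add: inner_sum_left inner_Basis if_distrib cong: if_cong)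
 also have "... = (\<Prod>b\<in>Basis. complex_of_real (exp (- (s \<bullet> b)\<^sup>2 / 2)))"
 unfolding b(2)[symmetric] by (rule product_integral_prod[OF finite_Basis b(1)])
 also have "... = complex_of_real (exp (- (s \<bullet> s) / 2))"
 by (simp add: exp_sum[symmetric] euclidean_inner[of s s] power2_eq_square sum_negf sum_divide_distrib flip: of_real_prod)
 finally show ?thesis .
qed

lemma prob_space_std_gaussian: "prob_space (std_gaussian :: (real ^ 'b) measure)"
proof
 let ?G = "std_gaussian :: (real ^ 'b) measure"
 have "complex_of_real (measure ?G (space ?G)) = 1" using std_gaussian_char[of 0] by (simp add: scaleR_conv_of_real)
 then have "measure ?G (space ?G) = 1" by (simp only: of_real_eq_1_iff)
 moreover from this have "emeasure ?G (space ?G) ~= \<infinity>" by (auto simp: measure_def)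
 ultimately show "emeasure ?G (space ?G) = 1" by (simp add: emeasure_eq_ennreal_measure)
qed

text \<open>With \<open>V\<close> an orthonormal basis of the form \<open>J\<close>, the covariance \<open>J\<inverse>\<close> is \<open>V V\<^sup>T\<close>, and the normal
 distribution is the image of the standard one under \<open>V\<close>.\<close>

theorem normal_distribution_facts:
 fixes J :: "real ^ 'b ^ 'b"
 assumes J: "pos_def J"
 defines "N \<equiv> multivariate_normal 0 (matrix_inv J)"
 shows "prob_space N" and "sets N = sets borel"
 and "(\<integral>x. cos (t \<bullet> x) \<partial>N) = exp (- (t \<bullet> (matrix_inv J *v t)) / 2)" and "(\<integral>x. sin (t \<bullet> x) \<partial>N) = 0"
proof -
 obtain V :: "real ^ 'b ^ 'b" where V: "transpose V ** J ** V = mat 1" using posdef_orthonormal[OF J] by blast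
 define W where "W = transpose V ** J"
 have WV: "W ** V = mat 1" unfolding W_def by (rule V)
 then have VW: "V ** W = mat 1" by (simp only: matrix_left_right_inverse)
 have VVJ: "(V ** transpose V) ** J = mat 1" using VW unfolding W_def by (simp only: matrix_mul_assoc)
 then have JVV: "J ** (V ** transpose V) = mat 1" by (simp only: matrix_left_right_inverse)
 define K where "K = matrix_inv J"
 have KJ: "J ** K = mat 1" "K ** J = mat 1" unfolding K_def using posdef_inverse[OF J] by blast+
 have "K = K ** (J ** (V ** transpose V))" unfolding JVV by simp
 also have "... = V ** transpose V" unfolding matrix_mul_assoc[of K J] KJ by simp
 finally have KV: "K = V ** transpose V" .
 have "K ** matrix_inv K = mat 1 & matrix_inv K ** K = mat 1" unfolding matrix_inv_def by (rule someI[of _ J]) (use KJ in blast)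
 then have "matrix_inv K = (J ** K) ** matrix_inv K" "K ** matrix_inv K = mat 1" unfolding KJ by simp_all
 then have invK: "matrix_inv K = J" by (simp add: matrix_mul_assoc[symmetric])
 have detK: "det K = (det V)^2" unfolding KV by (simp add: det_mul power2_eq_square)
 have "det V * det W = 1" using arg_cong[OF VW, of det] by (simp add: det_mul)
 then have dV: "det V ~= 0" by auto
 define \<phi> where "\<phi> x = exp (- (x \<bullet> (J *v x)) / 2) / sqrt ((2 * pi) ^ CARD('b) * det K)" for x :: "real ^ 'b"
 have cont: "continuous_on UNIV ((*v) A)" for A :: "real ^ 'b ^ 'b"
 by (intro linear_continuous_on linear_conv_bounded_linear[THEN iffD1] matrix_vector_mul_linear)
 have mV: "(*v) V \<in> borel_measurable borel" by (rule meas_contI[OF cont])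
 have m\<phi>: "\<phi> \<in> borel_measurable borel"
 proof -
 have nz: "sqrt ((2 * pi) ^ CARD('b) * det K) ~= 0" by (simp add: detK dV)
 show ?thesis unfolding \<phi>_def by (intro meas_contI continuous_intros cont ballI nz) simp_all
 qed
 have N: "N = density lborel (%x. ennreal (\<phi> x))" unfolding N_def multivariate_normal_def K_def[symmetric] invK \<phi>_def by simp
 show sN: "sets N = sets borel" unfolding N by simp
 have dens: "\<bar>det V\<bar> * \<phi> (V *v z) = (\<Prod>b\<in>Basis. std_normal_density (z \<bullet> b))" for z
 proof -
 have "(V *v z) \<bullet> (J *v (V *v z)) = z \<bullet> (transpose V *v (J *v (V *v z)))" by (rule inner_transpose[symmetric])
 also have "transpose V *v (J *v (V *v z)) = z" by (simp add: matrix_vector_mul_assoc matrix_mul_assoc V)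
 finally have e: "(V *v z) \<bullet> (J *v (V *v z)) = z \<bullet> z" .
 have r: "sqrt ((2 * pi) ^ CARD('b) * det K) = sqrt (2 * pi) ^ CARD('b) * \<bar>det V\<bar>"
 proof -
  have "sqrt ((2 * pi) ^ CARD('b)) = sqrt (2 * pi) ^ CARD('b)" by (rule real_sqrt_power)
  then show ?thesis unfolding detK real_sqrt_mult[of _ "(det V)^2"] real_sqrt_abs by (rule arg_cong)
 qed
 have "(\<Prod>b\<in>Basis. std_normal_density (z \<bullet> b)) = (1 / sqrt (2 * pi)) ^ CARD('b) * exp (\<Sum>b\<in>Basis. - (z \<bullet> b)\<^sup>2 / 2)"
  by (simp add: std_normal_density_def prod.distrib exp_sum prod_dividef power_divide)
 also have "(\<Sum>b\<in>Basis. - (z \<bullet> b)\<^sup>2 / 2) = - (z \<bullet> z) / 2"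
  by (simp add: euclidean_inner[of z z] power2_eq_square sum_negf sum_divide_distrib)
 finally show ?thesis unfolding \<phi>_def e r using dV by (simp add: power_divide)
 qed
 have "N = density (density (distr lborel borel ((*v) V)) (%_. ennreal \<bar>det V\<bar>)) (%x. ennreal (\<phi> x))"
 unfolding N by (rule arg_cong[of _ _ "%L. density L (%x. ennreal (\<phi> x))", OF lborel_invertible_image[OF VW WV]])
 also have "... = density (distr lborel borel ((*v) V)) (%x. ennreal \<bar>det V\<bar> * ennreal (\<phi> x))"
 using m\<phi> by (intro density_density_eq) simp_all
 also have "... = distr (density lborel (%z. ennreal \<bar>det V\<bar> * ennreal (\<phi> (V *v z)))) borel ((*v) V)"
 using m\<phi> mV by (intro density_distr) simp_all
 also have "... = distr std_gaussian borel ((*v) V)" unfolding std_gaussian_def dens[symmetric] by (simp only: ennreal_mult'[OF abs_ge_zero])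
 finally have NG: "N = distr std_gaussian borel ((*v) V)" .
 have mG: "(*v) V \<in> measurable std_gaussian borel" unfolding std_gaussian_def using mV by simp
 show pN: "prob_space N" unfolding NG by (rule prob_space.prob_space_distr[OF prob_space_std_gaussian mG])
 interpret N: prob_space N by (rule pN)
 have me: "(%x. exp (\<i> * complex_of_real (t \<bullet> x))) \<in> borel_measurable borel" by (intro meas_contI continuous_intros)
 have i: "integrable N (%x. exp (\<i> * complex_of_real (t \<bullet> x)))"
 by (intro N.integrable_const_bound[of _ 1]) (use me in \<open>simp_all add: measurable_cong_sets[OF sN refl]\<close>)
 have "(\<integral>x. exp (\<i> * complex_of_real (t \<bullet> x)) \<partial>N) = (\<integral>z. exp (\<i> * complex_of_real (t \<bullet> (V *v z))) \<partial>std_gaussian)"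
 unfolding NG by (rule integral_distr[OF mG me])
 also have "... = (\<integral>z. exp (\<i> * complex_of_real ((transpose V *v t) \<bullet> z)) \<partial>std_gaussian)"
 using inner_transpose[of _ V t] by (simp only: inner_commute)
 also have "... = complex_of_real (exp (- ((transpose V *v t) \<bullet> (transpose V *v t)) / 2))" by (rule std_gaussian_char)
 also have "(transpose V *v t) \<bullet> (transpose V *v t) = t \<bullet> (K *v t)"
 unfolding KV inner_transpose by (simp add: matrix_vector_mul_assoc[symmetric] inner_commute)
 finally have c: "(\<integral>x. exp (\<i> * complex_of_real (t \<bullet> x)) \<partial>N) = complex_of_real (exp (- (t \<bullet> (K *v t)) / 2))" .
 have "(\<integral>x. cos (t \<bullet> x) \<partial>N) = (\<integral>x. Re (exp (\<i> * complex_of_real (t \<bullet> x))) \<partial>N)" by (simp add: Re_exp)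
 also have "... = exp (- (t \<bullet> (K *v t)) / 2)" unfolding integral_Re[OF i] c by simp
 finally show "(\<integral>x. cos (t \<bullet> x) \<partial>N) = exp (- (t \<bullet> (matrix_inv J *v t)) / 2)" unfolding K_def .
 have "(\<integral>x. sin (t \<bullet> x) \<partial>N) = (\<integral>x. Im (exp (\<i> * complex_of_real (t \<bullet> x))) \<partial>N)" by (simp add: Im_exp)
 also have "... = 0" unfolding integral_Im[OF i] c by simp
 finally show "(\<integral>x. sin (t \<bullet> x) \<partial>N) = 0" .
qed

section \<open>Moments of sums over an independent sample\<close>

lemma exp_Complex_Re_cos: "Re (exp (\<i> * complex_of_real x)) = cos x" and exp_Complex_Im_sin: "Im (exp (\<i> * complex_of_real x)) = sin x"
 by (simp_all add: Re_exp Im_exp)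

locale iid_sample01 = prob_space M for M :: "'a measure" +
 fixes X :: "nat => 'a => real" and f :: "real => real"
 assumes X_measurable: "!!i. X i \<in> measurable M lborel01" and X_law: "!!i. distr M lborel01 (X i) = density lborel01 (%x. ennreal (f x))"
 and X_indep: "indep_vars (%_. borel) X UNIV" and bmeas_f: "bmeas f" and f_nonneg: "!!x. x \<in> {0..1} ==> 0 <= f x" and f_mass: "(I01 x. f x) = 1"
begin

lemma X_in: "z \<in> space M ==> X i z \<in> {0..1}" by (rule measurable_space[OF X_measurable, unfolded space_lborel01])

lemma comp_measurable: "bmeas h ==> (%z. h (X i z)) \<in> borel_measurable M" by (rule measurable_compose[OF X_measurable bmeas_measurable])

lemma comp_integrable:
 assumes h: "bmeas h" shows "integrable M (%z. h (X i z))"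
proof -
 obtain B where "\<forall>x\<in>{0..1}. \<bar>h x\<bar> <= B" using h unfolding bmeas_def by blast
 then have "AE z in M. norm (h (X i z)) <= B" using X_in by (intro AE_I2) (simp only: real_norm_def)
 then show ?thesis by (rule integrable_const_bound) (rule comp_measurable[OF h])
qed

lemma expectation_comp:
 assumes h: "bmeas h" shows "expectation (%z. h (X i z)) = (I01 x. h x * f x)"
proof -
 have "expectation (%z. h (X i z)) = (\<integral>x. h x \<partial>distr M lborel01 (X i))"
 by (rule integral_distr[symmetric, OF X_measurable bmeas_measurable[OF h]])
 also have "... = (I01 x. f x *\<^sub>R h x)" unfolding X_law
 proof (rule integral_density)
 show "AE x in lborel01. 0 <= f x" by (intro AE_I2) (use f_nonneg in simp)
 qed (use h bmeas_f in \<open>auto intro: bmeas_measurable\<close>)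
 finally show ?thesis by (simp add: mult.commute)
qed

lemma comp_indep:
 assumes h: "bmeas h" shows "indep_vars (%_. borel) (%i z. h (X i z)) UNIV"
proof -
 define g where "g = (%x. indicator {0..1} x *\<^sub>R h x)"
 have "g \<in> borel_measurable borel" using bmeas_measurable[OF h] unfolding g_def by (simp add: borel_measurable_restrict_space_iff)
 then have "indep_vars (%_. borel) (%i z. g (X i z)) UNIV" by (intro indep_vars_compose2[OF X_indep]) simp
 moreover have "(%z. g (X i z)) -` A \<inter> space M = (%z. h (X i z)) -` A \<inter> space M" for i and A :: "real set"
 using X_in[of _ i] by (auto simp: g_def)
 ultimately show ?thesis using comp_measurable[OF h] unfolding indep_vars_def2 by simp
qed

text \<open>Mixed terms factor by independence.\<close>

lemma sum_second_moment:
 assumes u: "bmeas u"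
 shows "integrable M (%z. (\<Sum>i<n. u (X i z))\<^sup>2)" and "expectation (%z. (\<Sum>i<n. u (X i z))\<^sup>2)
  <= real n * (I01 x. (u x)\<^sup>2 * f x) + (real n)^2 * (I01 x. u x * f x)^2"
proof -
 let ?v = "\<integral>x. (u x)\<^sup>2 * f x \<partial>lborel01" and ?m = "\<integral>x. u x * f x \<partial>lborel01"
 obtain B where B: "!!x. x \<in> {0..1} ==> \<bar>u x\<bar> <= B" using u unfolding bmeas_def by blast
 have B0: "0 <= B" using B[of 0] by simp
 have int: "integrable M (%z. u (X i z) * u (X k z))" for i k
 proof (rule integrable_const_bound[of _ "B * B"])
 have "\<bar>u (X i z)\<bar> * \<bar>u (X k z)\<bar> <= B * B" if "z \<in> space M" for z by (intro mult_mono B X_in that B0 abs_ge_zero)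
 then show "AE z in M. norm (u (X i z) * u (X k z)) <= B * B" by (intro AE_I2) (simp only: real_norm_def abs_mult)
 qed (intro borel_measurable_times comp_measurable u)
 have sqe: "(\<Sum>i<n. u (X i z))^2 = (\<Sum>i<n. \<Sum>k<n. u (X i z) * u (X k z))" for z by (simp only: power2_eq_square sum_product)
 show "integrable M (%z. (\<Sum>i<n. u (X i z))\<^sup>2)" unfolding sqe by (intro lint_summable int)
 have E: "expectation (%z. u (X i z) * u (X k z)) <= (if i = k then ?v else 0) + ?m\<^sup>2" for i k
 proof (cases "i = k")
 case True
 then show ?thesis using expectation_comp[OF bmeas_power2[OF u], of k] by (simp add: power2_eq_square)
 next
 case False
 have "expectation (%z. \<Prod>l\<in>{i, k}. u (X l z)) = (\<Prod>l\<in>{i, k}. expectation (%z. u (X l z)))"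
  by (rule indep_vars_lebesgue_integral) (auto intro: indep_vars_subset[OF comp_indep[OF u]] comp_integrable[OF u])
 then show ?thesis using False by (simp add: expectation_comp[OF u] power2_eq_square)
 qed
 have "expectation (%z. (\<Sum>i<n. u (X i z))\<^sup>2) = (\<Sum>i<n. \<Sum>k<n. expectation (%z. u (X i z) * u (X k z)))"
 unfolding sqe by (simp add: lint_sum int)
 also have "... <= (\<Sum>i<n. \<Sum>k<n. (if i = k then ?v else 0) + ?m\<^sup>2)" by (intro sum_mono E)
 also have "... = real n * ?v + (real n)^2 * ?m\<^sup>2" by (simp add: sum.distrib power2_eq_square distrib_left mult.assoc)
 finally show "expectation (%z. (\<Sum>i<n. u (X i z))\<^sup>2) <= real n * ?v + (real n)^2 * ?m\<^sup>2" .
qed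

lemma scaled_sum_second_moment:
 assumes u: "bmeas u" and n: "1 <= n"
 shows "integrable M (%z. (1 / sqrt (real n) * (\<Sum>i<n. u (X i z)))\<^sup>2)"
 and "expectation (%z. (1 / sqrt (real n) * (\<Sum>i<n. u (X i z)))\<^sup>2)
  <= (I01 x. (u x)\<^sup>2 * f x) + real n * (I01 x. u x * f x)^2"
proof -
 have eq: "(1 / sqrt (real n) * (\<Sum>i<n. u (X i z)))^2 = 1 / real n * (\<Sum>i<n. u (X i z))^2" for z by (simp add: power_mult_distrib power_divide)
 show "integrable M (%z. (1 / sqrt (real n) * (\<Sum>i<n. u (X i z)))\<^sup>2)" unfolding eq by (intro integrable_mult_right sum_second_moment u)
 have "expectation (%z. (1 / sqrt (real n) * (\<Sum>i<n. u (X i z)))\<^sup>2) = 1 / real n * expectation (%z. (\<Sum>i<n. u (X i z))\<^sup>2)"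
 unfolding eq by (rule integral_mult_right_zero)
 also have "... <= 1 / real n * (real n * (I01 x. (u x)\<^sup>2 * f x) + (real n)^2 * (I01 x. u x * f x)^2)"
 by (intro mult_left_mono sum_second_moment u) simp
 also have "... = (I01 x. (u x)\<^sup>2 * f x) + real n * (I01 x. u x * f x)^2" using n by (simp add: power2_eq_square distrib_left)
 finally show "expectation (%z. (1 / sqrt (real n) * (\<Sum>i<n. u (X i z)))\<^sup>2)
  <= (I01 x. (u x)\<^sup>2 * f x) + real n * (I01 x. u x * f x)^2" .
qed

lemma expectation_abs_le_sqrt:
 assumes Y: "Y \<in> borel_measurable M" "integrable M (%z. (Y z)\<^sup>2)" "expectation (%z. (Y z)\<^sup>2) <= b"
 shows "integrable M (%z. \<bar>Y z\<bar>)" "expectation (%z. \<bar>Y z\<bar>) <= sqrt b"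
proof -
 have le: "\<bar>y\<bar> <= 1 + y^2" for y :: real
 proof -
 have "2 * \<bar>y\<bar> <= 1 + y^2" using sum_squares_bound[of 1 "\<bar>y\<bar>"] by simp
 then show ?thesis using abs_ge_zero[of y] by linarith
 qed
 show i: "integrable M (%z. \<bar>Y z\<bar>)"
 proof (rule lint_bound)
 show "integrable M (%z. 1 + (Y z)^2)" using Y(2) by simp
 show "AE z in M. norm \<bar>Y z\<bar> <= norm (1 + (Y z)^2)" using le by (intro AE_I2) simp
 qed (use Y(1) in simp)
 have "0 <= variance (%z. \<bar>Y z\<bar>)" by (rule variance_positive)
 also have "... = expectation (%z. \<bar>Y z\<bar>\<^sup>2) - (expectation (%z. \<bar>Y z\<bar>))\<^sup>2" by (rule variance_eq[OF i]) (use Y(2) in simp)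
 finally show "expectation (%z. \<bar>Y z\<bar>) <= sqrt b" using Y(3) by (intro real_le_rsqrt) simp
qed

lemma markov:
 assumes Y: "integrable M Y" "!!z. z \<in> space M ==> 0 <= Y z" "expectation Y <= b" and c: "0 < c"
 shows "prob {z \<in> space M. c <= Y z} <= b / c"
proof -
 have "c * prob {z \<in> space M. c <= Y z} = expectation (%z. c * indicator {z \<in> space M. c <= Y z} z)" using Y(1) by (simp add: Int_absorb2)
 also have "... <= expectation Y"
 proof (rule integral_mono[OF _ Y(1)])
 show "integrable M (%z. c * indicator {z \<in> space M. c <= Y z} z)"
  using Y(1) by (intro integrable_mult_right integrable_real_indicator) (auto simp: emeasure_eq_measure)
 show "c * indicator {z \<in> space M. c <= Y z} z <= Y z" if "z \<in> space M" for z using Y(2)[OF that] c by (simp split: split_indicator)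
 qed
 finally show ?thesis using Y(3) c by (simp add: pos_le_divide_eq mult.commute)
qed

text \<open>The estimator is an average of kernel sections whose mean is the projection of the density; its
 variance at \<open>y\<close> is at most a multiple of the kernel's diagonal, which integrates to the dimension.\<close>

lemma aux_est_error:
 fixes n j r :: nat
 assumes r: "1 <= r" and n: "1 <= n" and M0: "!!x. x \<in> {0..1} ==> f x <= M0"
 defines "D \<equiv> (%z. sq (%y. aux_est n j r (%i. X i z) y - spline_proj r j f y))"
 shows "integrable M D" and "expectation D <= M0 * (2 ^ j + real r - 1) / real n"
proof -
 let ?K = "spline_kernel r j" and ?P = "spline_proj r j f"
 define g where "g z y = (aux_est n j r (%i. X i z) y - ?P y)^2" for z y
 interpret P: pair_sigma_finite M lborel01 ..
 have M00: "0 <= M0" using f_nonneg[of 0] M0[of 0] by simp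
 have mX: "(%z. bspline_scaled r j m (X i (fst z))) \<in> borel_measurable (M \<Otimes>\<^sub>M lborel01)" for m i
 by (rule measurable_compose[OF measurable_fst comp_measurable[OF bmeas_bspline_scaled[OF r]]])
 have mY: "(%z. bspline_scaled r j m (snd z)) \<in> borel_measurable (M \<Otimes>\<^sub>M lborel01)" for m
 by (rule measurable_compose[OF measurable_snd bmeas_measurable[OF bmeas_bspline_scaled[OF r]]])
 have mP: "(%z. ?P (snd z)) \<in> borel_measurable (M \<Otimes>\<^sub>M lborel01)"
 by (rule measurable_compose[OF measurable_snd bmeas_measurable[OF bmeas_spline_proj[OF r bmeas_f]]])
 have mg: "(%z. g (fst z) (snd z)) \<in> borel_measurable (M \<Otimes>\<^sub>M lborel01)" unfolding g_def aux_est_def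
 by (intro borel_measurable_power borel_measurable_diff borel_measurable_sum borel_measurable_times borel_measurable_const mX mY mP)
 then have mg': "case_prod g \<in> borel_measurable (M \<Otimes>\<^sub>M lborel01)" by (simp add: case_prod_beta')
 have D: "D z = (I01 y. g z y)" for z unfolding D_def sq_def g_def ..
 have mD: "D \<in> borel_measurable M" unfolding D[abs_def] by (rule U.borel_measurable_lebesgue_integral[OF mg'])
 have bA: "bmeas (aux_est n j r xs)" for xs unfolding aux_est_eq_kernel[abs_def] by (intro bmeas_intros bmeas_spline_kernel r)
 have nnD: "(\<integral>\<^sup>+y. ennreal (g z y) \<partial>lborel01) = ennreal (D z)" for z unfolding D by (rule nn_integral_eq_integral)
  (auto simp: g_def intro!: bmeas_integrable bmeas_intros bA bmeas_spline_proj r bmeas_f)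
 have nny: "(\<integral>\<^sup>+z. ennreal (g z y) \<partial>M) <= ennreal (M0 / real n * ?K y y)" if y: "y \<in> {0..1}" for y
 proof -
 define u where "u x = ?K x y - ?P y" for x
 have bK: "bmeas (%x. ?K x y)" by (rule bmeas_spline_kernel2[OF r])
 have bu: "bmeas u" unfolding u_def by (intro bmeas_intros bK)
 have iK: "integrable lborel01 (%x. ?K x y * f x)" "integrable lborel01 (%x. (?K x y)\<^sup>2 * f x)" "integrable lborel01 f"
  by (intro bmeas_integrable bmeas_intros bK bmeas_f)+
 have "(I01 x. u x * f x) = (I01 x. ?K x y * f x - ?P y * f x)" by (simp only: u_def left_diff_distrib)
 also have "... = ?P y - ?P y * 1" using iK by (simp add: f_mass spline_proj_def[symmetric])
 finally have u0: "(I01 x. u x * f x) = 0" by simp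
 have "(I01 x. (u x)\<^sup>2 * f x) = (I01 x. ((?K x y)^2 * f x - 2 * ?P y * (?K x y * f x)) + (?P y)^2 * f x)"
  by (intro lint_cong refl) (simp add: u_def power2_eq_square algebra_simps)
 also have "... = (I01 x. (?K x y)\<^sup>2 * f x) - 2 * ?P y * ?P y + (?P y)^2 * 1" using iK by (simp add: f_mass spline_proj_def[symmetric])
 also have "... <= (I01 x. (?K x y)\<^sup>2 * f x)" using zero_le_power2[of "?P y"] by (simp add: power2_eq_square)
 also have "... <= (I01 x. M0 * (?K x y)^2)"
 proof (rule integral_mono[OF iK(2)])
  show "integrable lborel01 (%x. M0 * (?K x y)^2)" by (intro bmeas_integrable bmeas_intros bK)
  show "(?K x y)^2 * f x <= M0 * (?K x y)^2" if "x \<in> space lborel01" for x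
  using mult_right_mono[OF M0[of x] zero_le_power2[of "?K x y"]] that by (simp add: mult.commute)
 qed
 also have "... = M0 * sq (?K y)" unfolding sq_def spline_kernel_sym[OF r, of j _ y] by (rule integral_mult_right_zero)
 also have "sq (?K y) = ?K y y" by (rule spline_kernel_diag[OF r y, symmetric])
 finally have u2: "(I01 x. (u x)\<^sup>2 * f x) <= M0 * ?K y y" .
 have geq: "g z y = 1 / real n * (1 / sqrt (real n) * (\<Sum>i<n. u (X i z)))^2" for z
 proof -
  have "aux_est n j r (%i. X i z) y - ?P y = 1 / real n * (\<Sum>i<n. u (X i z))"
  unfolding aux_est_eq_kernel u_def using n by (simp add: sum_subtractf right_diff_distrib)
  then show ?thesis unfolding g_def by (simp add: power_mult_distrib power_divide power2_eq_square)
 qed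
 have ig: "integrable M (%z. g z y)" unfolding geq by (intro integrable_mult_right scaled_sum_second_moment bu n)
 have "expectation (%z. g z y) = 1 / real n * expectation (%z. (1 / sqrt (real n) * (\<Sum>i<n. u (X i z)))\<^sup>2)"
  unfolding geq by (rule integral_mult_right_zero)
 also have "... <= 1 / real n * (M0 * ?K y y)" using scaled_sum_second_moment(2)[OF bu n] u2 unfolding u0 by (intro mult_left_mono) simp_all
 finally have "expectation (%z. g z y) <= M0 / real n * ?K y y" by simp
 then show ?thesis using nn_integral_eq_integral[OF ig] by (simp add: g_def ennreal_leI)
 qed
 let ?b = "M0 * (2 ^ j + real r - 1) / real n"
 have "(\<integral>\<^sup>+z. ennreal (D z) \<partial>M) = (\<integral>\<^sup>+z. \<integral>\<^sup>+y. ennreal (g z y) \<partial>lborel01 \<partial>M)" unfolding nnD ..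
 also have "... = (\<integral>\<^sup>+y. \<integral>\<^sup>+z. ennreal (g z y) \<partial>M \<partial>lborel01)"
 by (rule P.Fubini'[symmetric]) (use mg in \<open>simp add: case_prod_beta'\<close>)
 also have "... <= (\<integral>\<^sup>+y. ennreal (M0 / real n * ?K y y) \<partial>lborel01)" by (intro nn_integral_mono nny) simp
 also have "... = ennreal (I01 y. M0 / real n * ?K y y)"
 proof (rule nn_integral_eq_integral)
 show "integrable lborel01 (%y. M0 / real n * ?K y y)" by (intro bmeas_integrable bmeas_mult bmeas_const bmeas_spline_kernel_diag r)
 show "AE y in lborel01. 0 <= M0 / real n * ?K y y" by (intro AE_I2 mult_nonneg_nonneg) (use M00 spline_kernel_diag[OF r, of _ j] in simp_all)
 qed
 also have "(I01 y. M0 / real n * ?K y y) = ?b" unfolding integral_mult_right_zero spline_kernel_trace[OF r] by simp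
 finally have le: "(\<integral>\<^sup>+z. ennreal (D z) \<partial>M) <= ennreal ?b" .
 have D0: "0 <= D z" for z unfolding D_def by simp
 show iD: "integrable M D" by (rule integrableI_nonneg[OF mD]) (use D0 le in \<open>auto intro: le_less_trans\<close>)
 have b1: "0 <= 2 ^ j + real r - 1" using one_le_power[of "2::real" j] by linarith
 have b0: "0 <= ?b" by (intro divide_nonneg_nonneg mult_nonneg_nonneg M00 b1 of_nat_0_le_iff)
 show "expectation D <= ?b" using le b0 unfolding nn_integral_eq_integral[OF iD AE_I2[OF D0]] by simp
qed

lemma aux_est_inner:
 assumes r: "1 <= r" and w: "bmeas w"
 shows "(I01 y. aux_est n j r xs y * w y) = 1 / real n * (\<Sum>i<n. spline_proj r j w (xs i))"
proof -
 have eq: "aux_est n j r xs y * w y = 1 / real n * (\<Sum>i<n. spline_kernel r j (xs i) y * w y)" for y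
 by (simp only: aux_est_eq_kernel sum_distrib_right mult.assoc)
 have int: "integrable lborel01 (%y. spline_kernel r j x y * w y)" for x by (intro bmeas_integrable bmeas_intros bmeas_spline_kernel r w)
 have K: "(I01 y. spline_kernel r j x y * w y) = spline_proj r j w x" for x
 unfolding spline_proj_def by (intro lint_cong refl) (simp only: spline_kernel_sym[OF r, of j x])
 show ?thesis unfolding eq integral_mult_right_zero lint_sum[OF int] K ..
qed

text \<open>The projection error of \<open>w\<close> is orthogonal to the spline space, so its mean only involves the product of
 the projection errors of \<open>w\<close> and of the density.\<close>

lemma projection_error_moment:
 fixes n j r :: nat
 assumes r: "1 <= r" and n: "1 <= n" and w: "bmeas w" and M0: "!!x. x \<in> {0..1} ==> f x <= M0"
 defines "ew \<equiv> sq (%x. w x - spline_proj r j w x)" and "ef \<equiv> sq (%x. f x - spline_proj r j f x)"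
 shows "integrable M (%z. (1 / sqrt (real n) * (\<Sum>i<n. spline_proj r j w (X i z) - w (X i z)))\<^sup>2)"
 and "expectation (%z. (1 / sqrt (real n) * (\<Sum>i<n. spline_proj r j w (X i z) - w (X i z)))\<^sup>2)
  <= M0 * ew + real n * (ew * ef)"
proof -
 let ?u = "%x. spline_proj r j w x - w x" and ?P = "spline_proj r j f"
 have bP: "bmeas ?P" "bmeas (spline_proj r j w)" by (intro bmeas_spline_proj r w bmeas_f)+
 have bu: "bmeas ?u" by (intro bmeas_diff bP w)
 show "integrable M (%z. (1 / sqrt (real n) * (\<Sum>i<n. ?u (X i z)))\<^sup>2)" by (rule scaled_sum_second_moment(1)[OF bu n])
 have ew: "sq ?u = ew" unfolding ew_def by (rule sq_minus_commute)
 have v: "(I01 x. (?u x)\<^sup>2 * f x) <= M0 * ew"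
 proof -
 have "(I01 x. (?u x)\<^sup>2 * f x) <= (I01 x. M0 * (?u x)^2)"
 proof (rule integral_mono)
  show "(?u x)^2 * f x <= M0 * (?u x)^2" if "x \<in> space lborel01" for x
  using mult_right_mono[OF M0[of x] zero_le_power2[of "?u x"]] that by (simp add: mult.commute)
 qed (intro bmeas_integrable bmeas_intros bu bP w bmeas_f)+
 then show ?thesis unfolding integral_mult_right_zero sq_def[symmetric] ew .
 qed
 have "(I01 x. ?u x * ?P x) = (I01 x. spline_proj r j w x * ?P x) - (I01 x. w x * ?P x)"
 unfolding left_diff_distrib by (intro lint_diff bmeas_integrable bmeas_mult bP w)
 also have "... = 0" using spline_proj_inner[OF r w spline_proj_in_space[OF r bmeas_f], of j] by simp
 finally have "(I01 x. ?u x * f x) = (I01 x. ?u x * f x) - (I01 x. ?u x * ?P x)" by simp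
 also have "... = (I01 x. ?u x * (f x - ?P x))" unfolding right_diff_distrib by (intro lint_diff[symmetric] bmeas_integrable bmeas_mult bu bP bmeas_f)
 finally have "(I01 x. ?u x * f x)^2 <= sq ?u * sq (%x. f x - ?P x)" using cauchy_schwarz_U[OF bu bmeas_diff[OF bmeas_f bP(1)]] by simp
 then have "real n * (I01 x. ?u x * f x)^2 <= real n * (ew * ef)" unfolding ew ef_def by (intro mult_left_mono) simp_all
 then show "expectation (%z. (1 / sqrt (real n) * (\<Sum>i<n. ?u (X i z)))\<^sup>2) <= M0 * ew + real n * (ew * ef)"
 using scaled_sum_second_moment(2)[OF bu n] v by linarith
qed

text \<open>The central limit theorem, read off at the point \<open>sqrt v\<close> of the
 characteristic functions.\<close>

lemma clt_trigonometric:
 assumes h: "bmeas h" "(I01 x. h x * f x) = 0" and v: "(I01 x. (h x)\<^sup>2 * f x) = v" "0 < v"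
 shows "(%n. expectation (%z. cos (1 / sqrt (real n) * (\<Sum>i<n. h (X i z))))) ---> exp (- v / 2)"
 and "(%n. expectation (%z. sin (1 / sqrt (real n) * (\<Sum>i<n. h (X i z))))) ---> 0"
proof -
 let ?S = "%n z. \<Sum>i<n. h (X i z)" and ?Y = "%n z. 1 / sqrt (real n) * (\<Sum>i<n. h (X i z))"
 let ?\<sigma> = "sqrt v"
 have E0: "expectation (%z. h (X i z)) = 0" for i unfolding expectation_comp[OF h(1)] h(2) ..
 have s2: "?\<sigma>\<^sup>2 = v" using v(2) by simp
 have wc: "weak_conv_m (%n. distr M borel (%z. ?S n z / sqrt (real n * ?\<sigma>\<^sup>2))) std_normal_distribution"
 proof (rule central_limit_theorem_zero_mean[OF comp_indep[OF h(1)] E0])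
 show "0 < ?\<sigma>" using v(2) by simp
 show "integrable M (%z. (h (X n z))\<^sup>2)" for n by (rule comp_integrable[OF bmeas_power2[OF h(1)]])
 show "variance (%z. h (X n z)) = ?\<sigma>\<^sup>2" for n unfolding E0 s2 using expectation_comp[OF bmeas_power2[OF h(1)], of n] v(1) by simp
 show "distr M borel (%z. h (X n z)) = distr (density lborel01 (%x. ennreal (f x))) borel h" for n unfolding X_law[of n, symmetric]
  by (subst distr_distr[OF bmeas_measurable[OF h(1)] X_measurable[of n]]) (simp add: comp_def)
 qed
 have mS: "?S n \<in> borel_measurable M" for n by (intro borel_measurable_sum comp_measurable h(1))
 have mZ: "(%z. ?S n z / sqrt (real n * ?\<sigma>\<^sup>2)) \<in> borel_measurable M" for n using mS by (intro borel_measurable_divide) simp_all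
 have ci: "(%n. char (distr M borel (%z. ?S n z / sqrt (real n * ?\<sigma>\<^sup>2))) ?\<sigma>) ---> char std_normal_distribution ?\<sigma>"
 by (rule levy_continuity1[OF real_distribution_distr[OF mZ] real_dist_normal_dist wc])
 have sc: "?\<sigma> * (?S n z / sqrt (real n * ?\<sigma>\<^sup>2)) = ?Y n z" for n z unfolding s2 real_sqrt_mult using v(2) by simp
 have me: "(%x :: real. exp (\<i> * complex_of_real (?\<sigma> * x))) \<in> borel_measurable borel" by (intro meas_contI continuous_intros)
 have ch: "char (distr M borel (%z. ?S n z / sqrt (real n * ?\<sigma>\<^sup>2))) ?\<sigma> = (CLINT z|M. exp (\<i> * complex_of_real (?Y n z)))" for n
 unfolding char_def by (subst integral_distr[OF mZ me]) (simp only: sc)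
 have lim: "(%n. CLINT z|M. exp (\<i> * complex_of_real (?Y n z))) ---> complex_of_real (exp (- v / 2))"
 using ci[unfolded ch] unfolding char_std_normal_distribution s2 .
 have mY: "?Y n \<in> borel_measurable M" for n using mS by (intro borel_measurable_times) simp_all
 have i: "integrable M (%z. exp (\<i> * complex_of_real (?Y n z)))" for n
 proof (rule integrable_const_bound[of _ 1])
 have "(%x :: real. exp (\<i> * complex_of_real x)) \<in> borel_measurable borel" by (intro meas_contI continuous_intros)
 from measurable_compose[OF mY this]
 show "(%z. exp (\<i> * complex_of_real (?Y n z))) \<in> borel_measurable M" .
 qed simp
 have "(%n. CLINT z|M. exp (\<i> * complex_of_real (?Y n z))) = (%n. Complex (expectation (%z. cos (?Y n z))) (expectation (%z. sin (?Y n z))))"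
 proof (rule ext, rule complex_eqI)
 fix n
 have "Re (CLINT z|M. exp (\<i> * complex_of_real (?Y n z))) = (\<integral>z. Re (exp (\<i> * complex_of_real (?Y n z))) \<partial>M)"
  by (rule integral_Re[OF i, symmetric])
 then show "Re (CLINT z|M. exp (\<i> * complex_of_real (?Y n z)))
  = Re (Complex (expectation (%z. cos (?Y n z))) (expectation (%z. sin (?Y n z))))" by (simp only: complex.sel exp_Complex_Re_cos)
 have "Im (CLINT z|M. exp (\<i> * complex_of_real (?Y n z))) = (\<integral>z. Im (exp (\<i> * complex_of_real (?Y n z))) \<partial>M)"
  by (rule integral_Im[OF i, symmetric])
 then show "Im (CLINT z|M. exp (\<i> * complex_of_real (?Y n z)))
  = Im (Complex (expectation (%z. cos (?Y n z))) (expectation (%z. sin (?Y n z))))" by (simp only: complex.sel exp_Complex_Im_sin)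
 qed
 note L = lim[unfolded this]
 show "(%n. expectation (%z. cos (?Y n z))) ---> exp (- v / 2)" using tendsto_Re[OF L] by (simp only: complex.sel Re_complex_of_real)
 show "(%n. expectation (%z. sin (?Y n z))) ---> 0" using tendsto_Im[OF L] by (simp only: complex.sel Im_complex_of_real)
qed

end

section \<open>Asymptotic normality of the minimizer\<close>

text \<open>All error terms are products of powers of the sample size and of the dimension of the
 spline space.\<close>

lemma powr_rate_tendsto_0:
 fixes a :: "nat => real"
 assumes a: "a \<in> bigtheta sequentially (%n. real n powr \<alpha>)" and pos: "!!n. 0 < a n" and neg: "\<gamma> + \<alpha> * \<beta> < 0"
 shows "(%n. real n powr \<gamma> * a n powr \<beta>) ---> 0"
proof -
 have "\<exists>C. \<forall>\<^sub>F n in sequentially. a n powr \<beta> <= C * real n powr (\<alpha> * \<beta>)"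
 proof (cases "0 <= \<beta>")
 case True
 obtain c where c: "c > 0" "\<forall>\<^sub>F n in sequentially. norm (a n) <= c * norm (real n powr \<alpha>)"
  using landau_o.bigE[OF bigthetaD1[OF a]] by blast
 have "\<forall>\<^sub>F n in sequentially. a n powr \<beta> <= c powr \<beta> * real n powr (\<alpha> * \<beta>)" using c(2)
 proof eventually_elim
  case (elim n)
  then have "a n powr \<beta> <= (c * real n powr \<alpha>) powr \<beta>" using pos[of n] True by (intro powr_mono2) simp_all
  also have "... = c powr \<beta> * real n powr (\<alpha> * \<beta>)" using c(1) by (simp add: powr_mult powr_powr)
  finally show ?case .
 qed
 then show ?thesis by blast
 next
 case False
 obtain c where c: "c > 0" "\<forall>\<^sub>F n in sequentially. norm (a n) \<ge> c * norm (real n powr \<alpha>)"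
  using landau_omega.bigE[OF bigthetaD2[OF a]] by blast
 have "\<forall>\<^sub>F n in sequentially. a n powr \<beta> <= c powr \<beta> * real n powr (\<alpha> * \<beta>)" using c(2) eventually_gt_at_top[of 0]
 proof eventually_elim
  case (elim n)
  then have "a n powr \<beta> <= (c * real n powr \<alpha>) powr \<beta>" using pos[of n] False c(1) by (intro powr_mono2') simp_all
  also have "... = c powr \<beta> * real n powr (\<alpha> * \<beta>)" using c(1) by (simp add: powr_mult powr_powr)
  finally show ?case .
 qed
 then show ?thesis by blast
 qed
 then obtain C where C: "\<forall>\<^sub>F n in sequentially. a n powr \<beta> <= C * real n powr (\<alpha> * \<beta>)" by blast
 have lim: "(%n. C * real n powr (\<gamma> + \<alpha> * \<beta>)) ---> C * 0"
 by (intro tendsto_mult tendsto_const tendsto_neg_powr[OF neg filterlim_real_sequentially])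
 show ?thesis
 proof (rule tendsto_sandwich[OF _ _ tendsto_const lim[simplified]])
 show "\<forall>\<^sub>F n in sequentially. 0 <= real n powr \<gamma> * a n powr \<beta>" by simp
 show "\<forall>\<^sub>F n in sequentially. real n powr \<gamma> * a n powr \<beta> <= C * real n powr (\<gamma> + \<alpha> * \<beta>)" using C
 proof eventually_elim
  case (elim n)
  then have "real n powr \<gamma> * a n powr \<beta> <= real n powr \<gamma> * (C * real n powr (\<alpha> * \<beta>))" by (intro mult_left_mono) simp_all
  also have "... = C * real n powr (\<gamma> + \<alpha> * \<beta>)" by (simp add: powr_add)
  finally show ?case .
 qed
 qed
qed

lemma cos_lipschitz: "\<bar>cos x - cos y\<bar> <= \<bar>x - y :: real\<bar>" and sin_lipschitz: "\<bar>sin x - sin y\<bar> <= \<bar>x - y :: real\<bar>"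
proof -
 have "\<bar>sin ((x + y) / 2)\<bar> * \<bar>sin ((y - x) / 2)\<bar> <= 1 * \<bar>(y - x) / 2\<bar>" by (intro mult_mono abs_sin_x_le_abs_x) simp_all
 then show "\<bar>cos x - cos y\<bar> <= \<bar>x - y\<bar>" unfolding cos_diff_cos abs_mult by simp
 have "\<bar>sin ((x - y) / 2)\<bar> * \<bar>cos ((x + y) / 2)\<bar> <= \<bar>(x - y) / 2\<bar> * 1" by (intro mult_mono abs_sin_x_le_abs_x) simp_all
 then show "\<bar>sin x - sin y\<bar> <= \<bar>x - y\<bar>" unfolding sin_diff_sin abs_mult by simp
qed

text \<open>Convergence in probability to zero of the difference carries over limits of bounded
 Lipschitz expectations.\<close>

lemma (in prob_space) expectation_lipschitz_close:
 fixes \<phi> :: "real => real"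
 assumes \<phi>: "!!x y. \<bar>\<phi> x - \<phi> y\<bar> <= \<bar>x - y\<bar>" "!!x. \<bar>\<phi> x\<bar> <= 1" "continuous_on UNIV \<phi>"
 and UV: "!!n. U n \<in> borel_measurable M" "!!n. V n \<in> borel_measurable M"
 and close: "!!\<eta>. 0 < \<eta> ==> (%n. prob {z \<in> space M. \<eta> <= \<bar>U n z - V n z\<bar>}) ---> 0"
 and lim: "(%n. expectation (%z. \<phi> (V n z))) ---> l"
 shows "(%n. expectation (%z. \<phi> (U n z))) ---> l"
proof -
 have m\<phi>: "\<phi> \<in> borel_measurable borel" by (rule meas_contI[OF \<phi>(3)])
 have i: "integrable M (%z. \<phi> (Y z))" if "Y \<in> borel_measurable M" for Y
 by (rule integrable_const_bound[of _ 1]) (use \<phi>(2) measurable_compose[OF that m\<phi>] in auto)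
 have "(%n. expectation (%z. \<phi> (U n z)) - expectation (%z. \<phi> (V n z))) ---> 0"
 proof (rule LIMSEQ_I)
 fix \<epsilon> :: real assume \<epsilon>: "0 < \<epsilon>"
 define \<eta> where "\<eta> = \<epsilon> / 2"
 have \<eta>: "0 < \<eta>" using \<epsilon> by (simp add: \<eta>_def)
 let ?A = "%n. {z \<in> space M. \<eta> <= \<bar>U n z - V n z\<bar>}"
 have A: "?A n \<in> events" for n using UV[of n] by measurable
 have b: "\<bar>expectation (%z. \<phi> (U n z)) - expectation (%z. \<phi> (V n z))\<bar> <= \<eta> + 2 * prob (?A n)" for n
 proof -
  have iA: "integrable M (%z. 2 * indicator (?A n) z :: real)" by (intro integrable_mult_right integrable_real_indicator A) (simp add: emeasure_eq_measure)
  have "expectation (%z. \<phi> (U n z)) - expectation (%z. \<phi> (V n z)) = expectation (%z. \<phi> (U n z) - \<phi> (V n z))"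
  by (rule lint_diff[OF i[OF UV(1)] i[OF UV(2)], symmetric])
  moreover have "\<bar>expectation (%z. \<phi> (U n z) - \<phi> (V n z))\<bar> <= expectation (%z. \<bar>\<phi> (U n z) - \<phi> (V n z)\<bar>)"
  by (rule integral_abs_bound)
  moreover have "expectation (%z. \<bar>\<phi> (U n z) - \<phi> (V n z)\<bar>) <= expectation (%z. \<eta> + 2 * indicator (?A n) z)"
  proof (rule integral_mono)
  show "integrable M (%z. \<bar>\<phi> (U n z) - \<phi> (V n z)\<bar>)" by (intro integrable_abs Bochner_Integration.integrable_diff i UV)
  show "integrable M (%z. \<eta> + 2 * indicator (?A n) z)" by (intro lint_addable iA) simp
  fix z assume w: "z \<in> space M"
  show "\<bar>\<phi> (U n z) - \<phi> (V n z)\<bar> <= \<eta> + 2 * indicator (?A n) z"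
  proof (cases "z \<in> ?A n")
   case True
   then show ?thesis using \<phi>(2)[of "U n z"] \<phi>(2)[of "V n z"] \<eta> unfolding indicator_simps(1)[OF True] by linarith
  next
   case False
   then show ?thesis using \<phi>(1)[of "U n z" "V n z"] w unfolding indicator_simps(2)[OF False] by simp
  qed
  qed
  moreover have "expectation (%z. \<eta> + 2 * indicator (?A n) z) = \<eta> + 2 * prob (?A n)"
  using iA A by (subst lint_add) (simp_all add: prob_space Int_absorb2)
  ultimately show ?thesis by linarith
 qed
 have "\<forall>\<^sub>F n in sequentially. prob (?A n) < \<epsilon> / 4" by (rule order_tendstoD(2)[OF close[OF \<eta>]]) (use \<epsilon> in simp)
 then have "\<forall>\<^sub>F n in sequentially. norm (expectation (%z. \<phi> (U n z)) - expectation (%z. \<phi> (V n z)) - 0) < \<epsilon>"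
 proof eventually_elim
  case (elim n)
  have "\<eta> + 2 * prob (?A n) < \<epsilon>" using elim by (simp add: \<eta>_def)
  then show ?case using b[of n] by simp
 qed
 then show "\<exists>no. \<forall>n\<ge>no. norm (expectation (%z. \<phi> (U n z)) - expectation (%z. \<phi> (V n z)) - 0) < \<epsilon>"
  unfolding eventually_sequentially .
 qed
 from tendsto_add[OF this lim] show ?thesis by simp
qed

locale estimation_sample = density_family \<Theta> p \<theta>0 \<rho> + iid_sample01 M X "p \<theta>0"
 for \<Theta> :: "(real ^ 'b) set" and p \<theta>0 \<rho> and M :: "'a measure" and X
begin

abbreviation score :: "'b => real => real" where
 "score i x \<equiv> grad0 x $ i / p \<theta>0 x"

definition score_sum :: "nat => 'a => real ^ 'b" where
 "score_sum n z = (\<chi> i. 1 / sqrt (real n) * (\<Sum>k<n. score i (X k z)))"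

text \<open>The difference between integrating the score against the estimator and averaging it over
 the sample.\<close>

definition score_bias :: "nat => nat => nat => 'a => real ^ 'b" where
 "score_bias r j n z = (\<chi> i. 1 / sqrt (real n) * (\<Sum>k<n. spline_proj r j (score i) (X k z) - score i (X k z)))"

lemma pos_nz: "x \<in> {0..1} ==> p \<theta>0 x ~= 0" using pos by force

lemma bmeas_score: "bmeas (score i)" by (intro bmeas_continuous_on continuous_intros cont_grad0 cont_x \<theta>0_in) (use pos_nz in blast)

lemma score_combination:
 fixes a :: "real ^ 'b"
 shows "bmeas (%x. a \<bullet> grad0 x / p \<theta>0 x)" and "(I01 x. a \<bullet> grad0 x / p \<theta>0 x * p \<theta>0 x) = 0"
 and "(I01 x. (a \<bullet> grad0 x / p \<theta>0 x)\<^sup>2 * p \<theta>0 x) = a \<bullet> (J *v a)"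
 and "a \<bullet> score_sum n z = 1 / sqrt (real n) * (\<Sum>k<n. a \<bullet> grad0 (X k z) / p \<theta>0 (X k z))"
proof -
 show "bmeas (%x. a \<bullet> grad0 x / p \<theta>0 x)"
 by (intro bmeas_continuous_on continuous_on_divide cont_inner_grad0 cont_x \<theta>0_in) (use pos_nz in blast)
 have "(I01 x. a \<bullet> grad0 x / p \<theta>0 x * p \<theta>0 x) = (I01 x. a \<bullet> grad0 x)" by (intro lint_cong refl) (use pos_nz in simp)
 then show "(I01 x. a \<bullet> grad0 x / p \<theta>0 x * p \<theta>0 x) = 0" unfolding integral_inner_grad0 .
 show "(I01 x. (a \<bullet> grad0 x / p \<theta>0 x)\<^sup>2 * p \<theta>0 x) = a \<bullet> (J *v a)" unfolding information_quadratic
 by (intro lint_cong refl) (use pos_nz in \<open>simp add: power_divide power2_eq_square\<close>)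
 have "a \<bullet> score_sum n z = (\<Sum>i\<in>UNIV. \<Sum>k<n. 1 / sqrt (real n) * (a $ i * score i (X k z)))"
 by (simp add: inner_vec_def score_sum_def sum_distrib_left mult_ac)
 also have "... = (\<Sum>k<n. \<Sum>i\<in>UNIV. 1 / sqrt (real n) * (a $ i * score i (X k z)))" by (rule sum.swap)
 also have "... = 1 / sqrt (real n) * (\<Sum>k<n. a \<bullet> grad0 (X k z) / p \<theta>0 (X k z))"
 unfolding inner_grad0 by (simp only: sum_distrib_left sum_divide_distrib times_divide_eq_right)
 finally show "a \<bullet> score_sum n z = 1 / sqrt (real n) * (\<Sum>k<n. a \<bullet> grad0 (X k z) / p \<theta>0 (X k z))" .
qed

lemma score_mean: "(I01 x. score i x * p \<theta>0 x) = 0" using score_combination(2)[of "axis i 1"] by (simp add: inner_axis')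

text \<open>Integrating against the auxiliary estimator averages the projected score over the
 sample, because the kernel is symmetric.\<close>

lemma scaled_cross_moment:
 assumes r: "1 <= r" and n: "1 <= n"
 shows "sqrt (real n) *\<^sub>R cross_moment (aux_est n j r (%i. X i z)) = score_sum n z + score_bias r j n z"
proof -
 let ?q = "aux_est n j r (%i. X i z)"
 have bq: "bmeas ?q" unfolding aux_est_eq_kernel[abs_def] by (intro bmeas_intros bmeas_spline_kernel r)
 have "cross_moment ?q $ i = 1 / real n * (\<Sum>k<n. spline_proj r j (score i) (X k z))" for i
 proof -
 have alg: "(a - b) * c = a * c - c * b" for a b c :: real by (simp add: algebra_simps)
 have "cross_moment ?q $ i = (I01 x. ?q x * score i x - score i x * p \<theta>0 x)" unfolding cross_moment_def vec_lambda_beta alg ..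
 also have "... = (I01 x. ?q x * score i x) - (I01 x. score i x * p \<theta>0 x)" by (intro lint_diff bmeas_integrable bmeas_mult bq bmeas_score bmeas_f)
 finally show ?thesis unfolding score_mean aux_est_inner[OF r bmeas_score] by simp
 qed
 moreover have "sqrt (real n) * (1 / real n * c) = 1 / sqrt (real n) * c" for c
 proof -
 have "u * (1 / (u * u) * c) = 1 / u * c" if "u ~= 0" for u :: real using that by simp
 from this[of "sqrt (real n)"] n show ?thesis by simp
 qed
 ultimately show ?thesis unfolding vec_eq_iff score_sum_def score_bias_def
 by (simp only: vector_scaleR_component vector_add_component vec_lambda_beta distrib_left[symmetric] sum.distrib[symmetric] diff_add_cancel add_diff_cancel_left' add.commute) (simp add: add.commute)
qed

text \<open>The deviation of the auxiliary estimator from the projected density is a spline, so that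
 a small \<open>L\<^sup>2\<close> norm makes it uniformly small; then the estimator is positive and
 the deterministic expansion applies.\<close>

lemma estimator_expansion:
 fixes r :: nat
 assumes r: "2 <= r"
 shows "\<exists>C\<ge>0. \<exists>C0>0. \<forall>\<epsilon>>0. \<exists>\<delta>>0. \<forall>n j z \<theta>. 1 <= n --> z \<in> space M -->
 is_arg_min (Q_obj n j r (%i. X i z) p) (%\<theta>. \<theta> \<in> \<Theta>) \<theta> -->
 (\<forall>x\<in>{0..1}. \<bar>p \<theta>0 x - spline_proj r j (p \<theta>0) x\<bar> <= \<delta>) -->
 C0 * 2 ^ j * sq (%y. aux_est n j r (%i. X i z) y - spline_proj r j (p \<theta>0) y) < \<delta>^2 -->
 norm (sqrt (real n) *\<^sub>R (\<theta> - \<theta>0) - matrix_inv J *v (score_sum n z + score_bias r j n z))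
  <= \<epsilon> * norm (score_sum n z + score_bias r j n z)
  + C * (sqrt (real n) * (2 * sq (%y. aux_est n j r (%i. X i z) y - spline_proj r j (p \<theta>0) y)
     + 2 * sq (%x. p \<theta>0 x - spline_proj r j (p \<theta>0) x)))"
proof -
 let ?f = "p \<theta>0"
 have r1: "1 <= r" using r by simp
 have cf: "continuous_on {0..1} ?f" by (rule cont_x[OF \<theta>0_in])
 obtain x0 where "x0 \<in> {0..1}" "\<forall>y\<in>{0..1}. ?f x0 <= ?f y" using continuous_attains_inf[of "{0..1::real}" ?f] cf by auto
 then obtain m where m: "0 < m" "!!x. x \<in> {0..1} ==> m <= ?f x" using pos by blast
 obtain C0 where C0: "0 < C0" "!!j s x. s \<in> spline_space r j ==> x \<in> {0..1} ==> (s x)^2 <= C0 * 2 ^ j * sq s"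
 by (rule spline_sup_le[OF r]) (rule that)
 obtain C where C: "0 <= C" and exp: "!!\<epsilon>. 0 < \<epsilon> ==> \<exists>\<delta>>0. \<forall>q \<theta>. continuous_on {0..1} q --> (\<forall>x\<in>{0..1}. \<bar>q x - p \<theta>0 x\<bar> <= \<delta>) --> \<theta> \<in> \<Theta> -->
 (\<forall>\<theta>'\<in>\<Theta>. (I01 x. (q x - p \<theta> x)\<^sup>2 / q x) <= (I01 x. (q x - p \<theta>' x)\<^sup>2 / q x)) -->
 norm (\<theta> - \<theta>0 - matrix_inv J *v cross_moment q) <= \<epsilon> * norm (cross_moment q) + C * sq (%x. q x - p \<theta>0 x)"
 using minimizer_expansion by blast
 show ?thesis
 proof (rule exI[of _ C], rule conjI[OF C], rule exI[of _ C0], rule conjI[OF C0(1)], intro allI impI)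
 fix \<epsilon> :: real assume "0 < \<epsilon>"
 then obtain \<delta>1 where \<delta>1: "0 < \<delta>1" and min: "!!q \<theta>. continuous_on {0..1} q ==> (\<forall>x\<in>{0..1}. \<bar>q x - p \<theta>0 x\<bar> <= \<delta>1) ==> \<theta> \<in> \<Theta> ==>
  (\<forall>\<theta>'\<in>\<Theta>. (I01 x. (q x - p \<theta> x)\<^sup>2 / q x) <= (I01 x. (q x - p \<theta>' x)\<^sup>2 / q x)) ==>
  norm (\<theta> - \<theta>0 - matrix_inv J *v cross_moment q) <= \<epsilon> * norm (cross_moment q) + C * sq (%x. q x - p \<theta>0 x)"
  using exp[of \<epsilon>] by blast
 define \<delta> where "\<delta> = min \<delta>1 m / 3"
 have \<delta>: "0 < \<delta>" "2 * \<delta> <= \<delta>1" "2 * \<delta> < m" using \<delta>1 m(1) by (auto simp: \<delta>_def)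
 show "\<exists>\<delta>>0. \<forall>n j z \<theta>. 1 <= n --> z \<in> space M -->
 is_arg_min (Q_obj n j r (%i. X i z) p) (%\<theta>. \<theta> \<in> \<Theta>) \<theta> -->
 (\<forall>x\<in>{0..1}. \<bar>p \<theta>0 x - spline_proj r j (p \<theta>0) x\<bar> <= \<delta>) -->
 C0 * 2 ^ j * sq (%y. aux_est n j r (%i. X i z) y - spline_proj r j (p \<theta>0) y) < \<delta>^2 -->
 norm (sqrt (real n) *\<^sub>R (\<theta> - \<theta>0) - matrix_inv J *v (score_sum n z + score_bias r j n z))
  <= \<epsilon> * norm (score_sum n z + score_bias r j n z)
  + C * (sqrt (real n) * (2 * sq (%y. aux_est n j r (%i. X i z) y - spline_proj r j (p \<theta>0) y)
     + 2 * sq (%x. p \<theta>0 x - spline_proj r j (p \<theta>0) x)))"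
 proof (rule exI[of _ \<delta>], rule conjI[OF \<delta>(1)], intro allI impI)
  fix n j :: nat and z \<theta>
  assume n: "1 <= n" and z: "z \<in> space M" and arg: "is_arg_min (Q_obj n j r (%i. X i z) p) (%\<theta>. \<theta> \<in> \<Theta>) \<theta>"
  and f\<delta>: "\<forall>x\<in>{0..1}. \<bar>?f x - spline_proj r j ?f x\<bar> <= \<delta>"
  and D\<delta>: "C0 * 2 ^ j * sq (%y. aux_est n j r (%i. X i z) y - spline_proj r j ?f y) < \<delta>^2"
  define q where "q = aux_est n j r (%i. X i z)"
  let ?P = "spline_proj r j ?f" and ?A = "cross_moment q"
  have cq: "continuous_on {0..1} q" unfolding q_def aux_est_def[abs_def] by (intro continuous_intros bspline_scaled_continuous r)
  obtain c' where c': "!!x. x \<in> {0..1} ==> ?P x = spline_comb r j c' x"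
  using spline_proj_in_space[OF r1 bmeas_f, of j] unfolding spline_space_def by blast
  define c where "c l = (\<Sum>m\<in>spline_index r j. 2 ^ j * spline_gram_inv r j l m
  * (1 / real n * (\<Sum>i<n. bspline_scaled r j m (X i z))))" for l
  have "q y = spline_comb r j c y" for y unfolding q_def aux_est_def spline_comb_def c_def by (simp only: sum_distrib_right)
  then have "\<forall>x\<in>{0..1}. q x - ?P x = spline_comb r j (%l. c l - c' l) x"
  using c' by (simp add: spline_comb_def left_diff_distrib sum_subtractf)
  then have sp: "(%x. q x - ?P x) \<in> spline_space r j" unfolding spline_space_def by blast
  have qP: "\<bar>q x - ?P x\<bar> <= \<delta>" if "x \<in> {0..1}" for x
  proof (rule power2_le_imp_le)
  show "\<bar>q x - ?P x\<bar>\<^sup>2 <= \<delta>^2" using C0(2)[OF sp that] D\<delta> unfolding q_def[symmetric] by simp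
  qed (use \<delta>(1) in simp)
  have qf: "\<bar>q x - ?f x\<bar> <= 2 * \<delta>" if "x \<in> {0..1}" for x using qP[OF that] bspec[OF f\<delta> that] by linarith
  have qpos: "\<forall>y\<in>{0..1}. 0 < aux_est n j r (%i. X i z) y" unfolding q_def[symmetric]
  proof
  fix y :: real assume y: "y \<in> {0..1}"
  show "0 < q y" using qf[OF y] m(2)[OF y] \<delta>(3) by linarith
  qed
  have Q: "Q_obj n j r (%i. X i z) p \<theta>' = (I01 x. (q x - p \<theta>' x)\<^sup>2 / q x)" for \<theta>' unfolding Q_obj_def if_P[OF qpos] q_def ..
  have "\<theta> \<in> \<Theta>" and argm: "\<forall>\<theta>'\<in>\<Theta>. (I01 x. (q x - p \<theta> x)\<^sup>2 / q x) <= (I01 x. (q x - p \<theta>' x)\<^sup>2 / q x)"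
  using arg unfolding is_arg_min_def Q by (auto simp: not_less)
  then have e: "norm (\<theta> - \<theta>0 - matrix_inv J *v ?A) <= \<epsilon> * norm ?A + C * sq (%x. q x - ?f x)"
  by (intro min cq argm) (use qf \<delta>(2) in \<open>meson order_trans\<close>)
  have bP: "bmeas ?P" by (rule bmeas_spline_proj[OF r1 bmeas_f])
  have "sq (%x. q x - ?f x) = sq (%x. (q x - ?P x) + (?P x - ?f x))" by simp
  also have "... <= 2 * sq (%x. q x - ?P x) + 2 * sq (%x. ?P x - ?f x)" by (intro sq_add_le bmeas_diff bP bmeas_f bmeas_continuous_on cq)
  also have "sq (%x. ?P x - ?f x) = sq (%x. ?f x - ?P x)" by (rule sq_minus_commute)
  finally have e2: "C * sq (%x. q x - ?f x) <= C * (2 * sq (%x. q x - ?P x) + 2 * sq (%x. ?f x - ?P x))" by (rule mult_left_mono[OF _ C])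
  define sn where "sn = sqrt (real n)"
  have sn: "0 <= sn" by (simp add: sn_def)
  have sA: "sn *\<^sub>R ?A = score_sum n z + score_bias r j n z" unfolding sn_def q_def by (rule scaled_cross_moment[OF r1 n])
  have "sn *\<^sub>R (\<theta> - \<theta>0) - matrix_inv J *v (sn *\<^sub>R ?A) = sn *\<^sub>R (\<theta> - \<theta>0 - matrix_inv J *v ?A)"
  by (simp only: matrix_vector_mult_scaleR scaleR_diff_right)
  then have "norm (sn *\<^sub>R (\<theta> - \<theta>0) - matrix_inv J *v (sn *\<^sub>R ?A)) = sn * norm (\<theta> - \<theta>0 - matrix_inv J *v ?A)"
  using sn by simp
  also have "... <= sn * (\<epsilon> * norm ?A + C * (2 * sq (%x. q x - ?P x) + 2 * sq (%x. ?f x - ?P x)))"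
  by (rule mult_left_mono[OF order_trans[OF e add_left_mono[OF e2]] sn])
  also have "... = \<epsilon> * norm (sn *\<^sub>R ?A) + C * (sn * (2 * sq (%x. q x - ?P x) + 2 * sq (%x. ?f x - ?P x)))"
  using sn by (simp add: distrib_left mult_ac)
  finally show "norm (sqrt (real n) *\<^sub>R (\<theta> - \<theta>0) - matrix_inv J *v (score_sum n z + score_bias r j n z))
  <= \<epsilon> * norm (score_sum n z + score_bias r j n z)
  + C * (sqrt (real n) * (2 * sq (%y. aux_est n j r (%i. X i z) y - ?P y) + 2 * sq (%x. ?f x - ?P x)))" unfolding sA unfolding sn_def q_def .
 qed
 qed
qed

end

context estimation_sample
begin

text \<open>Every term of the expansion has a small first moment: the variance of the estimator is
 of the order of the dimension divided by the sample size, the squared bias of the density estimate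
 is of smaller order than the inverse root of the sample size because \<open>1 / 2 < \<tau>\<close>, and the
 bias of the score average is a product of two projection errors.\<close>

theorem linearization:
 fixes r :: nat and j :: "nat => nat" and \<tau> Cf \<eta> :: real and s Cw :: "'b => real" and \<theta>hat :: "nat => 'a => real ^ 'b"
 assumes r: "2 <= r" and \<tau>: "1 / 2 < \<tau>" and rate: "(%n. 2 ^ j n :: real) \<in> bigtheta sequentially (%n. real n powr (1 / (2 * \<tau> + 1)))"
 and Cf: "0 <= Cf" "!!j. sq (%x. p \<theta>0 x - spline_proj r j (p \<theta>0) x) <= Cf * (2 ^ j) powr (- 2 * \<tau>)"
 and unif: "!!e. 0 < e ==> \<forall>\<^sub>F j in sequentially. \<forall>x\<in>{0..1}. \<bar>p \<theta>0 x - spline_proj r j (p \<theta>0) x\<bar> <= e"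
 and Cw: "!!i. 1 / 2 < s i" "!!i. 0 <= Cw i"
  "!!i j. sq (%x. score i x - spline_proj r j (score i) x) <= Cw i * (2 ^ j) powr (- 2 * s i)" and argmin: "!!n z. 1 <= n ==> z \<in> space M ==>
  is_arg_min (Q_obj n (j n) r (%i. X i z) p) (%\<theta>. \<theta> \<in> \<Theta>) (\<theta>hat n z)" and \<eta>: "0 < \<eta>"
 shows "(%n. prob {z \<in> space M. \<eta> <= norm (sqrt (real n) *\<^sub>R (\<theta>hat n z - \<theta>0) - matrix_inv J *v score_sum n z)}) ---> 0"
proof -
 have r1: "1 <= r" using r by simp
 define a where "a n = (2::real) ^ j n" for n
 have a0: "0 < a n" for n by (simp add: a_def)
 define \<alpha> where "\<alpha> = 1 / (2 * \<tau> + 1)"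
 have \<alpha>: "0 < \<alpha>" "\<alpha> < 1 / 2" using \<tau> by (simp_all add: \<alpha>_def field_simps)
 have \<alpha>\<tau>: "\<alpha> * (2 * \<tau>) = 1 - \<alpha>" using \<tau> by (simp add: \<alpha>_def field_simps)
 define P where "P \<gamma> \<beta> n = real n powr \<gamma> * a n powr \<beta>" for \<gamma> \<beta> :: real and n
 have P0: "P \<gamma> \<beta> ---> 0" if "\<gamma> + \<alpha> * \<beta> < 0" for \<gamma> \<beta>
 unfolding P_def[abs_def] by (rule powr_rate_tendsto_0[OF rate[folded a_def \<alpha>_def] a0 that])
 have t1: "P (- 1) 2 ---> 0" and t2: "P (- 1) 1 ---> 0" and t3: "P (- (1 / 2)) 1 ---> 0" and t4: "P (- (1 / 2)) 0 ---> 0"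
 by (rule P0; use \<alpha> in simp)+
 have t5: "P (1 / 2) (- 2 * \<tau>) ---> 0"
 proof (rule P0)
 have "\<alpha> * (- 2 * \<tau>) = - (\<alpha> * (2 * \<tau>))" by simp
 then show "1 / 2 + \<alpha> * (- 2 * \<tau>) < 0" using \<alpha>\<tau> \<alpha>(2) by linarith
 qed
 have \<alpha>s: "\<alpha> / 2 < \<alpha> * s i" for i using mult_strict_left_mono[OF Cw(1)[of i] \<alpha>(1)] by simp
 have t6: "P 0 (- 2 * s i) ---> 0" for i
 proof (rule P0)
 have "\<alpha> * (- 2 * s i) = - 2 * (\<alpha> * s i)" by simp
 then show "0 + \<alpha> * (- 2 * s i) < 0" using \<alpha>s[of i] \<alpha>(1) by linarith
 qed
 have t7: "P 1 (- 2 * s i + - 2 * \<tau>) ---> 0" for i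
 proof (rule P0)
 have "\<alpha> * (- 2 * s i + - 2 * \<tau>) = - 2 * (\<alpha> * s i) - \<alpha> * (2 * \<tau>)" by (simp add: algebra_simps)
 then show "1 + \<alpha> * (- 2 * s i + - 2 * \<tau>) < 0" using \<alpha>s[of i] \<alpha>\<tau> by linarith
 qed
 have a_inf: "filterlim j at_top sequentially" unfolding filterlim_at_top
 proof
 fix N
 have "P 0 (- 1) ---> 0" by (rule P0) (use \<alpha> in simp)
 then have "\<forall>\<^sub>F n in sequentially. P 0 (- 1) n < 1 / 2 ^ N" by (rule order_tendstoD(2)) simp
 then show "\<forall>\<^sub>F n in sequentially. N <= j n" using eventually_gt_at_top[of 0]
 proof eventually_elim
  case (elim n)
  then have "1 / (2::real) ^ j n < 1 / 2 ^ N" by (simp add: P_def a_def powr_minus_divide)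
  then have "(2::real) ^ N < 2 ^ j n" by (simp add: field_simps)
  then show ?case by simp
 qed
 qed
 obtain M0 where M0': "\<forall>x\<in>{0..1}. \<bar>p \<theta>0 x\<bar> <= M0" using bmeas_f unfolding bmeas_def by blast
 have M0: "p \<theta>0 x <= M0" if "x \<in> {0..1}" for x using bspec[OF M0' that] by linarith
 have M00: "0 <= M0" using M0'[rule_format, of 0] by simp
 obtain C C0 where C: "0 <= C" and C0: "0 < C0" and expansion: "!!\<epsilon>. 0 < \<epsilon> ==> \<exists>\<delta>>0. \<forall>n j z \<theta>. 1 <= n --> z \<in> space M -->
 is_arg_min (Q_obj n j r (%i. X i z) p) (%\<theta>. \<theta> \<in> \<Theta>) \<theta> -->
 (\<forall>x\<in>{0..1}. \<bar>p \<theta>0 x - spline_proj r j (p \<theta>0) x\<bar> <= \<delta>) -->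
 C0 * 2 ^ j * sq (%y. aux_est n j r (%i. X i z) y - spline_proj r j (p \<theta>0) y) < \<delta>^2 -->
 norm (sqrt (real n) *\<^sub>R (\<theta> - \<theta>0) - matrix_inv J *v (score_sum n z + score_bias r j n z))
  <= \<epsilon> * norm (score_sum n z + score_bias r j n z)
  + C * (sqrt (real n) * (2 * sq (%y. aux_est n j r (%i. X i z) y - spline_proj r j (p \<theta>0) y)
     + 2 * sq (%x. p \<theta>0 x - spline_proj r j (p \<theta>0) x)))" using estimator_expansion[OF r] by blast
 have "bounded_linear ((*v) (matrix_inv J))" by (intro linear_conv_bounded_linear[THEN iffD1] matrix_vector_mul_linear)
 then obtain B where B: "0 < B" "!!v. norm (matrix_inv J *v v) <= norm v * B" using bounded_linear.pos_bounded by blast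
 define D where "D n z = sq (%y. aux_est n (j n) r (%i. X i z) y - spline_proj r (j n) (p \<theta>0) y)" for n z
 define ef where "ef n = sq (%x. p \<theta>0 x - spline_proj r (j n) (p \<theta>0) x)" for n
 define T where "T n z = sqrt (real n) * (2 * D n z + 2 * ef n)" for n z
 let ?S = score_sum and ?V = "%n. score_bias r (j n) n"
 define s1 where "s1 n z = (\<Sum>i\<in>UNIV. \<bar>?S n z $ i\<bar>)" for n z
 define v1 where "v1 n z = (\<Sum>i\<in>UNIV. \<bar>?V n z $ i\<bar>)" for n z
 define db where "db n = C0 * (M0 * (P (- 1) 2 n + (real r - 1) * P (- 1) 1 n))" for n
 define tb where "tb n = 2 * (M0 * (P (- (1 / 2)) 1 n + (real r - 1) * P (- (1 / 2)) 0 n)) + 2 * (Cf * P (1 / 2) (- 2 * \<tau>) n)" for n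
 define vb where "vb i n = M0 * (Cw i * P 0 (- 2 * s i) n) + Cw i * Cf * P 1 (- 2 * s i + - 2 * \<tau>) n" for i n
 define vn where "vn n = (\<Sum>i\<in>UNIV. sqrt (vb i n))" for n
 define s0 where "s0 = (\<Sum>i\<in>UNIV. sqrt (I01 x. (score i x)\<^sup>2 * p \<theta>0 x))"
 have s00: "0 <= s0" unfolding s0_def
 by (intro sum_nonneg real_sqrt_ge_zero integral_nonneg_AE AE_I2 mult_nonneg_nonneg zero_le_power2) (use f_nonneg in simp)
 have db0: "db ---> 0"
 proof -
 have "db ---> C0 * (M0 * (0 + (real r - 1) * 0))" unfolding db_def[abs_def] by (intro tendsto_mult tendsto_add tendsto_const t1 t2)
 then show ?thesis by simp
 qed
 have tb0: "tb ---> 0"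
 proof -
 have "tb ---> 2 * (M0 * (0 + (real r - 1) * 0)) + 2 * (Cf * 0)" unfolding tb_def[abs_def] by (intro tendsto_mult tendsto_add tendsto_const t3 t4 t5)
 then show ?thesis by simp
 qed
 have vn0: "vn ---> 0"
 proof -
 have "vn ---> (\<Sum>i\<in>(UNIV :: 'b set). sqrt (M0 * (Cw i * 0) + Cw i * Cf * 0))" unfolding vn_def[abs_def] vb_def
  by (intro tendsto_sum tendsto_real_sqrt tendsto_mult tendsto_add tendsto_const t6 t7)
 then show ?thesis by simp
 qed
 have a2: "a n powr 2 = a n * a n" "a n powr 1 = a n" "a n powr 0 = 1" for n using a0[of n] by (simp_all add: power2_eq_square)
 have sn: "sqrt (real n) = real n powr (1 / 2)" for n by (rule powr_half_sqrt[symmetric]) simp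
 have sd: "real n powr (- (1 / 2)) = sqrt (real n) / real n" for n
 proof -
 have "real n powr (1 / 2 - 1) = sqrt (real n) / real n" unfolding powr_diff sn by simp
 then show ?thesis by simp
 qed
 have in1: "real n powr (- 1) = 1 / real n" for n by (simp add: powr_minus_divide)
 have D: "integrable M (D n)" "expectation (D n) <= M0 * (a n + real r - 1) / real n" if n: "1 <= n" for n
 unfolding D_def[abs_def] a_def by (rule aux_est_error[OF r1 n M0]; assumption)+
 have D0: "0 <= D n z" for n z unfolding D_def by simp
 have ED: "expectation (%z. C0 * a n * D n z) <= db n" if n: "1 <= n" for n
 proof -
 have "expectation (%z. C0 * a n * D n z) = C0 * a n * expectation (D n)" by (rule integral_mult_right_zero)
 also have "... <= C0 * a n * (M0 * (a n + real r - 1) / real n)" by (intro mult_left_mono D(2) n) (use C0 a0[of n] in simp)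
 also have "... = db n" unfolding db_def P_def in1 a2 by (simp add: add_divide_distrib diff_divide_distrib algebra_simps)
 finally show ?thesis .
 qed
 have ef_le: "ef n <= Cf * a n powr (- 2 * \<tau>)" for n unfolding ef_def a_def by (rule Cf(2))
 have ef0: "0 <= ef n" for n unfolding ef_def by simp
 have ET: "integrable M (T n)" "expectation (T n) <= tb n" if n: "1 <= n" for n
 proof -
 show "integrable M (T n)" unfolding T_def[abs_def] by (intro integrable_mult_right lint_addable D(1) n integrable_const)
 have "expectation (T n) = sqrt (real n) * expectation (%z. 2 * D n z + 2 * ef n)" unfolding T_def by (rule integral_mult_right_zero)
 also have "expectation (%z. 2 * D n z + 2 * ef n) = 2 * expectation (D n) + 2 * ef n" using D(1)[OF n] by (simp add: prob_space)
 also have "sqrt (real n) * (2 * expectation (D n) + 2 * ef n)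
  <= sqrt (real n) * (2 * (M0 * (a n + real r - 1) / real n) + 2 * (Cf * a n powr (- 2 * \<tau>)))"
  using D(2)[OF n] ef_le[of n] by (intro mult_left_mono) simp_all
 also have "... = 2 * (M0 * ((sqrt (real n) / real n) * a n + (real r - 1) * (sqrt (real n) / real n))) + 2 * (Cf * (sqrt (real n) * a n powr (- 2 * \<tau>)))"
  by (simp add: add_divide_distrib diff_divide_distrib algebra_simps)
 also have "... = tb n" unfolding tb_def P_def a2 sd sn[symmetric] by simp
 finally show "expectation (T n) <= tb n" .
 qed
 have Es: "integrable M (s1 n)" "expectation (s1 n) <= s0" if n: "1 <= n" for n
 proof -
 have eq: "?S n z $ i = 1 / sqrt (real n) * (\<Sum>k<n. score i (X k z))" for i z by (simp add: score_sum_def)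
 have m: "(%z. ?S n z $ i) \<in> borel_measurable M" for i unfolding eq
  by (intro borel_measurable_times borel_measurable_const borel_measurable_sum comp_measurable[OF bmeas_score])
 have i2: "integrable M (%z. (?S n z $ i)\<^sup>2)" for i unfolding eq by (rule scaled_sum_second_moment(1)[OF bmeas_score n])
 have e2: "expectation (%z. (?S n z $ i)\<^sup>2) <= (I01 x. (score i x)\<^sup>2 * p \<theta>0 x)" for i
  using scaled_sum_second_moment(2)[OF bmeas_score[of i] n] unfolding eq score_mean by simp
 note A = expectation_abs_le_sqrt[OF m i2 e2]
 show "integrable M (s1 n)" unfolding s1_def[abs_def] by (intro lint_summable A(1))
 have "expectation (s1 n) = (\<Sum>i\<in>UNIV. expectation (%z. \<bar>?S n z $ i\<bar>))" unfolding s1_def by (rule lint_sum[OF A(1)])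
 also have "... <= s0" unfolding s0_def by (rule sum_mono) (rule A(2))
 finally show "expectation (s1 n) <= s0" .
 qed
 have Ev: "integrable M (v1 n)" "expectation (v1 n) <= vn n" if n: "1 <= n" for n
 proof -
 have eq: "?V n z $ i = 1 / sqrt (real n) * (\<Sum>k<n. spline_proj r (j n) (score i) (X k z) - score i (X k z))" for i z by (simp add: score_bias_def)
 have m: "(%z. ?V n z $ i) \<in> borel_measurable M" for i unfolding eq
  by (intro borel_measurable_times borel_measurable_const borel_measurable_sum borel_measurable_diff
   comp_measurable[OF bmeas_score] comp_measurable[OF bmeas_spline_proj[OF r1 bmeas_score]])
 have i2: "integrable M (%z. (?V n z $ i)\<^sup>2)" for i unfolding eq by (rule projection_error_moment(1)[OF r1 n bmeas_score M0])
 have e2: "expectation (%z. (?V n z $ i)\<^sup>2) <= vb i n" for i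
 proof -
  define ew where "ew = sq (%x. score i x - spline_proj r (j n) (score i) x)"
  have w: "ew <= Cw i * a n powr (- 2 * s i)" unfolding ew_def a_def by (rule Cw(3))
  have w0: "0 <= ew" unfolding ew_def by simp
  have w1: "0 <= Cw i * a n powr (- 2 * s i)" using Cw(2)[of i] by simp
  have "expectation (%z. (?V n z $ i)\<^sup>2) <= M0 * ew + real n * (ew * ef n)"
  unfolding eq ew_def ef_def by (rule projection_error_moment(2)[OF r1 n bmeas_score M0])
  also have "... <= M0 * (Cw i * a n powr (- 2 * s i)) + real n * ((Cw i * a n powr (- 2 * s i)) * (Cf * a n powr (- 2 * \<tau>)))"
  by (intro add_mono mult_left_mono mult_mono w ef_le w1 ef0 M00) simp
  also have "... = vb i n" using n a0[of n] unfolding vb_def P_def powr_add by simp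
  finally show ?thesis .
 qed
 note A = expectation_abs_le_sqrt[OF m i2 e2]
 show "integrable M (v1 n)" unfolding v1_def[abs_def] by (intro lint_summable A(1))
 have "expectation (v1 n) = (\<Sum>i\<in>UNIV. expectation (%z. \<bar>?V n z $ i\<bar>))" unfolding v1_def by (rule lint_sum[OF A(1)])
 also have "... <= vn n" unfolding vn_def by (rule sum_mono) (rule A(2))
 finally show "expectation (v1 n) <= vn n" .
 qed
 have s1n: "norm (?S n z) <= s1 n z" and v1n: "norm (?V n z) <= v1 n z" for n z unfolding s1_def v1_def by (rule norm_le_l1_cart)+
 have s10: "0 <= s1 n z" and v10: "0 <= v1 n z" for n z unfolding s1_def v1_def by (simp_all add: sum_nonneg)
 have T0: "0 <= T n z" for n z unfolding T_def using D0 ef0 by simp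
 show ?thesis
 proof (rule LIMSEQ_I)
 fix \<kappa> :: real assume \<kappa>: "0 < \<kappa>"
 define \<epsilon> where "\<epsilon> = \<kappa> * \<eta> / (2 * (s0 + 1))"
 have \<epsilon>: "0 < \<epsilon>" using \<kappa> \<eta> s00 by (simp add: \<epsilon>_def)
 have \<epsilon>s: "\<epsilon> * s0 / \<eta> < \<kappa>"
 proof -
  have "\<epsilon> * s0 / \<eta> = \<kappa> * (s0 / (2 * (s0 + 1)))" using \<eta> by (simp add: \<epsilon>_def)
  also have "... < \<kappa> * 1" by (rule mult_strict_left_mono[OF _ \<kappa>]) (use s00 in simp)
  finally show ?thesis by simp
 qed
 obtain \<delta> where \<delta>: "0 < \<delta>" and step: "!!n j z \<theta>. 1 <= n ==> z \<in> space M ==>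
  is_arg_min (Q_obj n j r (%i. X i z) p) (%\<theta>. \<theta> \<in> \<Theta>) \<theta> ==>
  (\<forall>x\<in>{0..1}. \<bar>p \<theta>0 x - spline_proj r j (p \<theta>0) x\<bar> <= \<delta>) ==>
  C0 * 2 ^ j * sq (%y. aux_est n j r (%i. X i z) y - spline_proj r j (p \<theta>0) y) < \<delta>^2 ==>
  norm (sqrt (real n) *\<^sub>R (\<theta> - \<theta>0) - matrix_inv J *v (score_sum n z + score_bias r j n z))
   <= \<epsilon> * norm (score_sum n z + score_bias r j n z)
   + C * (sqrt (real n) * (2 * sq (%y. aux_est n j r (%i. X i z) y - spline_proj r j (p \<theta>0) y)
     + 2 * sq (%x. p \<theta>0 x - spline_proj r j (p \<theta>0) x)))" using expansion[OF \<epsilon>] by blast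
 define W where "W n z = \<epsilon> * (s1 n z + v1 n z) + C * T n z + B * v1 n z" for n z
 define wb where "wb n = \<epsilon> * (s0 + vn n) + C * tb n + B * vn n" for n
 let ?R = "%n z. norm (sqrt (real n) *\<^sub>R (\<theta>hat n z - \<theta>0) - matrix_inv J *v ?S n z)"
 have W0: "0 <= W n z" for n z unfolding W_def by (intro add_nonneg_nonneg mult_nonneg_nonneg s10 v10 T0 C) (use \<epsilon> B(1) in simp_all)
 have iW: "integrable M (W n)" if "1 <= n" for n unfolding W_def[abs_def] by (intro lint_addable integrable_mult_right Es(1) Ev(1) ET(1) that)
 have EW: "expectation (W n) <= wb n" if n: "1 <= n" for n
 proof -
  have "expectation (W n) = \<epsilon> * (expectation (s1 n) + expectation (v1 n)) + C * expectation (T n) + B * expectation (v1 n)"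
  unfolding W_def using Es(1)[OF n] Ev(1)[OF n] ET(1)[OF n] by simp
  also have "... <= wb n" unfolding wb_def by (intro add_mono mult_left_mono Es(2) Ev(2) ET(2) n C) (use \<epsilon> B(1) in simp_all)
  finally show ?thesis .
 qed
 have prob_le: "prob {z \<in> space M. \<eta> <= ?R n z} <= db n / \<delta>^2 + wb n / \<eta>"
  if n: "1 <= n" and u: "\<forall>x\<in>{0..1}. \<bar>p \<theta>0 x - spline_proj r (j n) (p \<theta>0) x\<bar> <= \<delta>" for n
 proof -
  let ?A = "{z \<in> space M. \<delta>\<^sup>2 <= C0 * a n * D n z}" and ?B = "{z \<in> space M. \<eta> <= W n z}"
  have iD: "integrable M (%z. C0 * a n * D n z)" by (intro integrable_mult_right D(1) n)
  note borel_measurable_integrable[OF iD] borel_measurable_integrable[OF iW[OF n]]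
  then have mAB: "?A \<in> events" "?B \<in> events" by measurable
  have "{z \<in> space M. \<eta> <= ?R n z} \<subseteq> ?A \<union> ?B"
  proof
  fix z assume "z \<in> {z \<in> space M. \<eta> <= ?R n z}"
  then have z: "z \<in> space M" and R: "\<eta> <= ?R n z" by simp_all
  show "z \<in> ?A \<union> ?B"
  proof (cases "\<delta>^2 <= C0 * a n * D n z")
   case False
   then have "C0 * 2 ^ j n * sq (%y. aux_est n (j n) r (%i. X i z) y - spline_proj r (j n) (p \<theta>0) y) < \<delta>^2"
    unfolding a_def D_def by (simp only: not_le)
   from step[OF n z argmin[OF n z] u this]
   have 1: "norm (sqrt (real n) *\<^sub>R (\<theta>hat n z - \<theta>0) - matrix_inv J *v (?S n z + ?V n z)) <= \<epsilon> * norm (?S n z + ?V n z) + C * T n z"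
    unfolding T_def D_def ef_def .
   have 2: "norm (?S n z + ?V n z) <= s1 n z + v1 n z" using norm_triangle_ineq[of "?S n z" "?V n z"] s1n[of n z] v1n[of n z] by linarith
   have 3: "norm (matrix_inv J *v ?V n z) <= B * v1 n z" by (rule order_trans[OF B(2)])
    (use mult_right_mono[OF v1n[of n z] less_imp_le[OF B(1)]] in \<open>simp only: mult.commute\<close>)
   have "sqrt (real n) *\<^sub>R (\<theta>hat n z - \<theta>0) - matrix_inv J *v ?S n z
    = (sqrt (real n) *\<^sub>R (\<theta>hat n z - \<theta>0) - matrix_inv J *v (?S n z + ?V n z)) + matrix_inv J *v ?V n z"
    by (simp add: matrix_vector_right_distrib)
   then have "?R n z <= norm (sqrt (real n) *\<^sub>R (\<theta>hat n z - \<theta>0) - matrix_inv J *v (?S n z + ?V n z)) + norm (matrix_inv J *v ?V n z)"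
    by (simp only: norm_triangle_ineq)
   also have "... <= W n z" using 1 3 mult_left_mono[OF 2, of \<epsilon>] \<epsilon> unfolding W_def by linarith
   finally show ?thesis using z R by simp
  qed (use z in simp)
  qed
  then have "prob {z \<in> space M. \<eta> <= ?R n z} <= prob (?A \<union> ?B)" by (rule finite_measure_mono) (use mAB in blast)
  also have "... <= prob ?A + prob ?B" by (rule measure_Un_le[OF mAB])
  also have "... <= db n / \<delta>^2 + wb n / \<eta>"
  proof (rule add_mono)
  show "prob ?A <= db n / \<delta>^2" by (rule markov[OF iD _ ED[OF n]]) (use C0 a0[of n] D0 \<delta> in simp_all)
  show "prob ?B <= wb n / \<eta>" by (rule markov[OF iW[OF n] W0 EW[OF n] \<eta>])
  qed
  finally show ?thesis .
 qed
 have "(%n. db n / \<delta>^2 + wb n / \<eta>) ---> 0 / \<delta>^2 + (\<epsilon> * (s0 + 0) + C * 0 + B * 0) / \<eta>"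
  unfolding wb_def using \<delta> \<eta> by (intro tendsto_add tendsto_divide tendsto_mult tendsto_const db0 vn0 tb0) simp_all
 then have "\<forall>\<^sub>F n in sequentially. db n / \<delta>^2 + wb n / \<eta> < \<kappa>" by (rule order_tendstoD(2)) (use \<epsilon>s in simp)
 moreover have "\<forall>\<^sub>F n in sequentially. \<forall>x\<in>{0..1}. \<bar>p \<theta>0 x - spline_proj r (j n) (p \<theta>0) x\<bar> <= \<delta>"
  by (rule filterlim_iff[THEN iffD1, rule_format, OF a_inf unif[OF \<delta>]])
 ultimately have "\<forall>\<^sub>F n in sequentially. norm (prob {z \<in> space M. \<eta> <= ?R n z} - 0) < \<kappa>" using eventually_ge_at_top[of 1]
 proof eventually_elim
  case (elim n)
  show ?case using prob_le[OF elim(3) elim(2)] elim(1) by simp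
 qed
 then show "\<exists>no. \<forall>n\<ge>no. norm (prob {z \<in> space M. \<eta> <= ?R n z} - 0) < \<kappa>" unfolding eventually_sequentially .
 qed
qed

text \<open>Characteristic functions converge along every direction by the one-dimensional central
 limit theorem, and second moments of the score average give tightness. Indices are shifted by one
 since the estimator at sample size zero is arbitrary.\<close>

theorem asymptotic_normality:
 fixes \<theta>hat :: "nat => 'a => real ^ 'b"
 assumes meas: "!!n. 1 <= n ==> \<theta>hat n \<in> borel_measurable M"
 and linear: "!!\<eta>. 0 < \<eta> ==> (%n. prob {z \<in> space M. \<eta> <= norm (sqrt (real n) *\<^sub>R (\<theta>hat n z - \<theta>0) - matrix_inv J *v score_sum n z)}) ---> 0"
 shows "weak_conv_to (%n. distr M borel (%z. sqrt (real n) *\<^sub>R (\<theta>hat n z - \<theta>0))) (multivariate_normal 0 (matrix_inv J))"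
proof -
 define K where "K = matrix_inv J"
 define Z where "Z n z = sqrt (real (Suc n)) *\<^sub>R (\<theta>hat (Suc n) z - \<theta>0)" for n z
 let ?S = "%n. score_sum (Suc n)"
 let ?\<mu> = "%n. distr M borel (Z n)"
 have KJ: "K ** J = mat 1" unfolding K_def by (rule posdef_inverse(2)[OF posdef])
 have mZ: "Z n \<in> borel_measurable M" for n
 unfolding Z_def[abs_def] using meas[of "Suc n"] by (intro borel_measurable_scaleR borel_measurable_diff) simp_all
 have mS: "score_sum n \<in> borel_measurable M" for n
 proof (rule borel_measurable_vecI)
 show "(%z. score_sum n z $ i) \<in> borel_measurable M" for i unfolding score_sum_def vec_lambda_beta
  by (intro borel_measurable_times borel_measurable_const borel_measurable_sum comp_measurable[OF bmeas_score])
 qed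
 have mK: "(*v) K \<in> borel_measurable borel" by (intro meas_contI linear_continuous_on linear_conv_bounded_linear[THEN iffD1] matrix_vector_mul_linear)
 have mKS: "(%z. K *v ?S n z) \<in> borel_measurable M" for n by (rule measurable_compose[OF mS mK])
 have lin: "(%n. prob {z \<in> space M. \<eta> <= norm (Z n z - K *v ?S n z)}) ---> 0" if "0 < \<eta>" for \<eta>
 using LIMSEQ_Suc[OF linear[OF that]] unfolding Z_def K_def .
 have mR: "{z \<in> space M. \<eta> <= norm (Z n z - K *v ?S n z)} \<in> events" for \<eta> n
 using measurable_compose[OF borel_measurable_diff[OF mZ[of n] mKS[of n]] borel_measurable_norm] by measurable
 have minner: "(%z. t \<bullet> Y z) \<in> borel_measurable M" if "Y \<in> borel_measurable M" for t :: "real ^ 'b" and Y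
 by (intro borel_measurable_inner borel_measurable_const that)
 have trig: "(%n. expectation (%z. cos (t \<bullet> Z n z))) ---> exp (- (t \<bullet> (K *v t)) / 2)
  & (%n. expectation (%z. sin (t \<bullet> Z n z))) ---> 0" for t
 proof (cases "t = 0")
 case True
 then show ?thesis by (simp add: prob_space)
 next
 case False
 define a where "a = t v* K"
 have aK: "t \<bullet> (K *v v) = a \<bullet> v" for v unfolding a_def by (rule dot_lmul_matrix[symmetric])
 have tJ: "transpose J = J" using posdef unfolding pos_def_def by blast
 have "(J *v a) \<bullet> v = t \<bullet> v" for v
 proof -
  have "(J *v a) \<bullet> v = a \<bullet> (J *v v)" using inner_transpose[of a J v] unfolding tJ by simp
  also have "... = t \<bullet> (K *v (J *v v))" by (rule aK[symmetric])
  also have "K *v (J *v v) = v" by (simp add: matrix_vector_mul_assoc KJ)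
  finally show ?thesis .
 qed
 then have Ja: "J *v a = t" using vector_eq_rdot by blast
 then have "a ~= 0" using False by auto
 then have pos: "0 < a \<bullet> (J *v a)" using posdef unfolding pos_def_def by blast
 have v: "a \<bullet> (J *v a) = t \<bullet> (K *v t)" unfolding aK Ja ..
 note clt = clt_trigonometric[OF score_combination(1) score_combination(2) score_combination(3) pos]
 have close: "(%n. prob {z \<in> space M. \<eta> <= \<bar>t \<bullet> Z n z - a \<bullet> ?S n z\<bar>}) ---> 0" if \<eta>: "0 < \<eta>" for \<eta>
 proof (rule tendsto_sandwich[OF _ _ tendsto_const lin])
  have nt: "0 < norm t" using False by simp
  show "0 < \<eta> / norm t" using \<eta> nt by simp
  show "\<forall>\<^sub>F n in sequentially. 0 <= prob {z \<in> space M. \<eta> <= \<bar>t \<bullet> Z n z - a \<bullet> ?S n z\<bar>}" by simp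
  have "prob {z \<in> space M. \<eta> <= \<bar>t \<bullet> Z n z - a \<bullet> ?S n z\<bar>} <= prob {z \<in> space M. \<eta> / norm t <= norm (Z n z - K *v ?S n z)}" for n
  proof (rule finite_measure_mono[OF _ mR], rule subsetI)
  fix z assume "z \<in> {z \<in> space M. \<eta> <= \<bar>t \<bullet> Z n z - a \<bullet> ?S n z\<bar>}"
  then have z: "z \<in> space M" and le: "\<eta> <= \<bar>t \<bullet> Z n z - a \<bullet> ?S n z\<bar>" by simp_all
  have "t \<bullet> Z n z - a \<bullet> ?S n z = t \<bullet> (Z n z - K *v ?S n z)" by (simp only: inner_diff_right aK)
  then have "\<eta> <= norm t * norm (Z n z - K *v ?S n z)" using le Cauchy_Schwarz_ineq2[of t "Z n z - K *v ?S n z"] by linarith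
  then show "z \<in> {z \<in> space M. \<eta> / norm t <= norm (Z n z - K *v ?S n z)}" using z nt by (simp add: pos_divide_le_eq mult.commute)
  qed
  then show "\<forall>\<^sub>F n in sequentially. prob {z \<in> space M. \<eta> <= \<bar>t \<bullet> Z n z - a \<bullet> ?S n z\<bar>}
   <= prob {z \<in> space M. \<eta> / norm t <= norm (Z n z - K *v ?S n z)}" by (rule always_eventually[OF allI])
 qed
 have "(%n. expectation (%z. cos (t \<bullet> Z n z))) ---> exp (- (a \<bullet> (J *v a)) / 2)"
 proof (rule expectation_lipschitz_close[OF cos_lipschitz abs_cos_le_one _ minner[OF mZ] minner[OF mS] close])
  show "continuous_on UNIV (cos :: real => real)" by (intro continuous_intros)
  show "(%n. expectation (%z. cos (a \<bullet> ?S n z))) ---> exp (- (a \<bullet> (J *v a)) / 2)"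
  using LIMSEQ_Suc[OF clt(1)] unfolding score_combination(4) .
 qed
 moreover have "(%n. expectation (%z. sin (t \<bullet> Z n z))) ---> 0"
 proof (rule expectation_lipschitz_close[OF sin_lipschitz abs_sin_le_one _ minner[OF mZ] minner[OF mS] close])
  show "continuous_on UNIV (sin :: real => real)" by (intro continuous_intros)
  show "(%n. expectation (%z. sin (a \<bullet> ?S n z))) ---> 0" using LIMSEQ_Suc[OF clt(2)] unfolding score_combination(4) .
 qed
 ultimately show ?thesis unfolding v ..
 qed
 note N = normal_distribution_facts[OF posdef]
 have mtrig: "(%x. cos (t \<bullet> x)) \<in> borel_measurable borel" "(%x. sin (t \<bullet> x)) \<in> borel_measurable borel" for t :: "real ^ 'b"
 by (intro meas_contI continuous_intros)+
 have "weak_conv_to ?\<mu> (multivariate_normal 0 (matrix_inv J))"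
 proof (rule weak_conv_from_trig)
 show "prob_space (?\<mu> n)" for n by (rule prob_space_distr[OF mZ])
 show "sets (?\<mu> n) = sets borel" for n by simp
 show "prob_space (multivariate_normal 0 (matrix_inv J))" "sets (multivariate_normal 0 (matrix_inv J)) = sets borel" by (rule N)+
 show "(%n. \<integral>x. cos (t \<bullet> x) \<partial>?\<mu> n) ---> (\<integral>x. cos (t \<bullet> x) \<partial>multivariate_normal 0 (matrix_inv J))" for t
  unfolding integral_distr[OF mZ mtrig(1)] N(3) using trig[of t] unfolding K_def by (rule conjunct1)
 show "(%n. \<integral>x. sin (t \<bullet> x) \<partial>?\<mu> n) ---> (\<integral>x. sin (t \<bullet> x) \<partial>multivariate_normal 0 (matrix_inv J))" for t
  unfolding integral_distr[OF mZ mtrig(2)] N(4) using trig[of t] by (rule conjunct2)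
 fix e :: real assume e: "0 < e"
 define c where "c = (\<Sum>i\<in>UNIV. \<integral>x. (score i x)\<^sup>2 * p \<theta>0 x \<partial>lborel01)"
 have i2: "integrable M (%z. (norm (?S n z))\<^sup>2)" and e2: "expectation (%z. (norm (?S n z))\<^sup>2) <= c" for n
 proof -
  have eq: "(norm (?S n z))^2 = (\<Sum>i\<in>UNIV. (1 / sqrt (real (Suc n)) * (\<Sum>k<Suc n. score i (X k z)))\<^sup>2)" for z
  unfolding power2_norm_eq_inner inner_vec_def score_sum_def by (simp add: power2_eq_square)
  have n: "1 <= Suc n" by simp
  note m1 = scaled_sum_second_moment(1)[OF bmeas_score n] and m2 = scaled_sum_second_moment(2)[OF bmeas_score n, unfolded score_mean]
  show "integrable M (%z. (norm (?S n z))\<^sup>2)" unfolding eq by (intro lint_summable m1)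
  have "expectation (%z. (norm (?S n z))\<^sup>2) = (\<Sum>i\<in>UNIV. expectation (%z. (1 / sqrt (real (Suc n)) * (\<Sum>k<Suc n. score i (X k z)))\<^sup>2))"
  unfolding eq by (rule lint_sum[OF m1])
  also have "... <= c" unfolding c_def
  proof (rule sum_mono)
  show "expectation (%z. (1 / sqrt (real (Suc n)) * (\<Sum>k<Suc n. score i (X k z)))\<^sup>2) <= (I01 x. (score i x)\<^sup>2 * p \<theta>0 x)" for i
   using m2[of i] by simp
  qed
  finally show "expectation (%z. (norm (?S n z))\<^sup>2) <= c" .
 qed
 have "bounded_linear ((*v) K)" by (intro linear_conv_bounded_linear[THEN iffD1] matrix_vector_mul_linear)
 then obtain B where B: "0 < B" "!!v. norm (K *v v) <= norm v * B" using bounded_linear.pos_bounded by blast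
 define b where "b = \<bar>c\<bar> / (e / 2) + 1"
 have b: "0 < b" "c / b <= e / 2"
 proof -
  have 0: "0 <= \<bar>c\<bar> / (e / 2)" using e by simp
  then show b0: "0 < b" unfolding b_def by linarith
  have "c <= (e / 2) * (\<bar>c\<bar> / (e / 2))" using e by simp
  also have "... <= (e / 2) * b" unfolding b_def by (rule mult_left_mono) (use e in simp_all)
  finally show "c / b <= e / 2" using b0 by (simp only: pos_divide_le_eq)
 qed
 define R where "R = 1 + sqrt b * B"
 have "\<forall>\<^sub>F n in sequentially. prob {z \<in> space M. 1 <= norm (Z n z - K *v ?S n z)} < e / 2"
  by (rule order_tendstoD(2)[OF lin]) (use e in simp_all)
 then have "\<forall>\<^sub>F n in sequentially. measure (?\<mu> n) {x. R < norm x} <= e"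
 proof eventually_elim
  case (elim n)
  let ?A = "{z \<in> space M. 1 <= norm (Z n z - K *v ?S n z)}" and ?B = "{z \<in> space M. b <= (norm (?S n z))^2}"
  have mB: "?B \<in> events" using borel_measurable_integrable[OF i2[of n]] by measurable
  have "measure (?\<mu> n) {x. R < norm x} = prob (Z n -` {x. R < norm x} \<inter> space M)" by (rule measure_distr[OF mZ]) simp
  also have "... <= prob (?A \<union> ?B)"
  proof (rule finite_measure_mono[OF _ sets.Un[OF mR mB]], rule subsetI)
  fix z assume "z \<in> Z n -` {x. R < norm x} \<inter> space M"
  then have z: "z \<in> space M" and R: "R < norm (Z n z)" by simp_all
  show "z \<in> ?A \<union> ?B"
  proof (rule ccontr)
   assume "z \<notin> ?A \<union> ?B"
   then have 1: "norm (Z n z - K *v ?S n z) < 1" and 2: "(norm (?S n z))^2 < b" using z by simp_all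
   have "norm (?S n z) <= sqrt b" using 2 by (intro real_le_rsqrt) simp
   then have "norm (?S n z) * B <= sqrt b * B" using B(1) by (intro mult_right_mono) simp_all
   then have "norm (K *v ?S n z) <= sqrt b * B" by (rule order_trans[OF B(2)])
   then show False using 1 R norm_triangle_sub[of "Z n z" "K *v ?S n z"] unfolding R_def by linarith
  qed
  qed
  also have "... <= prob ?A + prob ?B" by (rule measure_Un_le[OF mR mB])
  also have "prob ?B <= c / b" by (rule markov[OF i2 _ e2 b(1)]) simp
  finally show ?case using elim b(2) by linarith
 qed
 then show "\<exists>R. \<forall>\<^sub>F n in sequentially. measure (?\<mu> n) {x. R < norm x} <= e" by blast
 qed
 then show ?thesis unfolding weak_conv_to_def Z_def by (intro allI impI) (rule LIMSEQ_imp_Suc, blast)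
qed

end

theorem theorem2:
  fixes M :: "'a measure"
    and X :: "nat \<Rightarrow> 'a \<Rightarrow> real"
    and p0 :: "real \<Rightarrow> real"
    and \<Theta> :: "(real ^ 'b) set"
    and p :: "real ^ 'b \<Rightarrow> real \<Rightarrow> real"
    and \<theta>0 :: "real ^ 'b"
    and \<tau> :: real
    and r :: nat
    and j :: "nat \<Rightarrow> nat"
    and \<theta>hat :: "nat \<Rightarrow> 'a \<Rightarrow> real ^ 'b"
  assumes "prob_space M"
    and "prob_density01 p0"
    and "\<And>i. distributed M lborel01 (X i) (\<lambda>x. ennreal (p0 x))"
    and "prob_space.indep_vars M (\<lambda>_. borel) X UNIV"
    and "\<And>\<theta>. \<theta> \<in> \<Theta> \<Longrightarrow> prob_density01 (p \<theta>)"
    and "2 \<le> r"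
    and "assumption_P1 \<Theta> p p0 \<theta>0 \<tau>"
    and "1 / 2 < \<tau>" and "\<tau> < real r"
    and "\<And>n. 1 \<le> n \<Longrightarrow> 1 \<le> j n"
    and "(\<lambda>n. 2 ^ j n :: real) \<in> bigtheta sequentially (\<lambda>n. real n powr (1 / (2 * \<tau> + 1)))"
    and "\<And>n. 1 \<le> n \<Longrightarrow> \<theta>hat n \<in> borel_measurable M"
    and "\<And>n \<omega>. 1 \<le> n \<Longrightarrow> \<omega> \<in> space M \<Longrightarrow>
           is_arg_min (Q_obj n (j n) r (\<lambda>i. X i \<omega>) p) (\<lambda>\<theta>. \<theta> \<in> \<Theta>) (\<theta>hat n \<omega>)"
  shows "weak_conv_to (\<lambda>n. distr M borel (\<lambda>\<omega>. sqrt (real n) *\<^sub>R (\<theta>hat n \<omega> - \<theta>0)))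
           (multivariate_normal 0 (matrix_inv (information_matrix p \<theta>0)))"
proof -
 interpret M: prob_space M by fact
 note P1 = assms(7)[unfolded assumption_P1_def]
 have c\<Theta>: "compact \<Theta>" and \<theta>0: "\<theta>0 \<in> \<Theta>" and p0: "AE x in lborel01. p0 x = p \<theta>0 x"
 and ident: "\<forall>\<theta>\<in>\<Theta>. (AE x in lborel01. p \<theta> x = p \<theta>0 x) --> \<theta> = \<theta>0"
 and ct: "\<forall>x\<in>{0..1}. continuous_on \<Theta> (%\<theta>. p \<theta> x)" and pos: "\<forall>x\<in>{0..1}. 0 < p \<theta>0 x"
 and pB: "p ` \<Theta> \<subseteq> cont_besov \<tau>" and pd: "pos_def (information_matrix p \<theta>0)" using P1 by blast+
 obtain \<rho> where \<rho>: "0 < \<rho>" "ball \<theta>0 \<rho> \<subseteq> \<Theta>" "\<forall>x\<in>{0..1}. C2_on (ball \<theta>0 \<rho>) (%\<theta>. p \<theta> x)"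
 "(\<integral>\<^sup>+x. (SUP \<theta>\<in>ball \<theta>0 \<rho>. ennreal ((norm (gradient (%\<theta>. p \<theta> x) \<theta>))^2)) \<partial>lborel01) < \<infinity>"
 "(\<integral>\<^sup>+x. (SUP \<theta>\<in>ball \<theta>0 \<rho>. ennreal (onorm ((*v) (hessian (%\<theta>. p \<theta> x) \<theta>)))) \<partial>lborel01) < \<infinity>"
 using P1 by blast
 obtain \<sigma> where \<sigma>: "1 / 2 < \<sigma>" "\<forall>q. (%x. gradient (%\<theta>. p \<theta> x) \<theta>0 $ q) \<in> cont_besov \<sigma>" using P1 by blast
 have cx: "continuous_on {0..1} (p \<theta>)" if "\<theta> \<in> \<Theta>" for \<theta> using pB that unfolding cont_besov_def by blast
 have mass: "(I01 x. p \<theta> x) = 1" if "\<theta> \<in> \<Theta>" for \<theta>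
 proof -
 have d: "p \<theta> \<in> borel_measurable lborel01" "\<forall>x\<in>{0..1}. 0 <= p \<theta> x" "(\<integral>\<^sup>+x. ennreal (p \<theta> x) \<partial>lborel01) = 1"
  using assms(5)[OF that] unfolding prob_density01_def by blast+
 have "(I01 x. p \<theta> x) = enn2real (\<integral>\<^sup>+x. ennreal (p \<theta> x) \<partial>lborel01)"
  by (rule integral_eq_nn_integral[OF d(1)]) (intro AE_I2, use d(2) in simp)
 then show ?thesis unfolding d(3) by simp
 qed
 have cg: "continuous_on {0..1} (%x. gradient (%\<theta>. p \<theta> x) \<theta>0 $ i)" for i using \<sigma>(2) unfolding cont_besov_def by blast
 have df: "density_family \<Theta> p \<theta>0 \<rho>"
 by (rule density_family.intro) (use c\<Theta> \<theta>0 ident ct cx mass pos \<rho> cg pd in \<open>blast+\<close>)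
 have iid: "iid_sample01 M X (p \<theta>0)"
 proof (rule iid_sample01.intro[OF M.prob_space_axioms], rule iid_sample01_axioms.intro)
 show "X i \<in> measurable M lborel01" for i by (rule distributed_measurable[OF assms(3)])
 have "distr M lborel01 (X i) = density lborel01 (%x. ennreal (p0 x))" for i by (rule distributed_distr_eq_density[OF assms(3)])
 also have "density lborel01 (%x. ennreal (p0 x)) = density lborel01 (%x. ennreal (p \<theta>0 x))"
 proof (rule density_cong)
  show "(%x. ennreal (p0 x)) \<in> borel_measurable lborel01" "(%x. ennreal (p \<theta>0 x)) \<in> borel_measurable lborel01"
  using assms(2) assms(5)[OF \<theta>0] unfolding prob_density01_def by (auto intro: measurable_compose[OF _ measurable_ennreal])
  show "AE x in lborel01. ennreal (p0 x) = ennreal (p \<theta>0 x)" using p0 by eventually_elim simp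
 qed
 finally show "distr M lborel01 (X i) = density lborel01 (%x. ennreal (p \<theta>0 x))" for i .
 show "M.indep_vars (%_. borel) X UNIV" by fact
 show "bmeas (p \<theta>0)" by (rule bmeas_continuous_on[OF cx[OF \<theta>0]])
 show "0 <= p \<theta>0 x" if "x \<in> {0..1}" for x by (rule less_imp_le[OF bspec[OF pos that]])
 show "(I01 x. p \<theta>0 x) = 1" by (rule mass[OF \<theta>0])
 qed
 interpret E: estimation_sample \<Theta> p \<theta>0 \<rho> M X by (rule estimation_sample.intro[OF df iid])
 have fB: "p \<theta>0 \<in> cont_besov \<tau>" using pB \<theta>0 by blast
 have \<tau>0: "0 < \<tau>" using assms(8) by linarith
 obtain a L where aL: "1 <= a" "a <= r" "0 <= L" "continuous_on {0..1} (p \<theta>0)"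
 "!!z. z ~= 0 ==> \<bar>z\<bar> < 1 ==> sq (iter_diff a z (p \<theta>0)) <= L * \<bar>z\<bar> powr (2 * \<tau>)"
 by (rule cont_besov_differences[OF fB \<tau>0 assms(9)]) (rule that)
 note rates = spline_proj_rates[OF aL(4) assms(6) aL(1,2) less_imp_le[OF \<tau>0] aL(3)]
 have unif: "\<forall>\<^sub>F j in sequentially. \<forall>x\<in>{0..1}. \<bar>p \<theta>0 x - spline_proj r j (p \<theta>0) x\<bar> <= e" if "0 < e" for e
 by (rule rates(2)) (rule aL(5), assumption, assumption, rule assms(8), rule that)
 have "\<exists>C\<ge>0. \<forall>j. sq (%x. p \<theta>0 x - spline_proj r j (p \<theta>0) x) <= C * (2 ^ j) powr (- 2 * \<tau>)"
 by (rule rates(1)) (rule aL(5))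
 then obtain Cf where Cf: "0 <= Cf" "!!j. sq (%x. p \<theta>0 x - spline_proj r j (p \<theta>0) x) <= Cf * (2 ^ j) powr (- 2 * \<tau>)" by blast
 have "\<forall>i. \<exists>s C. 1 / 2 < s & 0 <= C & (\<forall>j. sq (%x. E.score i x - spline_proj r j (E.score i) x) <= C * (2 ^ j) powr (- 2 * s))"
 proof
 fix i
 have g: "(%x. E.grad0 x $ i) \<in> cont_besov \<sigma>" unfolding E.grad0_def using \<sigma>(2) by blast
 obtain s C where "1 / 2 < s" "0 <= C"
  "!!j. sq (%x. E.grad0 x $ i / p \<theta>0 x - spline_proj r j (%x. E.grad0 x $ i / p \<theta>0 x) x) <= C * (2 ^ j) powr (- 2 * s)"
  by (rule quotient_proj_rate[OF g fB E.pos \<sigma>(1) assms(8) assms(6)]) (assumption, rule that)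
 then show "\<exists>s C. 1 / 2 < s & 0 <= C & (\<forall>j. sq (%x. E.score i x - spline_proj r j (E.score i) x) <= C * (2 ^ j) powr (- 2 * s))" by blast
 qed
 from choice[OF this] obtain s where
 "\<forall>i. \<exists>C. 1 / 2 < s i & 0 <= C & (\<forall>j. sq (%x. E.score i x - spline_proj r j (E.score i) x) <= C * (2 ^ j) powr (- 2 * s i))" by (rule exE)
 from choice[OF this] obtain Cw where
 Cw: "\<forall>i. 1 / 2 < s i & 0 <= Cw i & (\<forall>j. sq (%x. E.score i x - spline_proj r j (E.score i) x) <= Cw i * (2 ^ j) powr (- 2 * s i))" by (rule exE)
 show ?thesis
 proof (rule E.asymptotic_normality[OF assms(12)])
 fix \<eta> :: real assume \<eta>: "0 < \<eta>"
 show "(%n. M.prob {\<xi> \<in> space M. \<eta> <= norm (sqrt (real n) *\<^sub>R (\<theta>hat n \<xi> - \<theta>0) - matrix_inv (information_matrix p \<theta>0) *v E.score_sum n \<xi>)}) ---> 0"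
 proof (rule E.linearization[OF assms(6) assms(8) assms(11) Cf unif _ _ _ assms(13) \<eta>])
  show "1 / 2 < s i" "0 <= Cw i" "sq (%x. E.score i x - spline_proj r j (E.score i) x) <= Cw i * (2 ^ j) powr (- 2 * s i)" for i j using Cw by blast+
 qed
 qed
qed

end
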